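(* If $H$ is a quasi-Hopf algebra, $A$ is an algebra in ${}^H\mathscr{M}$ and $F\in H\otimes H$ is any cochain twist based on $H$, then ${}^H{}_A\mathscr{M}_A$ and ${}^{H_F}{}_{A_F}\mathscr{M}_{A_F}$ are equivalent as closed monoidal categories.
   Context: Fix a commutative ring $k$ with unit; $\otimes=\otimes_k$. A quasi-bialgebra is an associative unital $k$-algebra $H$ with algebra homomorphisms $\Delta:H\to H\otimes H$, $\epsilon:H\to k$ and an invertible $\phi\in H^{\otimes 3}$ such that for all $h\in H$: $(\epsilon\otimes\mathrm{id})\Delta(h)=h=(\mathrm{id}\otimes\epsilon)\Delta(h)$; $(\mathrm{id}\otimes\Delta)\Delta(h)\cdot\phi=\phi\cdot(\Delta\otimes\mathrm{id})\Delta(h)$; $(\mathrm{id}\otimes\mathrm{id}\otimes\Delta)(\phi)\cdot(\Delta\otimes\mathrm{id}\otimes\mathrm{id})(\phi)=(1\otimes\phi)\cdot(\mathrm{id}\otimes\Delta\otimes\mathrm{id})(\phi)\cdot(\phi\otimes1)$; $(\mathrm{id}\otimes\epsilon\otimes\mathrm{id})(\phi)=1\otimes1$. Notation (summation understood): $\Delta(h)=h_{(1)}\otimes h_{(2)}$, $\phi=\phi^{(1)}\otimes\phi^{(2)}\otimes\phi^{(3)}$, $\phi^{-1}=\phi^{(-1)}\otimes\phi^{(-2)}\otimes\phi^{(-3)}$. A quasi-Hopf algebra is a quasi-bialgebra with a quasi-antipode $(S,\alpha,\beta)$: an algebra anti-automorphism $S:H\to H$ and $\alpha,\beta\in H$ with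 $S(h_{(1)})\alpha h_{(2)}=\epsilon(h)\alpha$, $h_{(1)}\beta S(h_{(2)})=\epsilon(h)\beta$ for all $h$, $\phi^{(1)}\beta S(\phi^{(2)})\alpha\phi^{(3)}=1$, $S(\phi^{(-1)})\alpha\phi^{(-2)}\beta S(\phi^{(-3)})=1$. ${}^H\mathscr{M}$ is the category of left $H$-modules (action $\triangleright$) and $H$-equivariant $k$-linear maps, monoidal with $h\triangleright(v\otimes w)=(h_{(1)}\triangleright v)\otimes(h_{(2)}\triangleright w)$, unit $I=k$ (action via $\epsilon$) and associator $\Phi_{V,W,X}((v\otimes w)\otimes x)=(\phi^{(1)}\triangleright v)\otimes((\phi^{(2)}\triangleright w)\otimes(\phi^{(3)}\triangleright x))$. It is closed with internal hom $\hom(V,W)=\mathrm{Hom}_k(V,W)$, $h\triangleright L=(h_{(1)}\triangleright\cdot)\circ L\circ(S(h_{(2)})\triangleright\cdot)$, $\hom(f^{\mathrm{op}},g)(L)=g\circ L\circ f$. Evaluation: $\mathrm{ev}_{V,W}(L\otimes v)=\phi^{(1)}\triangleright L\big((S(\phi^{(2)})\alpha\phi^{(3)})\triangleright v\big)$. Composition: $\bullet_{V,W,X}:\hom(W,X)\otimes\hom(V,W)\to\hom(V,X)$ is the unique ${}^H\mathscr{M}$-morphism with $\mathrm{ev}_{V,X}\circ(\bullet_{V,W,X}\otimes\mathrm{id}_V)=\mathrm{ev}_{W,X}\circ(\mathrm{id}\otimes\mathrm{ev}_{V,W})\circ\Phi_{\hom(W,X),\hom(V,W),V}$. An algebra in ${}^H\mathscr{M}$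 is an object $A$ with ${}^H\mathscr{M}$-morphisms $\mu_A:A\otimes A\to A$ (written $aa'$) and $\eta_A:I\to A$ ($1_A=\eta_A(1)$) such that $(aa')a''=(\phi^{(1)}\triangleright a)\big((\phi^{(2)}\triangleright a')(\phi^{(3)}\triangleright a'')\big)$ and $1_Aa=a=a1_A$. An $A$-bimodule in ${}^H\mathscr{M}$ is an object $V$ with ${}^H\mathscr{M}$-morphisms $l_V:A\otimes V\to V$ (written $av$) and $r_V:V\otimes A\to V$ (written $va$) such that $(va)a'=(\phi^{(1)}\triangleright v)\big((\phi^{(2)}\triangleright a)(\phi^{(3)}\triangleright a')\big)$, $a(a'v)=\big((\phi^{(-1)}\triangleright a)(\phi^{(-2)}\triangleright a')\big)(\phi^{(-3)}\triangleright v)$, $a(va')=\big((\phi^{(-1)}\triangleright a)(\phi^{(-2)}\triangleright v)\big)(\phi^{(-3)}\triangleright a')$, $1_Av=v=v1_A$. ${}^H{}_A\mathscr{M}_A$ is the category of $A$-bimodules in ${}^H\mathscr{M}$ with morphisms the $H$-equivariant left and right $A$-linear $k$-linear maps. ${}^H{}_A\mathscr{M}_A$ is monoidal: $V\otimes_A W=(V\otimes W)/\mathrm{Im}\big(r_V\otimes\mathrm{id}-(\mathrm{id}\otimes l_W)\circ\Phi_{V,A,W}\big)$, $v\otimes_A w$ the class of $v\otimes w$, with bimodule structure $a(v\otimes_A w)=\big((\phi^{(-1)}\triangleright a)(\phi^{(-2)}\triangleright v)\big)\otimes_A(\phi^{(-3)}\triangleright w)$, $(v\otimes_A w)a=(\phi^{(1)}\triangleright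 v)\otimes_A\big((\phi^{(2)}\triangleright w)(\phi^{(3)}\triangleright a)\big)$; associator induced by $\Phi$; unit object $A$; unitors induced by $l_V$, $r_V$. (The same formulas without passing to the quotient make $V\otimes W$ an $A$-bimodule.) It is closed with internal hom $\hom_A$: for $A$-bimodules $V,W$, $\hom(V,W)$ is an $A$-bimodule via $aL=\widehat{l}_W(a)\bullet_{V,W,W}L$ and $La=L\bullet_{V,V,W}\widehat{l}_V(a)$, where $\widehat{l}_V(a)=(\phi^{(-1)}\triangleright a)\big((\phi^{(-2)}\beta S(\phi^{(-3)}))\triangleright(\,\cdot\,)\big)$; $\mathrm{ev}_{V,W}$ descends to $\mathrm{ev}^A_{V,W}:\hom(V,W)\otimes_A V\to W$. With $f_1(L\otimes_A(v\otimes a))=\mathrm{ev}^A_{V,W}(L\otimes_A(va))$, $f_2(L\otimes_A(v\otimes a))=\mathrm{ev}^A_{V,W}\big((\phi^{(-1)}\triangleright L)\otimes_A(\phi^{(-2)}\triangleright v)\big)(\phi^{(-3)}\triangleright a)$ and $D_i:\hom(V,W)\to\hom(V\otimes A,W)$, $D_i(L)=f_i\big((\phi^{(-1)}\triangleright L)\otimes_A((\phi^{(-2)}\beta S(\phi^{(-3)}))\triangleright_{V\otimes A}(\,\cdot\,))\big)$, one sets $\hom_A(V,W)=\mathrm{Ker}(D_1-D_2)\subseteq\hom(V,W)$ with induced structures. A cochain twist based on $H$ is an invertible $F=F^{(1)}\otimes F^{(2)}\in H\otimes H$ with $(\epsilon\otimes\mathrm{id})(F)=1=(\mathrm{id}\otimes\epsilon)(F)$;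 write $F^{-1}=F^{(-1)}\otimes F^{(-2)}$. $H_F$ is the algebra $H$ with counit $\epsilon$, $\Delta_F(h)=F\Delta(h)F^{-1}$, $\phi_F=(1\otimes F)(\mathrm{id}\otimes\Delta)(F)\,\phi\,(\Delta\otimes\mathrm{id})(F^{-1})(F^{-1}\otimes1)$, $S_F=S$, $\alpha_F=S(F^{(-1)})\alpha F^{(-2)}$, $\beta_F=F^{(1)}\beta S(F^{(2)})$. $A_F$ is the algebra in ${}^{H_F}\mathscr{M}$ with the module and unit of $A$ and product $a\star_F a'=(F^{(-1)}\triangleright a)(F^{(-2)}\triangleright a')$. The functor $\mathcal{F}:{}^H{}_A\mathscr{M}_A\to{}^{H_F}{}_{A_F}\mathscr{M}_{A_F}$ sends $V$ to the same $H$-module with $a\star_F v=(F^{(-1)}\triangleright a)(F^{(-2)}\triangleright v)$, $v\star_F a=(F^{(-1)}\triangleright v)(F^{(-2)}\triangleright a)$, and is the identity on maps; it is the equivalence meant. An equivalence of closed monoidal categories is an equivalence which is a (strong) monoidal functor (here with coherence maps $v\otimes_{A_F}w\mapsto(F^{(-1)}\triangleright v)\otimes_A(F^{(-2)}\triangleright w)$ and $\mathrm{id}:A_F\to\mathcal{F}(A)$) and which respects internal homs through a natural isomorphism $\hom_{A_F}\circ(\mathcal{F}^{\mathrm{op}}\times\mathcal{F})\Rightarrow\mathcal{F}\circ\hom_A$ (here given by $L\mapsto(F^{(-1)}\triangleright\cdot)\circ L\circ(S(F^{(-2)})\triangleright\cdot)$). *)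

theory Defs
  imports "HOL-Algebra.Module" "HOL-Algebra.AbelCoset"
begin

section \<open>Tensor products over a commutative ring\<close>

text \<open>
  The ground ring \<open>k\<close> and all modules are records with carriers, so that maps are only meaningful on
  carriers. An element of \<open>V \<otimes> W\<close> is a class of finite formal sums of pairs, the formal sum
  \<open>(v\<^sub>1, w\<^sub>1) + \<dots> + (v\<^sub>n, w\<^sub>n)\<close> being written as a list. No coefficients or inverses are needed, as
  \<open>r (v, w) = (r v, w)\<close> and \<open>- (v, w) = (- v, w)\<close> in the quotient.
\<close>

type_synonym ('v, 'w) tens = "('v \<times> 'w) list set"

inductive tens_rel ::
  "('k, 'r) ring_scheme \<Rightarrow> ('k, 'v, 'y) module_scheme \<Rightarrow> ('k, 'w, 'z) module_scheme
    \<Rightarrow> ('v \<times> 'w) list \<Rightarrow> ('v \<times> 'w) list \<Rightarrow> bool"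
  for k V W where
  refl: "set xs \<subseteq> carrier V \<times> carrier W \<Longrightarrow> tens_rel k V W xs xs"
| sym: "tens_rel k V W xs ys \<Longrightarrow> tens_rel k V W ys xs"
| trans: "tens_rel k V W xs ys \<Longrightarrow> tens_rel k V W ys zs \<Longrightarrow> tens_rel k V W xs zs"
| app: "tens_rel k V W xs xs' \<Longrightarrow> tens_rel k V W ys ys' \<Longrightarrow> tens_rel k V W (xs @ ys) (xs' @ ys')"
| comm: "set xs \<subseteq> carrier V \<times> carrier W \<Longrightarrow> set ys \<subseteq> carrier V \<times> carrier W
    \<Longrightarrow> tens_rel k V W (xs @ ys) (ys @ xs)"
| zero: "w \<in> carrier W \<Longrightarrow> tens_rel k V W [(\<zero>\<^bsub>V\<^esub>, w)] []"
| add_left: "v \<in> carrier V \<Longrightarrow> v' \<in> carrier V \<Longrightarrow> w \<in> carrier W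
    \<Longrightarrow> tens_rel k V W [(v \<oplus>\<^bsub>V\<^esub> v', w)] [(v, w), (v', w)]"
| add_right: "v \<in> carrier V \<Longrightarrow> w \<in> carrier W \<Longrightarrow> w' \<in> carrier W
    \<Longrightarrow> tens_rel k V W [(v, w \<oplus>\<^bsub>W\<^esub> w')] [(v, w), (v, w')]"
| smult: "r \<in> carrier k \<Longrightarrow> v \<in> carrier V \<Longrightarrow> w \<in> carrier W
    \<Longrightarrow> tens_rel k V W [(r \<odot>\<^bsub>V\<^esub> v, w)] [(v, r \<odot>\<^bsub>W\<^esub> w)]"

definition tens_class ::
  "('k, 'r) ring_scheme \<Rightarrow> ('k, 'v, 'y) module_scheme \<Rightarrow> ('k, 'w, 'z) module_scheme
    \<Rightarrow> ('v \<times> 'w) list \<Rightarrow> ('v, 'w) tens" where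
  "tens_class k V W xs = {ys. tens_rel k V W xs ys}"

text \<open>The pure tensor \<open>v \<otimes> w\<close>.\<close>

definition pure ::
  "('k, 'r) ring_scheme \<Rightarrow> ('k, 'v, 'y) module_scheme \<Rightarrow> ('k, 'w, 'z) module_scheme
    \<Rightarrow> 'v \<Rightarrow> 'w \<Rightarrow> ('v, 'w) tens" where
  "pure k V W v w = tens_class k V W [(v, w)]"

text \<open>
  The fields \<^const>\<open>mult\<close> and \<^const>\<open>one\<close> are those of the tensor product algebra; they carry no
  information if \<open>V\<close> and \<open>W\<close> are mere modules.
\<close>

definition tensor ::
  "('k, 'r) ring_scheme \<Rightarrow> ('k, 'v, 'y) module_scheme \<Rightarrow> ('k, 'w, 'z) module_scheme
    \<Rightarrow> ('k, ('v, 'w) tens) module" where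
  "tensor k V W =
    \<lparr>carrier = tens_class k V W ` {xs. set xs \<subseteq> carrier V \<times> carrier W},
     mult = (\<lambda>s t. \<Union>xs\<in>s. \<Union>ys\<in>t.
       tens_class k V W [(v \<otimes>\<^bsub>V\<^esub> v', w \<otimes>\<^bsub>W\<^esub> w'). (v, w) \<leftarrow> xs, (v', w') \<leftarrow> ys]),
     one = pure k V W \<one>\<^bsub>V\<^esub> \<one>\<^bsub>W\<^esub>,
     zero = tens_class k V W [],
     add = (\<lambda>s t. \<Union>xs\<in>s. \<Union>ys\<in>t. tens_class k V W (xs @ ys)),
     smult = (\<lambda>r s. \<Union>xs\<in>s. tens_class k V W (map (\<lambda>(v, w). (r \<odot>\<^bsub>V\<^esub> v, w)) xs))\<rparr>"

definition list_sum :: "('m, 'z) ring_scheme \<Rightarrow> 'm list \<Rightarrow> 'm" where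
  "list_sum M xs = foldr (add M) xs \<zero>\<^bsub>M\<^esub>"

text \<open>
  The linear map \<open>V \<otimes> W \<rightarrow> M\<close> induced by a bilinear map \<open>f\<close>. Read as Sweedler notation,
  \<open>tlift M (\<lambda>a b. E a b) t\<close> is \<open>E t\<^sup>(\<^sup>1\<^sup>) t\<^sup>(\<^sup>2\<^sup>)\<close>, summation understood.
\<close>

definition tlift :: "('m, 'z) ring_scheme \<Rightarrow> ('v \<Rightarrow> 'w \<Rightarrow> 'm) \<Rightarrow> ('v, 'w) tens \<Rightarrow> 'm" where
  "tlift M f t = the_elem ((\<lambda>xs. list_sum M (map (\<lambda>(v, w). f v w) xs)) ` t)"

definition tlift3 ::
  "('m, 'z) ring_scheme \<Rightarrow> ('u \<Rightarrow> 'v \<Rightarrow> 'w \<Rightarrow> 'm) \<Rightarrow> ('u, ('v, 'w) tens) tens \<Rightarrow> 'm" where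
  "tlift3 M f t = tlift M (\<lambda>a s. tlift M (\<lambda>b c. f a b c) s) t"

text \<open>\<open>tmap k V W f g\<close> is \<open>f \<otimes> g\<close>, with values in \<open>V \<otimes> W\<close>.\<close>

definition tmap ::
  "('k, 'r) ring_scheme \<Rightarrow> ('k, 'v, 'y) module_scheme \<Rightarrow> ('k, 'w, 'z) module_scheme
    \<Rightarrow> ('s \<Rightarrow> 'v) \<Rightarrow> ('t \<Rightarrow> 'w) \<Rightarrow> ('s, 't) tens \<Rightarrow> ('v, 'w) tens" where
  "tmap k V W f g = tlift (tensor k V W) (\<lambda>v w. pure k V W (f v) (g w))"

text \<open>The canonical isomorphism \<open>(U \<otimes> V) \<otimes> W \<rightarrow> U \<otimes> (V \<otimes> W)\<close> of \<open>k\<close>-modules.\<close>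

definition tassoc ::
  "('k, 'r) ring_scheme \<Rightarrow> ('k, 'u, 'x) module_scheme \<Rightarrow> ('k, 'v, 'y) module_scheme
    \<Rightarrow> ('k, 'w, 'z) module_scheme \<Rightarrow> (('u, 'v) tens, 'w) tens \<Rightarrow> ('u, ('v, 'w) tens) tens" where
  "tassoc k U V W =
    (let T = tensor k U (tensor k V W)
     in tlift T (\<lambda>s w. tlift T (\<lambda>u v. pure k U (tensor k V W) u (pure k V W v w)) s))"

definition linear_map ::
  "('k, 'r) ring_scheme \<Rightarrow> ('k, 'v, 'y) module_scheme \<Rightarrow> ('k, 'w, 'z) module_scheme
    \<Rightarrow> ('v \<Rightarrow> 'w) \<Rightarrow> bool" where
  "linear_map k V W f \<longleftrightarrow>
    f \<in> carrier V \<rightarrow> carrier W \<and>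
    (\<forall>x\<in>carrier V. \<forall>y\<in>carrier V. f (x \<oplus>\<^bsub>V\<^esub> y) = f x \<oplus>\<^bsub>W\<^esub> f y) \<and>
    (\<forall>r\<in>carrier k. \<forall>x\<in>carrier V. f (r \<odot>\<^bsub>V\<^esub> x) = r \<odot>\<^bsub>W\<^esub> f x)"

definition bilinear_map ::
  "('k, 'r) ring_scheme \<Rightarrow> ('k, 'u, 'x) module_scheme \<Rightarrow> ('k, 'v, 'y) module_scheme
    \<Rightarrow> ('k, 'w, 'z) module_scheme \<Rightarrow> ('u \<Rightarrow> 'v \<Rightarrow> 'w) \<Rightarrow> bool" where
  "bilinear_map k U V W b \<longleftrightarrow>
    (\<forall>u\<in>carrier U. linear_map k V W (b u)) \<and>
    (\<forall>v\<in>carrier V. linear_map k U W (\<lambda>u. b u v))"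

text \<open>The \<open>k\<close>-module of linear maps. Its elements are extensional, i.e. fixed outside the carrier.\<close>

definition lin_hom ::
  "('k, 'r) ring_scheme \<Rightarrow> ('k, 'v, 'y) module_scheme \<Rightarrow> ('k, 'w, 'z) module_scheme
    \<Rightarrow> ('k, 'v \<Rightarrow> 'w) module" where
  "lin_hom k V W =
    \<lparr>carrier = {L \<in> extensional (carrier V). linear_map k V W L},
     mult = undefined,
     one = undefined,
     zero = (\<lambda>v\<in>carrier V. \<zero>\<^bsub>W\<^esub>),
     add = (\<lambda>L L'. \<lambda>v\<in>carrier V. L v \<oplus>\<^bsub>W\<^esub> L' v),
     smult = (\<lambda>r L. \<lambda>v\<in>carrier V. r \<odot>\<^bsub>W\<^esub> L v)\<rparr>"


section \<open>Quasi-Hopf algebras\<close>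

record ('k, 'h) quasi_hopf = "('k, 'h) module" +
  comult :: "'h \<Rightarrow> ('h, 'h) tens"
  counit :: "'h \<Rightarrow> 'k"
  phi :: "('h, ('h, 'h) tens) tens"
  antip :: "'h \<Rightarrow> 'h"
  qalpha :: "'h"
  qbeta :: "'h"

definition k_algebra :: "('k, 'r) ring_scheme \<Rightarrow> ('k, 'h, 'z) module_scheme \<Rightarrow> bool" where
  "k_algebra k H \<longleftrightarrow>
    cring k \<and> ring H \<and> module k H \<and>
    (\<forall>r\<in>carrier k. \<forall>x\<in>carrier H. \<forall>y\<in>carrier H.
      (r \<odot>\<^bsub>H\<^esub> x) \<otimes>\<^bsub>H\<^esub> y = r \<odot>\<^bsub>H\<^esub> (x \<otimes>\<^bsub>H\<^esub> y) \<and>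
      x \<otimes>\<^bsub>H\<^esub> (r \<odot>\<^bsub>H\<^esub> y) = r \<odot>\<^bsub>H\<^esub> (x \<otimes>\<^bsub>H\<^esub> y))"

definition algebra_hom ::
  "('k, 'r) ring_scheme \<Rightarrow> ('k, 'v, 'y) module_scheme \<Rightarrow> ('k, 'w, 'z) module_scheme
    \<Rightarrow> ('v \<Rightarrow> 'w) \<Rightarrow> bool" where
  "algebra_hom k H K f \<longleftrightarrow> f \<in> ring_hom H K \<and> linear_map k H K f"

definition ground_module :: "('k, 'r) ring_scheme \<Rightarrow> ('k, 'k) module" where
  "ground_module k =
    \<lparr>carrier = carrier k, mult = mult k, one = one k, zero = zero k, add = add k,
     smult = mult k\<rparr>"

text \<open>
  \<open>H\<^sup>\<otimes>\<^sup>3\<close> and \<open>H\<^sup>\<otimes>\<^sup>4\<close> are bracketed to the right; \<^const>\<open>tassoc\<close> moves other bracketings into this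
  form.
\<close>

abbreviation tens2 where "tens2 k H \<equiv> tensor k H H"
abbreviation tens3 where "tens3 k H \<equiv> tensor k H (tens2 k H)"
abbreviation tens4 where "tens4 k H \<equiv> tensor k H (tens3 k H)"

definition phi_inv ::
  "('k, 'r) ring_scheme \<Rightarrow> ('k, 'h) quasi_hopf \<Rightarrow> ('h, ('h, 'h) tens) tens" where
  "phi_inv k H = inv\<^bsub>tens3 k H\<^esub> (phi H)"

definition id_comult ::
  "('k, 'r) ring_scheme \<Rightarrow> ('k, 'h) quasi_hopf \<Rightarrow> ('h, 'h) tens \<Rightarrow> ('h, ('h, 'h) tens) tens" where
  "id_comult k H = tmap k H (tens2 k H) id (comult H)"

definition comult_id ::
  "('k, 'r) ring_scheme \<Rightarrow> ('k, 'h) quasi_hopf \<Rightarrow> ('h, 'h) tens \<Rightarrow> ('h, ('h, 'h) tens) tens" where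
  "comult_id k H t = tassoc k H H H (tmap k (tens2 k H) H (comult H) id t)"

definition tens3_one ::
  "('k, 'r) ring_scheme \<Rightarrow> ('k, 'h) quasi_hopf
    \<Rightarrow> ('h, ('h, 'h) tens) tens \<Rightarrow> ('h, ('h, ('h, 'h) tens) tens) tens" where
  "tens3_one k H t =
    tmap k H (tens3 k H) id (tassoc k H H H)
      (tassoc k H (tens2 k H) H (pure k (tens3 k H) H t \<one>\<^bsub>H\<^esub>))"

definition quasi_bialgebra :: "('k, 'r) ring_scheme \<Rightarrow> ('k, 'h) quasi_hopf \<Rightarrow> bool" where
  "quasi_bialgebra k H \<longleftrightarrow>
    k_algebra k H \<and>
    algebra_hom k H (tens2 k H) (comult H) \<and>
    algebra_hom k H (ground_module k) (counit H) \<and>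
    phi H \<in> Units (tens3 k H) \<and>
    (\<forall>h\<in>carrier H. tlift H (\<lambda>a b. counit H a \<odot>\<^bsub>H\<^esub> b) (comult H h) = h) \<and>
    (\<forall>h\<in>carrier H. tlift H (\<lambda>a b. counit H b \<odot>\<^bsub>H\<^esub> a) (comult H h) = h) \<and>
    (\<forall>h\<in>carrier H.
      id_comult k H (comult H h) \<otimes>\<^bsub>tens3 k H\<^esub> phi H =
      phi H \<otimes>\<^bsub>tens3 k H\<^esub> comult_id k H (comult H h)) \<and>
    tmap k H (tens3 k H) id (id_comult k H) (phi H) \<otimes>\<^bsub>tens4 k H\<^esub>
      tassoc k H H (tens2 k H) (tmap k (tens2 k H) (tens2 k H) (comult H) id (phi H)) =
    pure k H (tens3 k H) \<one>\<^bsub>H\<^esub> (phi H) \<otimes>\<^bsub>tens4 k H\<^esub>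
      tmap k H (tens3 k H) id (comult_id k H) (phi H) \<otimes>\<^bsub>tens4 k H\<^esub>
      tens3_one k H (phi H) \<and>
    tmap k H H id (tlift H (\<lambda>b c. counit H b \<odot>\<^bsub>H\<^esub> c)) (phi H) = \<one>\<^bsub>tens2 k H\<^esub>"

definition algebra_anti_automorphism ::
  "('k, 'r) ring_scheme \<Rightarrow> ('k, 'h, 'z) module_scheme \<Rightarrow> ('h \<Rightarrow> 'h) \<Rightarrow> bool" where
  "algebra_anti_automorphism k H S \<longleftrightarrow>
    bij_betw S (carrier H) (carrier H) \<and> linear_map k H H S \<and> S \<one>\<^bsub>H\<^esub> = \<one>\<^bsub>H\<^esub> \<and>
    (\<forall>x\<in>carrier H. \<forall>y\<in>carrier H. S (x \<otimes>\<^bsub>H\<^esub> y) = S y \<otimes>\<^bsub>H\<^esub> S x)"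

definition quasi_hopf_algebra :: "('k, 'r) ring_scheme \<Rightarrow> ('k, 'h) quasi_hopf \<Rightarrow> bool" where
  "quasi_hopf_algebra k H \<longleftrightarrow>
    quasi_bialgebra k H \<and>
    algebra_anti_automorphism k H (antip H) \<and>
    qalpha H \<in> carrier H \<and> qbeta H \<in> carrier H \<and>
    (\<forall>h\<in>carrier H.
      tlift H (\<lambda>a b. antip H a \<otimes>\<^bsub>H\<^esub> qalpha H \<otimes>\<^bsub>H\<^esub> b) (comult H h) =
        counit H h \<odot>\<^bsub>H\<^esub> qalpha H) \<and>
    (\<forall>h\<in>carrier H.
      tlift H (\<lambda>a b. a \<otimes>\<^bsub>H\<^esub> qbeta H \<otimes>\<^bsub>H\<^esub> antip H b) (comult H h) =
        counit H h \<odot>\<^bsub>H\<^esub> qbeta H) \<and>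
    tlift3 H (\<lambda>a b c. a \<otimes>\<^bsub>H\<^esub> qbeta H \<otimes>\<^bsub>H\<^esub> antip H b \<otimes>\<^bsub>H\<^esub> qalpha H \<otimes>\<^bsub>H\<^esub> c) (phi H) = \<one>\<^bsub>H\<^esub> \<and>
    tlift3 H (\<lambda>a b c. antip H a \<otimes>\<^bsub>H\<^esub> qalpha H \<otimes>\<^bsub>H\<^esub> b \<otimes>\<^bsub>H\<^esub> qbeta H \<otimes>\<^bsub>H\<^esub> antip H c) (phi_inv k H)
      = \<one>\<^bsub>H\<^esub>"


section \<open>The closed monoidal category of \<open>H\<close>-modules\<close>

record ('k, 'h, 'v) hmodule = "('k, 'v) module" +
  act :: "'h \<Rightarrow> 'v \<Rightarrow> 'v"

definition h_module ::
  "('k, 'r) ring_scheme \<Rightarrow> ('k, 'h) quasi_hopf \<Rightarrow> ('k, 'h, 'v, 'z) hmodule_scheme \<Rightarrow> bool" where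
  "h_module k H V \<longleftrightarrow>
    module k V \<and> bilinear_map k H V V (act V) \<and>
    (\<forall>v\<in>carrier V. act V \<one>\<^bsub>H\<^esub> v = v) \<and>
    (\<forall>g\<in>carrier H. \<forall>h\<in>carrier H. \<forall>v\<in>carrier V. act V (g \<otimes>\<^bsub>H\<^esub> h) v = act V g (act V h v))"

definition h_linear ::
  "('k, 'r) ring_scheme \<Rightarrow> ('k, 'h) quasi_hopf \<Rightarrow> ('k, 'h, 'v, 'y) hmodule_scheme
    \<Rightarrow> ('k, 'h, 'w, 'z) hmodule_scheme \<Rightarrow> ('v \<Rightarrow> 'w) \<Rightarrow> bool" where
  "h_linear k H V W f \<longleftrightarrow>
    linear_map k V W f \<and> (\<forall>h\<in>carrier H. \<forall>v\<in>carrier V. f (act V h v) = act W h (f v))"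

text \<open>The action of \<open>u \<in> H \<otimes> H\<close> on \<open>V \<otimes> W\<close>.\<close>

definition act2 ::
  "('k, 'r) ring_scheme \<Rightarrow> ('k, 'h, 'v, 'y) hmodule_scheme \<Rightarrow> ('k, 'h, 'w, 'z) hmodule_scheme
    \<Rightarrow> ('h, 'h) tens \<Rightarrow> ('v, 'w) tens \<Rightarrow> ('v, 'w) tens" where
  "act2 k V W u t = tlift (tensor k V W) (\<lambda>a b. tmap k V W (act V a) (act W b) t) u"

definition h_tensor ::
  "('k, 'r) ring_scheme \<Rightarrow> ('k, 'h) quasi_hopf \<Rightarrow> ('k, 'h, 'v, 'y) hmodule_scheme
    \<Rightarrow> ('k, 'h, 'w, 'z) hmodule_scheme \<Rightarrow> ('k, 'h, ('v, 'w) tens) hmodule" where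
  "h_tensor k H V W =
    module.extend (tensor k V W) (hmodule.fields (\<lambda>h. act2 k V W (comult H h)))"

definition h_unit :: "('k, 'r) ring_scheme \<Rightarrow> ('k, 'h) quasi_hopf \<Rightarrow> ('k, 'h, 'k) hmodule" where
  "h_unit k H = module.extend (ground_module k) (hmodule.fields (\<lambda>h r. counit H h \<otimes>\<^bsub>k\<^esub> r))"

definition h_assoc ::
  "('k, 'r) ring_scheme \<Rightarrow> ('k, 'h) quasi_hopf \<Rightarrow> ('k, 'h, 'v, 'x) hmodule_scheme
    \<Rightarrow> ('k, 'h, 'w, 'y) hmodule_scheme \<Rightarrow> ('k, 'h, 'u, 'z) hmodule_scheme
    \<Rightarrow> (('v, 'w) tens, 'u) tens \<Rightarrow> ('v, ('w, 'u) tens) tens" where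
  "h_assoc k H V W X t =
    tlift3 (tensor k V (tensor k W X))
      (\<lambda>a b c. tmap k V (tensor k W X) (act V a) (tmap k W X (act W b) (act X c))
        (tassoc k V W X t)) (phi H)"

text \<open>\<open>L \<mapsto> (u\<^sup>(\<^sup>1\<^sup>) \<triangleright> \<cdot>) \<circ> L \<circ> (S(u\<^sup>(\<^sup>2\<^sup>)) \<triangleright> \<cdot>)\<close> for \<open>u \<in> H \<otimes> H\<close>.\<close>

definition hom_act ::
  "('k, 'r) ring_scheme \<Rightarrow> ('k, 'h) quasi_hopf \<Rightarrow> ('k, 'h, 'v, 'y) hmodule_scheme
    \<Rightarrow> ('k, 'h, 'w, 'z) hmodule_scheme \<Rightarrow> ('h, 'h) tens \<Rightarrow> ('v \<Rightarrow> 'w) \<Rightarrow> ('v \<Rightarrow> 'w)" where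
  "hom_act k H V W u L =
    tlift (lin_hom k V W) (\<lambda>a b. \<lambda>v\<in>carrier V. act W a (L (act V (antip H b) v))) u"

definition h_hom ::
  "('k, 'r) ring_scheme \<Rightarrow> ('k, 'h) quasi_hopf \<Rightarrow> ('k, 'h, 'v, 'y) hmodule_scheme
    \<Rightarrow> ('k, 'h, 'w, 'z) hmodule_scheme \<Rightarrow> ('k, 'h, 'v \<Rightarrow> 'w) hmodule" where
  "h_hom k H V W =
    module.extend (lin_hom k V W) (hmodule.fields (\<lambda>h. hom_act k H V W (comult H h)))"

definition h_ev ::
  "('k, 'h) quasi_hopf \<Rightarrow> ('k, 'h, 'v, 'y) hmodule_scheme \<Rightarrow> ('k, 'h, 'w, 'z) hmodule_scheme
    \<Rightarrow> ('v \<Rightarrow> 'w, 'v) tens \<Rightarrow> 'w" where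
  "h_ev H V W =
    tlift W (\<lambda>L v. tlift3 W
      (\<lambda>a b c. act W a (L (act V (antip H b \<otimes>\<^bsub>H\<^esub> qalpha H \<otimes>\<^bsub>H\<^esub> c) v))) (phi H))"

definition h_comp ::
  "('k, 'r) ring_scheme \<Rightarrow> ('k, 'h) quasi_hopf \<Rightarrow> ('k, 'h, 'v, 'x) hmodule_scheme
    \<Rightarrow> ('k, 'h, 'w, 'y) hmodule_scheme \<Rightarrow> ('k, 'h, 'u, 'z) hmodule_scheme
    \<Rightarrow> ('w \<Rightarrow> 'u, 'v \<Rightarrow> 'w) tens \<Rightarrow> ('v \<Rightarrow> 'u)" where
  "h_comp k H V W X =
    (let P = h_tensor k H (h_hom k H W X) (h_hom k H V W)
     in THE m. m \<in> extensional (carrier P) \<and> h_linear k H P (h_hom k H V X) m \<and>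
       (\<forall>t\<in>carrier (h_tensor k H P V).
         h_ev H V X (tmap k (h_hom k H V X) V m id t) =
         h_ev H W X (tmap k (h_hom k H W X) W id (h_ev H V W)
           (h_assoc k H (h_hom k H W X) (h_hom k H V W) V t))))"


section \<open>Algebras and bimodules\<close>

text \<open>A bilinear map \<open>m\<close> which corresponds to a morphism \<open>V \<otimes> W \<rightarrow> X\<close> of \<open>H\<close>-modules.\<close>

definition tensor_morphism ::
  "('k, 'r) ring_scheme \<Rightarrow> ('k, 'h) quasi_hopf \<Rightarrow> ('k, 'h, 'v, 'x) hmodule_scheme
    \<Rightarrow> ('k, 'h, 'w, 'y) hmodule_scheme \<Rightarrow> ('k, 'h, 'u, 'z) hmodule_scheme
    \<Rightarrow> ('v \<Rightarrow> 'w \<Rightarrow> 'u) \<Rightarrow> bool" where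
  "tensor_morphism k H V W X m \<longleftrightarrow>
    bilinear_map k V W X m \<and> h_linear k H (h_tensor k H V W) X (tlift X m)"

text \<open>
  The product and the unit of an algebra in the category of \<open>H\<close>-modules are the fields
  \<^const>\<open>mult\<close> and \<^const>\<open>one\<close> of its record.
\<close>

definition h_algebra ::
  "('k, 'r) ring_scheme \<Rightarrow> ('k, 'h) quasi_hopf \<Rightarrow> ('k, 'h, 'a) hmodule \<Rightarrow> bool" where
  "h_algebra k H A \<longleftrightarrow>
    h_module k H A \<and>
    tensor_morphism k H A A A (mult A) \<and>
    \<one>\<^bsub>A\<^esub> \<in> carrier A \<and> h_linear k H (h_unit k H) A (\<lambda>r. r \<odot>\<^bsub>A\<^esub> \<one>\<^bsub>A\<^esub>) \<and>
    (\<forall>a\<in>carrier A. \<forall>a'\<in>carrier A. \<forall>a''\<in>carrier A.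
      (a \<otimes>\<^bsub>A\<^esub> a') \<otimes>\<^bsub>A\<^esub> a'' =
        tlift3 A (\<lambda>x y z. act A x a \<otimes>\<^bsub>A\<^esub> (act A y a' \<otimes>\<^bsub>A\<^esub> act A z a'')) (phi H)) \<and>
    (\<forall>a\<in>carrier A. \<one>\<^bsub>A\<^esub> \<otimes>\<^bsub>A\<^esub> a = a \<and> a \<otimes>\<^bsub>A\<^esub> \<one>\<^bsub>A\<^esub> = a)"

record ('k, 'h, 'a, 'v) bimodule = "('k, 'h, 'v) hmodule" +
  lact :: "'a \<Rightarrow> 'v \<Rightarrow> 'v"
  ract :: "'v \<Rightarrow> 'a \<Rightarrow> 'v"

definition a_bimodule ::
  "('k, 'r) ring_scheme \<Rightarrow> ('k, 'h) quasi_hopf \<Rightarrow> ('k, 'h, 'a) hmodule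
    \<Rightarrow> ('k, 'h, 'a, 'v) bimodule \<Rightarrow> bool" where
  "a_bimodule k H A V \<longleftrightarrow>
    h_module k H V \<and>
    tensor_morphism k H A V V (lact V) \<and>
    tensor_morphism k H V A V (ract V) \<and>
    (\<forall>v\<in>carrier V. \<forall>a\<in>carrier A. \<forall>a'\<in>carrier A.
      ract V (ract V v a) a' =
        tlift3 V (\<lambda>x y z. ract V (act V x v) (act A y a \<otimes>\<^bsub>A\<^esub> act A z a')) (phi H)) \<and>
    (\<forall>a\<in>carrier A. \<forall>a'\<in>carrier A. \<forall>v\<in>carrier V.
      lact V a (lact V a' v) =
        tlift3 V (\<lambda>x y z. lact V (act A x a \<otimes>\<^bsub>A\<^esub> act A y a') (act V z v)) (phi_inv k H)) \<and>
    (\<forall>a\<in>carrier A. \<forall>v\<in>carrier V. \<forall>a'\<in>carrier A.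
      lact V a (ract V v a') =
        tlift3 V (\<lambda>x y z. ract V (lact V (act A x a) (act V y v)) (act A z a')) (phi_inv k H)) \<and>
    (\<forall>v\<in>carrier V. lact V \<one>\<^bsub>A\<^esub> v = v \<and> ract V v \<one>\<^bsub>A\<^esub> = v)"

definition bimodule_hom ::
  "('k, 'r) ring_scheme \<Rightarrow> ('k, 'h) quasi_hopf \<Rightarrow> ('k, 'h, 'a) hmodule
    \<Rightarrow> ('k, 'h, 'a, 'v) bimodule \<Rightarrow> ('k, 'h, 'a, 'w) bimodule \<Rightarrow> ('v \<Rightarrow> 'w) \<Rightarrow> bool" where
  "bimodule_hom k H A V W f \<longleftrightarrow>
    h_linear k H V W f \<and>
    (\<forall>a\<in>carrier A. \<forall>v\<in>carrier V. f (lact V a v) = lact W a (f v)) \<and>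
    (\<forall>v\<in>carrier V. \<forall>a\<in>carrier A. f (ract V v a) = ract W (f v) a)"

text \<open>\<open>A\<close> as a bimodule over itself.\<close>

definition regular :: "('k, 'h, 'a) hmodule \<Rightarrow> ('k, 'h, 'a, 'a) bimodule" where
  "regular A = hmodule.extend A (bimodule.fields (mult A) (mult A))"


section \<open>The monoidal structure on bimodules\<close>

text \<open>The bimodule \<open>V \<otimes> W\<close>.\<close>

definition b_tensor ::
  "('k, 'r) ring_scheme \<Rightarrow> ('k, 'h) quasi_hopf \<Rightarrow> ('k, 'h, 'a) hmodule
    \<Rightarrow> ('k, 'h, 'a, 'v) bimodule \<Rightarrow> ('k, 'h, 'a, 'w) bimodule
    \<Rightarrow> ('k, 'h, 'a, ('v, 'w) tens) bimodule" where
  "b_tensor k H A V W =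
    (let T = tensor k V W in
     hmodule.extend (h_tensor k H V W) (bimodule.fields
       (\<lambda>a t. tlift T (\<lambda>v w. tlift3 T
          (\<lambda>x y z. pure k V W (lact V (act A x a) (act V y v)) (act W z w)) (phi_inv k H)) t)
       (\<lambda>t a. tlift T (\<lambda>v w. tlift3 T
          (\<lambda>x y z. pure k V W (act V x v) (ract W (act W y w) (act A z a))) (phi H)) t)))"

text \<open>The submodule \<open>Im (r\<^sub>V \<otimes> id - (id \<otimes> l\<^sub>W) \<circ> \<Phi>)\<close>.\<close>

definition balancing ::
  "('k, 'r) ring_scheme \<Rightarrow> ('k, 'h) quasi_hopf \<Rightarrow> ('k, 'h, 'a) hmodule
    \<Rightarrow> ('k, 'h, 'a, 'v) bimodule \<Rightarrow> ('k, 'h, 'a, 'w) bimodule \<Rightarrow> ('v, 'w) tens set" where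
  "balancing k H A V W =
    (\<lambda>t. tmap k V W (tlift V (ract V)) id t \<ominus>\<^bsub>tensor k V W\<^esub>
         tmap k V W id (tlift W (lact W)) (h_assoc k H V A W t))
    ` carrier (h_tensor k H (h_tensor k H V A) W)"

text \<open>
  For an additive subgroup \<open>N\<close> of \<open>M\<close>: the map into \<open>M / N\<close> induced on cosets by the map \<open>f\<close> into
  \<open>M\<close>, and the value on a coset of a map which is constant on it.
\<close>

definition coset_map ::
  "('m, 'z) ring_scheme \<Rightarrow> 'm set \<Rightarrow> ('n \<Rightarrow> 'm) \<Rightarrow> 'n set \<Rightarrow> 'm set" where
  "coset_map M N f C = (\<Union>x\<in>C. N +>\<^bsub>M\<^esub> f x)"

definition coset_val :: "('m \<Rightarrow> 'n) \<Rightarrow> 'm set \<Rightarrow> 'n" where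
  "coset_val f C = the_elem (f ` C)"

definition quotient_bimodule ::
  "('k, 'h, 'a, 'v) bimodule \<Rightarrow> 'v set \<Rightarrow> ('k, 'h, 'a, 'v set) bimodule" where
  "quotient_bimodule M N =
    \<lparr>carrier = a_rcosets\<^bsub>M\<^esub> N,
     mult = undefined,
     one = undefined,
     zero = N,
     add = set_add M,
     smult = (\<lambda>r. coset_map M N (\<lambda>x. r \<odot>\<^bsub>M\<^esub> x)),
     act = (\<lambda>h. coset_map M N (act M h)),
     lact = (\<lambda>a. coset_map M N (lact M a)),
     ract = (\<lambda>C a. coset_map M N (\<lambda>x. ract M x a) C)\<rparr>"

text \<open>The bimodule \<open>V \<otimes>\<^sub>A W\<close> and its elements \<open>v \<otimes>\<^sub>A w\<close>.\<close>

type_synonym ('v, 'w) btens = "('v, 'w) tens set"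

definition tensor_over ::
  "('k, 'r) ring_scheme \<Rightarrow> ('k, 'h) quasi_hopf \<Rightarrow> ('k, 'h, 'a) hmodule
    \<Rightarrow> ('k, 'h, 'a, 'v) bimodule \<Rightarrow> ('k, 'h, 'a, 'w) bimodule
    \<Rightarrow> ('k, 'h, 'a, ('v, 'w) btens) bimodule" where
  "tensor_over k H A V W = quotient_bimodule (b_tensor k H A V W) (balancing k H A V W)"

definition pure_over ::
  "('k, 'r) ring_scheme \<Rightarrow> ('k, 'h) quasi_hopf \<Rightarrow> ('k, 'h, 'a) hmodule
    \<Rightarrow> ('k, 'h, 'a, 'v) bimodule \<Rightarrow> ('k, 'h, 'a, 'w) bimodule
    \<Rightarrow> 'v \<Rightarrow> 'w \<Rightarrow> ('v, 'w) btens" where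
  "pure_over k H A V W v w = balancing k H A V W +>\<^bsub>tensor k V W\<^esub> pure k V W v w"

text \<open>\<open>f \<otimes>\<^sub>A g : V \<otimes>\<^sub>A W \<rightarrow> V' \<otimes>\<^sub>A W'\<close>.\<close>

definition map_over ::
  "('k, 'r) ring_scheme \<Rightarrow> ('k, 'h) quasi_hopf \<Rightarrow> ('k, 'h, 'a) hmodule
    \<Rightarrow> ('k, 'h, 'a, 'v) bimodule \<Rightarrow> ('k, 'h, 'a, 'w) bimodule
    \<Rightarrow> ('k, 'h, 'a, 's) bimodule \<Rightarrow> ('k, 'h, 'a, 't) bimodule
    \<Rightarrow> ('v \<Rightarrow> 's) \<Rightarrow> ('w \<Rightarrow> 't) \<Rightarrow> ('v, 'w) btens \<Rightarrow> ('s, 't) btens" where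
  "map_over k H A V W V' W' f g =
    (\<lambda>C\<in>carrier (tensor_over k H A V W).
      coset_map (tensor k V' W') (balancing k H A V' W') (tmap k V' W' f g) C)"

text \<open>\<open>(v \<otimes>\<^sub>A w) \<otimes>\<^sub>A x \<mapsto> (\<phi>\<^sup>(\<^sup>1\<^sup>) \<triangleright> v) \<otimes>\<^sub>A ((\<phi>\<^sup>(\<^sup>2\<^sup>) \<triangleright> w) \<otimes>\<^sub>A (\<phi>\<^sup>(\<^sup>3\<^sup>) \<triangleright> x))\<close>\<close>

definition assoc_over ::
  "('k, 'r) ring_scheme \<Rightarrow> ('k, 'h) quasi_hopf \<Rightarrow> ('k, 'h, 'a) hmodule
    \<Rightarrow> ('k, 'h, 'a, 'v) bimodule \<Rightarrow> ('k, 'h, 'a, 'w) bimodule \<Rightarrow> ('k, 'h, 'a, 'x) bimodule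
    \<Rightarrow> (('v, 'w) btens, 'x) btens \<Rightarrow> ('v, ('w, 'x) btens) btens" where
  "assoc_over k H A V W X =
    (let T = tensor_over k H A V (tensor_over k H A W X) in
     coset_val (tlift T (\<lambda>D x. coset_val (tlift T (\<lambda>v w. tlift3 T
       (\<lambda>p q r. pure_over k H A V (tensor_over k H A W X) (act V p v)
         (pure_over k H A W X (act W q w) (act X r x))) (phi H))) D)))"

definition lunit_over ::
  "('k, 'h, 'a, 'v) bimodule \<Rightarrow> ('a, 'v) btens \<Rightarrow> 'v" where
  "lunit_over V = coset_val (tlift V (lact V))"

definition runit_over ::
  "('k, 'h, 'a, 'v) bimodule \<Rightarrow> ('v, 'a) btens \<Rightarrow> 'v" where
  "runit_over V = coset_val (tlift V (ract V))"


section \<open>The internal hom of bimodules\<close>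

definition lhat ::
  "('k, 'r) ring_scheme \<Rightarrow> ('k, 'h) quasi_hopf \<Rightarrow> ('k, 'h, 'a) hmodule
    \<Rightarrow> ('k, 'h, 'a, 'v) bimodule \<Rightarrow> 'a \<Rightarrow> ('v \<Rightarrow> 'v)" where
  "lhat k H A V a =
    (\<lambda>v\<in>carrier V. tlift3 V
      (\<lambda>x y z. lact V (act A x a) (act V (y \<otimes>\<^bsub>H\<^esub> qbeta H \<otimes>\<^bsub>H\<^esub> antip H z) v)) (phi_inv k H))"

text \<open>The bimodule \<open>hom(V, W)\<close>.\<close>

definition b_hom ::
  "('k, 'r) ring_scheme \<Rightarrow> ('k, 'h) quasi_hopf \<Rightarrow> ('k, 'h, 'a) hmodule
    \<Rightarrow> ('k, 'h, 'a, 'v) bimodule \<Rightarrow> ('k, 'h, 'a, 'w) bimodule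
    \<Rightarrow> ('k, 'h, 'a, 'v \<Rightarrow> 'w) bimodule" where
  "b_hom k H A V W =
    hmodule.extend (h_hom k H V W) (bimodule.fields
      (\<lambda>a L. h_comp k H V W W (pure k (h_hom k H W W) (h_hom k H V W) (lhat k H A W a) L))
      (\<lambda>L a. h_comp k H V V W (pure k (h_hom k H V W) (h_hom k H V V) L (lhat k H A V a))))"

definition ev_over ::
  "('k, 'h) quasi_hopf \<Rightarrow> ('k, 'h, 'a, 'v) bimodule \<Rightarrow> ('k, 'h, 'a, 'w) bimodule
    \<Rightarrow> ('v \<Rightarrow> 'w, 'v) btens \<Rightarrow> 'w" where
  "ev_over H V W = coset_val (h_ev H V W)"

definition hom_f1 ::
  "('k, 'r) ring_scheme \<Rightarrow> ('k, 'h) quasi_hopf \<Rightarrow> ('k, 'h, 'a) hmodule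
    \<Rightarrow> ('k, 'h, 'a, 'v) bimodule \<Rightarrow> ('k, 'h, 'a, 'w) bimodule
    \<Rightarrow> ('v \<Rightarrow> 'w, ('v, 'a) tens) btens \<Rightarrow> 'w" where
  "hom_f1 k H A V W =
    coset_val (tlift W (\<lambda>L. tlift W
      (\<lambda>v a. ev_over H V W (pure_over k H A (b_hom k H A V W) V L (ract V v a)))))"

definition hom_f2 ::
  "('k, 'r) ring_scheme \<Rightarrow> ('k, 'h) quasi_hopf \<Rightarrow> ('k, 'h, 'a) hmodule
    \<Rightarrow> ('k, 'h, 'a, 'v) bimodule \<Rightarrow> ('k, 'h, 'a, 'w) bimodule
    \<Rightarrow> ('v \<Rightarrow> 'w, ('v, 'a) tens) btens \<Rightarrow> 'w" where
  "hom_f2 k H A V W =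
    coset_val (tlift W (\<lambda>L. tlift W (\<lambda>v a. tlift3 W (\<lambda>x y z.
      ract W
        (ev_over H V W
          (pure_over k H A (b_hom k H A V W) V (act (b_hom k H A V W) x L) (act V y v)))
        (act A z a)) (phi_inv k H))))"

definition hom_D ::
  "('k, 'r) ring_scheme \<Rightarrow> ('k, 'h) quasi_hopf \<Rightarrow> ('k, 'h, 'a) hmodule
    \<Rightarrow> ('k, 'h, 'a, 'v) bimodule \<Rightarrow> ('k, 'h, 'a, 'w) bimodule
    \<Rightarrow> (('v \<Rightarrow> 'w, ('v, 'a) tens) btens \<Rightarrow> 'w)
    \<Rightarrow> ('v \<Rightarrow> 'w) \<Rightarrow> (('v, 'a) tens \<Rightarrow> 'w)" where
  "hom_D k H A V W f L =
    (let VA = b_tensor k H A V (regular A) in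
     (\<lambda>t\<in>carrier VA. tlift3 W
       (\<lambda>x y z. f (pure_over k H A (b_hom k H A V W) VA (act (b_hom k H A V W) x L)
         (act VA (y \<otimes>\<^bsub>H\<^esub> qbeta H \<otimes>\<^bsub>H\<^esub> antip H z) t))) (phi_inv k H)))"

definition hom_over ::
  "('k, 'r) ring_scheme \<Rightarrow> ('k, 'h) quasi_hopf \<Rightarrow> ('k, 'h, 'a) hmodule
    \<Rightarrow> ('k, 'h, 'a, 'v) bimodule \<Rightarrow> ('k, 'h, 'a, 'w) bimodule
    \<Rightarrow> ('k, 'h, 'a, 'v \<Rightarrow> 'w) bimodule" where
  "hom_over k H A V W =
    (let hVA = h_hom k H (b_tensor k H A V (regular A)) W in
     b_hom k H A V W
      \<lparr>carrier := a_kernel (b_hom k H A V W) hVA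
        (\<lambda>L. hom_D k H A V W (hom_f1 k H A V W) L \<ominus>\<^bsub>hVA\<^esub>
             hom_D k H A V W (hom_f2 k H A V W) L)\<rparr>)"


section \<open>Categories, functors and equivalences\<close>

record ('o, 'm) cat =
  Ob :: "'o set"
  Hom :: "'o \<Rightarrow> 'o \<Rightarrow> 'm set"
  Id :: "'o \<Rightarrow> 'm"
  Comp :: "'o \<Rightarrow> 'o \<Rightarrow> 'o \<Rightarrow> 'm \<Rightarrow> 'm \<Rightarrow> 'm" \<comment> \<open>\<open>Comp C X Y Z g f = g \<circ> f\<close> for \<open>f : X \<rightarrow> Y\<close>, \<open>g : Y \<rightarrow> Z\<close>\<close>

definition category :: "('o, 'm) cat \<Rightarrow> bool" where
  "category C \<longleftrightarrow>
    (\<forall>X\<in>Ob C. Id C X \<in> Hom C X X) \<and>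
    (\<forall>X\<in>Ob C. \<forall>Y\<in>Ob C. \<forall>Z\<in>Ob C. \<forall>f\<in>Hom C X Y. \<forall>g\<in>Hom C Y Z. Comp C X Y Z g f \<in> Hom C X Z) \<and>
    (\<forall>X\<in>Ob C. \<forall>Y\<in>Ob C. \<forall>f\<in>Hom C X Y.
      Comp C X X Y f (Id C X) = f \<and> Comp C X Y Y (Id C Y) f = f) \<and>
    (\<forall>W\<in>Ob C. \<forall>X\<in>Ob C. \<forall>Y\<in>Ob C. \<forall>Z\<in>Ob C. \<forall>f\<in>Hom C W X. \<forall>g\<in>Hom C X Y. \<forall>h\<in>Hom C Y Z.
      Comp C W Y Z h (Comp C W X Y g f) = Comp C W X Z (Comp C X Y Z h g) f)"

definition iso_in :: "('o, 'm) cat \<Rightarrow> 'o \<Rightarrow> 'o \<Rightarrow> 'm \<Rightarrow> bool" where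
  "iso_in C X Y f \<longleftrightarrow>
    X \<in> Ob C \<and> Y \<in> Ob C \<and> f \<in> Hom C X Y \<and>
    (\<exists>g\<in>Hom C Y X. Comp C X Y X g f = Id C X \<and> Comp C Y X Y f g = Id C Y)"

definition op_cat :: "('o, 'm) cat \<Rightarrow> ('o, 'm) cat" where
  "op_cat C =
    \<lparr>Ob = Ob C, Hom = (\<lambda>X Y. Hom C Y X), Id = Id C, Comp = (\<lambda>X Y Z g f. Comp C Z Y X f g)\<rparr>"

definition prod_cat :: "('o, 'm) cat \<Rightarrow> ('p, 'n) cat \<Rightarrow> ('o \<times> 'p, 'm \<times> 'n) cat" where
  "prod_cat C D =
    \<lparr>Ob = Ob C \<times> Ob D,
     Hom = (\<lambda>(X, X') (Y, Y'). Hom C X Y \<times> Hom D X' Y'),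
     Id = (\<lambda>(X, X'). (Id C X, Id D X')),
     Comp = (\<lambda>(X, X') (Y, Y') (Z, Z') (g, g') (f, f').
       (Comp C X Y Z g f, Comp D X' Y' Z' g' f'))\<rparr>"

text \<open>The action on morphisms takes the domain and the codomain as additional arguments.\<close>

record ('o, 'm, 'p, 'n) fctr =
  fob :: "'o \<Rightarrow> 'p"
  fmap :: "'o \<Rightarrow> 'o \<Rightarrow> 'm \<Rightarrow> 'n"

definition is_functor :: "('o, 'm) cat \<Rightarrow> ('p, 'n) cat \<Rightarrow> ('o, 'm, 'p, 'n) fctr \<Rightarrow> bool" where
  "is_functor C D F \<longleftrightarrow>
    category C \<and> category D \<and>
    (\<forall>X\<in>Ob C. fob F X \<in> Ob D) \<and>
    (\<forall>X\<in>Ob C. \<forall>Y\<in>Ob C. \<forall>f\<in>Hom C X Y. fmap F X Y f \<in> Hom D (fob F X) (fob F Y)) \<and>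
    (\<forall>X\<in>Ob C. fmap F X X (Id C X) = Id D (fob F X)) \<and>
    (\<forall>X\<in>Ob C. \<forall>Y\<in>Ob C. \<forall>Z\<in>Ob C. \<forall>f\<in>Hom C X Y. \<forall>g\<in>Hom C Y Z.
      fmap F X Z (Comp C X Y Z g f) =
        Comp D (fob F X) (fob F Y) (fob F Z) (fmap F Y Z g) (fmap F X Y f))"

definition id_fctr :: "('o, 'm, 'o, 'm) fctr" where
  "id_fctr = \<lparr>fob = (\<lambda>X. X), fmap = (\<lambda>X Y f. f)\<rparr>"

definition comp_fctr ::
  "('p, 'n, 'q, 'l) fctr \<Rightarrow> ('o, 'm, 'p, 'n) fctr \<Rightarrow> ('o, 'm, 'q, 'l) fctr" where
  "comp_fctr G F =
    \<lparr>fob = (\<lambda>X. fob G (fob F X)),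
     fmap = (\<lambda>X Y f. fmap G (fob F X) (fob F Y) (fmap F X Y f))\<rparr>"

definition op_fctr :: "('o, 'm, 'p, 'n) fctr \<Rightarrow> ('o, 'm, 'p, 'n) fctr" where
  "op_fctr F = \<lparr>fob = fob F, fmap = (\<lambda>X Y. fmap F Y X)\<rparr>"

definition prod_fctr ::
  "('o, 'm, 'p, 'n) fctr \<Rightarrow> ('o2, 'm2, 'p2, 'n2) fctr
    \<Rightarrow> ('o \<times> 'o2, 'm \<times> 'm2, 'p \<times> 'p2, 'n \<times> 'n2) fctr" where
  "prod_fctr F G =
    \<lparr>fob = (\<lambda>(X, X'). (fob F X, fob G X')),
     fmap = (\<lambda>(X, X') (Y, Y') (f, f'). (fmap F X Y f, fmap G X' Y' f'))\<rparr>"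

definition natural_iso ::
  "('o, 'm) cat \<Rightarrow> ('p, 'n) cat \<Rightarrow> ('o, 'm, 'p, 'n) fctr \<Rightarrow> ('o, 'm, 'p, 'n) fctr
    \<Rightarrow> ('o \<Rightarrow> 'n) \<Rightarrow> bool" where
  "natural_iso C D F G \<eta> \<longleftrightarrow>
    is_functor C D F \<and> is_functor C D G \<and>
    (\<forall>X\<in>Ob C. iso_in D (fob F X) (fob G X) (\<eta> X)) \<and>
    (\<forall>X\<in>Ob C. \<forall>Y\<in>Ob C. \<forall>f\<in>Hom C X Y.
      Comp D (fob F X) (fob F Y) (fob G Y) (\<eta> Y) (fmap F X Y f) =
      Comp D (fob F X) (fob G X) (fob G Y) (fmap G X Y f) (\<eta> X))"

definition equivalence :: "('o, 'm) cat \<Rightarrow> ('p, 'n) cat \<Rightarrow> ('o, 'm, 'p, 'n) fctr \<Rightarrow> bool" where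
  "equivalence C D F \<longleftrightarrow>
    is_functor C D F \<and>
    (\<exists>G. is_functor D C G \<and>
      (\<exists>\<eta>. natural_iso C C id_fctr (comp_fctr G F) \<eta>) \<and>
      (\<exists>\<epsilon>. natural_iso D D (comp_fctr F G) id_fctr \<epsilon>))"


section \<open>The category of bimodules\<close>

text \<open>
  As there is no type of all bimodules, there is one category for each type \<open>'v\<close>: that of the
  bimodules whose carrier is a set of elements of \<open>'v\<close>. Tensor products and internal homs have
  carriers over other types and hence are functors between categories of this kind. Since finitely
  many types embed into a common one, nothing is lost by considering morphisms within one such
  category only.
\<close>

definition bimod_cat ::
  "('k, 'r) ring_scheme \<Rightarrow> ('k, 'h) quasi_hopf \<Rightarrow> ('k, 'h, 'a) hmodule
    \<Rightarrow> (('k, 'h, 'a, 'v) bimodule, 'v \<Rightarrow> 'v) cat" where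
  "bimod_cat k H A =
    \<lparr>Ob = {V. a_bimodule k H A V},
     Hom = (\<lambda>V W. {f \<in> extensional (carrier V). bimodule_hom k H A V W f}),
     Id = (\<lambda>V. \<lambda>v\<in>carrier V. v),
     Comp = (\<lambda>U V W g f. compose (carrier U) g f)\<rparr>"

definition tensor_functor ::
  "('k, 'r) ring_scheme \<Rightarrow> ('k, 'h) quasi_hopf \<Rightarrow> ('k, 'h, 'a) hmodule
    \<Rightarrow> (('k, 'h, 'a, 'v) bimodule \<times> ('k, 'h, 'a, 'w) bimodule, ('v \<Rightarrow> 'v) \<times> ('w \<Rightarrow> 'w),
        ('k, 'h, 'a, ('v, 'w) btens) bimodule, ('v, 'w) btens \<Rightarrow> ('v, 'w) btens) fctr" where
  "tensor_functor k H A =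
    \<lparr>fob = (\<lambda>(V, W). tensor_over k H A V W),
     fmap = (\<lambda>(V, W) (V', W') (f, g). map_over k H A V W V' W' f g)\<rparr>"

text \<open>The functor \<open>hom\<^sub>A\<close>, contravariant in the first argument: here \<open>f : V' \<rightarrow> V\<close>, \<open>g : W \<rightarrow> W'\<close>.\<close>

definition hom_functor ::
  "('k, 'r) ring_scheme \<Rightarrow> ('k, 'h) quasi_hopf \<Rightarrow> ('k, 'h, 'a) hmodule
    \<Rightarrow> (('k, 'h, 'a, 'v) bimodule \<times> ('k, 'h, 'a, 'w) bimodule, ('v \<Rightarrow> 'v) \<times> ('w \<Rightarrow> 'w),
        ('k, 'h, 'a, 'v \<Rightarrow> 'w) bimodule, ('v \<Rightarrow> 'w) \<Rightarrow> ('v \<Rightarrow> 'w)) fctr" where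
  "hom_functor k H A =
    \<lparr>fob = (\<lambda>(V, W). hom_over k H A V W),
     fmap = (\<lambda>(V, W) (V', W') (f, g).
       \<lambda>L\<in>carrier (hom_over k H A V W). \<lambda>v\<in>carrier V'. g (L (f v)))\<rparr>"


section \<open>Cochain twists\<close>

definition cochain_twist ::
  "('k, 'r) ring_scheme \<Rightarrow> ('k, 'h) quasi_hopf \<Rightarrow> ('h, 'h) tens \<Rightarrow> bool" where
  "cochain_twist k H F \<longleftrightarrow>
    F \<in> Units (tens2 k H) \<and>
    tlift H (\<lambda>a b. counit H a \<odot>\<^bsub>H\<^esub> b) F = \<one>\<^bsub>H\<^esub> \<and>
    tlift H (\<lambda>a b. counit H b \<odot>\<^bsub>H\<^esub> a) F = \<one>\<^bsub>H\<^esub>"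

definition twist_inv ::
  "('k, 'r) ring_scheme \<Rightarrow> ('k, 'h) quasi_hopf \<Rightarrow> ('h, 'h) tens \<Rightarrow> ('h, 'h) tens" where
  "twist_inv k H F = inv\<^bsub>tens2 k H\<^esub> F"

text \<open>The quasi-Hopf algebra \<open>H\<^sub>F\<close>.\<close>

definition twist_hopf ::
  "('k, 'r) ring_scheme \<Rightarrow> ('k, 'h) quasi_hopf \<Rightarrow> ('h, 'h) tens \<Rightarrow> ('k, 'h) quasi_hopf" where
  "twist_hopf k H F =
    H\<lparr>comult := (\<lambda>h. F \<otimes>\<^bsub>tens2 k H\<^esub> comult H h \<otimes>\<^bsub>tens2 k H\<^esub> twist_inv k H F),
      phi :=
        pure k H (tens2 k H) \<one>\<^bsub>H\<^esub> F \<otimes>\<^bsub>tens3 k H\<^esub> id_comult k H F \<otimes>\<^bsub>tens3 k H\<^esub> phi H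
        \<otimes>\<^bsub>tens3 k H\<^esub> comult_id k H (twist_inv k H F)
        \<otimes>\<^bsub>tens3 k H\<^esub> tassoc k H H H (pure k (tens2 k H) H (twist_inv k H F) \<one>\<^bsub>H\<^esub>),
      qalpha := tlift H (\<lambda>a b. antip H a \<otimes>\<^bsub>H\<^esub> qalpha H \<otimes>\<^bsub>H\<^esub> b) (twist_inv k H F),
      qbeta := tlift H (\<lambda>a b. a \<otimes>\<^bsub>H\<^esub> qbeta H \<otimes>\<^bsub>H\<^esub> antip H b) F\<rparr>"

text \<open>The algebra \<open>A\<^sub>F\<close>.\<close>

definition twist_algebra ::
  "('k, 'r) ring_scheme \<Rightarrow> ('k, 'h) quasi_hopf \<Rightarrow> ('h, 'h) tens
    \<Rightarrow> ('k, 'h, 'a) hmodule \<Rightarrow> ('k, 'h, 'a) hmodule" where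
  "twist_algebra k H F A =
    A\<lparr>mult := (\<lambda>a a'. tlift A (\<lambda>x y. act A x a \<otimes>\<^bsub>A\<^esub> act A y a') (twist_inv k H F))\<rparr>"

definition twist_bimodule ::
  "('k, 'r) ring_scheme \<Rightarrow> ('k, 'h) quasi_hopf \<Rightarrow> ('h, 'h) tens \<Rightarrow> ('k, 'h, 'a) hmodule
    \<Rightarrow> ('k, 'h, 'a, 'v) bimodule \<Rightarrow> ('k, 'h, 'a, 'v) bimodule" where
  "twist_bimodule k H F A V =
    V\<lparr>lact := (\<lambda>a v. tlift V (\<lambda>x y. lact V (act A x a) (act V y v)) (twist_inv k H F)),
      ract := (\<lambda>v a. tlift V (\<lambda>x y. ract V (act V x v) (act A y a)) (twist_inv k H F))\<rparr>"

text \<open>The functor \<open>\<F>\<close>.\<close>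

definition twist_functor ::
  "('k, 'r) ring_scheme \<Rightarrow> ('k, 'h) quasi_hopf \<Rightarrow> ('h, 'h) tens \<Rightarrow> ('k, 'h, 'a) hmodule
    \<Rightarrow> (('k, 'h, 'a, 'v) bimodule, 'v \<Rightarrow> 'v, ('k, 'h, 'a, 'v) bimodule, 'v \<Rightarrow> 'v) fctr" where
  "twist_functor k H F A = \<lparr>fob = twist_bimodule k H F A, fmap = (\<lambda>V W f. f)\<rparr>"

text \<open>The coherence map \<open>\<F>(V) \<otimes>\<^sub>A\<^sub>F \<F>(W) \<rightarrow> \<F>(V \<otimes>\<^sub>A W)\<close>.\<close>

definition twist_tensor_map ::
  "('k, 'r) ring_scheme \<Rightarrow> ('k, 'h) quasi_hopf \<Rightarrow> ('h, 'h) tens \<Rightarrow> ('k, 'h, 'a) hmodule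
    \<Rightarrow> ('k, 'h, 'a, 'v) bimodule \<Rightarrow> ('k, 'h, 'a, 'w) bimodule
    \<Rightarrow> ('v, 'w) btens \<Rightarrow> ('v, 'w) btens" where
  "twist_tensor_map k H F A V W =
    (\<lambda>C\<in>carrier (tensor_over k (twist_hopf k H F) (twist_algebra k H F A)
                  (twist_bimodule k H F A V) (twist_bimodule k H F A W)).
      coset_map (tensor k V W) (balancing k H A V W) (act2 k V W (twist_inv k H F)) C)"

definition twist_unit_map :: "('k, 'h, 'a) hmodule \<Rightarrow> 'a \<Rightarrow> 'a" where
  "twist_unit_map A = (\<lambda>a\<in>carrier A. a)"

text \<open>The map \<open>hom\<^sub>A\<^sub>F(\<F>(V), \<F>(W)) \<rightarrow> \<F>(hom\<^sub>A(V, W))\<close>.\<close>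

definition twist_hom_map ::
  "('k, 'r) ring_scheme \<Rightarrow> ('k, 'h) quasi_hopf \<Rightarrow> ('h, 'h) tens \<Rightarrow> ('k, 'h, 'a) hmodule
    \<Rightarrow> ('k, 'h, 'a, 'v) bimodule \<Rightarrow> ('k, 'h, 'a, 'w) bimodule
    \<Rightarrow> ('v \<Rightarrow> 'w) \<Rightarrow> ('v \<Rightarrow> 'w)" where
  "twist_hom_map k H F A V W =
    (\<lambda>L\<in>carrier (hom_over k (twist_hopf k H F) (twist_algebra k H F A)
                  (twist_bimodule k H F A V) (twist_bimodule k H F A W)).
      hom_act k H V W (twist_inv k H F) L)"

text \<open>
  \<open>\<F>\<close> is strong monoidal: the two coherence maps are (natural) isomorphisms, and they are compatible
  with the associators and with the left and right unitors. The type arguments are the element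
  types of the carriers of the three bimodules involved.
\<close>

definition twist_strong_monoidal ::
  "('k, 'r) ring_scheme \<Rightarrow> ('k, 'h) quasi_hopf \<Rightarrow> ('h, 'h) tens \<Rightarrow> ('k, 'h, 'a) hmodule
    \<Rightarrow> 'v itself \<Rightarrow> 'w itself \<Rightarrow> 'x itself \<Rightarrow> bool" where
  "twist_strong_monoidal k H F A (_ :: 'v itself) (_ :: 'w itself) (_ :: 'x itself) \<longleftrightarrow>
    (let H' = twist_hopf k H F; A' = twist_algebra k H F A in
     natural_iso
       (prod_cat (bimod_cat k H A :: (('k, 'h, 'a, 'v) bimodule, 'v \<Rightarrow> 'v) cat)
                 (bimod_cat k H A :: (('k, 'h, 'a, 'w) bimodule, 'w \<Rightarrow> 'w) cat))
       (bimod_cat k H' A')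
       (comp_fctr (tensor_functor k H' A')
         (prod_fctr (twist_functor k H F A) (twist_functor k H F A)))
       (comp_fctr (twist_functor k H F A) (tensor_functor k H A))
       (\<lambda>(V, W). twist_tensor_map k H F A V W) \<and>
     iso_in (bimod_cat k H' A') (regular A') (twist_bimodule k H F A (regular A))
       (twist_unit_map A) \<and>
     (\<forall>(V :: ('k, 'h, 'a, 'v) bimodule) (W :: ('k, 'h, 'a, 'w) bimodule)
       (X :: ('k, 'h, 'a, 'x) bimodule).
       a_bimodule k H A V \<and> a_bimodule k H A W \<and> a_bimodule k H A X \<longrightarrow>
       (let V' = twist_bimodule k H F A V; W' = twist_bimodule k H F A W;
            X' = twist_bimodule k H F A X in
        \<forall>t\<in>carrier (tensor_over k H' A' (tensor_over k H' A' V' W') X').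
          assoc_over k H A V W X
            (twist_tensor_map k H F A (tensor_over k H A V W) X
              (map_over k H' A' (tensor_over k H' A' V' W') X'
                (twist_bimodule k H F A (tensor_over k H A V W)) X'
                (twist_tensor_map k H F A V W) (\<lambda>x. x) t)) =
          twist_tensor_map k H F A V (tensor_over k H A W X)
            (map_over k H' A' V' (tensor_over k H' A' W' X')
              V' (twist_bimodule k H F A (tensor_over k H A W X))
              (\<lambda>v. v) (twist_tensor_map k H F A W X)
              (assoc_over k H' A' V' W' X' t)))) \<and>
     (\<forall>V :: ('k, 'h, 'a, 'v) bimodule. a_bimodule k H A V \<longrightarrow>
       (let V' = twist_bimodule k H F A V; FA = twist_bimodule k H F A (regular A) in
        (\<forall>t\<in>carrier (tensor_over k H' A' (regular A') V').
          lunit_over V (twist_tensor_map k H F A (regular A) V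
            (map_over k H' A' (regular A') V' FA V' (twist_unit_map A) (\<lambda>v. v) t)) =
          lunit_over V' t) \<and>
        (\<forall>t\<in>carrier (tensor_over k H' A' V' (regular A')).
          runit_over V (twist_tensor_map k H F A V (regular A)
            (map_over k H' A' V' (regular A') V' FA (\<lambda>v. v) (twist_unit_map A) t)) =
          runit_over V' t))))"

text \<open>\<open>\<F>\<close> respects internal homs: \<open>hom\<^sub>A\<^sub>F \<circ> (\<F>\<^sup>o\<^sup>p \<times> \<F>) \<cong> \<F> \<circ> hom\<^sub>A\<close>.\<close>

definition twist_preserves_hom ::
  "('k, 'r) ring_scheme \<Rightarrow> ('k, 'h) quasi_hopf \<Rightarrow> ('h, 'h) tens \<Rightarrow> ('k, 'h, 'a) hmodule
    \<Rightarrow> 'v itself \<Rightarrow> 'w itself \<Rightarrow> bool" where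
  "twist_preserves_hom k H F A (_ :: 'v itself) (_ :: 'w itself) \<longleftrightarrow>
    (let H' = twist_hopf k H F; A' = twist_algebra k H F A in
     natural_iso
       (prod_cat (op_cat (bimod_cat k H A :: (('k, 'h, 'a, 'v) bimodule, 'v \<Rightarrow> 'v) cat))
                 (bimod_cat k H A :: (('k, 'h, 'a, 'w) bimodule, 'w \<Rightarrow> 'w) cat))
       (bimod_cat k H' A')
       (comp_fctr (hom_functor k H' A')
         (prod_fctr (op_fctr (twist_functor k H F A)) (twist_functor k H F A)))
       (comp_fctr (twist_functor k H F A) (hom_functor k H A))
       (\<lambda>(V, W). twist_hom_map k H F A V W))"

text \<open>
  \<open>\<F>\<close> is an equivalence of closed monoidal categories. The first two conditions say that the target
  category is that of bimodules over an algebra in the category of modules over a quasi-Hopf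
  algebra.
\<close>

definition twist_closed_monoidal_equivalence ::
  "('k, 'r) ring_scheme \<Rightarrow> ('k, 'h) quasi_hopf \<Rightarrow> ('h, 'h) tens \<Rightarrow> ('k, 'h, 'a) hmodule
    \<Rightarrow> 'v itself \<Rightarrow> 'w itself \<Rightarrow> 'x itself \<Rightarrow> bool" where
  "twist_closed_monoidal_equivalence k H F A (v :: 'v itself) (w :: 'w itself) (x :: 'x itself) \<longleftrightarrow>
    quasi_hopf_algebra k (twist_hopf k H F) \<and>
    h_algebra k (twist_hopf k H F) (twist_algebra k H F A) \<and>
    equivalence
      (bimod_cat k H A :: (('k, 'h, 'a, 'v) bimodule, 'v \<Rightarrow> 'v) cat)
      (bimod_cat k (twist_hopf k H F) (twist_algebra k H F A))
      (twist_functor k H F A) \<and>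
    twist_strong_monoidal k H F A v w x \<and>
    twist_preserves_hom k H F A v w"

end

theory Submission
  imports Defs
begin

text \<open>
 Algebras, bimodules, internal homs, their actions, evaluations and composition are all given by
 \<open>H\<close>-equivariant bilinear products which satisfy associativity laws
 \<open>(u v) w = (\<phi>\<^sub>1 u) ((\<phi>\<^sub>2 v) (\<phi>\<^sub>3 w))\<close>, possibly with four different products (predicate \<open>alaw\<close>).
 Replacing every product \<open>x y\<close> by \<open>(F\<inverse>\<^sub>1 x) (F\<inverse>\<^sub>2 y)\<close> turns laws for \<open>\<phi>\<close> into laws for \<open>\<phi>\<^sub>F\<close>
 (\<open>assoc_twist\<close>), and back again, as \<open>F\<inverse>\<close> is a twist of \<open>H\<^sub>F\<close> that leads back to \<open>H\<close>. So all that remains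
 is to describe the constructions on bimodules by such laws alone.

 For this the pentagon is read as five laws between products of four factors, any four of which
 imply the fifth (\<open>edges\<close>). A map descends to \<open>V \<otimes>\<^sub>A W\<close> iff it satisfies a law (\<open>kills_iff\<close>), and actions,
 associator and unitors of \<open>V \<otimes>\<^sub>A W\<close> are the products completing a law. The coherence map
 is the twisted product \<open>v \<otimes>\<^sub>A w\<close>, hence it is compatible with everything given by laws.

 For internal homs, evaluation and coevaluation form an adjunction (\<open>ev_coev\<close>, \<open>coev_ev\<close>), so that
 products with values in \<open>hom(V, W)\<close> are determined by their evaluations
 (\<open>products_into_hom_eq\<close>). Composition and the actions of \<open>A\<close> are then laws for evaluation, and
 \<open>hom\<^sub>A(V, W)\<close> is the largest \<open>H\<close>-stable set of maps satisfying a law with the right actions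
 (\<open>hom_over_eq\<close>). Since evaluation for \<open>H\<^sub>F\<close> is the twisted evaluation after
 \<open>L \<mapsto> (F\<inverse>\<^sub>1 \<triangleright>) L (S(F\<inverse>\<^sub>2) \<triangleright>)\<close> (\<open>ev_twist\<close>), this map identifies the internal homs.
\<close>

abbreviation in_carrier (infix "|:" 50) where "x |: V == x \<in> carrier V"
abbreviation add_in ("_ \<oplus>[_] _" [65, 0, 66] 65) where "x \<oplus>[V] y == add V x y"
abbreviation minus_in ("_ \<ominus>[_] _" [65, 0, 66] 65) where "x \<ominus>[V] y == a_minus V x y"
abbreviation neg_in ("\<ominus>[_] _" [0, 81] 80) where "\<ominus>[V] x == a_inv V x"
abbreviation mult_in ("_ \<otimes>[_] _" [70, 0, 71] 70) where "x \<otimes>[A] y == mult A x y"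
abbreviation smult_in ("_ \<odot>[_] _" [71, 0, 70] 70) where "r \<odot>[V] x == smult V r x"
abbreviation one_in ("\<one>[_]") where "\<one>[A] == one A"
abbreviation zero_in ("\<zero>[_]") where "\<zero>[V] == zero V"
abbreviation lmap where "lmap == linear_map"
abbreviation blmap where "blmap == bilinear_map"
abbreviation hmod where "hmod == h_module"
abbreviation pure3 where "pure3 k U V W u v w == pure k U (tensor k V W) u (pure k V W v w)"

text \<open>
 With \<open>t = t\<^sub>1 \<otimes> t\<^sub>2 \<otimes> t\<^sub>3\<close>, these two are \<open>((t\<^sub>1 u) (t\<^sub>2 v)) (t\<^sub>3 w)\<close> and \<open>(t\<^sub>1 u) ((t\<^sub>2 v) (t\<^sub>3 w))\<close>.
\<close>

abbreviation nested_l where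
  "nested_l U V W X m1 m2 t u v w == tlift3 X (%a b c. m2 (m1 (act U a u) (act V b v)) (act W c w)) t"
abbreviation nested_r where
  "nested_r U V W X m3 m4 t u v w == tlift3 X (%a b c. m4 (act U a u) (m3 (act V b v) (act W c w))) t"

section \<open>Linear maps\<close>

named_theorems lin

lemma module_abelian: "module k V ==> abelian_group V" unfolding module_def by simp

lemma module_zero_closed: "module k V ==> \<zero>[V] |: V"
 by (simp add: module_abelian abelian_group.axioms abelian_monoid.zero_closed)

lemma module_add_closed:
 "module k V ==> x |: V ==> y |: V ==> x \<oplus>[V] y |: V"
 by (simp add: module_abelian abelian_group.axioms abelian_monoid.a_closed)

lemma module_minus_closed:
 "module k V ==> x |: V ==> y |: V ==> x \<ominus>[V] y |: V" by (simp add: module_abelian abelian_group.minus_closed)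

lemmas module_closed = module_zero_closed module_add_closed module_minus_closed module.smult_closed

lemma linear_mapI:
 assumes "!!x. x |: V ==> f x |: W"
  and "!!x y. x |: V ==> y |: V ==> f (x \<oplus>[V] y) = f x \<oplus>[W] f y"
  and "!!r x. r |: k ==> x |: V ==> f (r \<odot>[V] x) = r \<odot>[W] f x"
 shows "lmap k V W f" using assms unfolding linear_map_def by auto

lemma lin_cl: "lmap k V W f ==> x |: V ==> f x |: W" unfolding linear_map_def by auto

lemma linear_add:
 "lmap k V W f ==> x |: V ==> y |: V ==> f (x \<oplus>[V] y) = f x \<oplus>[W] f y" unfolding linear_map_def by auto

lemma linear_smult:
 "lmap k V W f ==> r |: k ==> x |: V ==> f (r \<odot>[V] x) = r \<odot>[W] f x" unfolding linear_map_def by auto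

lemma linear_abelian_group_hom:
 "lmap k V W f ==> module k V ==> module k W ==> abelian_group_hom V W f" by (intro abelian_group_homI)
  (auto simp: module_abelian group_hom_def group_hom_axioms_def hom_def linear_map_def
    abelian_group.a_group)

lemma linear_zero: "lmap k V W f ==> module k V ==> module k W ==> f \<zero>[V] = \<zero>[W]"
 using abelian_group_hom.hom_zero[OF linear_abelian_group_hom] .

lemma linear_minus:
 assumes "lmap k V W f" "module k V" "module k W" "x |: V" "y |: V"
 shows "f (x \<ominus>[V] y) = f x \<ominus>[W] f y"
proof -
 interpret abelian_group V using assms module_abelian by blast
 interpret f: abelian_group_hom V W f using linear_abelian_group_hom assms by blast
 show ?thesis using assms by (simp add: a_minus_def f.hom_add f.hom_a_inv)
qed

lemma linear_id [lin]: "lmap k V V (%x. x)" by (rule linear_mapI) auto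

lemma lin_comp:
 "lmap k V W f ==> lmap k U V g ==> lmap k U W (%x. f (g x))" unfolding linear_map_def by (auto simp: Pi_iff)

lemma linear_const_zero:
 assumes "module k W" shows "lmap k V W (%x. \<zero>[W])"
proof -
 interpret module k W by fact
 show ?thesis by (rule linear_mapI) auto
qed

lemma linear_sum:
 assumes "module k W" "lmap k V W f" "lmap k V W g"
 shows "lmap k V W (%x. f x \<oplus>[W] g x)"
proof -
 interpret module k W by fact
 note cl = lin_cl[OF assms(2)] lin_cl[OF assms(3)]
 show ?thesis by (rule linear_mapI)
  (auto simp: cl linear_add[OF assms(2)] linear_add[OF assms(3)] linear_smult[OF assms(2)]
    linear_smult[OF assms(3)] M.a_ac smult_r_distr)
qed

lemma linear_diff:
 assumes "module k W" "lmap k V W f" "lmap k V W g"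
 shows "lmap k V W (%x. f x \<ominus>[W] g x)"
proof -
 interpret module k W by fact
 note cl = lin_cl[OF assms(2)] lin_cl[OF assms(3)]
 show ?thesis by (rule linear_mapI)
  (auto simp: cl linear_add[OF assms(2)] linear_add[OF assms(3)] linear_smult[OF assms(2)]
    linear_smult[OF assms(3)] M.a_ac smult_r_distr M.minus_add a_minus_def smult_r_minus)
qed

lemma linear_scale:
 assumes "module k W" "lmap k V W f" "r |: k"
 shows "lmap k V W (%x. r \<odot>[W] f x)"
proof -
 interpret module k W by fact
 note cl = lin_cl[OF assms(2)]
 show ?thesis using assms(3) by (intro linear_mapI)
  (auto simp: cl linear_add[OF assms(2)] linear_smult[OF assms(2)] smult_r_distr
    smult_assoc1[symmetric] R.m_comm)
qed

lemma linear_map_cong: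
 assumes "!!x. x |: V ==> f x = g x" "module k V"
 shows "lmap k V W f \<longleftrightarrow> lmap k V W g"
proof -
 interpret module k V by fact
 show ?thesis unfolding linear_map_def using assms(1) by (auto simp: Pi_iff)
qed

lemma bilI:
 assumes "!!u. u |: U ==> lmap k V W (b u)"
  and "!!v. v |: V ==> lmap k U W (%u. b u v)"
 shows "blmap k U V W b" using assms unfolding bilinear_map_def by auto

lemma bil_cl:
 "blmap k U V W b ==> u |: U ==> v |: V ==> b u v |: W" unfolding bilinear_map_def using lin_cl by fastforce

lemma bil_r:
 "blmap k U V W b ==> u |: U ==> lmap k V W (b u)" unfolding bilinear_map_def by auto

lemma bil_l:
 "blmap k U V W b ==> v |: V ==> lmap k U W (%u. b u v)" unfolding bilinear_map_def by auto

lemma bil1: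
 "blmap k U V W b ==> lmap k Z U f ==> v |: V
  ==> lmap k Z W (%z. b (f z) v)" using lin_comp[OF bil_l] .

lemma bil2:
 "blmap k U V W b ==> lmap k Z V f ==> u |: U
  ==> lmap k Z W (%z. b u (f z))" using lin_comp[OF bil_r] .

lemmas bil = bil1 bil2 bil_cl bil_r

definition trilinear where
 "trilinear k U V W M f \<longleftrightarrow>
  (\<forall>v\<in>carrier V. \<forall>w\<in>carrier W. lmap k U M (%u. f u v w)) \<and>
  (\<forall>u\<in>carrier U. blmap k V W M (f u))"

lemma trilinearI:
 assumes "!!v w. v |: V ==> w |: W ==> lmap k U M (%u. f u v w)"
  and "!!u w. u |: U ==> w |: W ==> lmap k V M (%v. f u v w)"
  and "!!u v. u |: U ==> v |: V ==> lmap k W M (%w. f u v w)"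
 shows "trilinear k U V W M f" using assms unfolding trilinear_def by (auto intro: bilI)

definition quadlinear where
 "quadlinear k U V W X M f \<longleftrightarrow>
  (\<forall>v\<in>carrier V. \<forall>w\<in>carrier W. \<forall>x\<in>carrier X. lmap k U M (%u. f u v w x)) \<and>
  (\<forall>u\<in>carrier U. trilinear k V W X M (f u))"

lemma quadlinearI:
 assumes "!!v w x. v |: V ==> w |: W ==> x |: X
   ==> lmap k U M (%u. f u v w x)"
  and "!!u w x. u |: U ==> w |: W ==> x |: X
   ==> lmap k V M (%v. f u v w x)"
  and "!!u v x. u |: U ==> v |: V ==> x |: X
   ==> lmap k W M (%w. f u v w x)"
  and "!!u v w. u |: U ==> v |: V ==> w |: W
   ==> lmap k X M (%x. f u v w x)"
 shows "quadlinear k U V W X M f" using assms unfolding quadlinear_def by (auto intro: trilinearI)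

section \<open>Tensor products\<close>

lemma list_sum_simps [simp]:
 "list_sum M [] = \<zero>[M]" "list_sum M (x # xs) = x \<oplus>[M] list_sum M xs" by (simp_all add: list_sum_def)

lemma list_sum_closed:
 assumes "abelian_group M" "set xs \<subseteq> carrier M" shows "list_sum M xs |: M"
proof -
 interpret abelian_group M by fact
 show ?thesis using assms(2) by (induction xs) auto
qed

lemma list_sum_append:
 assumes "abelian_group M" "set xs \<subseteq> carrier M" "set ys \<subseteq> carrier M"
 shows "list_sum M (xs @ ys) = list_sum M xs \<oplus>[M] list_sum M ys"
proof -
 interpret abelian_group M by fact
 show ?thesis using assms(2,3) by (induction xs) (auto simp: list_sum_closed[OF assms(1)] a_assoc)
qed

locale two_modules =
 fixes k :: "('k, 'r) ring_scheme" and V :: "('k, 'v, 'y) module_scheme"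
  and W :: "('k, 'w, 'z) module_scheme"
 assumes mV: "module k V" and mW: "module k W"
begin

interpretation V: module k V by (rule mV)
interpretation W: module k W by (rule mW)

lemma tens_rel_set:
 "tens_rel k V W xs ys ==>
  set xs \<subseteq> carrier V \<times> carrier W \<and> set ys \<subseteq> carrier V \<times> carrier W"
 by (induction rule: tens_rel.induct) auto

lemma tens_class_eqI: "tens_rel k V W xs ys ==> tens_class k V W xs = tens_class k V W ys"
 unfolding tens_class_def by (auto intro: tens_rel.trans tens_rel.sym)

lemma tens_class_self:
 "set xs \<subseteq> carrier V \<times> carrier W ==> xs \<in> tens_class k V W xs"
 unfolding tens_class_def by (auto intro: tens_rel.refl)

lemma tens_classD: "ys \<in> tens_class k V W xs ==> tens_rel k V W xs ys" unfolding tens_class_def by auto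

lemma tens_carrierE:
 assumes "t |: tensor k V W"
 obtains xs where "set xs \<subseteq> carrier V \<times> carrier W" "t = tens_class k V W xs"
 using assms unfolding tensor_def by auto

lemma tens_class_carrier:
 "set xs \<subseteq> carrier V \<times> carrier W ==> tens_class k V W xs |: tensor k V W" unfolding tensor_def by auto

lemma UN_constI: "x \<in> A ==> (!!y. y \<in> A ==> f y = c) ==> \<Union> (f ` A) = c" by auto

lemma tens_add_class:
 assumes "set xs \<subseteq> carrier V \<times> carrier W" "set ys \<subseteq> carrier V \<times> carrier W"
 shows "tens_class k V W xs \<oplus>[tensor k V W] tens_class k V W ys = tens_class k V W (xs @ ys)"
 unfolding tensor_def ring_record_simps by (rule UN_constI[OF tens_class_self[OF assms(1)]],
   rule UN_constI[OF tens_class_self[OF assms(2)]],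
   rule tens_class_eqI, blast intro: tens_rel.app tens_classD tens_rel.sym)

lemma tens_rel_smult:
 assumes "r |: k"
 shows "tens_rel k V W xs ys ==>
  tens_rel k V W (map (%(v, w). (r \<odot>[V] v, w)) xs) (map (%(v, w). (r \<odot>[V] v, w)) ys)"
proof (induction rule: tens_rel.induct)
 case (refl xs) then show ?case using assms by (intro tens_rel.refl) auto
next
 case (comm xs ys) then show ?case using assms by (auto simp: subset_iff intro!: tens_rel.comm)
next
 case (zero w) then show ?case using assms by (auto intro!: tens_rel.zero)
next
 case (add_left v v' w) then show ?case using assms by (auto simp: V.smult_r_distr intro!: tens_rel.add_left)
next
 case (add_right v w w') then show ?case using assms by (auto intro!: tens_rel.add_right)
next
 case (smult s v w)
 then have "r \<odot>[V] (s \<odot>[V] v) = s \<odot>[V] (r \<odot>[V] v)"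
  using assms by (simp add: V.smult_assoc1[symmetric] V.R.m_comm)
 then show ?case using smult assms by (auto intro!: tens_rel.smult)
qed (auto intro: tens_rel.sym tens_rel.trans tens_rel.app)

lemma tens_smult_class:
 assumes "set xs \<subseteq> carrier V \<times> carrier W" "r |: k"
 shows "r \<odot>[tensor k V W] tens_class k V W xs
  = tens_class k V W (map (%(v, w). (r \<odot>[V] v, w)) xs)" unfolding tensor_def module.simps ring_record_simps
 by (rule UN_constI[OF tens_class_self[OF assms(1)]], rule tens_class_eqI)
  (rule tens_rel_smult[OF assms(2)], rule tens_rel.sym, erule tens_classD)

lemma tens_zero: "\<zero>[tensor k V W] = tens_class k V W []" unfolding tensor_def by simp

lemma tens_abelian_monoid: "abelian_monoid (tensor k V W)"
proof (rule abelian_monoidI)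
 fix x y z assume "x |: tensor k V W" "y |: tensor k V W" "z |: tensor k V W"
 then obtain xs ys zs where *: "set xs \<subseteq> carrier V \<times> carrier W" "x = tens_class k V W xs"
  "set ys \<subseteq> carrier V \<times> carrier W" "y = tens_class k V W ys"
  "set zs \<subseteq> carrier V \<times> carrier W" "z = tens_class k V W zs" by (auto elim!: tens_carrierE)
 then show "x \<oplus>[tensor k V W] y \<oplus>[tensor k V W] z = x \<oplus>[tensor k V W] (y \<oplus>[tensor k V W] z)"
  by (simp add: tens_add_class)
next
 fix x y assume "x |: tensor k V W" "y |: tensor k V W"
 then obtain xs ys where *: "set xs \<subseteq> carrier V \<times> carrier W" "x = tens_class k V W xs"
  "set ys \<subseteq> carrier V \<times> carrier W" "y = tens_class k V W ys" by (auto elim!: tens_carrierE)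
 then show "x \<oplus>[tensor k V W] y |: tensor k V W" by (auto simp: tens_add_class intro!: tens_class_carrier)
 show "x \<oplus>[tensor k V W] y = y \<oplus>[tensor k V W] x" using * by (simp add: tens_add_class tens_class_eqI tens_rel.comm)
next
 fix x assume "x |: tensor k V W"
 then obtain xs where *: "set xs \<subseteq> carrier V \<times> carrier W" "x = tens_class k V W xs"
  by (auto elim!: tens_carrierE)
 then show "\<zero>[tensor k V W] \<oplus>[tensor k V W] x = x" by (simp add: tens_add_class tens_zero)
qed (auto simp: tens_zero tens_class_carrier)

interpretation T: abelian_monoid "tensor k V W" by (rule tens_abelian_monoid)

lemma pure_closed: "v |: V ==> w |: W ==> pure k V W v w |: tensor k V W" unfolding pure_def by (auto intro: tens_class_carrier)

lemma tens_class_Cons: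
 assumes "v |: V" "w |: W" "set xs \<subseteq> carrier V \<times> carrier W"
 shows "tens_class k V W ((v, w) # xs) = pure k V W v w \<oplus>[tensor k V W] tens_class k V W xs"
 unfolding pure_def using assms by (simp add: tens_add_class)

lemma pure_add_left:
 "v |: V ==> v' |: V ==> w |: W ==>
  pure k V W (v \<oplus>[V] v') w = pure k V W v w \<oplus>[tensor k V W] pure k V W v' w"
 unfolding pure_def by (simp add: tens_add_class tens_class_eqI tens_rel.add_left)

lemma pure_add_right:
 "v |: V ==> w' |: W ==> w |: W ==>
  pure k V W v (w \<oplus>[W] w') = pure k V W v w \<oplus>[tensor k V W] pure k V W v w'"
 unfolding pure_def by (simp add: tens_add_class tens_class_eqI tens_rel.add_right)

lemma pure_smult_left:
 "v |: V ==> r |: k ==> w |: W ==>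
  pure k V W (r \<odot>[V] v) w = r \<odot>[tensor k V W] pure k V W v w" unfolding pure_def by (simp add: tens_smult_class)

lemma pure_smult_right:
 "v |: V ==> r |: k ==> w |: W ==>
  pure k V W v (r \<odot>[W] w) = r \<odot>[tensor k V W] pure k V W v w"
 unfolding pure_def by (simp add: tens_smult_class tens_class_eqI[OF tens_rel.smult, symmetric])

lemma tens_smult_closed:
 "r |: k ==> x |: (tensor k V W) ==> r \<odot>[tensor k V W] x |: tensor k V W"
 by (elim tens_carrierE) (auto simp: tens_smult_class subset_iff intro!: tens_class_carrier)

lemma tens_smult_add:
 assumes "r |: k" "x |: tensor k V W" "y |: tensor k V W"
 shows "r \<odot>[tensor k V W] (x \<oplus>[tensor k V W] y)
   = r \<odot>[tensor k V W] x \<oplus>[tensor k V W] r \<odot>[tensor k V W] y"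
proof -
 from assms obtain xs ys where *: "set xs \<subseteq> carrier V \<times> carrier W" "x = tens_class k V W xs"
  "set ys \<subseteq> carrier V \<times> carrier W" "y = tens_class k V W ys" by (auto elim!: tens_carrierE)
 have "set (map (%(v, w). (r \<odot>[V] v, w)) xs) \<subseteq> carrier V \<times> carrier W"
  "set (map (%(v, w). (r \<odot>[V] v, w)) ys) \<subseteq> carrier V \<times> carrier W" using * assms by (auto simp: subset_iff)
 then show ?thesis using * assms by (simp add: tens_smult_class tens_add_class)
qed

lemma tens_induct [consumes 1, case_names zero step]:
 assumes "t |: tensor k V W" "P \<zero>[tensor k V W]"
  and step: "!!v w t. v |: V ==> w |: W ==> t |: (tensor k V W) ==> P t
   ==> P (pure k V W v w \<oplus>[tensor k V W] t)"
 shows "P t"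
proof -
 obtain xs where *: "set xs \<subseteq> carrier V \<times> carrier W" "t = tens_class k V W xs"
  using assms(1) by (rule tens_carrierE)
 from *(1) have "P (tens_class k V W xs)"
 proof (induction xs)
  case Nil then show ?case using assms(2) by (simp add: tens_zero)
 next
  case (Cons p xs)
  then show ?case by (cases p) (auto simp: tens_class_Cons intro!: step tens_class_carrier)
 qed
 then show ?thesis using * by simp
qed

lemma tens_smult_zero: "r |: k ==> r \<odot>[tensor k V W] \<zero>[tensor k V W] = \<zero>[tensor k V W]"
 by (simp add: tens_zero tens_smult_class)

lemma tens_smult_l_distr:
 assumes "a |: k" "b |: k" "x |: tensor k V W"
 shows "(a \<oplus>[k] b) \<odot>[tensor k V W] x
   = a \<odot>[tensor k V W] x \<oplus>[tensor k V W] b \<odot>[tensor k V W] x" using assms(3)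
proof (induction rule: tens_induct)
 case zero then show ?case using assms by (simp add: tens_smult_zero)
next
 case (step v w t)
 then show ?case using assms by (simp add: tens_smult_add pure_closed pure_smult_left[symmetric] V.smult_l_distr
    pure_add_left T.a_ac tens_smult_closed)
qed

lemma tens_pure_zero: "w |: W ==> pure k V W \<zero>[V] w = \<zero>[tensor k V W]"
 unfolding pure_def tens_zero by (rule tens_class_eqI, rule tens_rel.zero)

lemma tens_smult_null:
 "x |: (tensor k V W) ==> \<zero>[k] \<odot>[tensor k V W] x = \<zero>[tensor k V W]"
proof (induction rule: tens_induct)
 case zero then show ?case by (simp add: tens_smult_zero)
next
 case (step v w t)
 then show ?case by (simp add: tens_smult_add pure_closed pure_smult_left[symmetric] tens_pure_zero)
qed

lemma tens_smult_one:
 "x |: (tensor k V W) ==> \<one>[k] \<odot>[tensor k V W] x = x"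
proof (induction rule: tens_induct)
 case zero then show ?case by (simp add: tens_smult_zero)
next
 case (step v w t)
 then show ?case by (simp add: tens_smult_add pure_closed pure_smult_left[symmetric])
qed

lemma tens_smult_assoc:
 assumes "a |: k" "b |: k" "x |: tensor k V W"
 shows "(a \<otimes>[k] b) \<odot>[tensor k V W] x = a \<odot>[tensor k V W] (b \<odot>[tensor k V W] x)" using assms(3)
proof (induction rule: tens_induct)
 case zero then show ?case using assms by (simp add: tens_smult_zero)
next
 case (step v w t)
 then show ?case using assms by (simp add: tens_smult_add pure_closed pure_smult_left[symmetric] V.smult_assoc1
    tens_smult_closed)
qed

lemma tens_abelian_group: "abelian_group (tensor k V W)"
proof (rule abelian_groupI)
 fix x assume x: "x |: tensor k V W"
 have "(\<ominus>[k] \<one>[k]) \<odot>[tensor k V W] x \<oplus>[tensor k V W] \<one>[k] \<odot>[tensor k V W] x = \<zero>[tensor k V W]"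
  using x by (subst tens_smult_l_distr[symmetric]) (auto simp: tens_smult_null V.R.l_neg)
 then show "\<exists>y\<in>carrier (tensor k V W). y \<oplus>[tensor k V W] x = \<zero>[tensor k V W]"
  using x tens_smult_one tens_smult_closed by (metis V.R.a_inv_closed V.R.one_closed)
qed (auto simp: T.a_ac)

lemma tensor_module: "module k (tensor k V W)" by (rule moduleI)
  (auto simp: tens_abelian_group tens_smult_closed tens_smult_add tens_smult_l_distr
   tens_smult_assoc tens_smult_one V.R.is_cring)

lemma pure_bilinear: "blmap k V W (tensor k V W) (pure k V W)" by (intro bilI linear_mapI)
  (auto simp: pure_closed pure_add_left pure_add_right pure_smult_left pure_smult_right)

lemma tens_class_sum:
 "set xs \<subseteq> carrier V \<times> carrier W ==>
  tens_class k V W xs = list_sum (tensor k V W) (map (%(v, w). pure k V W v w) xs)"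
 by (induction xs) (auto simp: tens_class_Cons tens_zero[symmetric])

lemma tlift_class:
 assumes "blmap k V W M f" "module k M" "set xs \<subseteq> carrier V \<times> carrier W"
 shows "tlift M f (tens_class k V W xs) = list_sum M (map (%(v, w). f v w) xs)"
proof -
 interpret M: module k M by fact
 note cl = bil_cl[OF assms(1)]
 have in_M: "set (map (%(v, w). f v w) xs) \<subseteq> carrier M"
  if "set xs \<subseteq> carrier V \<times> carrier W" for xs using that cl by auto
 have inv: "list_sum M (map (%(v, w). f v w) xs) = list_sum M (map (%(v, w). f v w) ys)"
  if "tens_rel k V W xs ys" for xs ys using that
 proof (induction rule: tens_rel.induct)
  case (app xs xs' ys ys')
  then show ?case using tens_rel_set[OF app(1)] tens_rel_set[OF app(2)]
   by (simp only: map_append) (simp add: list_sum_append[OF M.abelian_group_axioms] in_M del: set_map)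
 next
  case (comm xs ys)
  then show ?case by (simp only: map_append)
    (simp add: list_sum_append[OF M.abelian_group_axioms] in_M
    list_sum_closed[OF M.abelian_group_axioms] M.a_comm del: set_map)
 next
  case (zero w)
  then show ?case using linear_zero[OF bil_l[OF assms(1)] mV assms(2), of w] by simp
 next
  case (add_left v v' w)
  then show ?case using cl linear_add[OF bil_l[OF assms(1)]] by (simp add: M.a_assoc)
 next
  case (add_right v w w')
  then show ?case using cl linear_add[OF bil_r[OF assms(1)]] by (simp add: M.a_assoc)
 next
  case (smult r v w)
  then show ?case using cl linear_smult[OF bil_l[OF assms(1)]] linear_smult[OF bil_r[OF assms(1)]] by simp
 qed auto
 have "(%xs. list_sum M (map (%(v, w). f v w) xs)) ` tens_class k V W xs
   = {list_sum M (map (%(v, w). f v w) xs)}"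
 proof (intro equalityI subsetI)
  fix y assume "y \<in> (%xs. list_sum M (map (%(v, w). f v w) xs)) ` tens_class k V W xs"
  then obtain ys where "tens_rel k V W xs ys" "y = list_sum M (map (%(v, w). f v w) ys)" using tens_classD by auto
  then show "y \<in> {list_sum M (map (%(v, w). f v w) xs)}" using inv by simp
 next
  fix y assume "y \<in> {list_sum M (map (%(v, w). f v w) xs)}"
  then show "y \<in> (%xs. list_sum M (map (%(v, w). f v w) xs)) ` tens_class k V W xs"
   using tens_class_self[OF assms(3)] by (auto intro!: image_eqI)
 qed
 then show ?thesis unfolding tlift_def by simp
qed

lemma tlift_pure:
 assumes "blmap k V W M f" "module k M" "v |: V" "w |: W"
 shows "tlift M f (pure k V W v w) = f v w"
proof -
 interpret M: module k M by fact
 show ?thesis using assms bil_cl[OF assms(1)] unfolding pure_def by (simp add: tlift_class[OF assms(1,2)])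
qed

lemma tlift_linear:
 assumes "blmap k V W M f" "module k M"
 shows "lmap k (tensor k V W) M (tlift M f)"
proof -
 interpret M: module k M by fact
 note cl = bil_cl[OF assms(1)]
 have in_M: "set (map (%(v, w). f v w) xs) \<subseteq> carrier M"
  if "set xs \<subseteq> carrier V \<times> carrier W" for xs using that cl by auto
 note LC = list_sum_closed[OF M.abelian_group_axioms]
 show ?thesis
 proof (rule linear_mapI)
  fix x assume "x |: tensor k V W"
  then show "tlift M f x |: M" by (elim tens_carrierE) (simp add: tlift_class[OF assms] LC in_M del: set_map)
 next
  fix x y assume "x |: tensor k V W" "y |: tensor k V W"
  then show "tlift M f (x \<oplus>[tensor k V W] y) = tlift M f x \<oplus>[M] tlift M f y" by (elim tens_carrierE)
    (simp add: tlift_class[OF assms] tens_add_class in_M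
    list_sum_append[OF M.abelian_group_axioms] del: set_map)
 next
  fix r x assume r: "r |: k" and "x |: tensor k V W"
  then obtain xs where xs: "set xs \<subseteq> carrier V \<times> carrier W" "x = tens_class k V W xs" by (elim tens_carrierE)
  have "list_sum M (map (%(v, w). f v w) (map (%(v, w). (r \<odot>[V] v, w)) xs))
    = r \<odot>[M] list_sum M (map (%(v, w). f v w) xs)" using xs(1) r by (induction xs)
    (auto simp: linear_smult[OF bil_l[OF assms(1)]] M.smult_r_distr LC in_M cl simp del: set_map)
  moreover have "set (map (%(v, w). (r \<odot>[V] v, w)) xs) \<subseteq> carrier V \<times> carrier W" using xs r by auto
  ultimately show "tlift M f (r \<odot>[tensor k V W] x) = r \<odot>[M] tlift M f x"
   using xs r by (simp add: tlift_class[OF assms] tens_smult_class del: map_map)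
 qed
qed

lemma tensor_eqI:
 assumes "lmap k (tensor k V W) M f" "lmap k (tensor k V W) M g" "module k M"
  and "!!v w. v |: V ==> w |: W ==> f (pure k V W v w) = g (pure k V W v w)"
  and "t |: tensor k V W"
 shows "f t = g t" using assms(5)
proof (induction rule: tens_induct)
 case zero
 then show ?case using linear_zero[OF assms(1) tensor_module] linear_zero[OF assms(2) tensor_module] assms(3) by simp
next
 case (step v w t)
 then show ?case using assms(4) linear_add[OF assms(1)] linear_add[OF assms(2)] by (simp add: pure_closed)
qed

end

lemmas tensor_is_module = two_modules.tensor_module[OF two_modules.intro]
lemmas pure_bil = two_modules.pure_bilinear[OF two_modules.intro]
lemmas pure_in = two_modules.pure_closed[OF two_modules.intro]
lemmas tlift_pure_eq = two_modules.tlift_pure[OF two_modules.intro]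
lemmas tlift_lin = two_modules.tlift_linear[OF two_modules.intro]
lemmas tensor_eq = two_modules.tensor_eqI[OF two_modules.intro]

lemma tlift_arg:
 "blmap k V W M f ==> module k V ==> module k W ==> module k M
  ==> lmap k Z (tensor k V W) g ==> lmap k Z M (%z. tlift M f (g z))" using lin_comp[OF tlift_lin] .

lemma tlift_closed:
 "blmap k V W M f ==> module k V ==> module k W ==> module k M
  ==> t |: (tensor k V W) ==> tlift M f t |: M" using lin_cl[OF tlift_lin] .

lemma tlift_cong:
 assumes "module k V" "module k W" "t |: tensor k V W"
  and "!!v w. v |: V ==> w |: W ==> f v w = g v w"
 shows "tlift M f t = tlift M g t"
proof -
 interpret two_modules k V W using assms by (simp add: two_modules_def)
 obtain zs where zs: "set zs \<subseteq> carrier V \<times> carrier W" "t = tens_class k V W zs"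
  using assms(3) by (rule tens_carrierE)
 have "(%xs. list_sum M (map (%(v, w). f v w) xs)) ` t = (%xs. list_sum M (map (%(v, w). g v w) xs)) ` t"
 proof (rule image_cong, rule HOL.refl)
  fix xs assume "xs \<in> t"
  then have "set xs \<subseteq> carrier V \<times> carrier W" using tens_rel_set tens_classD zs by blast
  then have "map (%(v, w). f v w) xs = map (%(v, w). g v w) xs" using assms(4) by auto
  then show "list_sum M (map (%(v, w). f v w) xs) = list_sum M (map (%(v, w). g v w) xs)" by (simp only:)
 qed
 then show ?thesis unfolding tlift_def by simp
qed

text \<open>
 For operations given by a sum over the legs of \<open>t\<close>, such as the action on a tensor product.
\<close>

lemma tlift_param:
 assumes "t |: tensor k V W" "module k V" "module k W" "module k M"
  and "!!v w. v |: V ==> w |: W ==> lmap k Z M (%z. F z v w)"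
  and "!!z. z |: Z ==> blmap k V W M (F z)"
  and "module k Z"
 shows "lmap k Z M (%z. tlift M (F z) t)"
proof -
 interpret two_modules k V W using assms by (simp add: two_modules_def)
 obtain xs where xs: "set xs \<subseteq> carrier V \<times> carrier W" "t = tens_class k V W xs"
  using assms(1) by (rule tens_carrierE)
 have "lmap k Z M (%z. list_sum M (map (%(v, w). F z v w) xs))" using xs(1)
  by (induction xs) (auto intro!: linear_const_zero linear_sum assms(4,5))
 then show ?thesis by (subst linear_map_cong[OF _ assms(7)]) (auto simp: xs tlift_class assms)
qed

lemma tlift_linear_comp:
 assumes "blmap k V W M f" "lmap k M N g" "module k V" "module k W" "module k M"
  "module k N" "t |: tensor k V W"
 shows "g (tlift M f t) = tlift N (%v w. g (f v w)) t"
proof -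
 have b: "blmap k V W N (%v w. g (f v w))" using assms(1,2) by (auto simp: bilinear_map_def intro: lin_comp)
 show ?thesis by (rule tensor_eq[of k V W N "%t. g (tlift M f t)"])
   (auto intro!: lin_comp[OF assms(2)] tlift_lin assms b simp: tlift_pure_eq[OF _ _ assms(1)] tlift_pure_eq[OF _ _ b] assms)
qed

text \<open>
 Tensors are sets of formal sums; equations between them are never proved by comparing elements.
\<close>

declare equalityI [rule del]

section \<open>Maps between tensor products\<close>

lemma pure1 [lin]:
 "lmap k Z V f ==> w |: W ==> module k V ==> module k W
  ==> lmap k Z (tensor k V W) (%z. pure k V W (f z) w)" by (rule bil1[OF pure_bil])

lemma pure2 [lin]:
 "lmap k Z W f ==> v |: V ==> module k V ==> module k W
  ==> lmap k Z (tensor k V W) (%z. pure k V W v (f z))" by (rule bil2[OF pure_bil])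

lemmas [lin] = tensor_is_module pure_in

lemma tmap_bil:
 "lmap k V V' f ==> lmap k W W' g ==> module k V' ==> module k W'
  ==> blmap k V W (tensor k V' W') (%v w. pure k V' W' (f v) (g w))" by (intro bilI) (auto simp: lin lin_cl)

lemma tmap_lin:
 "lmap k V V' f ==> lmap k W W' g ==> module k V ==> module k W ==> module k V'
  ==> module k W' ==> lmap k (tensor k V W) (tensor k V' W') (tmap k V' W' f g)"
 unfolding tmap_def by (intro tlift_lin tmap_bil tensor_is_module)

lemma tmap_pure:
 "lmap k V V' f ==> lmap k W W' g ==> module k V ==> module k W ==> module k V'
  ==> module k W' ==> v |: V ==> w |: W
  ==> tmap k V' W' f g (pure k V W v w) = pure k V' W' (f v) (g w)" unfolding tmap_def
 by (subst tlift_pure_eq[where V = V and W = W]) (auto intro: tmap_bil tensor_is_module)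

lemma tmap_comp_lin:
 "lmap k V V' f ==> lmap k W W' g ==> module k V ==> module k W ==> module k V'
  ==> module k W' ==> lmap k Z (tensor k V W) h
  ==> lmap k Z (tensor k V' W') (%z. tmap k V' W' f g (h z))" by (rule lin_comp[OF tmap_lin])

lemma tmap_cong:
 assumes "!!v. v |: V ==> f v = f' v" "!!w. w |: W ==> g w = g' w"
  "module k V" "module k W" "t |: tensor k V W"
 shows "tmap k V' W' f g t = tmap k V' W' f' g' t" unfolding tmap_def by (rule tlift_cong[of k V W]) (simp_all add: assms)

lemma trilinearD:
 assumes "trilinear k U V W M f"
 shows "v |: V ==> w |: W ==> lmap k U M (%u. f u v w)"
  "u |: U ==> blmap k V W M (f u)" using assms unfolding trilinear_def by auto

lemma trilinear_inner:
 assumes "trilinear k U V W M f" "module k U" "module k V" "module k W" "module k M"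
 shows "blmap k U (tensor k V W) M (%u. tlift M (f u))"
proof (rule bilI)
 fix t assume "t |: tensor k V W"
 then show "lmap k U M (%u. tlift M (f u) t)" using assms trilinearD[OF assms(1)] by (intro tlift_param[where V=V and W=W]) auto
qed (auto intro!: tlift_lin assms(2-) trilinearD[OF assms(1)])

lemma tlift3_lin:
 assumes "trilinear k U V W M f" "module k U" "module k V" "module k W" "module k M"
 shows "lmap k (tensor k U (tensor k V W)) M (tlift3 M f)"
 unfolding tlift3_def using assms by (intro tlift_lin trilinear_inner) (auto simp: lin)

lemma tlift3_pure:
 assumes "trilinear k U V W M f" "module k U" "module k V" "module k W" "module k M"
  "u |: U" "v |: V" "w |: W"
 shows "tlift3 M f (pure3 k U V W u v w) = f u v w" unfolding tlift3_def
 by (subst tlift_pure_eq[where V = U and W = "tensor k V W"])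
  (auto intro!: trilinear_inner simp: assms lin tlift_pure_eq[OF _ _ trilinearD(2)[OF assms(1)]])

lemma tensor3_eq:
 assumes "lmap k (tensor k U (tensor k V W)) M f" "lmap k (tensor k U (tensor k V W)) M g"
  "module k U" "module k V" "module k W" "module k M"
  "!!u v w. u |: U ==> v |: V ==> w |: W ==>
   f (pure3 k U V W u v w) = g (pure3 k U V W u v w)"
  "t |: (tensor k U (tensor k V W))"
 shows "f t = g t"
proof (rule tensor_eq[OF _ _ assms(1,2)])
 fix u s assume u: "u |: U" and s: "s |: tensor k V W"
 show "f (pure k U (tensor k V W) u s) = g (pure k U (tensor k V W) u s)"
  by (rule tensor_eq[of k V W M "%s. f (pure k U (tensor k V W) u s)"])
   (auto intro!: lin_comp[OF assms(1)] lin_comp[OF assms(2)] assms(7) simp: lin assms(3-6) u s)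
qed (auto simp: lin assms)

lemma tensor3l_eq:
 assumes "lmap k (tensor k (tensor k U V) W) M f" "lmap k (tensor k (tensor k U V) W) M g"
  "module k U" "module k V" "module k W" "module k M"
  "!!u v w. u |: U ==> v |: V ==> w |: W ==>
   f (pure k (tensor k U V) W (pure k U V u v) w) = g (pure k (tensor k U V) W (pure k U V u v) w)"
  "t |: (tensor k (tensor k U V) W)"
 shows "f t = g t"
proof (rule tensor_eq[OF _ _ assms(1,2)])
 fix s w assume w: "w |: W" and s: "s |: tensor k U V"
 show "f (pure k (tensor k U V) W s w) = g (pure k (tensor k U V) W s w)"
  by (rule tensor_eq[of k U V M "%s. f (pure k (tensor k U V) W s w)"])
   (auto intro!: lin_comp[OF assms(1)] lin_comp[OF assms(2)] assms(7) simp: lin assms(3-6) w s)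
qed (auto simp: lin assms)

lemma tensor4_eq:
 assumes "lmap k (tensor k U (tensor k V (tensor k W X))) M f"
  "lmap k (tensor k U (tensor k V (tensor k W X))) M g"
  "module k U" "module k V" "module k W" "module k X" "module k M"
  "!!u v w x. u |: U ==> v |: V ==> w |: W ==> x |: X ==>
   f (pure k U (tensor k V (tensor k W X)) u (pure3 k V W X v w x))
   = g (pure k U (tensor k V (tensor k W X)) u (pure3 k V W X v w x))"
  "t |: (tensor k U (tensor k V (tensor k W X)))"
 shows "f t = g t"
proof (rule tensor_eq[OF _ _ assms(1,2)])
 fix u s assume u: "u |: U" and s: "s |: (tensor k V (tensor k W X))"
 show "f (pure k U (tensor k V (tensor k W X)) u s) = g (pure k U (tensor k V (tensor k W X)) u s)"
  by (rule tensor3_eq[of k V W X M "%s. f (pure k U (tensor k V (tensor k W X)) u s)"])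
   (auto intro!: lin_comp[OF assms(1)] lin_comp[OF assms(2)] assms(8) simp: lin assms(3-7) u s)
qed (auto simp: lin assms)

lemma tassoc_aux:
 assumes "module k U" "module k V" "module k W"
 shows "blmap k (tensor k U V) W (tensor k U (tensor k V W))
  (%s w. tlift (tensor k U (tensor k V W)) (%u v. pure3 k U V W u v w) s)"
  (is ?th1)
  and "w |: W ==> blmap k U V (tensor k U (tensor k V W))
   (%u v. pure3 k U V W u v w)" (is "_ ==> ?th2 w")
proof -
 have *: "?th2 w" if "w |: W" for w by (rule bilI) (auto simp: lin assms that)
 show ?th1
 proof (rule bilI)
  fix s assume "s |: tensor k U V"
  then show "lmap k W (tensor k U (tensor k V W))
   (%w. tlift (tensor k U (tensor k V W)) (%u v. pure3 k U V W u v w) s)" by (rule tlift_param) (auto simp: lin assms *)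
 qed (auto intro!: tlift_lin * simp: lin assms)
 show "w |: W ==> ?th2 w" by (rule *)
qed

lemma tassoc_lin:
 "module k U ==> module k V ==> module k W ==>
  lmap k (tensor k (tensor k U V) W) (tensor k U (tensor k V W)) (tassoc k U V W)"
 unfolding tassoc_def Let_def by (intro tlift_lin tassoc_aux) (auto simp: lin)

lemma tassoc_pure:
 "module k U ==> module k V ==> module k W ==> u |: U ==> v |: V ==> w |: W
  ==> tassoc k U V W (pure k (tensor k U V) W (pure k U V u v) w)
   = pure3 k U V W u v w" unfolding tassoc_def Let_def
 by (simp add: tlift_pure_eq[OF _ _ tassoc_aux(1)] tlift_pure_eq[OF _ _ tassoc_aux(2)] lin)

lemma tassoc_comp_lin [lin]:
 "lmap k Z (tensor k (tensor k U V) W) h ==> module k U ==> module k V ==> module k W ==>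
  lmap k Z (tensor k U (tensor k V W)) (%z. tassoc k U V W (h z))" using lin_comp[OF tassoc_lin] .

lemma tassoc_closed [lin]:
 "t |: (tensor k (tensor k U V) W) ==> module k U ==> module k V ==> module k W ==>
  tassoc k U V W t |: (tensor k U (tensor k V W))" using lin_cl[OF tassoc_lin] .

section \<open>Tensor products of algebras and their actions\<close>

lemma k_algebraD:
 assumes "k_algebra k B"
 shows "module k B" "ring B" "cring k"
  "blmap k B B B (mult B)" "\<one>[B] |: B"
proof -
 interpret module k B using assms k_algebra_def by blast
 interpret ring B using assms k_algebra_def by blast
 show "module k B" "ring B" "cring k" "\<one>[B] |: B" by unfold_locales auto
 show "blmap k B B B (mult B)" using assms by (intro bilI linear_mapI) (auto simp: k_algebra_def r_distr l_distr)
qed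

lemma mult1 [lin]:
 "lmap k Z B f ==> x |: B ==> k_algebra k B ==> lmap k Z B (%z. f z \<otimes>[B] x)" by (rule bil1[OF k_algebraD(4)])

lemma mult2 [lin]:
 "lmap k Z B f ==> x |: B ==> k_algebra k B ==> lmap k Z B (%z. x \<otimes>[B] f z)" by (rule bil2[OF k_algebraD(4)])

lemma alg_mult_closed:
 "k_algebra k B ==> x |: B ==> y |: B ==> x \<otimes>[B] y |: B" by (rule bil_cl[OF k_algebraD(4)])

lemma alg_one: "k_algebra k B ==> \<one>[B] |: B" by (rule k_algebraD)

lemma k_algebraI:
 assumes "module k B" and b: "blmap k B B B (mult B)" and "\<one>[B] |: B"
  and "!!x. x |: B ==> \<one>[B] \<otimes>[B] x = x" "!!x. x |: B ==> x \<otimes>[B] \<one>[B] = x"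
  and "!!x y z. x |: B ==> y |: B ==> z |: B ==>
   (x \<otimes>[B] y) \<otimes>[B] z = x \<otimes>[B] (y \<otimes>[B] z)"
 shows "k_algebra k B"
proof -
 interpret module k B by fact
 have "ring B" using assms bil_cl[OF b] linear_add[OF bil_l[OF b]] linear_add[OF bil_r[OF b]]
  by (intro ringI monoidI abelian_group_axioms) auto
 then show ?thesis using assms(1) linear_smult[OF bil_l[OF b]] linear_smult[OF bil_r[OF b]]
  unfolding k_algebra_def by (auto simp: R.is_cring)
qed

locale two_algebras =
 fixes k :: "('k, 'r) ring_scheme" and B :: "('k, 'b, 'y) module_scheme"
  and C :: "('k, 'c, 'z) module_scheme"
 assumes aB: "k_algebra k B" and aC: "k_algebra k C"
begin

lemma modules [simp]: "module k B" "module k C" "two_modules k B C"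
 using aB aC k_algebraD two_modules.intro by (blast, blast, metis)

interpretation B: ring B by (rule k_algebraD[OF aB])
interpretation C: ring C by (rule k_algebraD[OF aC])
interpretation BC: two_modules k B C by simp

lemmas aBC = aB aC alg_mult_closed[OF aB] alg_mult_closed[OF aC] alg_one[OF aB] alg_one[OF aC]

lemma tens_mult_bil:
 assumes "b |: B" "c |: C"
 shows "blmap k B C (tensor k B C) (%b' c'. pure k B C (b \<otimes>[B] b') (c \<otimes>[C] c'))"
 by (intro bilI) (simp_all add: lin aBC assms)

lemma tens_mult_bil2:
 assumes "t |: tensor k B C"
 shows "blmap k B C (tensor k B C)
  (%b c. tlift (tensor k B C) (%b' c'. pure k B C (b \<otimes>[B] b') (c \<otimes>[C] c')) t)"
 by (intro bilI tlift_param[OF assms]) (simp_all add: lin aBC tens_mult_bil)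

lemma tens_mult_eq:
 assumes s: "s |: tensor k B C" and t: "t |: tensor k B C"
 shows "s \<otimes>[tensor k B C] t = tlift (tensor k B C) (%b c. tlift (tensor k B C)
  (%b' c'. pure k B C (b \<otimes>[B] b') (c \<otimes>[C] c')) t) s"
proof -
 note T = tensor_is_module[OF modules(1,2)]
 let ?T = "tensor k B C"
 let ?l = "%xs ys. [(v \<otimes>[B] v', w \<otimes>[C] w'). (v, w) \<leftarrow> xs, (v', w') \<leftarrow> ys]"
 have inner: "tens_class k B C (map (%(v', w'). (v \<otimes>[B] v', w \<otimes>[C] w')) ys)
   = tlift ?T (%b' c'. pure k B C (v \<otimes>[B] b') (w \<otimes>[C] c')) (tens_class k B C ys)"
  if "v |: B" "w |: C" "set ys \<subseteq> carrier B \<times> carrier C" for v w ys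
 proof -
  have "set (map (%(v', w'). (v \<otimes>[B] v', w \<otimes>[C] w')) ys) \<subseteq> carrier B \<times> carrier C"
   using that by auto
  then show ?thesis using that by (simp add: BC.tlift_class[OF tens_mult_bil T])
    (simp add: BC.tens_class_sum comp_def case_prod_unfold)
 qed
 have eq: "tens_class k B C (?l xs ys) = tlift ?T (%b c. tlift ?T
   (%b' c'. pure k B C (b \<otimes>[B] b') (c \<otimes>[C] c')) (tens_class k B C ys)) (tens_class k B C xs)"
  if "set xs \<subseteq> carrier B \<times> carrier C" "set ys \<subseteq> carrier B \<times> carrier C" for xs ys
  unfolding BC.tlift_class[OF tens_mult_bil2[OF BC.tens_class_carrier[OF that(2)]] T that(1)] using that(1)
 proof (induction xs)
  case Nil then show ?case by (simp add: BC.tens_zero)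
 next
  case (Cons p xs)
  obtain v w where p: "p = (v, w)" by (cases p)
  have sub: "set (?l xs ys) \<subseteq> carrier B \<times> carrier C"
   "set (map (%(v', w'). (v \<otimes>[B] v', w \<otimes>[C] w')) ys) \<subseteq> carrier B \<times> carrier C"
   using Cons.prems that(2) p by auto
  show ?case using Cons p that(2) by (simp add: BC.tens_add_class[OF sub(2,1), symmetric] inner[symmetric])
 qed
 obtain xs ys where *: "set xs \<subseteq> carrier B \<times> carrier C" "s = tens_class k B C xs"
  "set ys \<subseteq> carrier B \<times> carrier C" "t = tens_class k B C ys" using s t by (auto elim!: BC.tens_carrierE)
 have eq': "tens_class k B C (?l xs' ys') = tlift ?T (%b c. tlift ?T
   (%b' c'. pure k B C (b \<otimes>[B] b') (c \<otimes>[C] c')) t) s" if "xs' \<in> s" "ys' \<in> t" for xs' ys'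
 proof -
  have r: "tens_rel k B C xs xs'" "tens_rel k B C ys ys'" using that * by (auto dest: BC.tens_classD)
  then show ?thesis using eq[of xs' ys'] BC.tens_rel_set[OF r(1)] BC.tens_rel_set[OF r(2)]
    BC.tens_class_eqI[OF r(1)] BC.tens_class_eqI[OF r(2)] * by simp
 qed
 have "xs \<in> s" "ys \<in> t" using * BC.tens_class_self by auto
 then have "(\<Union>xs\<in>s. \<Union>ys\<in>t. tens_class k B C (?l xs ys)) = tlift ?T (%b c. tlift ?T
   (%b' c'. pure k B C (b \<otimes>[B] b') (c \<otimes>[C] c')) t) s"
  by (intro BC.UN_constI[where x = xs and A = s] BC.UN_constI[where x = ys and A = t]) (simp_all add: eq')
 then show ?thesis unfolding tensor_def by simp
qed

lemma tens_mult_bilinear: "blmap k (tensor k B C) (tensor k B C) (tensor k B C) (mult (tensor k B C))"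
proof (rule bilI)
 note T = tensor_is_module[OF modules(1,2)]
 fix s assume s: "s |: tensor k B C"
 have "lmap k (tensor k B C) (tensor k B C) (%t. tlift (tensor k B C) (%b c. tlift (tensor k B C)
  (%b' c'. pure k B C (b \<otimes>[B] b') (c \<otimes>[C] c')) t) s)"
  by (rule tlift_param[OF s]) (auto intro!: tlift_lin tens_mult_bil tens_mult_bil2 T)
 then show "lmap k (tensor k B C) (tensor k B C) (mult (tensor k B C) s)"
  by (subst linear_map_cong[OF _ T]) (auto simp: tens_mult_eq s)
next
 note T = tensor_is_module[OF modules(1,2)]
 fix t assume t: "t |: tensor k B C"
 show "lmap k (tensor k B C) (tensor k B C) (%s. s \<otimes>[tensor k B C] t)"
  by (subst linear_map_cong[OF tens_mult_eq[OF _ t] T])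
   (auto intro!: tlift_lin tens_mult_bil2 T t)
qed

lemma tens_mult_pure:
 "b |: B ==> c |: C ==> b' |: B ==> c' |: C ==>
  pure k B C b c \<otimes>[tensor k B C] pure k B C b' c' = pure k B C (b \<otimes>[B] b') (c \<otimes>[C] c')"
 by (simp add: tens_mult_eq pure_in tlift_pure_eq[OF _ _ tens_mult_bil2] lin tlift_pure_eq[OF _ _ tens_mult_bil])

lemma tens_one: "\<one>[tensor k B C] = pure k B C \<one>[B] \<one>[C]" unfolding tensor_def by simp

lemma tens_k_algebra: "k_algebra k (tensor k B C)"
proof (rule k_algebraI[OF tensor_is_module[OF modules(1,2)] tens_mult_bilinear])
 let ?T = "tensor k B C"
 note m = tensor_is_module[OF modules(1,2)]
 note [simp] = bil_cl[OF tens_mult_bilinear] pure_in tens_mult_pure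
 note l = bil1[OF tens_mult_bilinear] bil2[OF tens_mult_bilinear]
 show one: "\<one>[?T] |: ?T" by (simp add: tens_one)
 show "\<one>[?T] \<otimes>[?T] x = x" if "x |: ?T" for x
  by (rule tensor_eq[OF modules(1,2) _ _ _ _ that]) (auto intro!: l linear_id m one simp: tens_one)
 show "x \<otimes>[?T] \<one>[?T] = x" if "x |: ?T" for x
  by (rule tensor_eq[OF modules(1,2) _ _ _ _ that]) (auto intro!: l linear_id m one simp: tens_one)
 fix x y z assume x: "x |: ?T" and y: "y |: ?T" and z: "z |: ?T"
 show "(x \<otimes>[?T] y) \<otimes>[?T] z = x \<otimes>[?T] (y \<otimes>[?T] z)"
 proof (rule tensor_eq[OF modules(1,2) _ _ m _ x])
  fix b c assume bc: "b |: B" "c |: C"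
  show "(pure k B C b c \<otimes>[?T] y) \<otimes>[?T] z = pure k B C b c \<otimes>[?T] (y \<otimes>[?T] z)"
  proof (rule tensor_eq[OF modules(1,2) _ _ m _ y])
   fix b' c' assume bc': "b' |: B" "c' |: C"
   show "(pure k B C b c \<otimes>[?T] pure k B C b' c') \<otimes>[?T] z
    = pure k B C b c \<otimes>[?T] (pure k B C b' c' \<otimes>[?T] z)" by (rule tensor_eq[OF modules(1,2) _ _ m _ z])
    (auto intro!: l linear_id simp: bc bc' B.m_assoc C.m_assoc)
  qed (auto intro!: l linear_id simp: bc z)
 qed (auto intro!: l linear_id simp: y z)
qed

end

lemmas tensor_k_algebra [lin] = two_algebras.tens_k_algebra[OF two_algebras.intro]
lemmas tmult_pure = two_algebras.tens_mult_pure[OF two_algebras.intro]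

lemma tensor_one: "\<one>[tensor k B C] = pure k B C \<one>[B] \<one>[C]" unfolding tensor_def by simp

definition alg_module where
 "alg_module k B V \<rho> \<longleftrightarrow> k_algebra k B \<and> module k V \<and> blmap k B V V \<rho> \<and>
  (\<forall>v\<in>carrier V. \<rho> \<one>[B] v = v) \<and>
  (\<forall>a\<in>carrier B. \<forall>b\<in>carrier B. \<forall>v\<in>carrier V. \<rho> (a \<otimes>[B] b) v = \<rho> a (\<rho> b v))"

definition tensor_act where
 "tensor_act k V W \<rho> \<sigma> u t = tlift (tensor k V W) (%a b. tmap k V W (\<rho> a) (\<sigma> b) t) u"

lemma act2_tensor_act: "act2 k V W = tensor_act k V W (act V) (act W)" by (intro ext) (simp add: act2_def tensor_act_def)

locale two_alg_modules =
 fixes k :: "('k, 'r) ring_scheme" and B :: "('k, 'b, 'y) module_scheme"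
  and C :: "('k, 'c, 'z) module_scheme" and V :: "('k, 'v, 'yy) module_scheme"
  and W :: "('k, 'w, 'zz) module_scheme" and \<rho> :: "'b => 'v => 'v" and \<sigma> :: "'c => 'w => 'w"
 assumes mV: "alg_module k B V \<rho>" and mW: "alg_module k C W \<sigma>"
begin

lemma props [simp]: "module k V" "module k W" "k_algebra k B" "k_algebra k C"
 "blmap k B V V \<rho>" "blmap k C W W \<sigma>" "module k B" "module k C"
 using mV mW k_algebraD(1) unfolding alg_module_def by auto

lemma act_bil:
 assumes "t |: tensor k V W"
 shows "blmap k B C (tensor k V W) (%a b. tmap k V W (\<rho> a) (\<sigma> b) t)" unfolding tmap_def
 by (intro bilI tlift_param[OF assms])
  (auto simp: lin bil1[OF props(5)] bil1[OF props(6)] bil2[OF props(5)] bil2[OF props(6)]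
   bil_cl[OF props(5)] bil_cl[OF props(6)] intro!: tmap_bil bil_r[OF props(5)] bil_r[OF props(6)])

lemma act_bilinear:
 "blmap k (tensor k B C) (tensor k V W) (tensor k V W) (tensor_act k V W \<rho> \<sigma>)" unfolding tensor_act_def
proof (rule bilI)
 fix u assume u: "u |: tensor k B C"
 show "lmap k (tensor k V W) (tensor k V W)
   (%t. tlift (tensor k V W) (%a b. tmap k V W (\<rho> a) (\<sigma> b) t) u)"
  by (rule tlift_param[OF u]) (auto simp: lin intro!: tmap_lin act_bil bil_r[OF props(5)] bil_r[OF props(6)])
qed (auto intro!: tlift_lin act_bil simp: lin)

lemma act_pure1:
 "a |: B ==> b |: C ==> t |: (tensor k V W) ==>
  tensor_act k V W \<rho> \<sigma> (pure k B C a b) t = tmap k V W (\<rho> a) (\<sigma> b) t"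
 unfolding tensor_act_def by (subst tlift_pure_eq[OF _ _ act_bil]) (auto simp: lin)

lemma act_pure:
 "a |: B ==> b |: C ==> v |: V ==> w |: W ==>
  tensor_act k V W \<rho> \<sigma> (pure k B C a b) (pure k V W v w) = pure k V W (\<rho> a v) (\<sigma> b w)"
 by (subst act_pure1) (auto simp: pure_in tmap_pure[OF bil_r[OF props(5)] bil_r[OF props(6)]])

lemma act_module: "alg_module k (tensor k B C) (tensor k V W) (tensor_act k V W \<rho> \<sigma>)" unfolding alg_module_def
proof (intro conjI ballI)
 note l = bil1[OF act_bilinear] bil2[OF act_bilinear]
 note cl = bil_cl[OF props(5)] bil_cl[OF props(6)] bil_cl[OF act_bilinear]
 show "k_algebra k (tensor k B C)" "module k (tensor k V W)" by (auto simp: lin)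
 show "blmap k (tensor k B C) (tensor k V W) (tensor k V W) (tensor_act k V W \<rho> \<sigma>)" by (rule act_bilinear)
 fix t assume t: "t |: tensor k V W"
 show "tensor_act k V W \<rho> \<sigma> \<one>[tensor k B C] t = t" by (rule tensor_eq[OF props(1,2) _ _ _ _ t])
   (use mV mW in "auto intro!: l linear_id simp: lin tensor_one act_pure k_algebraD(5)[OF props(3)] k_algebraD(5)[OF props(4)] alg_module_def")
 fix x y assume x: "x |: tensor k B C" and y: "y |: tensor k B C"
 note A = tensor_k_algebra[OF props(3,4)]
 show "tensor_act k V W \<rho> \<sigma> (x \<otimes>[tensor k B C] y) t
  = tensor_act k V W \<rho> \<sigma> x (tensor_act k V W \<rho> \<sigma> y t)"
 proof (rule tensor_eq[of k B C, OF _ _ _ _ _ _ x])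
  fix a b assume ab: "a |: B" "b |: C"
  show "tensor_act k V W \<rho> \<sigma> (pure k B C a b \<otimes>[tensor k B C] y) t
   = tensor_act k V W \<rho> \<sigma> (pure k B C a b) (tensor_act k V W \<rho> \<sigma> y t)"
  proof (rule tensor_eq[of k B C, OF _ _ _ _ _ _ y])
   fix a' b' assume ab': "a' |: B" "b' |: C"
   show "tensor_act k V W \<rho> \<sigma> (pure k B C a b \<otimes>[tensor k B C] pure k B C a' b') t
    = tensor_act k V W \<rho> \<sigma> (pure k B C a b) (tensor_act k V W \<rho> \<sigma> (pure k B C a' b') t)"
    by (rule tensor_eq[OF props(1,2) _ _ _ _ t])
    (use mV mW ab ab' in "auto intro!: l linear_id simp: lin tmult_pure act_pure cl alg_module_def alg_mult_closed[OF props(3)] alg_mult_closed[OF props(4)]")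
  qed (auto intro!: l linear_id mult2 A simp: ab t lin cl)
 qed (auto intro!: l linear_id mult1 A simp: y t lin cl)
qed

end

lemmas tensor_act_module = two_alg_modules.act_module[OF two_alg_modules.intro]
lemmas tensor_act_pure = two_alg_modules.act_pure[OF two_alg_modules.intro]

lemma alg_homD:
 assumes "algebra_hom k B C f"
 shows "lmap k B C f" "f \<one>[B] = \<one>[C]"
  "x |: B ==> y |: B ==> f (x \<otimes>[B] y) = f x \<otimes>[C] f y"
  "x |: B ==> f x |: C" using assms unfolding algebra_hom_def ring_hom_def linear_map_def by auto

lemma algebra_homI:
 assumes "lmap k B C f" "f \<one>[B] = \<one>[C]"
  "!!x y. x |: B ==> y |: B ==> f (x \<otimes>[B] y) = f x \<otimes>[C] f y"
 shows "algebra_hom k B C f" using assms unfolding algebra_hom_def ring_hom_def linear_map_def by auto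

lemma algebra_hom_comp:
 "algebra_hom k B C f ==> algebra_hom k D B g ==> algebra_hom k D C (%x. f (g x))"
 by (rule algebra_homI) (auto simp: alg_homD intro: lin_comp alg_homD)

lemma algebra_hom_tensorI:
 assumes f: "lmap k (tensor k B C) D f" and one: "f (pure k B C \<one>[B] \<one>[C]) = \<one>[D]"
  and alg: "k_algebra k B" "k_algebra k C" "k_algebra k D"
  and m: "!!b c b' c'. b |: B ==> c |: C ==> b' |: B ==> c' |: C ==>
   f (pure k B C (b \<otimes>[B] b') (c \<otimes>[C] c')) = f (pure k B C b c) \<otimes>[D] f (pure k B C b' c')"
 shows "algebra_hom k (tensor k B C) D f"
proof (rule algebra_homI[OF f])
 show "f \<one>[tensor k B C] = \<one>[D]" using one by (simp add: tensor_one)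
 note mo = k_algebraD(1)[OF alg(1)] k_algebraD(1)[OF alg(2)] k_algebraD(1)[OF alg(3)]
 note A = tensor_k_algebra[OF alg(1,2)]
 note cl = lin_cl[OF f]
 fix x y assume x: "x |: tensor k B C" and y: "y |: tensor k B C"
 show "f (x \<otimes>[tensor k B C] y) = f x \<otimes>[D] f y"
 proof (rule tensor_eq[OF mo(1,2) _ _ mo(3) _ x])
  fix a b assume ab: "a |: B" "b |: C"
  show "f (pure k B C a b \<otimes>[tensor k B C] y) = f (pure k B C a b) \<otimes>[D] f y"
   by (rule tensor_eq[OF mo(1,2) _ _ mo(3) _ y])
    (auto intro!: lin_comp[OF f] mult2 f alg A cl simp: lin mo ab m tmult_pure[OF alg(1,2)])
 qed (auto intro!: lin_comp[OF f] mult1 f alg A cl linear_id simp: y)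
qed

declare id_apply [simp del]

lemma tmap_algebra_hom:
 assumes "algebra_hom k B B' f" "algebra_hom k C C' g"
  "k_algebra k B" "k_algebra k B'" "k_algebra k C" "k_algebra k C'"
 shows "algebra_hom k (tensor k B C) (tensor k B' C') (tmap k B' C' f g)"
proof (rule algebra_hom_tensorI)
 note m = assms(3-6)[THEN k_algebraD(1)]
 note t = tmap_pure[OF alg_homD(1)[OF assms(1)] alg_homD(1)[OF assms(2)] m(1,3,2,4)]
 show "lmap k (tensor k B C) (tensor k B' C') (tmap k B' C' f g)"
  by (rule tmap_lin) (simp_all add: m assms alg_homD(1)[OF assms(1)] alg_homD(1)[OF assms(2)])
 show "tmap k B' C' f g (pure k B C \<one>[B] \<one>[C]) = \<one>[tensor k B' C']"
  by (simp add: t k_algebraD(5) assms(3-6)[THEN k_algebraD(5)] tensor_one alg_homD(2)[OF assms(1)] alg_homD(2)[OF assms(2)])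
 fix b c b' c' assume "b |: B" "c |: C" "b' |: B" "c' |: C"
 then show "tmap k B' C' f g (pure k B C (b \<otimes>[B] b') (c \<otimes>[C] c')) =
  tmap k B' C' f g (pure k B C b c) \<otimes>[tensor k B' C'] tmap k B' C' f g (pure k B C b' c')"
  by (simp add: id_apply t alg_mult_closed[OF assms(3)] alg_mult_closed[OF assms(5)] tmult_pure assms
   alg_homD[OF assms(1)] alg_homD[OF assms(2)])
qed (simp_all add: assms lin)

lemma algebra_hom_id: "algebra_hom k B B id" by (rule algebra_homI) (auto intro!: linear_mapI simp: id_apply)

lemma inl_algebra_hom:
 "k_algebra k B ==> k_algebra k C ==> algebra_hom k B (tensor k B C) (%t. pure k B C t \<one>[C])"
 using ring.ring_simprules[OF k_algebraD(2)[of k C]]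
 by (intro algebra_homI) (simp_all add: lin k_algebraD alg_one tensor_one tmult_pure)

lemma inr_algebra_hom:
 "k_algebra k B ==> k_algebra k C ==> algebra_hom k C (tensor k B C) (%t. pure k B C \<one>[B] t)"
 using ring.ring_simprules[OF k_algebraD(2)[of k B]]
 by (intro algebra_homI) (simp_all add: lin k_algebraD alg_one tensor_one tmult_pure)

lemma tassoc_algebra_hom:
 assumes a: "k_algebra k B" "k_algebra k C" "k_algebra k D"
 shows "algebra_hom k (tensor k (tensor k B C) D) (tensor k B (tensor k C D)) (tassoc k B C D)"
proof (rule algebra_hom_tensorI)
 note m = a[THEN k_algebraD(1)]
 note one = a[THEN k_algebraD(5)]
 note A = tensor_k_algebra[OF a(1,2)] tensor_k_algebra[OF a(2,3)]
 note cl = alg_mult_closed[OF a(1)] alg_mult_closed[OF a(2)] alg_mult_closed[OF a(3)]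
  alg_mult_closed[OF A(1)] alg_mult_closed[OF A(2)]
 show "lmap k (tensor k (tensor k B C) D) (tensor k B (tensor k C D)) (tassoc k B C D)" by (rule tassoc_lin[OF m])
 show "tassoc k B C D (pure k (tensor k B C) D \<one>[tensor k B C] \<one>[D]) = \<one>[tensor k B (tensor k C D)]"
  by (simp add: tensor_one tassoc_pure m one)
 fix s x t y
 assume s: "s |: tensor k B C" and t: "t |: tensor k B C"
  and xy: "x |: D" "y |: D"
 let ?T = "tensor k B (tensor k C D)"
 have mT: "module k ?T" by (simp add: lin m)
 have kT: "k_algebra k ?T" by (simp add: lin a)
 show "tassoc k B C D (pure k (tensor k B C) D (s \<otimes>[tensor k B C] t) (x \<otimes>[D] y))
  = tassoc k B C D (pure k (tensor k B C) D s x) \<otimes>[?T] tassoc k B C D (pure k (tensor k B C) D t y)"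
 proof (rule tensor_eq[OF m(1,2) _ _ mT _ s])
  fix b c assume bc: "b |: B" "c |: C"
  show "tassoc k B C D (pure k (tensor k B C) D (pure k B C b c \<otimes>[tensor k B C] t) (x \<otimes>[D] y))
  = tassoc k B C D (pure k (tensor k B C) D (pure k B C b c) x) \<otimes>[?T] tassoc k B C D (pure k (tensor k B C) D t y)"
   by (rule tensor_eq[OF m(1,2) _ _ mT _ t])
    (simp_all add: lin m a kT bc xy cl tassoc_pure tmult_pure A)
 qed (simp_all add: lin m a kT xy cl t A)
qed (simp_all add: lin assms)

section \<open>Structure maps of a quasi-Hopf algebra\<close>

locale quasi_hopf_alg =
 fixes k :: "'k ring" and H :: "('k, 'h) quasi_hopf"
 assumes qh: "quasi_hopf_algebra k H"
begin

abbreviation "H2 == tens2 k H"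
abbreviation "H3 == tens3 k H"
abbreviation "H4 == tens4 k H"
abbreviation "pH == pure k H H"
abbreviation "pH2 == pure k H (tens2 k H)"
abbreviation "pH3 == pure k H (tens3 k H)"
abbreviation prod1 (infixl "*1" 70) where "x *1 y == x \<otimes>[H] y"
abbreviation prod2 (infixl "*2" 70) where "x *2 y == x \<otimes>[H2] y"
abbreviation prod3 (infixl "*3" 70) where "x *3 y == x \<otimes>[H3] y"
abbreviation prod4 (infixl "*4" 70) where "x *4 y == x \<otimes>[H4] y"
abbreviation one1 ("\<one>\<^sub>1") where "\<one>\<^sub>1 == \<one>[H]"
abbreviation one2 ("\<one>\<^sub>2") where "\<one>\<^sub>2 == \<one>[H2]"
abbreviation one3 ("\<one>\<^sub>3") where "\<one>\<^sub>3 == \<one>[H3]"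
abbreviation one4 ("\<one>\<^sub>4") where "\<one>\<^sub>4 == \<one>[H4]"
abbreviation "\<Delta> == comult H"
abbreviation "\<phi> == phi H"
abbreviation "\<psi> == phi_inv k H"
abbreviation "S == antip H"
text \<open>
 Subscripts count positions: \<open>e1\<close>, \<open>e2\<close> apply \<open>\<Delta>\<close> to leg 1, 2 of an element of \<open>H2\<close>, and \<open>d1\<close>, \<open>d2\<close>, \<open>d3\<close> to a leg
 of one of \<open>H3\<close>; \<open>j0\<close>, \<open>i0\<close> put a unit in front, and \<open>j3\<close>, \<open>i4\<close> one at the end.
\<close>

abbreviation "e1 == comult_id k H"
abbreviation "e2 == id_comult k H"
abbreviation "j0 == pure k H (tens2 k H) \<one>\<^sub>1"
abbreviation "j3 t == tassoc k H H H (pure k (tens2 k H) H t \<one>\<^sub>1)"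
abbreviation "i0 == pure k H (tens3 k H) \<one>\<^sub>1"
abbreviation "i4 == tens3_one k H"
abbreviation "d1 t == tassoc k H H (tens2 k H) (tmap k (tens2 k H) (tens2 k H) (comult H) id t)"
abbreviation "d2 == tmap k H (tens3 k H) id (comult_id k H)"
abbreviation "d3 == tmap k H (tens3 k H) id (id_comult k H)"
abbreviation "j33 t == tassoc k H H (tens2 k H) (pure k (tens2 k H) (tens2 k H) t \<one>[tens2 k H])"
abbreviation "K s b == tmap k H (tens3 k H) id (tassoc k H H H)
   (tassoc k H (tens2 k H) H (pure k (tens3 k H) H s b))"
abbreviation "counit_l C == tlift C (%b c. counit H b \<odot>[C] c)"
abbreviation "counit_r == tlift H (%a b. counit H b \<odot>[H] a)"
abbreviation "\<kappa> == tmap k H H id (counit_l H)"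

lemmas qb = qh[unfolded quasi_hopf_algebra_def quasi_bialgebra_def]

lemma H_alg [simp]: "k_algebra k H" using qb by blast
lemma H_mod [simp]: "module k H" by (rule k_algebraD[OF H_alg])
lemma alg234 [simp]: "k_algebra k H2" "k_algebra k H3" "k_algebra k H4" by (simp_all add: lin)
lemma mod234 [simp]: "module k H2" "module k H3" "module k H4" by (simp_all add: lin)

sublocale H: ring H by (rule k_algebraD[OF H_alg])
sublocale H2: ring H2 by (rule k_algebraD(2)[where k = k]) simp
sublocale H3: ring H3 by (rule k_algebraD(2)[where k = k]) simp
sublocale H4: ring H4 by (rule k_algebraD(2)[where k = k]) simp

lemma comult_hom: "algebra_hom k H H2 \<Delta>" using qb by blast
lemma counit_hom: "algebra_hom k H (ground_module k) (counit H)" using qb by blast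
lemma counit_comult: "h |: H ==> counit_l H (\<Delta> h) = h" "h |: H ==> counit_r (\<Delta> h) = h" using qb by blast+
lemma coassoc: "h |: H ==> e2 (\<Delta> h) *3 \<phi> = \<phi> *3 e1 (\<Delta> h)" using qb by blast
lemma pentagon: "d3 \<phi> *4 d1 \<phi> = i0 \<phi> *4 d2 \<phi> *4 i4 \<phi>" using qb by blast
lemma kappa_phi: "\<kappa> \<phi> = \<one>\<^sub>2" using qb by blast
lemma phi_unit: "\<phi> \<in> Units H3" using qb by blast
lemma phi_closed [simp]: "\<phi> |: H3" "\<psi> |: H3" using phi_unit unfolding phi_inv_def by (auto intro: H3.Units_closed)
lemma phi_inv_eq [simp]: "\<phi> *3 \<psi> = \<one>\<^sub>3" "\<psi> *3 \<phi> = \<one>\<^sub>3"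
 using phi_unit unfolding phi_inv_def by auto

lemma anti: "lmap k H H S" "bij_betw S (carrier H) (carrier H)" "S \<one>\<^sub>1 = \<one>\<^sub>1"
 "x |: H ==> y |: H ==> S (x *1 y) = S y *1 S x" using qb unfolding algebra_anti_automorphism_def by auto
lemma ab [simp]: "qalpha H |: H" "qbeta H |: H" using qb by auto
lemma antipode:
 "h |: H ==> tlift H (%a b. S a *1 qalpha H *1 b) (\<Delta> h) = counit H h \<odot>[H] qalpha H"
 "h |: H ==> tlift H (%a b. a *1 qbeta H *1 S b) (\<Delta> h) = counit H h \<odot>[H] qbeta H"
 "tlift3 H (%a b c. a *1 qbeta H *1 S b *1 qalpha H *1 c) \<phi> = \<one>\<^sub>1"
 "tlift3 H (%a b c. S a *1 qalpha H *1 b *1 qbeta H *1 S c) \<psi> = \<one>\<^sub>1" using qb by blast+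

lemma S_lin [lin]: "lmap k Z H f ==> lmap k Z H (%z. S (f z))" by (rule lin_comp[OF anti(1)])
lemma S_closed [simp]: "x |: H ==> S x |: H" by (rule lin_cl[OF anti(1)])
lemma comult_lin [lin]: "lmap k Z H f ==> lmap k Z H2 (%z. \<Delta> (f z))" by (rule lin_comp[OF alg_homD(1)[OF comult_hom]])
lemma comult_closed [simp]: "x |: H ==> \<Delta> x |: H2" by (rule alg_homD[OF comult_hom])
lemma counit_closed [simp]: "x |: H ==> counit H x |: k" using alg_homD(4)[OF counit_hom] by (simp add: ground_module_def)
lemma counit_facts: "counit H \<one>\<^sub>1 = \<one>[k]"
 "x |: H ==> y |: H ==> counit H (x *1 y) = counit H x \<otimes>[k] counit H y"
 "x |: H ==> y |: H ==> counit H (x \<oplus>[H] y) = counit H x \<oplus>[k] counit H y"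
 "r |: k ==> x |: H ==> counit H (r \<odot>[H] x) = r \<otimes>[k] counit H x"
 using alg_homD[OF counit_hom] linear_add[OF alg_homD(1)[OF counit_hom]]
  linear_smult[OF alg_homD(1)[OF counit_hom]] by (simp_all add: ground_module_def)

lemma counit1 [lin]:
 assumes "lmap k Z H f" "x |: M" "module k M"
 shows "lmap k Z M (%z. counit H (f z) \<odot>[M] x)"
proof (rule lin_comp[OF _ assms(1)])
 interpret module k M by fact
 show "lmap k H M (%z. counit H z \<odot>[M] x)" by (rule linear_mapI) (auto simp: counit_facts assms smult_l_distr smult_assoc1)
qed
lemma counit2 [lin]:
 "lmap k Z M f ==> h |: H ==> module k M ==> lmap k Z M (%z. counit H h \<odot>[M] f z)" by (rule linear_scale) auto

lemma counit_smult_closed [simp]: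
 "x |: M ==> h |: H ==> module k M ==> counit H h \<odot>[M] x |: M" by (simp add: module.smult_closed)

text \<open>All these maps are homomorphisms of algebras and are known on pure tensors.\<close>

lemma e2_hom: "algebra_hom k H2 H3 e2"
 unfolding id_comult_def by (intro tmap_algebra_hom algebra_hom_id comult_hom) (simp_all add: lin)
lemma e1_hom: "algebra_hom k H2 H3 e1" unfolding comult_id_def
 by (intro algebra_hom_comp[OF tassoc_algebra_hom tmap_algebra_hom] algebra_hom_id comult_hom) (simp_all add: lin)
lemma j0_hom: "algebra_hom k H2 H3 j0" by (rule inr_algebra_hom) simp_all
lemma j3_hom: "algebra_hom k H2 H3 j3" by (rule algebra_hom_comp[OF tassoc_algebra_hom inl_algebra_hom]) simp_all
lemma i0_hom: "algebra_hom k H3 H4 i0" by (rule inr_algebra_hom) simp_all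
lemma K_hom: "algebra_hom k (tensor k H3 H) H4 (%t. tmap k H H3 id (tassoc k H H H) (tassoc k H H2 H t))"
 by (intro algebra_hom_comp[OF tmap_algebra_hom tassoc_algebra_hom] algebra_hom_id tassoc_algebra_hom) (simp_all add: lin)
lemma i4_hom: "algebra_hom k H3 H4 i4" unfolding tens3_one_def by (rule algebra_hom_comp[OF K_hom inl_algebra_hom]) simp_all
lemma d1_hom: "algebra_hom k H3 H4 d1"
 by (intro algebra_hom_comp[OF tassoc_algebra_hom tmap_algebra_hom] algebra_hom_id comult_hom) (simp_all add: lin)
lemma d2_hom: "algebra_hom k H3 H4 d2" by (intro tmap_algebra_hom algebra_hom_id e1_hom) simp_all
lemma d3_hom: "algebra_hom k H3 H4 d3" by (intro tmap_algebra_hom algebra_hom_id e2_hom) simp_all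
lemma j33_hom: "algebra_hom k H2 H4 j33" by (rule algebra_hom_comp[OF tassoc_algebra_hom inl_algebra_hom]) simp_all

lemma counit_l_bil: "module k C ==> blmap k H C C (%b c. counit H b \<odot>[C] c)" by (rule bilI) (simp_all add: lin)
lemma counit_r_bil: "blmap k H H H (%a b. counit H b \<odot>[H] a)" by (rule bilI) (simp_all add: lin)
lemma counit_l_pure [simp]:
 "module k C ==> h |: H ==> c |: C ==> counit_l C (pure k H C h c) = counit H h \<odot>[C] c"
 by (simp add: tlift_pure_eq[OF _ _ counit_l_bil])
lemma counit_r_pure [simp]:
 "h |: H ==> c |: H ==> counit_r (pH h c) = counit H c \<odot>[H] h" by (simp add: tlift_pure_eq[OF _ _ counit_r_bil])

lemma k_algebra_smult:
 assumes "k_algebra k C" "r |: k" "s |: k" "x |: C" "y |: C"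
 shows "(r \<otimes>[k] s) \<odot>[C] (x \<otimes>[C] y) = (r \<odot>[C] x) \<otimes>[C] (s \<odot>[C] y)"
proof -
 interpret module k C by (rule k_algebraD[OF assms(1)])
 note * = assms(1)[unfolded k_algebra_def]
 have "(r \<odot>[C] x) \<otimes>[C] (s \<odot>[C] y) = s \<odot>[C] (r \<odot>[C] (x \<otimes>[C] y))" using * assms(2-) by simp
 also have "... = (s \<otimes>[k] r) \<odot>[C] (x \<otimes>[C] y)"
  using assms by (simp add: smult_assoc1 alg_mult_closed[OF assms(1)])
 finally show ?thesis using assms by (simp add: R.m_comm)
qed

lemma counit_l_hom: "k_algebra k C ==> algebra_hom k (tensor k H C) C (counit_l C)" by (rule algebra_hom_tensorI)
  (auto simp: k_algebraD counit_l_bil alg_mult_closed counit_facts k_algebra_smult module.smult_one intro!: tlift_lin)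
lemma counit_r_hom: "algebra_hom k H2 H counit_r" by (rule algebra_hom_tensorI)
  (auto simp: k_algebraD counit_r_bil alg_mult_closed counit_facts k_algebra_smult module.smult_one intro!: tlift_lin)

lemma kappa_hom: "algebra_hom k H3 H2 \<kappa>" by (intro tmap_algebra_hom algebra_hom_id counit_l_hom) simp_all

lemmas homs = e2_hom e1_hom j0_hom j3_hom i0_hom i4_hom d1_hom d2_hom d3_hom j33_hom
 counit_l_hom counit_r_hom kappa_hom

lemmas homs_lin [lin] = lin_comp[OF alg_homD(1)[OF e2_hom]] lin_comp[OF alg_homD(1)[OF e1_hom]]
 lin_comp[OF alg_homD(1)[OF i4_hom]]
 lin_comp[OF alg_homD(1)[OF d1_hom]] lin_comp[OF alg_homD(1)[OF d2_hom]]
 lin_comp[OF alg_homD(1)[OF d3_hom]] lin_comp[OF alg_homD(1)[OF counit_l_hom]]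
 lin_comp[OF alg_homD(1)[OF counit_r_hom]] lin_comp[OF alg_homD(1)[OF kappa_hom]]
 lin_comp[OF alg_homD(1)[OF K_hom]]

lemmas homs_closed [simp] = alg_homD(4)[OF e2_hom] alg_homD(4)[OF e1_hom] alg_homD(4)[OF j0_hom]
 alg_homD(4)[OF j3_hom] alg_homD(4)[OF i0_hom] alg_homD(4)[OF i4_hom] alg_homD(4)[OF d1_hom]
 alg_homD(4)[OF d2_hom] alg_homD(4)[OF d3_hom] alg_homD(4)[OF j33_hom] alg_homD(4)[OF counit_l_hom]
 alg_homD(4)[OF counit_r_hom] alg_homD(4)[OF kappa_hom]

lemma pure_cl [simp]:
 "a |: H ==> b |: H ==> pH a b |: H2"
 "a |: H ==> s |: H2 ==> pH2 a s |: H3"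
 "a |: H ==> u |: H3 ==> pH3 a u |: H4" by (simp_all add: pure_in)

lemma tassoc_p [simp]:
 "a |: H ==> b |: H ==> c |: H ==>
  tassoc k H H H (pure k H2 H (pH a b) c) = pH2 a (pH b c)"
 "a |: H ==> b |: H ==> s |: H2 ==>
  tassoc k H H H2 (pure k H2 H2 (pH a b) s) = pH3 a (pH2 b s)"
 "a |: H ==> s |: H2 ==> c |: H ==>
  tassoc k H H2 H (pure k H3 H (pH2 a s) c) = pure3 k H H2 H a s c" by (simp_all add: tassoc_pure)

lemma e2_pure [simp]: "a |: H ==> b |: H ==> e2 (pH a b) = pH2 a (\<Delta> b)" unfolding id_comult_def
 by (subst tmap_pure[OF alg_homD(1)[OF algebra_hom_id] alg_homD(1)[OF comult_hom]]) (simp_all add: id_apply)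
lemma e1_pure [simp]: "a |: H ==> b |: H ==>
  e1 (pH a b) = tassoc k H H H (pure k H2 H (\<Delta> a) b)" unfolding comult_id_def
 by (subst tmap_pure[OF alg_homD(1)[OF comult_hom] alg_homD(1)[OF algebra_hom_id]]) (simp_all add: id_apply)
lemma d1_pure [simp]: "a |: H ==> s |: H2 ==>
  d1 (pH2 a s) = tassoc k H H H2 (pure k H2 H2 (\<Delta> a) s)"
 by (subst tmap_pure[OF alg_homD(1)[OF comult_hom] alg_homD(1)[OF algebra_hom_id]]) (simp_all add: id_apply)
lemma d2_pure [simp]: "a |: H ==> s |: H2 ==> d2 (pH2 a s) = pH3 a (e1 s)"
 by (subst tmap_pure[OF alg_homD(1)[OF algebra_hom_id] alg_homD(1)[OF e1_hom]]) (simp_all add: id_apply)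
lemma d3_pure [simp]: "a |: H ==> s |: H2 ==> d3 (pH2 a s) = pH3 a (e2 s)"
 by (subst tmap_pure[OF alg_homD(1)[OF algebra_hom_id] alg_homD(1)[OF e2_hom]]) (simp_all add: id_apply)
lemma K_pure' [simp]: "a |: H ==> t |: (tensor k H2 H) ==>
  tmap k H H3 id (tassoc k H H H) (pure k H (tensor k H2 H) a t) = pH3 a (tassoc k H H H t)"
 by (subst tmap_pure[where V = H and W = "tensor k H2 H"])
  (simp_all add: lin id_apply tassoc_lin alg_homD(1)[OF algebra_hom_id])
lemma K_pure: "a |: H ==> s |: H2 ==> b |: H ==>
  K (pH2 a s) b = pH3 a (tassoc k H H H (pure k H2 H s b))" by (simp add: lin)
lemma i4_pure [simp]: "a |: H ==> s |: H2 ==> i4 (pH2 a s) = pH3 a (j3 s)"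
 unfolding tens3_one_def by (simp only: K_pure H.one_closed)
lemma kappa_pure [simp]: "a |: H ==> s |: H2 ==> \<kappa> (pH2 a s) = pH a (counit_l H s)"
 by (subst tmap_pure[OF alg_homD(1)[OF algebra_hom_id] alg_homD(1)[OF counit_l_hom]]) (simp_all add: id_apply)

lemmas H2_eq = tensor_eq[OF H_mod H_mod]
lemmas H3_eq = tensor3_eq[OF _ _ H_mod H_mod H_mod]
text \<open>Naturality relations between the maps \<open>H\<^sup>\<otimes>\<^sup>2 \<rightarrow> H\<^sup>\<otimes>\<^sup>3 \<rightarrow> H\<^sup>\<otimes>\<^sup>4\<close>.\<close>

lemma nat_a: assumes "t |: H2"
 shows "d3 (j0 t) = i0 (e2 t)" "d2 (j0 t) = i0 (e1 t)" "d1 (j0 t) = i0 (j0 t)"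
 using assms by (simp_all add: alg_homD(2)[OF comult_hom] tensor_one del: d1_pure) 
  (subst d1_pure, simp_all add: alg_homD(2)[OF comult_hom] tensor_one)

lemma nat_j33: assumes t: "t |: H2"
 shows "d3 (j3 t) = j33 t" "i4 (j3 t) = j33 t" "i0 (j3 t) = i4 (j0 t)"
 by (rule H2_eq[OF _ _ _ _ t, of H4]; simp add: lin tensor_one alg_homD(2)[OF comult_hom])+

lemma nat_s: assumes s: "s |: H2" and b: "b |: H"
 shows "i4 (tassoc k H H H (pure k H2 H s b)) = tassoc k H H H2 (pure k H2 H2 s (pH b \<one>\<^sub>1))"
  "d3 (tassoc k H H H (pure k H2 H s b)) = tassoc k H H H2 (pure k H2 H2 s (\<Delta> b))"
 by (rule H2_eq[OF _ _ _ _ s, of H4]; simp add: lin b)+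

lemma nat_b: assumes t: "t |: H2"
 shows "d1 (j3 t) = i4 (e1 t)" "d2 (j3 t) = i4 (e2 t)" "d1 (e2 t) = d3 (e1 t)"
 by (rule H2_eq[OF _ _ _ _ t, of H4]; simp add: lin nat_s)+

lemma nat_phi3: assumes t: "t |: H2"
 shows "d3 (e2 t) *4 i0 \<phi> = i0 \<phi> *4 d2 (e2 t)"
 by (rule H2_eq[OF _ _ _ _ t, of H4]) (simp_all add: lin tmult_pure coassoc)

lemma K_e1: assumes s: "s |: H2" and b: "b |: H"
 shows "d1 (tassoc k H H H (pure k H2 H s b)) = K (e1 s) b"
proof (rule H2_eq[OF _ _ _ _ s, of H4])
 have *: "tassoc k H H H2 (pure k H2 H2 u (pH y b)) = K (tassoc k H H H (pure k H2 H u y)) b"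
  if "u |: H2" "y |: H" for u y by (rule H2_eq[OF _ _ _ _ that(1), of H4]) (simp_all add: lin b that)
 fix x y assume "x |: H" "y |: H"
 then show "d1 (tassoc k H H H (pure k H2 H (pH x y) b)) = K (e1 (pH x y)) b" using b by (simp add: *)
qed (simp_all add: lin b)

lemma K_e2: assumes s: "s |: H2" and b: "b |: H"
 shows "d2 (tassoc k H H H (pure k H2 H s b)) = K (e2 s) b" by (rule H2_eq[OF _ _ _ _ s, of H4]) (simp_all add: lin b)

lemma nat_phi1: assumes t: "t |: H2"
 shows "i4 \<phi> *4 d1 (e1 t) = d2 (e1 t) *4 i4 \<phi>"
proof (rule H2_eq[OF _ _ _ _ t, of H4])
 fix a b assume ab: "a |: H" "b |: H"
 have K: "K s x *4 K s' x' = K (s *3 s') (x *1 x')"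
  if "s |: H3" "s' |: H3" "x |: H" "x' |: H" for s s' x x'
  using alg_homD(3)[OF K_hom, of "pure k H3 H s x" "pure k H3 H s' x'"] that by (simp add: lin tmult_pure)
 show "i4 \<phi> *4 d1 (e1 (pH a b)) = d2 (e1 (pH a b)) *4 i4 \<phi>" using ab by (simp add: K_e1 K_e2 tens3_one_def K coassoc)
qed (simp_all add: lin)

lemma nat_comm: assumes "s |: H2" "t |: H2"
 shows "j33 s *4 i0 (j0 t) = i0 (j0 t) *4 j33 s"
proof -
 have "i0 (j0 t) = tassoc k H H H2 (pure k H2 H2 \<one>\<^sub>2 t)" using assms by (simp add: tensor_one)
 moreover have "algebra_hom k (tensor k H2 H2) H4 (tassoc k H H H2)" by (rule tassoc_algebra_hom) simp_all
 ultimately show ?thesis using assms by (simp add: alg_homD(3)[symmetric] lin tmult_pure)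
qed

lemma kappa_maps: assumes t: "t |: H2"
 shows "\<kappa> (j0 t) = pH \<one>\<^sub>1 (counit_l H t)" "\<kappa> (j3 t) = pH (counit_r t) \<one>\<^sub>1"
  "\<kappa> (e1 t) = t" "\<kappa> (e2 t) = t"
proof -
 note sm = two_modules.pure_smult_left[OF two_modules.intro] two_modules.pure_smult_right[OF two_modules.intro]
 show "\<kappa> (j0 t) = pH \<one>\<^sub>1 (counit_l H t)" using t by simp
 have k1: "\<kappa> (tassoc k H H H (pure k H2 H s c)) = pH (counit_r s) c"
  if "s |: H2" "c |: H" for s c by (rule H2_eq[OF _ _ _ _ that(1), of H2]) (simp_all add: lin that sm)
 show "\<kappa> (j3 t) = pH (counit_r t) \<one>\<^sub>1" using k1 t by simp
 show "\<kappa> (e1 t) = t" by (rule H2_eq[OF _ _ _ _ t, of H2]) (simp_all add: lin k1 counit_comult)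
 show "\<kappa> (e2 t) = t" by (rule H2_eq[OF _ _ _ _ t, of H2]) (simp_all add: lin counit_comult)
qed

text \<open>
 Applying the counit to the third leg of the pentagon gives \<open>\<phi> = \<phi> \<cdot> ((id \<otimes> id \<otimes> \<epsilon>) \<phi> \<otimes> 1)\<close>.
\<close>

abbreviation "\<kappa>3 == tmap k H H id counit_r"

lemma kappa3_hom: "algebra_hom k H3 H2 \<kappa>3" by (intro tmap_algebra_hom algebra_hom_id counit_r_hom) simp_all
lemma kappa3_pure: "a |: H ==> s |: H2 ==> \<kappa>3 (pH2 a s) = pH a (counit_r s)"
 by (subst tmap_pure[OF alg_homD(1)[OF algebra_hom_id] alg_homD(1)[OF counit_r_hom]]) (simp_all add: id_apply)

lemma kappa3_phi: "\<kappa>3 \<phi> = \<one>\<^sub>2"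
proof -
 define Q where "Q = tmap k H H2 id \<kappa>"
 have Q: "algebra_hom k H4 H3 Q" unfolding Q_def by (intro tmap_algebra_hom algebra_hom_id kappa_hom) simp_all
 have Qp: "Q (pH3 a s) = pH2 a (\<kappa> s)" if "a |: H" "s |: H3" for a s unfolding Q_def using that
  by (subst tmap_pure[OF alg_homD(1)[OF algebra_hom_id] alg_homD(1)[OF kappa_hom]]) (simp_all add: id_apply)
 note [lin] = lin_comp[OF alg_homD(1)[OF Q]] lin_comp[OF alg_homD(1)[OF kappa3_hom]]
 have q1: "Q (d3 t) = t" if "t |: H3" for t
  by (rule tensor_eq[OF H_mod mod234(1) _ _ mod234(2) _ that]) (simp_all add: lin Qp kappa_maps)
 have q2: "Q (d2 t) = t" if "t |: H3" for t
  by (rule tensor_eq[OF H_mod mod234(1) _ _ mod234(2) _ that]) (simp_all add: lin Qp kappa_maps)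
 have q: "Q (tassoc k H H H2 (pure k H2 H2 s t)) = tassoc k H H H (pure k H2 H s (counit_l H t))"
  if "s |: H2" "t |: H2" for s t by (rule H2_eq[OF _ _ _ _ that(1), of H3]) (simp_all add: lin Qp that)
 have "Q (d1 t) = e1 (\<kappa> t)" if "t |: H3" for t
  by (rule tensor_eq[OF H_mod mod234(1) _ _ mod234(2) _ that]) (simp_all add: lin q)
 then have q3: "Q (d1 \<phi>) = \<one>\<^sub>3" by (simp add: kappa_phi alg_homD(2)[OF e1_hom])
 have q4: "Q (i0 \<phi>) = \<one>\<^sub>3" by (simp add: Qp kappa_phi tensor_one)
 have q5: "Q (i4 t) = j3 (\<kappa>3 t)" if "t |: H3" for t
  by (rule tensor_eq[OF H_mod mod234(1) _ _ mod234(2) _ that]) (simp_all add: lin Qp kappa3_pure kappa_maps)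
 have kk: "\<kappa>3 (j3 s) = s" if "s |: H2" for s by (rule H2_eq[OF _ _ _ _ that, of H2])
   (simp_all add: lin kappa3_pure counit_facts module.smult_one[OF H_mod])
 have cl: "\<kappa>3 \<phi> |: H2" by (rule alg_homD[OF kappa3_hom]) simp
 have "\<phi> *3 \<one>\<^sub>3 = \<one>\<^sub>3 *3 \<phi> *3 j3 (\<kappa>3 \<phi>)"
  using arg_cong[OF pentagon, of Q] by (simp add: alg_homD(3)[OF Q] q1 q2 q3 q4 q5)
 then have "\<psi> *3 (\<phi> *3 j3 (\<kappa>3 \<phi>)) = \<psi> *3 \<phi>" using cl by simp
 then have "j3 (\<kappa>3 \<phi>) = \<one>\<^sub>3" using cl H3.m_assoc[of \<psi> \<phi> "j3 (\<kappa>3 \<phi>)"] by simp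
 then have "\<kappa>3 \<phi> = \<kappa>3 \<one>\<^sub>3" using kk[OF cl] by simp
 then show ?thesis by (simp add: alg_homD(2)[OF kappa3_hom])
qed

end

context quasi_hopf_alg begin

section \<open>Functionals built from the antipode\<close>

abbreviation "\<A> c == tlift H (%a b. S a *1 c *1 b)"
abbreviation "\<B> c == tlift H (%a b. a *1 c *1 S b)"

lemma tlift_H2 [lin]:
 "blmap k H H M f ==> module k M ==> lmap k Z H2 g
  ==> lmap k Z M (%z. tlift M f (g z))" by (rule tlift_arg) simp_all

lemma tlift_H2_closed:
 "blmap k H H M f ==> module k M ==> t |: H2 ==> tlift M f t |: M" by (rule tlift_closed) simp_all

lemma tlift_H2_pure:
 "blmap k H H M f ==> module k M ==> a |: H ==> b |: H
  ==> tlift M f (pH a b) = f a b" by (rule tlift_pure_eq) simp_all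

lemma tlift_H3 [lin]:
 "trilinear k H H H M f ==> module k M ==> lmap k Z H3 g
  ==> lmap k Z M (%z. tlift3 M f (g z))" by (rule lin_comp[OF tlift3_lin]) simp_all

lemma tlift_H3_closed:
 "trilinear k H H H M f ==> module k M ==> t |: H3 ==> tlift3 M f t |: M" by (rule lin_cl[OF tlift3_lin]) simp_all

lemma tlift_H3_pure:
 "trilinear k H H H M f ==> module k M ==> a |: H ==> b |: H ==> c |: H
  ==> tlift3 M f (pH2 a (pH b c)) = f a b c" by (rule tlift3_pure) simp_all

lemma AB_bil: "c |: H ==> blmap k H H H (%a b. S a *1 c *1 b)"
 "c |: H ==> blmap k H H H (%a b. a *1 c *1 S b)" by (rule bilI; simp add: lin)+

lemma AB_pure [simp]:
 "c |: H ==> a |: H ==> b |: H ==> \<A> c (pH a b) = S a *1 c *1 b"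
 "c |: H ==> a |: H ==> b |: H ==> \<B> c (pH a b) = a *1 c *1 S b" by (simp_all add: tlift_H2_pure AB_bil)

lemma AB_closed [simp]:
 "c |: H ==> t |: H2 ==> \<A> c t |: H"
 "c |: H ==> t |: H2 ==> \<B> c t |: H" by (simp_all add: tlift_H2_closed AB_bil)

lemma AB_lin [lin]:
 "c |: H ==> lmap k Z H2 g ==> lmap k Z H (%z. \<A> c (g z))"
 "c |: H ==> lmap k Z H2 g ==> lmap k Z H (%z. \<B> c (g z))" by (simp_all add: tlift_H2 AB_bil)

lemma AB_lin' [lin]:
 "t |: H2 ==> lmap k Z H g ==> lmap k Z H (%z. \<A> (g z) t)"
 "t |: H2 ==> lmap k Z H g ==> lmap k Z H (%z. \<B> (g z) t)"
proof -
 show "t |: H2 ==> lmap k Z H g ==> lmap k Z H (%z. \<A> (g z) t)"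
  by (rule lin_comp[where V = H and f = "%c. \<A> c t"], rule tlift_param[where V = H and W = H]) (simp_all add: lin AB_bil)
 show "t |: H2 ==> lmap k Z H g ==> lmap k Z H (%z. \<B> (g z) t)"
  by (rule lin_comp[where V = H and f = "%c. \<B> c t"], rule tlift_param[where V = H and W = H]) (simp_all add: lin AB_bil)
qed

lemma A_mult:
 assumes c: "c |: H" and x: "x |: H2" and y: "y |: H2"
 shows "\<A> c (x *2 y) = \<A> (\<A> c x) y"
proof (rule H2_eq[OF _ _ _ _ x, of H])
 fix a b assume ab: "a |: H" "b |: H"
 show "\<A> c (pH a b *2 y) = \<A> (\<A> c (pH a b)) y"
  by (rule H2_eq[OF _ _ _ _ y, of H]) (simp_all add: lin c ab tmult_pure anti(4) H.m_assoc)
qed (simp_all add: lin c y)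

lemma B_mult:
 assumes c: "c |: H" and x: "x |: H2" and y: "y |: H2"
 shows "\<B> c (x *2 y) = \<B> (\<B> c y) x"
proof (rule H2_eq[OF _ _ _ _ x, of H])
 fix a b assume ab: "a |: H" "b |: H"
 show "\<B> c (pH a b *2 y) = \<B> (\<B> c y) (pH a b)"
  by (rule H2_eq[OF _ _ _ _ y, of H]) (simp_all add: lin c ab tmult_pure anti(4) H.m_assoc)
qed (simp_all add: lin c y)

text \<open>
 The shapes \<open>g(t\<^sub>1, S(t\<^sub>2) c t\<^sub>3)\<close> and \<open>g(t\<^sub>1, t\<^sub>2 c S(t\<^sub>3))\<close>, for a bilinear \<open>g\<close>, occur in the axioms of
 an antipode, in evaluation and in coevaluation.
\<close>

abbreviation "\<E> M g c == tlift3 M (%a b e. g a (S b *1 c *1 e))"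
abbreviation "\<Z> M g c == tlift3 M (%a b e. g a (b *1 c *1 S e))"

context
 fixes M :: "('k, 'm, 'z) module_scheme" and g :: "'h => 'h => 'm"
 assumes M: "module k M" and g: "blmap k H H M g"
begin

lemmas gl = bil1[OF g] bil2[OF g]

lemma EZ_tri: "c |: H ==> trilinear k H H H M (%a b e. g a (S b *1 c *1 e))"
 "c |: H ==> trilinear k H H H M (%a b e. g a (b *1 c *1 S e))" by (rule trilinearI; simp add: lin gl)+

lemma EZ_pure:
 "c |: H ==> x |: H ==> y |: H ==> z |: H ==>
  \<E> M g c (pH2 x (pH y z)) = g x (S y *1 c *1 z)"
 "c |: H ==> x |: H ==> y |: H ==> z |: H ==>
  \<Z> M g c (pH2 x (pH y z)) = g x (y *1 c *1 S z)" by (simp_all add: tlift_H3_pure EZ_tri M)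

lemma EZ_pure2:
 assumes c: "c |: H" and x: "x |: H" and s: "s |: H2"
 shows "\<E> M g c (pH2 x s) = g x (\<A> c s)" "\<Z> M g c (pH2 x s) = g x (\<B> c s)"
 by (rule H2_eq[OF _ _ _ _ s, of M]; simp add: lin gl M EZ_tri EZ_pure c x)+

lemma EZ_lin:
 "c |: H ==> lmap k Z H3 f ==> lmap k Z M (%z. \<E> M g c (f z))"
 "c |: H ==> lmap k Z H3 f ==> lmap k Z M (%z. \<Z> M g c (f z))" by (simp_all add: tlift_H3 EZ_tri M)

lemmas EZ_lin0 = EZ_lin[OF _ linear_id]

lemma E_j0:
 assumes c: "c |: H" and x: "x |: H2" and t: "t |: H3"
 shows "\<E> M g c (j0 x *3 t) = \<E> M g (\<A> c x) t" by (rule tensor_eq[OF H_mod mod234(1) _ _ M _ t])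
  (simp_all add: lin EZ_lin c x tmult_pure EZ_pure2 A_mult)

lemma Z_j0:
 assumes c: "c |: H" and x: "x |: H2" and t: "t |: H3"
 shows "\<Z> M g c (t *3 j0 x) = \<Z> M g (\<B> c x) t" by (rule tensor_eq[OF H_mod mod234(1) _ _ M _ t])
  (simp_all add: lin EZ_lin c x tmult_pure EZ_pure2 B_mult)

end

end

section \<open>The twisted quasi-Hopf algebra\<close>

lemma tens_rel_cong:
 assumes "carrier V = carrier V'" "add V = add V'" "zero V = zero V'" "smult V = smult V'"
  "carrier W = carrier W'" "add W = add W'" "zero W = zero W'" "smult W = smult W'"
 shows "tens_rel k V W = tens_rel k V' W'"
proof -
 have 1: "tens_rel k V' W' xs ys" if "tens_rel k V W xs ys" for xs ys using that
 proof (induction rule: tens_rel.induct)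
  case (trans xs ys zs) from trans(3,4) show ?case by (rule tens_rel.trans)
 qed (auto simp: assms intro: tens_rel.refl tens_rel.sym tens_rel.app tens_rel.comm tens_rel.zero
   tens_rel.add_left tens_rel.add_right tens_rel.smult)
 have 2: "tens_rel k V W xs ys" if "tens_rel k V' W' xs ys" for xs ys using that
 proof (induction rule: tens_rel.induct)
  case (trans xs ys zs) from trans(3,4) show ?case by (rule tens_rel.trans)
 qed (auto simp: assms[symmetric] intro: tens_rel.refl tens_rel.sym tens_rel.app tens_rel.comm tens_rel.zero
   tens_rel.add_left tens_rel.add_right tens_rel.smult)
 from 1 2 show ?thesis by (intro ext) blast
qed

lemma tensor_lin_cong:
 assumes "carrier V = carrier V'" "add V = add V'" "zero V = zero V'" "smult V = smult V'"
  "carrier W = carrier W'" "add W = add W'" "zero W = zero W'" "smult W = smult W'"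
 shows "tens_class k V W = tens_class k V' W'" "pure k V W = pure k V' W'"
  "carrier (tensor k V W) = carrier (tensor k V' W')" "add (tensor k V W) = add (tensor k V' W')"
  "zero (tensor k V W) = zero (tensor k V' W')" "smult (tensor k V W) = smult (tensor k V' W')"
proof -
 show *: "tens_class k V W = tens_class k V' W'" by (intro ext) (simp add: tens_class_def tens_rel_cong[OF assms])
 show "pure k V W = pure k V' W'" unfolding pure_def[abs_def] * ..
 show "carrier (tensor k V W) = carrier (tensor k V' W')" "add (tensor k V W) = add (tensor k V' W')"
  "zero (tensor k V W) = zero (tensor k V' W')" "smult (tensor k V W) = smult (tensor k V' W')"
  unfolding tensor_def * by (simp_all add: assms)
qed

lemma tensor_cong:
 assumes "carrier V = carrier V'" "add V = add V'" "zero V = zero V'" "smult V = smult V'"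
  "carrier W = carrier W'" "add W = add W'" "zero W = zero W'" "smult W = smult W'"
  "mult V = mult V'" "mult W = mult W'" "one V = one V'" "one W = one W'"
 shows "tensor k V W = tensor k V' W'" unfolding tensor_def tensor_lin_cong[OF assms(1-8)] by (simp add: assms)

lemma tlift_target_cong:
 assumes "add M = add M'" "zero M = zero M'"
 shows "tlift M = tlift M'" using assms by (intro ext) (simp add: tlift_def list_sum_def)

lemma tmap_id_pure:
 "lmap k W W' g ==> module k V ==> module k W ==> module k W' ==> v |: V ==> w |: W
  ==> tmap k V W' id g (pure k V W v w) = pure k V W' v (g w)"
 by (subst tmap_pure[OF alg_homD(1)[OF algebra_hom_id]]) (simp_all add: id_apply)

lemma tmap_pure_id:
 "lmap k V V' f ==> module k V ==> module k W ==> module k V' ==> v |: V ==> w |: W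
  ==> tmap k V' W f id (pure k V W v w) = pure k V' W (f v) w"
 by (subst tmap_pure[OF _ alg_homD(1)[OF algebra_hom_id]]) (simp_all add: id_apply)

lemma abelian_group_cong:
 assumes "carrier V = carrier V'" "add V = add V'" "zero V = zero V'" "abelian_group V"
 shows "abelian_group V'"
proof -
 interpret abelian_group V by fact
 show ?thesis
 proof (rule abelian_groupI)
  fix x assume "x |: V'"
  then show "\<exists>y\<in>carrier V'. y \<oplus>[V'] x = \<zero>[V']" using l_neg a_inv_closed by (metis assms(1-3))
 qed (simp_all add: assms(1-3)[symmetric] a_ac)
qed

lemma module_cong:
 assumes "carrier V = carrier V'" "add V = add V'" "zero V = zero V'" "smult V = smult V'" "module k V"
 shows "module k V'"
proof -
 interpret module k V by fact
 show ?thesis by (rule moduleI)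
   (simp_all add: assms(1-4)[symmetric] smult_l_distr smult_r_distr smult_assoc1 R.is_cring
    abelian_group_cong[OF assms(1-3) M.abelian_group_axioms])
qed

lemma linear_map_cong_modules:
 assumes "carrier V = carrier V'" "add V = add V'" "smult V = smult V'"
  "carrier W = carrier W'" "add W = add W'" "smult W = smult W'"
 shows "lmap k V W = lmap k V' W'" by (intro ext) (simp add: linear_map_def assms)

text \<open>
 The pentagon for \<open>\<phi>\<^sub>F\<close> is a computation with words in \<open>H\<^sup>\<otimes>\<^sup>4\<close>: images of \<open>F\<close> and \<open>F\<inverse>\<close> which meet cancel.
\<close>

lemma (in monoid) pentagon_twist_calculation:
 assumes cl [simp]: "a |: G" "a' |: G" "B |: G" "C |: G" "C' |: G"
  "D |: G" "E' |: G" "J |: G" "J' |: G" "M |: G" "M' |: G"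
  "N |: G" "N' |: G" "W' |: G" "X |: G" "Y |: G" "Y' |: G" "Z' |: G"
  "P0 |: G" "P1 |: G" "P2 |: G" "P3 |: G" "P4 |: G"
 and inv: "a' \<otimes> a = \<one>" "C' \<otimes> C = \<one>" "J' \<otimes> J = \<one>" "M' \<otimes> M = \<one>" "N' \<otimes> N = \<one>" "Y' \<otimes> Y = \<one>"
 and comm: "J \<otimes> a' = a' \<otimes> J" and P: "P3 \<otimes> P1 = P0 \<otimes> P2 \<otimes> P4"
 and n3: "X \<otimes> P0 = P0 \<otimes> D" and n1: "P4 \<otimes> Z' = E' \<otimes> P4"
 shows "(a \<otimes> (B \<otimes> X \<otimes> P3 \<otimes> Y' \<otimes> J') \<otimes> a') \<otimes> (J \<otimes> (a \<otimes> Y \<otimes> P1 \<otimes> Z' \<otimes> W') \<otimes> J')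
  = (a \<otimes> B \<otimes> P0 \<otimes> C' \<otimes> M') \<otimes> (M \<otimes> (C \<otimes> D \<otimes> P2 \<otimes> E' \<otimes> N') \<otimes> M') \<otimes> (M \<otimes> N \<otimes> P4 \<otimes> W' \<otimes> J')"
proof -
 have c: "x \<otimes> (y \<otimes> z) = z" if "x \<otimes> y = \<one>" "x |: G" "y |: G" "z |: G" for x y z
  using that by (simp add: m_assoc[symmetric])
 note i = c[OF inv(1)] c[OF inv(2)] c[OF inv(3)] c[OF inv(4)] c[OF inv(5)] c[OF inv(6)]
 have e: "x \<otimes> (y \<otimes> z) = u \<otimes> (v \<otimes> z)" if "x \<otimes> y = u \<otimes> v" "x |: G" "y |: G"
  "u |: G" "v |: G" "z |: G" for x y z u v using that by (simp add: m_assoc[symmetric])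
 have P': "P3 \<otimes> (P1 \<otimes> z) = P0 \<otimes> (P2 \<otimes> (P4 \<otimes> z))" if "z |: G" for z
  using that P by (metis cl m_assoc m_closed)
 have L: "(a \<otimes> (B \<otimes> X \<otimes> P3 \<otimes> Y' \<otimes> J') \<otimes> a') \<otimes> (J \<otimes> (a \<otimes> Y \<otimes> P1 \<otimes> Z' \<otimes> W') \<otimes> J')
  = a \<otimes> (B \<otimes> (P0 \<otimes> (D \<otimes> (P2 \<otimes> (E' \<otimes> (P4 \<otimes> (W' \<otimes> J')))))))"
  by (simp add: m_assoc e[OF comm[symmetric]] i P' e[OF n3] e[OF n1])
 show ?thesis unfolding L by (simp add: m_assoc i)
qed

locale twist_alg = quasi_hopf_alg k H for k :: "'k ring" and H :: "('k, 'h) quasi_hopf" +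
 fixes F :: "('h, 'h) tens"
 assumes twist: "cochain_twist k H F"
begin

abbreviation "HF == twist_hopf k H F"
abbreviation "F' == twist_inv k H F"

lemma F_unit: "F \<in> Units H2" using twist unfolding cochain_twist_def by blast
lemma F_closed [simp]: "F |: H2" "F' |: H2" using F_unit unfolding twist_inv_def by auto
lemma F_inv [simp]: "F *2 F' = \<one>\<^sub>2" "F' *2 F = \<one>\<^sub>2" using F_unit unfolding twist_inv_def by auto
lemma F_counit: "counit_l H F = \<one>\<^sub>1" "counit_r F = \<one>\<^sub>1" using twist unfolding cochain_twist_def by auto
lemma F'_counit: "counit_l H F' = \<one>\<^sub>1" "counit_r F' = \<one>\<^sub>1"
proof -
 have "counit_l H (F *2 F') = \<one>\<^sub>1" "counit_r (F *2 F') = \<one>\<^sub>1"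
  using alg_homD(2)[OF counit_l_hom[OF H_alg]] alg_homD(2)[OF counit_r_hom] by simp_all
 then show "counit_l H F' = \<one>\<^sub>1" "counit_r F' = \<one>\<^sub>1"
  by (simp_all add: alg_homD(3)[OF counit_l_hom[OF H_alg]] alg_homD(3)[OF counit_r_hom] F_counit
    del: F_inv)
qed

lemma HF_simps [simp]:
 "carrier HF = carrier H" "mult HF = mult H" "one HF = one H" "zero HF = zero H" "add HF = add H"
 "smult HF = smult H" "counit HF = counit H" "antip HF = S"
 "comult HF = (%h. F *2 \<Delta> h *2 F')"
 "phi HF = j0 F *3 e2 F *3 \<phi> *3 e1 F' *3 j3 F'"
 "qalpha HF = \<A> (qalpha H) F'" "qbeta HF = \<B> (qbeta H) F" by (simp_all add: twist_hopf_def)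

lemma HF_tensor [simp]:
 "tensor k HF W = tensor k H W" "tensor k W HF = tensor k W H"
 "pure k HF W = pure k H W" "pure k W HF = pure k W H" by (auto intro!: tensor_cong tensor_lin_cong)

lemma HF_maps [simp]:
 "tlift HF = tlift H" "tlift3 HF = tlift3 H" "tmap k HF W = tmap k H W" "tmap k W HF = tmap k W H"
 "tassoc k HF U V = tassoc k H U V" "tassoc k U HF V = tassoc k U H V" "tassoc k U V HF = tassoc k U V H"
 "lmap k HF W = lmap k H W" "lmap k W HF = lmap k W H"
proof -
 show t: "tlift HF = tlift H" by (rule tlift_target_cong) simp_all
 show "tlift3 HF = tlift3 H" by (intro ext) (simp add: tlift3_def t)
qed (auto simp: tmap_def[abs_def] tassoc_def[abs_def] intro!: linear_map_cong_modules)

lemma HF_alg: "k_algebra k HF"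
proof (rule k_algebraI)
 show "module k HF" by (rule module_cong[of H]) simp_all
 show "blmap k HF HF HF (mult HF)" using k_algebraD(4)[OF H_alg] by (simp add: bilinear_map_def)
qed (simp_all add: H.m_assoc)

lemma homs_mult [simp]:
 "x |: H2 ==> y |: H2 ==> e1 (x *2 y) = e1 x *3 e1 y"
 "x |: H2 ==> y |: H2 ==> e2 (x *2 y) = e2 x *3 e2 y"
 "u |: H3 ==> v |: H3 ==> d1 (u *3 v) = d1 u *4 d1 v"
 "u |: H3 ==> v |: H3 ==> d2 (u *3 v) = d2 u *4 d2 v"
 "u |: H3 ==> v |: H3 ==> d3 (u *3 v) = d3 u *4 d3 v"
 "u |: H3 ==> v |: H3 ==> i0 (u *3 v) = i0 u *4 i0 v"
 "u |: H3 ==> v |: H3 ==> i4 (u *3 v) = i4 u *4 i4 v"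
 "u |: H3 ==> v |: H3 ==> \<kappa> (u *3 v) = \<kappa> u *2 \<kappa> v" by (rule homs[THEN alg_homD(3)]; simp)+

lemma homs_inv:
 "e1 F' *3 e1 F = \<one>\<^sub>3" "e2 F' *3 e2 F = \<one>\<^sub>3"
 "j0 F' *3 j0 F = \<one>\<^sub>3" "j3 F' *3 j3 F = \<one>\<^sub>3"
 "e1 F *3 e1 F' = \<one>\<^sub>3" "e2 F *3 e2 F' = \<one>\<^sub>3"
 "j0 F *3 j0 F' = \<one>\<^sub>3" "j3 F *3 j3 F' = \<one>\<^sub>3"
 by (simp_all add: alg_homD(3)[OF e1_hom, symmetric] alg_homD(2)[OF e1_hom]
  alg_homD(3)[OF e2_hom, symmetric] alg_homD(2)[OF e2_hom]
  alg_homD(3)[OF j0_hom, symmetric] alg_homD(2)[OF j0_hom]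
  alg_homD(3)[OF j3_hom, symmetric] alg_homD(2)[OF j3_hom] del: homs_mult)

lemma H3_cancel:
 assumes "x *3 y = \<one>\<^sub>3" "x |: H3" "y |: H3" "z |: H3"
 shows "x *3 (y *3 z) = z" using assms by (simp add: H3.m_assoc[symmetric])

lemmas homs_cancel = homs_inv[THEN H3_cancel]

definition "phi_F = j0 F *3 e2 F *3 \<phi> *3 e1 F' *3 j3 F'"
definition "psi_F = j3 F *3 e1 F *3 \<psi> *3 e2 F' *3 j0 F'"

lemma phi_psi_F [simp]: "phi_F |: H3" "psi_F |: H3"
 "phi_F *3 psi_F = \<one>\<^sub>3" "psi_F *3 phi_F = \<one>\<^sub>3"
proof -
 show "phi_F |: H3" "psi_F |: H3" by (simp_all add: phi_F_def psi_F_def)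
 show "phi_F *3 psi_F = \<one>\<^sub>3"
  by (simp add: phi_F_def psi_F_def H3.m_assoc homs_cancel homs_inv H3_cancel[OF phi_inv_eq(1)])
 show "psi_F *3 phi_F = \<one>\<^sub>3"
  by (simp add: phi_F_def psi_F_def H3.m_assoc homs_cancel homs_inv H3_cancel[OF phi_inv_eq(2)])
qed

lemma phi_HF: "phi HF = phi_F" by (simp add: phi_F_def)
lemma phi_F_unit: "phi_F \<in> Units H3" unfolding Units_def using phi_psi_F by blast
lemma psi_HF: "phi_inv k HF = psi_F"
 unfolding phi_inv_def phi_HF by (simp add: H3.inv_unique' del: HF_simps) (metis H3.inv_unique' phi_psi_F)

lemma twisted_maps:
 assumes "t |: H2"
 shows "comult_id k HF t = j3 F *3 e1 t *3 j3 F'"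
  and "id_comult k HF t = j0 F *3 e2 t *3 j0 F'"
proof -
 let ?D = "%h. F *2 \<Delta> h *2 F'"
 have D: "lmap k H H2 ?D" by (simp add: lin)
 have i: "lmap k H H id" by (rule alg_homD(1)[OF algebra_hom_id])
 note a3 = alg_homD(3)[OF tassoc_algebra_hom[OF H_alg H_alg H_alg], symmetric]
 show "comult_id k HF t = j3 F *3 e1 t *3 j3 F'" by (rule H2_eq[OF _ _ _ _ assms, of H3])
   (simp_all add: comult_id_def lin tmap_pure_id[OF D] tmap_comp_lin[OF D i] a3 tmult_pure
    tmap_pure_id[OF alg_homD(1)[OF comult_hom]] tmap_comp_lin[OF alg_homD(1)[OF comult_hom] i])
 show "id_comult k HF t = j0 F *3 e2 t *3 j0 F'" by (rule H2_eq[OF _ _ _ _ assms, of H3])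
   (simp_all add: id_comult_def lin tmap_id_pure[OF D] tmap_comp_lin[OF i D] tmult_pure
    tmap_id_pure[OF alg_homD(1)[OF comult_hom]] tmap_comp_lin[OF i alg_homD(1)[OF comult_hom]])
qed

lemma twisted_maps3:
 assumes "t |: H3"
 shows "tassoc k H H H2 (tmap k H2 H2 (comult HF) id t) = j33 F *4 d1 t *4 j33 F'"
  and "tmap k H H3 id (comult_id k HF) t = i0 (j3 F) *4 d2 t *4 i0 (j3 F')"
  and "tmap k H H3 id (id_comult k HF) t = i0 (j0 F) *4 d3 t *4 i0 (j0 F')"
proof -
 let ?D = "%h. F *2 \<Delta> h *2 F'"
 let ?D1 = "%t. j3 F *3 e1 t *3 j3 F'"
 let ?D2 = "%t. j0 F *3 e2 t *3 j0 F'"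
 have D: "lmap k H H2 ?D" "lmap k H2 H3 ?D1" "lmap k H2 H3 ?D2" by (simp_all add: lin)
 have i: "lmap k H H id" "lmap k H2 H2 id" by (rule alg_homD(1)[OF algebra_hom_id])+
 note a3 = alg_homD(3)[OF tassoc_algebra_hom[OF H_alg H_alg alg234(1)], symmetric]
 show "tassoc k H H H2 (tmap k H2 H2 (comult HF) id t) = j33 F *4 d1 t *4 j33 F'"
  by (rule tensor_eq[OF H_mod mod234(1) _ _ mod234(3) _ assms])
   (simp_all add: lin tmap_pure_id[OF D(1)] tmap_comp_lin[OF D(1) i(2)] a3 tmult_pure)
 have "tmap k H H3 id (comult_id k HF) t = tmap k H H3 id ?D1 t"
  by (rule tmap_cong[OF _ _ H_mod mod234(1) assms]) (simp_all add: twisted_maps)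
 also have "... = i0 (j3 F) *4 d2 t *4 i0 (j3 F')" by (rule tensor_eq[OF H_mod mod234(1) _ _ mod234(3) _ assms])
   (simp_all add: lin tmap_id_pure[OF D(2)] tmap_comp_lin[OF i(1) D(2)] tmult_pure)
 finally show "tmap k H H3 id (comult_id k HF) t = i0 (j3 F) *4 d2 t *4 i0 (j3 F')" .
 have "tmap k H H3 id (id_comult k HF) t = tmap k H H3 id ?D2 t"
  by (rule tmap_cong[OF _ _ H_mod mod234(1) assms]) (simp_all add: twisted_maps)
 also have "... = i0 (j0 F) *4 d3 t *4 i0 (j0 F')" by (rule tensor_eq[OF H_mod mod234(1) _ _ mod234(3) _ assms])
   (simp_all add: lin tmap_id_pure[OF D(3)] tmap_comp_lin[OF i(1) D(3)] tmult_pure)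
 finally show "tmap k H H3 id (id_comult k HF) t = i0 (j0 F) *4 d3 t *4 i0 (j0 F')" .
qed

lemma twisted_coassoc:
 assumes h: "h |: H"
 shows "id_comult k HF (comult HF h) *3 phi_F = phi_F *3 comult_id k HF (comult HF h)"
proof -
 have c: "e2 (\<Delta> h) *3 (\<phi> *3 z) = \<phi> *3 (e1 (\<Delta> h) *3 z)" if "z |: H3" for z
  using that h coassoc[OF h] by (simp add: H3.m_assoc[symmetric])
 show ?thesis using h by (simp add: twisted_maps phi_F_def H3.m_assoc homs_cancel c)
qed

lemma homs_inv4:
 "i0 (j0 F') *4 i0 (j0 F) = \<one>\<^sub>4" "i0 (e1 F') *4 i0 (e1 F) = \<one>\<^sub>4"
 "j33 F' *4 j33 F = \<one>\<^sub>4" "i0 (j3 F') *4 i0 (j3 F) = \<one>\<^sub>4"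
 "i4 (e2 F') *4 i4 (e2 F) = \<one>\<^sub>4" "d1 (e2 F') *4 d1 (e2 F) = \<one>\<^sub>4"
 by (simp_all add: alg_homD(3)[OF i0_hom, symmetric] alg_homD(2)[OF i0_hom] homs_inv
   alg_homD(3)[OF i4_hom, symmetric] alg_homD(2)[OF i4_hom]
   alg_homD(3)[OF d1_hom, symmetric] alg_homD(2)[OF d1_hom]
   alg_homD(3)[OF j33_hom, symmetric] alg_homD(2)[OF j33_hom] del: homs_mult)

lemma twisted_pentagon:
 "tmap k H H3 id (id_comult k HF) phi_F *4 tassoc k H H H2 (tmap k H2 H2 (comult HF) id phi_F)
  = i0 phi_F *4 tmap k H H3 id (comult_id k HF) phi_F *4 i4 phi_F"
proof -
 have 3: "d3 phi_F = i0 (e2 F) *4 d3 (e2 F) *4 d3 \<phi> *4 d1 (e2 F') *4 j33 F'"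
  by (simp add: phi_F_def nat_a nat_j33 nat_b del: d3_pure)
 have 1: "d1 phi_F = i0 (j0 F) *4 d1 (e2 F) *4 d1 \<phi> *4 d1 (e1 F') *4 i4 (e1 F')"
  by (simp add: phi_F_def nat_a nat_b del: d1_pure d2_pure)
 have 2: "d2 phi_F = i0 (e1 F) *4 d2 (e2 F) *4 d2 \<phi> *4 d2 (e1 F') *4 i4 (e2 F')"
  by (simp add: phi_F_def nat_a nat_b del: d1_pure d2_pure)
 have 0: "i0 phi_F = i0 (j0 F) *4 i0 (e2 F) *4 i0 \<phi> *4 i0 (e1 F') *4 i0 (j3 F')" by (simp add: phi_F_def)
 have 4: "i4 phi_F = i0 (j3 F) *4 i4 (e2 F) *4 i4 \<phi> *4 i4 (e1 F') *4 j33 F'"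
  by (simp add: phi_F_def nat_j33(2) nat_j33(3)[symmetric])
 show ?thesis unfolding twisted_maps3[OF phi_psi_F(1)] 0 1 2 3 4 by (rule H4.pentagon_twist_calculation)
   (simp_all add: homs_inv4 nat_comm pentagon nat_phi1 nat_phi3)
qed

text \<open>
 The antipode axioms for \<open>H\<^sub>F\<close>: all occurrences of \<open>F\<close> cancel inside the functionals, up to
 counits of legs of \<open>F\<close>.
\<close>

lemma twisted_antipode:
 assumes h: "h |: H"
 shows "\<A> (\<A> (qalpha H) F') (F *2 \<Delta> h *2 F') = counit H h \<odot>[H] \<A> (qalpha H) F'"
  "\<B> (\<B> (qbeta H) F) (F *2 \<Delta> h *2 F') = counit H h \<odot>[H] \<B> (qbeta H) F"
proof -
 have "F' *2 (F *2 \<Delta> h *2 F') = \<Delta> h *2 F'"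
  "(F *2 \<Delta> h *2 F') *2 F = F *2 \<Delta> h" using h by (simp_all add: H2.m_assoc) (simp add: H2.m_assoc[symmetric])
 then have "\<A> (\<A> (qalpha H) F') (F *2 \<Delta> h *2 F') = \<A> (\<A> (qalpha H) (\<Delta> h)) F'"
  "\<B> (\<B> (qbeta H) F) (F *2 \<Delta> h *2 F') = \<B> (\<B> (qbeta H) (\<Delta> h)) F"
  using h by (simp_all add: A_mult[symmetric] B_mult[symmetric])
 then show "\<A> (\<A> (qalpha H) F') (F *2 \<Delta> h *2 F') = counit H h \<odot>[H] \<A> (qalpha H) F'"
  "\<B> (\<B> (qbeta H) F) (F *2 \<Delta> h *2 F') = counit H h \<odot>[H] \<B> (qbeta H) F"
  using h linear_smult[OF AB_lin'(1)[OF F_closed(2) linear_id], of "counit H h" "qalpha H"]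
   linear_smult[OF AB_lin'(2)[OF F_closed(1) linear_id], of "counit H h" "qbeta H"] by (simp_all add: antipode)
qed

end

context quasi_hopf_alg begin

abbreviation "\<P> c d == tlift3 H (%x y z. x *1 c *1 S y *1 d *1 z)"
abbreviation "\<Q> c d == tlift3 H (%x y z. S x *1 c *1 y *1 d *1 S z)"

lemma PQ_EZ: assumes c: "c |: H" and d: "d |: H" and t: "t |: H3"
 shows "\<P> c d t = \<E> H (%x y. x *1 c *1 y) d t"
  "\<Q> c d t = \<Z> H (%x y. S x *1 c *1 y) d t"
proof -
 have b: "blmap k H H H (%x y. x *1 c *1 y)" "blmap k H H H (%x y. S x *1 c *1 y)" by (rule bilI; simp add: lin c)+
 have tr: "trilinear k H H H H (%x y z. x *1 c *1 S y *1 d *1 z)"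
  "trilinear k H H H H (%x y z. S x *1 c *1 y *1 d *1 S z)" by (rule trilinearI; simp add: lin c d)+
 show "\<P> c d t = \<E> H (%x y. x *1 c *1 y) d t" by (rule H3_eq[where M = H, OF _ _ _ _ t])
   (simp_all add: tlift3_lin EZ_tri[OF H_mod b(1)] EZ_pure[OF H_mod b(1)] tlift_H3_pure tr c d H.m_assoc)
 show "\<Q> c d t = \<Z> H (%x y. S x *1 c *1 y) d t" by (rule H3_eq[where M = H, OF _ _ _ _ t])
   (simp_all add: tlift3_lin EZ_tri[OF H_mod b(2)] EZ_pure[OF H_mod b(2)] tlift_H3_pure tr c d H.m_assoc)
qed

lemma PQ_tri:
 "c |: H ==> d |: H ==> trilinear k H H H H (%x y z. x *1 c *1 S y *1 d *1 z)"
 "c |: H ==> d |: H ==> trilinear k H H H H (%x y z. S x *1 c *1 y *1 d *1 S z)" by (rule trilinearI; simp add: lin)+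

lemma PQ_facts [simp]:
 "c |: H ==> d |: H ==> x |: H ==> y |: H ==> z |: H ==>
  \<P> c d (pH2 x (pH y z)) = x *1 c *1 S y *1 d *1 z"
 "c |: H ==> d |: H ==> x |: H ==> y |: H ==> z |: H ==>
  \<Q> c d (pH2 x (pH y z)) = S x *1 c *1 y *1 d *1 S z"
 "c |: H ==> d |: H ==> t |: H3 ==> \<P> c d t |: H"
 "c |: H ==> d |: H ==> t |: H3 ==> \<Q> c d t |: H" by (simp_all add: tlift_H3_pure tlift_H3_closed PQ_tri)

lemma PQ_lin [lin]:
 "c |: H ==> d |: H ==> lmap k H3 H (\<P> c d)"
 "c |: H ==> d |: H ==> lmap k H3 H (\<Q> c d)"
 "c |: H ==> d |: H ==> lmap k Z H3 f ==> lmap k Z H (%z. \<P> c d (f z))"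
 "c |: H ==> d |: H ==> lmap k Z H3 f ==> lmap k Z H (%z. \<Q> c d (f z))" by (simp_all add: tlift_H3 PQ_tri tlift3_lin)

lemma PQ_lin_c [lin]:
 assumes "d |: H" "t |: H3" "lmap k Z H f" "module k Z"
 shows "lmap k Z H (%z. \<P> (f z) d t)" "lmap k Z H (%z. \<Q> (f z) d t)"
proof -
 have 1: "lmap k Z H (%z. tlift H (g z) s)"
  if "s |: H2" "!!z. z |: Z ==> blmap k H H H (g z)"
   "!!x y. x |: H ==> y |: H ==> lmap k Z H (%z. g z x y)" for g s by (rule tlift_param[OF that(1)]) (simp_all add: that assms)
 note f = lin_cl[OF assms(3)]
 note t = trilinear_inner[OF PQ_tri(1)] trilinear_inner[OF PQ_tri(2)]
 show "lmap k Z H (%z. \<P> (f z) d t)" unfolding tlift3_def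
 proof (rule tlift_param[OF assms(2)])
  fix v w assume vw: "v |: H" "w |: H2"
  show "lmap k Z H (%z. tlift H (%b c. v *1 f z *1 S b *1 d *1 c) w)"
   by (rule 1) (use vw trilinearD(2)[OF PQ_tri(1)] in "simp_all add: assms lin f")
 qed (simp_all add: assms t f)
 show "lmap k Z H (%z. \<Q> (f z) d t)" unfolding tlift3_def
 proof (rule tlift_param[OF assms(2)])
  fix v w assume vw: "v |: H" "w |: H2"
  show "lmap k Z H (%z. tlift H (%b c. S v *1 f z *1 b *1 d *1 S c) w)"
   by (rule 1) (use vw trilinearD(2)[OF PQ_tri(2)] in "simp_all add: assms lin f")
 qed (simp_all add: assms t f)
qed

lemma P_j3:
 assumes c: "c |: H" and d: "d |: H" and s: "s |: H2" and u: "u |: H" and t: "t |: H3"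
 shows "\<P> c d (t *3 tassoc k H H H (pure k H2 H s u)) = \<P> (\<B> c s) d t *1 u"
proof (rule H2_eq[OF _ _ _ _ s, of H])
 fix a b assume ab: "a |: H" "b |: H"
 show "\<P> c d (t *3 tassoc k H H H (pure k H2 H (pH a b) u)) = \<P> (\<B> c (pH a b)) d t *1 u"
  by (rule H3_eq[where M = H, OF _ _ _ _ t])
   (simp_all add: lin c d u ab tmult_pure anti(4) H.m_assoc)
qed (simp_all add: lin c d u t)

lemma Q_j3:
 assumes c: "c |: H" and d: "d |: H" and s: "s |: H2" and u: "u |: H" and t: "t |: H3"
 shows "\<Q> c d (tassoc k H H H (pure k H2 H s u) *3 t) = \<Q> (\<A> c s) d t *1 S u"
proof (rule H2_eq[OF _ _ _ _ s, of H])
 fix a b assume ab: "a |: H" "b |: H"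
 show "\<Q> c d (tassoc k H H H (pure k H2 H (pH a b) u) *3 t) = \<Q> (\<A> c (pH a b)) d t *1 S u"
  by (rule H3_eq[where M = H, OF _ _ _ _ t])
   (simp_all add: lin c d u ab tmult_pure anti(4) H.m_assoc)
qed (simp_all add: lin c d u t)

lemma PQ_e1:
 assumes t: "t |: H3" and u: "u |: H2"
 shows "\<P> (qbeta H) (qalpha H) (t *3 e1 u) = \<P> (qbeta H) (qalpha H) t *1 counit_l H u"
  "\<Q> (qalpha H) (qbeta H) (e1 u *3 t) = \<Q> (qalpha H) (qbeta H) t *1 S (counit_l H u)"
proof -
 have r: "\<P> (r \<odot>[H] qbeta H) (qalpha H) t = r \<odot>[H] \<P> (qbeta H) (qalpha H) t"
  "\<Q> (r \<odot>[H] qalpha H) (qbeta H) t = r \<odot>[H] \<Q> (qalpha H) (qbeta H) t" if "r |: k" for r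
  by (rule linear_smult[OF PQ_lin_c(1)[OF _ t linear_id]]; simp add: that)
   (rule linear_smult[OF PQ_lin_c(2)[OF _ t linear_id]]; simp add: that)
 have m: "(r \<odot>[H] x) *1 y = x *1 (r \<odot>[H] y)" "S (r \<odot>[H] x) = r \<odot>[H] S x"
  if "r |: k" "x |: H" "y |: H" for r x y using that H_alg linear_smult[OF anti(1)] by (auto simp: k_algebra_def)
 show "\<P> (qbeta H) (qalpha H) (t *3 e1 u) = \<P> (qbeta H) (qalpha H) t *1 counit_l H u"
  by (rule H2_eq[OF _ _ _ _ u, of H]) (simp_all add: lin t P_j3 antipode r m)
 show "\<Q> (qalpha H) (qbeta H) (e1 u *3 t) = \<Q> (qalpha H) (qbeta H) t *1 S (counit_l H u)"
  by (rule H2_eq[OF _ _ _ _ u, of H]) (simp_all add: lin t Q_j3 antipode r m)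
qed

text \<open>In the second and third leg, \<open>\<Delta>\<close> is absorbed by the antipode.\<close>

lemma EZ_e2:
 assumes M: "module k M" and g: "blmap k H H M g" and t: "t |: H3" and u: "u |: H2"
 shows "\<E> M g (qalpha H) (e2 u *3 t) = \<E> M (%x. g (counit_r u *1 x)) (qalpha H) t"
  "\<Z> M g (qbeta H) (t *3 e2 u) = \<Z> M (%x. g (x *1 counit_r u)) (qbeta H) t"
proof -
 have A: "\<A> (r \<odot>[H] c) s = r \<odot>[H] \<A> c s" "\<B> (r \<odot>[H] c) s = r \<odot>[H] \<B> c s"
  if "s |: H2" "r |: k" "c |: H" for s r c using linear_smult[OF AB_lin'(1)[OF that(1) linear_id] that(2,3)]
   linear_smult[OF AB_lin'(2)[OF that(1) linear_id] that(2,3)] .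
 note gl = bil1[OF g] bil2[OF g] bil_cl[OF g]
 have gb: "blmap k H H M (%x. g (c *1 x))" "blmap k H H M (%x. g (x *1 c))" if "c |: H" for c
  by (rule bilI; simp add: lin gl that bil_r[OF g])+
 note L = EZ_lin[OF M g] EZ_lin0[OF M g] EZ_lin[OF M gb(1)] EZ_lin0[OF M gb(1)] EZ_lin[OF M gb(2)] EZ_lin0[OF M gb(2)]
 note P = EZ_pure2[OF M g] EZ_pure2[OF M gb(1)] EZ_pure2[OF M gb(2)]
 have m: "(r \<odot>[H] x) *1 y = r \<odot>[H] (x *1 y)" "x *1 (r \<odot>[H] y) = r \<odot>[H] (x *1 y)"
  if "r |: k" "x |: H" "y |: H" for r x y using that H_alg by (auto simp: k_algebra_def)
 have gs: "g (r \<odot>[H] x) y = r \<odot>[M] g x y" "g x (r \<odot>[H] y) = r \<odot>[M] g x y"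
  if "r |: k" "x |: H" "y |: H" for r x y using that linear_smult[OF bil_l[OF g]] linear_smult[OF bil_r[OF g]] by auto
 show "\<E> M g (qalpha H) (e2 u *3 t) = \<E> M (%x. g (counit_r u *1 x)) (qalpha H) t"
 proof (rule tensor_eq[OF H_mod mod234(1) _ _ M _ t])
  fix a s assume as: "a |: H" "s |: H2"
  show "\<E> M g (qalpha H) (e2 u *3 pH2 a s) = \<E> M (%x. g (counit_r u *1 x)) (qalpha H) (pH2 a s)"
   unfolding P(3)[OF alg_homD(4)[OF counit_r_hom u] ab(1) as] by (rule H2_eq[OF _ _ _ _ u, of M])
    (simp_all add: lin L M as gl P tmult_pure A_mult antipode A m gs)
 qed (simp_all add: lin L M u)
 show "\<Z> M g (qbeta H) (t *3 e2 u) = \<Z> M (%x. g (x *1 counit_r u)) (qbeta H) t"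
 proof (rule tensor_eq[OF H_mod mod234(1) _ _ M _ t])
  fix a s assume as: "a |: H" "s |: H2"
  show "\<Z> M g (qbeta H) (pH2 a s *3 e2 u) = \<Z> M (%x. g (x *1 counit_r u)) (qbeta H) (pH2 a s)"
   unfolding P(6)[OF alg_homD(4)[OF counit_r_hom u] ab(2) as] by (rule H2_eq[OF _ _ _ _ u, of M])
    (simp_all add: lin L M as gl P tmult_pure B_mult antipode A m gs)
 qed (simp_all add: lin L M u)
qed

end

context twist_alg begin

theorem twist_quasi_hopf: "quasi_hopf_algebra k HF"
proof -
 let ?al = "qalpha H" and ?be = "qbeta H" and ?al' = "\<A> (qalpha H) F'" and ?be' = "\<B> (qbeta H) F"
 note b = bilI
 have bil: "blmap k H H H (%x y. x *1 c *1 y)" "blmap k H H H (%x y. S x *1 c *1 y)"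
  if "c |: H" for c by (rule bilI; simp add: lin that)+
 have j0: "\<P> c (\<A> d x) t = \<P> c d (j0 x *3 t)" "\<Q> c (\<B> d x) t = \<Q> c d (t *3 j0 x)"
  if "c |: H" "d |: H" "x |: H2" "t |: H3" for c d x t
  using that by (simp_all add: PQ_EZ E_j0[OF H_mod bil(1)] Z_j0[OF H_mod bil(2)])
 have e2: "\<P> ?be ?al (e2 F *3 t) = \<P> ?be ?al t" "\<Q> ?al ?be (t *3 e2 F') = \<Q> ?al ?be t"
  if t: "t |: H3" for t
 proof -
  have "\<E> H (%x. (*1) (\<one>\<^sub>1 *1 x *1 ?be)) ?al t = \<E> H (%x y. x *1 ?be *1 y) ?al t"
   "\<Z> H (%x. (*1) (S (x *1 \<one>\<^sub>1) *1 ?al)) ?be t = \<Z> H (%x y. S x *1 ?al *1 y) ?be t"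
   unfolding tlift3_def by (rule tlift_cong[OF H_mod mod234(1) t], rule tlift_cong[OF H_mod H_mod]; simp)+
  then show "\<P> ?be ?al (e2 F *3 t) = \<P> ?be ?al t" "\<Q> ?al ?be (t *3 e2 F') = \<Q> ?al ?be t"
   using EZ_e2(1)[OF H_mod bil(1)[OF ab(2)] t F_closed(1)] EZ_e2(2)[OF H_mod bil(2)[OF ab(1)] t F_closed(2)]
   by (simp_all add: PQ_EZ t F_counit F'_counit)
 qed
 have "\<P> ?be' ?al' phi_F = \<P> ?be ?al ((j0 F' *3 phi_F) *3 j3 F)" by (simp add: j0 P_j3)
 also have "(j0 F' *3 phi_F) *3 j3 F = e2 F *3 (\<phi> *3 e1 F')" by (simp add: phi_F_def H3.m_assoc homs_cancel homs_inv)
 also have "\<P> ?be ?al ... = \<one>\<^sub>1" by (simp add: e2 PQ_e1 F'_counit antipode)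
 finally have P: "\<P> ?be' ?al' phi_F = \<one>\<^sub>1" .
 have "\<Q> ?al' ?be' psi_F = \<Q> ?al ?be (j3 F' *3 (psi_F *3 j0 F))" by (simp add: j0 Q_j3 anti(3))
 also have "j3 F' *3 (psi_F *3 j0 F) = (e1 F *3 \<psi>) *3 e2 F'" by (simp add: psi_F_def H3.m_assoc homs_cancel homs_inv)
 also have "\<Q> ?al ?be ... = \<one>\<^sub>1" by (simp add: e2 PQ_e1 F_counit antipode anti(3))
 finally have Q: "\<Q> ?al' ?be' psi_F = \<one>\<^sub>1" .
 have k2: "\<kappa> (j0 t) = pH \<one>\<^sub>1 (counit_l H t)" "\<kappa> (j3 t) = pH (counit_r t) \<one>\<^sub>1"
  "\<kappa> (e1 t) = t" "\<kappa> (e2 t) = t" if "t |: H2" for t using that kappa_maps by auto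
 have kap: "\<kappa> phi_F = \<one>\<^sub>2"
  by (simp add: phi_F_def k2 kappa_phi F_counit F'_counit tensor_one[symmetric] del: kappa_pure)
 note hom = alg_homD[OF comult_hom]
 have D: "algebra_hom k HF H2 (comult HF)"
 proof (rule algebra_homI)
  fix x y assume "x |: HF" "y |: HF"
  then show "comult HF (x \<otimes>[HF] y) = comult HF x *2 comult HF y"
   by (simp add: hom H2.m_assoc) (simp add: H2.m_assoc[symmetric])
 qed (simp_all add: lin hom)
 have counit: "counit_l H (comult HF h) = h" "counit_r (comult HF h) = h" if "h |: H" for h
  using that by (simp_all add: alg_homD(3)[OF counit_l_hom[OF H_alg]] alg_homD(3)[OF counit_r_hom]
    F_counit F'_counit counit_comult)
 have eps: "algebra_hom k HF (ground_module k) (counit HF)" using counit_hom by (simp add: algebra_hom_def ring_hom_def)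
 have an: "algebra_anti_automorphism k HF (antip HF)" using anti by (simp add: algebra_anti_automorphism_def)
 have t3: "tens3_one k HF = i4" by (intro ext) (simp add: tens3_one_def)
 show ?thesis unfolding quasi_hopf_algebra_def quasi_bialgebra_def
  using HF_alg D eps an phi_F_unit twisted_pentagon twisted_coassoc kap P Q counit twisted_antipode
  by (simp add: phi_HF psi_HF t3 del: HF_simps(9,10)) (simp add: phi_F_def)
qed

end

section \<open>Modules over a quasi-Hopf algebra\<close>

text \<open>The product \<open>u \<otimes> v \<mapsto> m (t\<^sup>(\<^sup>1\<^sup>) \<triangleright> u) (t\<^sup>(\<^sup>2\<^sup>) \<triangleright> v)\<close>.\<close>

definition twprod ::
 "('k, 'h, 'u, 'x) hmodule_scheme => ('k, 'h, 'v, 'y) hmodule_scheme => ('m, 'z) ring_scheme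
  => ('h, 'h) tens => ('u => 'v => 'm) => 'u => 'v => 'm" where
 "twprod U V X t m u v = tlift X (%a b. m (act U a u) (act V b v)) t"

definition equivar where
 "equivar k H U V X m \<longleftrightarrow> blmap k U V X m \<and>
  (\<forall>h\<in>carrier H. \<forall>u\<in>carrier U. \<forall>v\<in>carrier V. act X h (m u v) = twprod U V X (comult H h) m u v)"

definition alaw where
 "alaw H U V W X m1 m2 m3 m4 \<longleftrightarrow>
  (\<forall>u\<in>carrier U. \<forall>v\<in>carrier V. \<forall>w\<in>carrier W. m2 (m1 u v) w =
   nested_r U V W X m3 m4 (phi H) u v w)"

definition "act3 k U V W = tensor_act k U (tensor k V W) (act U) (act2 k V W)"
definition "act4 k U V W X = tensor_act k U (tensor k V (tensor k W X)) (act U) (act3 k V W X)"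
definition "tlift4 M f t = tlift M (%u s. tlift3 M (f u) s) t"

lemma h_tensor_simps [simp]:
 "carrier (h_tensor k H V W) = carrier (tensor k V W)" "add (h_tensor k H V W) = add (tensor k V W)"
 "zero (h_tensor k H V W) = zero (tensor k V W)" "smult (h_tensor k H V W) = smult (tensor k V W)"
 "mult (h_tensor k H V W) = mult (tensor k V W)" "one (h_tensor k H V W) = one (tensor k V W)"
 "act (h_tensor k H V W) h = act2 k V W (comult H h)" by (simp_all add: h_tensor_def module.extend_def hmodule.fields_def)

lemma quadlinearD:
 assumes "quadlinear k U V W X M f"
 shows "v |: V ==> w |: W ==> x |: X ==> lmap k U M (%u. f u v w x)"
  "u |: U ==> trilinear k V W X M (f u)" using assms unfolding quadlinear_def by auto

lemma quadlinear_inner: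
 assumes q: "quadlinear k U V W X M f" and m: "module k U" "module k V" "module k W" "module k X" "module k M"
 shows "blmap k U (tensor k V (tensor k W X)) M (%u. tlift3 M (f u))"
proof (rule bilI)
 fix t assume t: "t |: (tensor k V (tensor k W X))"
 show "lmap k U M (%u. tlift3 M (f u) t)" unfolding tlift3_def
 proof (rule tlift_param[OF t])
  fix v s assume vs: "v |: V" "s |: tensor k W X"
  show "lmap k U M (%u. tlift M (f u v) s)" by (rule tlift_param[OF vs(2)])
    (use quadlinearD[OF q] trilinearD(2)[OF quadlinearD(2)[OF q]] vs m in auto)
 qed (use trilinear_inner[OF quadlinearD(2)[OF q]] m in "auto simp: lin")
qed (auto intro!: tlift3_lin quadlinearD[OF q] m)

lemma tlift4_lin:
 assumes "quadlinear k U V W X M f" "module k U" "module k V" "module k W" "module k X" "module k M"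
 shows "lmap k (tensor k U (tensor k V (tensor k W X))) M (tlift4 M f)"
 unfolding tlift4_def using assms by (intro tlift_lin quadlinear_inner) (auto simp: lin)

lemma tlift4_pure:
 assumes "quadlinear k U V W X M f" "module k U" "module k V" "module k W" "module k X" "module k M"
  "u |: U" "v |: V" "w |: W" "x |: X"
 shows "tlift4 M f (pure k U (tensor k V (tensor k W X)) u (pure3 k V W X v w x)) = f u v w x" unfolding tlift4_def
 by (subst tlift_pure_eq[where V = U and W = "tensor k V (tensor k W X)"])
  (simp_all add: quadlinear_inner assms lin tlift3_pure[OF quadlinearD(2)[OF assms(1)]])

lemma eqvD:
 "equivar k H U V X m ==> blmap k U V X m"
 "equivar k H U V X m ==> h |: H ==> u |: U ==> v |: V ==>
  act X h (m u v) = twprod U V X (comult H h) m u v" unfolding equivar_def by auto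

lemma equivariantI:
 "blmap k U V X m ==> (!!h u v. h |: H ==> u |: U ==> v |: V ==>
  act X h (m u v) = twprod U V X (comult H h) m u v) ==> equivar k H U V X m" unfolding equivar_def by auto

context quasi_hopf_alg begin

lemma hm_alg: "hmod k H V ==> alg_module k H V (act V)" unfolding h_module_def alg_module_def by simp

lemma hm_mod [simp]: "hmod k H V ==> module k V" unfolding h_module_def by simp

lemma hm_bil: "hmod k H V ==> blmap k H V V (act V)" unfolding h_module_def by simp

lemma hm_one [simp]: "hmod k H V ==> v |: V ==> act V \<one>\<^sub>1 v = v" unfolding h_module_def by simp

lemma hm_mult: "hmod k H V ==> a |: H ==> b |: H ==> v |: V
  ==> act V (a *1 b) v = act V a (act V b v)" unfolding h_module_def by simp

lemma hm_closed [simp]: "hmod k H V ==> a |: H ==> v |: V ==> act V a v |: V" by (rule bil_cl[OF hm_bil])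

lemma hm_lin [lin]:
 "lmap k Z H f ==> v |: V ==> hmod k H V ==> lmap k Z V (%z. act V (f z) v)"
 "lmap k Z V g ==> a |: H ==> hmod k H V ==> lmap k Z V (%z. act V a (g z))"
 "a |: H ==> hmod k H V ==> lmap k V V (act V a)" by (rule bil1[OF hm_bil] bil2[OF hm_bil] bil_r[OF hm_bil]; assumption)+

lemma act2_mod: "hmod k H V ==> hmod k H W ==> alg_module k H2 (tensor k V W) (act2 k V W)"
 unfolding act2_tensor_act by (rule tensor_act_module[OF hm_alg hm_alg])
lemma act2_pure [simp]:
 "hmod k H V ==> hmod k H W ==> a |: H ==> b |: H ==> v |: V ==> w |: W ==>
  act2 k V W (pH a b) (pure k V W v w) = pure k V W (act V a v) (act W b w)"
 unfolding act2_tensor_act by (rule tensor_act_pure[OF hm_alg hm_alg])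
lemma act3_mod: "hmod k H U ==> hmod k H V ==> hmod k H W ==>
  alg_module k H3 (tensor k U (tensor k V W)) (act3 k U V W)" unfolding act3_def by (rule tensor_act_module[OF hm_alg act2_mod])
lemma act3_pure [simp]:
 "hmod k H U ==> hmod k H V ==> hmod k H W ==> a |: H ==> s |: H2
  ==> u |: U ==> t |: (tensor k V W) ==>
  act3 k U V W (pH2 a s) (pure k U (tensor k V W) u t) = pure k U (tensor k V W) (act U a u) (act2 k V W s t)"
 unfolding act3_def by (rule tensor_act_pure[OF hm_alg act2_mod])
lemma act4_mod: "hmod k H U ==> hmod k H V ==> hmod k H W ==> hmod k H X ==>
  alg_module k H4 (tensor k U (tensor k V (tensor k W X))) (act4 k U V W X)"
 unfolding act4_def by (rule tensor_act_module[OF hm_alg act3_mod])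
lemma act4_pure [simp]:
 "hmod k H U ==> hmod k H V ==> hmod k H W ==> hmod k H X ==> a |: H ==> s |: H3
  ==> u |: U ==> t |: (tensor k V (tensor k W X)) ==>
  act4 k U V W X (pH3 a s) (pure k U (tensor k V (tensor k W X)) u t)
   = pure k U (tensor k V (tensor k W X)) (act U a u) (act3 k V W X s t)"
 unfolding act4_def by (rule tensor_act_pure[OF hm_alg act3_mod])

lemma alg_moduleD:
 assumes "alg_module k B V \<rho>"
 shows "lmap k Z B f ==> v |: V ==> lmap k Z V (%z. \<rho> (f z) v)"
  "lmap k Z V g ==> a |: B ==> lmap k Z V (%z. \<rho> a (g z))"
  "a |: B ==> lmap k V V (\<rho> a)"
  "a |: B ==> v |: V ==> \<rho> a v |: V"
  "a |: B ==> b |: B ==> v |: V ==> \<rho> (a \<otimes>[B] b) v = \<rho> a (\<rho> b v)"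
  "v |: V ==> \<rho> \<one>[B] v = v"
proof -
 have b: "blmap k B V V \<rho>" using assms unfolding alg_module_def by simp
 show "lmap k Z B f ==> v |: V ==> lmap k Z V (%z. \<rho> (f z) v)"
  "lmap k Z V g ==> a |: B ==> lmap k Z V (%z. \<rho> a (g z))"
  "a |: B ==> lmap k V V (\<rho> a)" "a |: B ==> v |: V ==> \<rho> a v |: V"
  by (rule bil1[OF b] bil2[OF b] bil_r[OF b] bil_cl[OF b]; assumption)+
qed (use assms in "auto simp: alg_module_def")

lemmas act234_lin [lin] = alg_moduleD(1-3)[OF act2_mod] alg_moduleD(1-3)[OF act3_mod] alg_moduleD(1-3)[OF act4_mod]
lemmas act234_closed [simp] = alg_moduleD(4)[OF act2_mod] alg_moduleD(4)[OF act3_mod] alg_moduleD(4)[OF act4_mod]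
lemmas act234_mult = alg_moduleD(5)[OF act2_mod] alg_moduleD(5)[OF act3_mod] alg_moduleD(5)[OF act4_mod]

lemma pure_hm [simp]:
 "hmod k H V ==> hmod k H W ==> v |: V ==> w |: W ==> pure k V W v w |: tensor k V W"
 "hmod k H V ==> hmod k H W ==> module k (tensor k V W)"
 "hmod k H U ==> hmod k H V ==> hmod k H W ==> u |: U ==> t |: (tensor k V W) ==>
  pure k U (tensor k V W) u t |: (tensor k U (tensor k V W))"
 "hmod k H U ==> hmod k H V ==> hmod k H W ==> module k (tensor k U (tensor k V W))"
 "hmod k H U ==> hmod k H V ==> hmod k H W ==> hmod k H X ==> u |: U
  ==> t' |: (tensor k V (tensor k W X)) ==>
  pure k U (tensor k V (tensor k W X)) u t' |: (tensor k U (tensor k V (tensor k W X)))" by (simp_all add: lin)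

subsection \<open>Twisting one product\<close>

lemma twprod_bil:
 assumes m: "blmap k U V X m" and "hmod k H U" "hmod k H V" "u |: U" "v |: V"
 shows "blmap k H H X (%a b. m (act U a u) (act V b v))" by (rule bilI) (simp_all add: lin bil1[OF m] bil2[OF m] assms)

lemma twprod_eq:
 assumes m: "blmap k U V X m" and [simp]: "hmod k H U" "hmod k H V" "module k X"
  "u |: U" "v |: V" and t: "t |: H2"
 shows "twprod U V X t m u v = tlift X m (act2 k U V t (pure k U V u v))" unfolding twprod_def by (rule H2_eq[OF _ _ _ _ t, of X])
  (simp_all add: lin twprod_bil[OF m] tlift_lin tlift_H2_pure[OF twprod_bil[OF m]] tlift_pure_eq[OF _ _ m]
   tlift_arg[OF m])

lemma twprod_lin [lin]:
 assumes m: "blmap k U V X m" and [simp]: "hmod k H U" "hmod k H V" "module k X" "u |: U" "v |: V"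
 shows "lmap k Z H2 f ==> lmap k Z X (%z. twprod U V X (f z) m u v)"
 unfolding twprod_def by (rule tlift_H2[OF twprod_bil[OF m]]) simp_all

lemma twprod_bilinear:
 assumes m: "blmap k U V X m" and [simp]: "hmod k H U" "hmod k H V" "module k X" and t: "t |: H2"
 shows "blmap k U V X (twprod U V X t m)"
proof (rule bilI)
 fix u assume u [simp]: "u |: U"
 have "lmap k V X (%v. tlift X m (act2 k U V t (pure k U V u v)))" by (rule tlift_arg[OF m]) (simp_all add: lin t)
 then show "lmap k V X (twprod U V X t m u)" by (subst linear_map_cong[where g = "%v. tlift X m (act2 k U V t (pure k U V u v))"])
   (simp_all add: twprod_eq[OF m] t)
next
 fix v assume v [simp]: "v |: V"
 have "lmap k U X (%u. tlift X m (act2 k U V t (pure k U V u v)))" by (rule tlift_arg[OF m]) (simp_all add: lin t)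
 then show "lmap k U X (%u. twprod U V X t m u v)"
  by (subst linear_map_cong[where g = "%u. tlift X m (act2 k U V t (pure k U V u v))"])
   (simp_all add: twprod_eq[OF m] t)
qed

lemma twprod_pure [simp]:
 assumes m: "blmap k U V X m" and "hmod k H U" "hmod k H V" "module k X" "u |: U" "v |: V"
  "a |: H" "b |: H"
 shows "twprod U V X (pH a b) m u v = m (act U a u) (act V b v)"
 unfolding twprod_def using assms by (simp add: tlift_H2_pure[OF twprod_bil[OF m]])

lemma twprod_mult:
 assumes m: "blmap k U V X m" and [simp]: "hmod k H U" "hmod k H V" "module k X"
  "u |: U" "v |: V" and t: "t |: H2" and s: "s |: H2"
 shows "twprod U V X s (twprod U V X t m) u v = twprod U V X (t *2 s) m u v"
proof -
 have "tlift X (twprod U V X t m) z = tlift X m (act2 k U V t z)" if "z |: tensor k U V" for z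
  by (rule tensor_eq[of k U V X, OF _ _ _ _ _ _ that])
   (simp_all add: tlift_lin m lin t twprod_bilinear tlift_arg[OF m] tlift_pure_eq[OF _ _ twprod_bilinear] twprod_eq)
 then show ?thesis by (simp add: twprod_eq m t s twprod_bilinear act234_mult)
qed

lemma twprod_one:
 "blmap k U V X m ==> hmod k H U ==> hmod k H V ==> module k X ==> u |: U ==> v |: V
  ==> twprod U V X \<one>\<^sub>2 m u v = m u v" by (simp add: tensor_one)

lemma equivar_twprod:
 assumes e: "equivar k H U V X m" and [simp]: "hmod k H U" "hmod k H V" "hmod k H X"
  "u |: U" "v |: V" "h |: H" and s: "s |: H2"
 shows "act X h (twprod U V X s m u v) = twprod U V X (\<Delta> h *2 s) m u v"
proof (rule H2_eq[OF _ _ _ _ s, of X])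
 note m = eqvD(1)[OF e]
 fix a b assume "a |: H" "b |: H"
 then show "act X h (twprod U V X (pH a b) m u v) = twprod U V X (\<Delta> h *2 pH a b) m u v"
  by (simp add: m eqvD(2)[OF e] twprod_mult[symmetric] twprod_bilinear)
qed (simp_all add: lin eqvD(1)[OF e])

lemma twprod_counit_l:
 assumes m: "blmap k U V X m" and [simp]: "hmod k H U" "hmod k H V" "module k X"
  "u |: U" "v |: V" and t: "t |: H2"
  and inv: "!!h. h |: H ==> act U h u = counit H h \<odot>[U] u"
 shows "twprod U V X t m u v = m u (act V (counit_l H t) v)" by (rule H2_eq[OF _ _ _ _ t, of X])
  (simp_all add: lin m inv bil2[OF m] linear_smult[OF bil_l[OF m]] linear_smult[OF bil_r[OF m]]
    linear_smult[OF bil_l[OF hm_bil[OF assms(3)]]])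

lemma twprod_counit_r:
 assumes m: "blmap k U V X m" and [simp]: "hmod k H U" "hmod k H V" "module k X"
  "u |: U" "v |: V" and t: "t |: H2"
  and inv: "!!h. h |: H ==> act V h v = counit H h \<odot>[V] v"
 shows "twprod U V X t m u v = m (act U (counit_r t) u) v" by (rule H2_eq[OF _ _ _ _ t, of X])
  (simp_all add: lin m inv bil1[OF m] linear_smult[OF bil_l[OF m]] linear_smult[OF bil_r[OF m]]
    linear_smult[OF bil_l[OF hm_bil[OF assms(2)]]])

lemma tensor_morphism_iff:
 assumes [simp]: "hmod k H U" "hmod k H V" "hmod k H X"
 shows "tensor_morphism k H U V X m \<longleftrightarrow> equivar k H U V X m"
proof
 assume "tensor_morphism k H U V X m"
 then have m: "blmap k U V X m" and
  e: "!!h t. h |: H ==> t |: (tensor k U V) ==> tlift X m (act2 k U V (\<Delta> h) t) = act X h (tlift X m t)"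
  unfolding tensor_morphism_def h_linear_def by auto
 show "equivar k H U V X m"
 proof (rule equivariantI[OF m])
  fix h u v assume "h |: H" "u |: U" "v |: V"
  then show "act X h (m u v) = twprod U V X (\<Delta> h) m u v"
   using e[of h "pure k U V u v"] by (simp add: twprod_eq m tlift_pure_eq[OF _ _ m])
 qed
next
 assume e: "equivar k H U V X m"
 note m = eqvD(1)[OF e]
 have "tlift X m (act2 k U V (\<Delta> h) t) = act X h (tlift X m t)" if h: "h |: H" and t: "t |: tensor k U V" for h t
  by (rule tensor_eq[of k U V X, OF _ _ _ _ _ _ t])
   (simp_all add: tlift_arg[OF m] lin h tlift_lin m tlift_pure_eq[OF _ _ m] eqvD(2)[OF e] twprod_eq)
 then show "tensor_morphism k H U V X m" unfolding tensor_morphism_def h_linear_def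
  using m tlift_lin[OF _ _ m] by (auto simp: linear_map_def)
qed

subsection \<open>Twisting two nested products\<close>

lemma tri_l:
 "blmap k U V P m1 ==> blmap k P W X m2 ==> trilinear k U V W X (%u v w. m2 (m1 u v) w)"
 by (rule trilinearI) (simp_all add: bil_cl bil_l bil_r bil1[of k P W X m2] linear_id)

lemma tri_r:
 "blmap k V W Q m3 ==> blmap k U Q X m4 ==> trilinear k U V W X (%u v w. m4 u (m3 v w))"
 by (rule trilinearI) (simp_all add: bil_cl bil_l bil_r bil2[of k U Q X m4] linear_id)

lemma act_trilinear:
 assumes f: "trilinear k U V W X f" and [simp]: "hmod k H U" "hmod k H V" "hmod k H W"
  "u |: U" "v |: V" "w |: W"
 shows "trilinear k H H H X (%a b c. f (act U a u) (act V b v) (act W c w))" by (rule trilinearI)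
  (simp_all add: lin_comp[OF trilinearD(1)[OF f]] lin_comp[OF bil_l[OF trilinearD(2)[OF f]]]
   lin_comp[OF bil_r[OF trilinearD(2)[OF f]]] lin)

lemma tlift3_act:
 assumes f: "trilinear k U V W X f" and [simp]: "hmod k H U" "hmod k H V" "hmod k H W" "module k X"
  "u |: U" "v |: V" "w |: W" and t: "t |: H3"
 shows "tlift3 X (%a b c. f (act U a u) (act V b v) (act W c w)) t
  = tlift3 X f (act3 k U V W t (pure3 k U V W u v w))" by (rule H3_eq[where M = X, OF _ _ _ _ t])
  (simp_all add: tlift3_lin act_trilinear[OF f] tlift_H3_pure lin_comp[OF tlift3_lin[OF f]] lin tlift3_pure[OF f])

lemma alaw_tlift:
 assumes b: "blmap k U V P m1" "blmap k P W X m2" "blmap k V W Q m3" "blmap k U Q X m4"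
  and [simp]: "hmod k H U" "hmod k H V" "hmod k H W" "module k X"
 shows "alaw H U V W X m1 m2 m3 m4 \<longleftrightarrow> (\<forall>z\<in>carrier (tensor k U (tensor k V W)).
  tlift3 X (%u v w. m2 (m1 u v) w) z = tlift3 X (%u v w. m4 u (m3 v w)) (act3 k U V W \<phi> z))"
proof -
 note t = tri_l[OF b(1,2)] tri_r[OF b(3,4)]
 show ?thesis
 proof
  assume a: "alaw H U V W X m1 m2 m3 m4"
  show "\<forall>z\<in>carrier (tensor k U (tensor k V W)).
   tlift3 X (%u v w. m2 (m1 u v) w) z = tlift3 X (%u v w. m4 u (m3 v w)) (act3 k U V W \<phi> z)"
  proof
   fix z assume z: "z |: (tensor k U (tensor k V W))"
   show "tlift3 X (%u v w. m2 (m1 u v) w) z = tlift3 X (%u v w. m4 u (m3 v w)) (act3 k U V W \<phi> z)"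
    by (rule tensor3_eq[where M = X, OF _ _ _ _ _ _ _ z])
    (use a in "simp_all add: tlift3_lin t lin_comp[OF tlift3_lin[OF t(2)]] lin tlift3_pure[OF t(1)]
    tlift3_act[OF t(2), symmetric] alaw_def")
  qed
 next
  assume "\<forall>z\<in>carrier (tensor k U (tensor k V W)).
   tlift3 X (%u v w. m2 (m1 u v) w) z = tlift3 X (%u v w. m4 u (m3 v w)) (act3 k U V W \<phi> z)"
  then show "alaw H U V W X m1 m2 m3 m4" unfolding alaw_def by (simp add: tlift3_act[OF t(2)] tlift3_pure[OF t(1), symmetric])
 qed
qed

lemma alaw_inv:
 assumes b: "blmap k U V P m1" "blmap k P W X m2" "blmap k V W Q m3" "blmap k U Q X m4"
  and [simp]: "hmod k H U" "hmod k H V" "hmod k H W" "module k X"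
 shows "alaw H U V W X m1 m2 m3 m4 \<longleftrightarrow> (\<forall>u\<in>carrier U. \<forall>v\<in>carrier V. \<forall>w\<in>carrier W.
  m4 u (m3 v w) = nested_l U V W X m1 m2 \<psi> u v w)"
proof -
 note t = tri_l[OF b(1,2)] tri_r[OF b(3,4)]
 have "act3 k U V W \<phi> (act3 k U V W \<psi> z) = z" "act3 k U V W \<psi> (act3 k U V W \<phi> z) = z"
  if "z |: (tensor k U (tensor k V W))" for z using that by (simp_all add: act234_mult[symmetric] alg_moduleD(6)[OF act3_mod])
 then have "alaw H U V W X m1 m2 m3 m4 \<longleftrightarrow> (\<forall>z\<in>carrier (tensor k U (tensor k V W)).
  tlift3 X (%u v w. m4 u (m3 v w)) z = tlift3 X (%u v w. m2 (m1 u v) w) (act3 k U V W \<psi> z))" unfolding alaw_tlift[OF assms]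
  by (metis act234_closed(2) assms(5-7) phi_closed)
 also have "... \<longleftrightarrow> (\<forall>u\<in>carrier U. \<forall>v\<in>carrier V. \<forall>w\<in>carrier W.
  m4 u (m3 v w) = nested_l U V W X m1 m2 \<psi> u v w)" (is "?l \<longleftrightarrow> ?r")
 proof
  assume ?r
  show ?l
  proof
   fix z assume z: "z |: (tensor k U (tensor k V W))"
   show "tlift3 X (%u v w. m4 u (m3 v w)) z = tlift3 X (%u v w. m2 (m1 u v) w) (act3 k U V W \<psi> z)"
    by (rule tensor3_eq[where M = X, OF _ _ _ _ _ _ _ z])
    (use \<open>?r\<close> in "simp_all add: tlift3_lin t lin_comp[OF tlift3_lin[OF t(1)]] lin tlift3_pure[OF t(2)]
    tlift3_act[OF t(1), symmetric]")
  qed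
 next
  assume ?l then show ?r by (simp add: tlift3_act[OF t(1)] tlift3_pure[OF t(2), symmetric])
 qed
 finally show ?thesis .
qed

lemma twprod_nested_left:
 assumes e: "equivar k H U V P m1" and m2: "blmap k P W X m2"
  and [simp]: "hmod k H U" "hmod k H V" "hmod k H W" "hmod k H P" "module k X"
  "u |: U" "v |: V" "w |: W" and t: "t |: H2" and s: "s |: H2"
 shows "twprod P W X t m2 (twprod U V P s m1 u v) w = tlift3 X (%u v w. m2 (m1 u v) w)
  (act3 k U V W (e1 t *3 j3 s) (pure3 k U V W u v w))"
proof (rule H2_eq[OF _ _ _ _ t, of X])
 note m1 = eqvD(1)[OF e]
 note tr = tri_l[OF m1 m2]
 have cl: "twprod U V P \<sigma> m1 u v |: P" if "\<sigma> |: H2" for \<sigma>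
  by (rule bil_cl[OF twprod_bilinear[OF m1]]) (simp_all add: that)
 note L = lin_comp[OF tlift3_lin[OF tr]]
 show "lmap k H2 X (%t. twprod P W X t m2 (twprod U V P s m1 u v) w)" by (simp add: lin cl s m2)
 show "lmap k H2 X (%t. tlift3 X (%u v w. m2 (m1 u v) w)
  (act3 k U V W (e1 t *3 j3 s) (pure3 k U V W u v w)))" by (simp add: lin L s)
 fix a b assume ab: "a |: H" "b |: H"
 have *: "m2 (twprod U V P \<sigma> m1 u v) (act W b w) = tlift3 X (%u v w. m2 (m1 u v) w)
  (act3 k U V W (tassoc k H H H (pure k H2 H \<sigma> b)) (pure3 k U V W u v w))"
  if \<sigma>: "\<sigma> |: H2" for \<sigma>
  by (rule H2_eq[OF _ _ _ _ \<sigma>, of X]) (simp_all add: lin L m1 ab bil1[OF m2] tlift3_pure[OF tr])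
 show "twprod P W X (pH a b) m2 (twprod U V P s m1 u v) w = tlift3 X (%u v w. m2 (m1 u v) w)
  (act3 k U V W (e1 (pH a b) *3 j3 s) (pure3 k U V W u v w))" using ab s
  by (simp add: m2 cl equivar_twprod[OF e] * tmult_pure alg_homD(3)[OF tassoc_algebra_hom, symmetric] lin)
qed simp

lemma twprod_nested_right:
 assumes e: "equivar k H V W Q m3" and m4: "blmap k U Q X m4"
  and [simp]: "hmod k H U" "hmod k H V" "hmod k H W" "hmod k H Q" "module k X"
  "u |: U" "v |: V" "w |: W" and t: "t |: H2" and s: "s |: H2"
 shows "twprod U Q X t m4 u (twprod V W Q s m3 v w) = tlift3 X (%u v w. m4 u (m3 v w))
  (act3 k U V W (e2 t *3 j0 s) (pure3 k U V W u v w))"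
proof (rule H2_eq[OF _ _ _ _ t, of X])
 note m3 = eqvD(1)[OF e]
 note tr = tri_r[OF m3 m4]
 have cl: "twprod V W Q \<sigma> m3 v w |: Q" if "\<sigma> |: H2" for \<sigma>
  by (rule bil_cl[OF twprod_bilinear[OF m3]]) (simp_all add: that)
 note L = lin_comp[OF tlift3_lin[OF tr]]
 show "lmap k H2 X (%t. twprod U Q X t m4 u (twprod V W Q s m3 v w))" by (simp add: lin cl s m4)
 show "lmap k H2 X (%t. tlift3 X (%u v w. m4 u (m3 v w))
  (act3 k U V W (e2 t *3 j0 s) (pure3 k U V W u v w)))" by (simp add: lin L s)
 fix a b assume ab: "a |: H" "b |: H"
 have *: "m4 (act U a u) (twprod V W Q \<sigma> m3 v w) = tlift3 X (%u v w. m4 u (m3 v w))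
  (act3 k U V W (pH2 a \<sigma>) (pure3 k U V W u v w))"
  if \<sigma>: "\<sigma> |: H2" for \<sigma>
  by (rule H2_eq[OF _ _ _ _ \<sigma>, of X]) (simp_all add: lin L m3 ab bil2[OF m4] tlift3_pure[OF tr])
 show "twprod U Q X (pH a b) m4 u (twprod V W Q s m3 v w) = tlift3 X (%u v w. m4 u (m3 v w))
  (act3 k U V W (e2 (pH a b) *3 j0 s) (pure3 k U V W u v w))" using ab s
  by (simp add: m4 cl equivar_twprod[OF e] * tmult_pure lin del: act3_pure)
qed simp

end

context twist_alg begin

text \<open>
 Twisting all products by \<open>F\<inverse>\<close> turns associativity with respect to \<open>\<phi>\<close> into
 associativity with respect to \<open>\<phi>\<^sub>F\<close>, because \<open>\<phi> (\<Delta> \<otimes> id)(F\<inverse>) (F\<inverse> \<otimes> 1) = (id \<otimes> \<Delta>)(F\<inverse>) (1 \<otimes> F\<inverse>) \<phi>\<^sub>F\<close>.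
\<close>

abbreviation "tw U V X == twprod U V X F'"

lemma h_module_HF: "hmod k HF V \<longleftrightarrow> hmod k H V" unfolding h_module_def bilinear_map_def by simp

theorem assoc_twist:
 assumes e: "equivar k H U V P m1" "equivar k H P W X m2" "equivar k H V W Q m3" "equivar k H U Q X m4"
  and [simp]: "hmod k H U" "hmod k H V" "hmod k H W" "hmod k H P" "hmod k H Q" "hmod k H X"
  and a: "alaw H U V W X m1 m2 m3 m4"
 shows "alaw HF U V W X (tw U V P m1) (tw P W X m2) (tw V W Q m3) (tw U Q X m4)" unfolding alaw_def
proof (intro ballI)
 fix u v w assume [simp]: "u |: U" "v |: V" "w |: W"
 note b = e[THEN eqvD(1)]
 let ?p = "pure3 k U V W u v w"
 let ?f1 = "tlift3 X (%u v w. m2 (m1 u v) w)" and ?f2 = "tlift3 X (%u v w. m4 u (m3 v w))"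
 note tr = tri_r[OF b(3,4)]
 have f: "?f1 z = ?f2 (act3 k U V W \<phi> z)" if "z |: (tensor k U (tensor k V W))" for z
  using a that unfolding alaw_tlift[OF b assms(5-7) hm_mod[OF assms(10)]] by blast
 have "tw P W X m2 (tw U V P m1 u v) w = ?f1 (act3 k U V W (e1 F' *3 j3 F') ?p)"
  by (rule twprod_nested_left[OF e(1) b(2)]) simp_all
 also have "... = ?f2 (act3 k U V W (\<phi> *3 (e1 F' *3 j3 F')) ?p)" by (simp add: f act234_mult)
 also have "\<phi> *3 (e1 F' *3 j3 F') = (e2 F' *3 j0 F') *3 phi_F" by (simp add: phi_F_def H3.m_assoc homs_cancel homs_inv)
 also have "?f2 (act3 k U V W ... ?p) = ?f2 (act3 k U V W (e2 F' *3 j0 F') (act3 k U V W phi_F ?p))" by (simp add: act234_mult)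
 also have "... = nested_r U V W X (tw V W Q m3) (tw U Q X m4) phi_F u v w"
 proof (rule H3_eq[where M = X, OF _ _ _ _ phi_psi_F(1)])
  note bb = tri_r[OF twprod_bilinear[OF b(3)] twprod_bilinear[OF b(4)]]
  have tr': "trilinear k H H H X (%a b c. tw U Q X m4 (act U a u) (tw V W Q m3 (act V b v) (act W c w)))"
   by (rule act_trilinear[OF bb]) simp_all
  show "lmap k H3 X (%t. ?f2 (act3 k U V W (e2 F' *3 j0 F') (act3 k U V W t ?p)))"
   by (rule lin_comp[OF tlift3_lin[OF tr]]) (simp_all add: lin)
  show "lmap k H3 X (tlift3 X (%a b c. tw U Q X m4 (act U a u) (tw V W Q m3 (act V b v) (act W c w))))"
   by (rule tlift3_lin[OF tr']) simp_all
  fix a b c assume [simp]: "a |: H" "b |: H" "c |: H"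
  show "?f2 (act3 k U V W (e2 F' *3 j0 F') (act3 k U V W (pH2 a (pH b c)) ?p))
   = nested_r U V W X (tw V W Q m3) (tw U Q X m4) (pH2 a (pH b c)) u v w"
   by (simp add: tlift_H3_pure[OF tr'] twprod_nested_right[OF e(3) b(4)])
 qed simp
 finally show "tw P W X m2 (tw U V P m1 u v) w
  = nested_r U V W X (tw V W Q m3) (tw U Q X m4) (phi HF) u v w" unfolding phi_HF .
qed

lemma equivar_twist:
 assumes e: "equivar k H U V X m" and [simp]: "hmod k H U" "hmod k H V" "hmod k H X"
 shows "equivar k HF U V X (tw U V X m)"
proof (rule equivariantI)
 note m = eqvD(1)[OF e]
 show "blmap k U V X (tw U V X m)" by (rule twprod_bilinear[OF m]) simp_all
 fix h u v assume "h |: HF" "u |: U" "v |: V"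
 moreover from this have "F' *2 (F *2 \<Delta> h *2 F') = \<Delta> h *2 F'"
  by (simp add: H2.m_assoc) (simp add: H2.m_assoc[symmetric])
 ultimately show "act X h (tw U V X m u v) = twprod U V X (comult HF h) (tw U V X m) u v"
  by (simp add: equivar_twprod[OF e] twprod_mult[OF m])
qed

end

lemma bilinear_cong:
 assumes "blmap k U V M g" "!!u v. u |: U ==> v |: V ==> f u v = g u v"
  "module k U" "module k V"
 shows "blmap k U V M f"
proof (rule bilI)
 fix u assume "u |: U"
 then show "lmap k V M (f u)" by (subst linear_map_cong[where g = "g u"]) (simp_all add: assms bil_r[OF assms(1)])
next
 fix v assume "v |: V"
 then show "lmap k U M (%u. f u v)" by (subst linear_map_cong[where g = "%u. g u v"]) (simp_all add: assms bil_l[OF assms(1)])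
qed

lemma trilinear_cong:
 assumes "trilinear k U V W M g" "!!u v w. u |: U ==> v |: V ==> w |: W ==> f u v w = g u v w"
  "module k U" "module k V" "module k W"
 shows "trilinear k U V W M f" unfolding trilinear_def
proof (intro conjI ballI)
 fix v w assume "v |: V" "w |: W"
 then show "lmap k U M (%u. f u v w)"
  by (subst linear_map_cong[where g = "%u. g u v w"]) (simp_all add: assms trilinearD[OF assms(1)])
next
 fix u assume u: "u |: U"
 show "blmap k V W M (f u)" by (rule bilinear_cong[OF trilinearD(2)[OF assms(1) u]]) (simp_all add: assms u)
qed

context quasi_hopf_alg begin

subsection \<open>Completing associativity laws\<close>

lemma hm_tensor [simp]:
 assumes V: "hmod k H V" and W: "hmod k H W" shows "hmod k H (h_tensor k H V W)"
proof -
 note m = act2_mod[OF V W]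
 have mod: "module k (h_tensor k H V W)" by (rule module_cong[of "tensor k V W"]) (simp_all add: assms)
 have "blmap k H (tensor k V W) (tensor k V W) (%h. act2 k V W (\<Delta> h))" by (rule bilI) (simp_all add: alg_moduleD[OF m] lin)
 then have "blmap k H (h_tensor k H V W) (h_tensor k H V W) (act (h_tensor k H V W))"
  unfolding bilinear_map_def linear_map_def by simp
 then show ?thesis unfolding h_module_def using mod by (simp add: alg_homD[OF comult_hom] alg_moduleD[OF m])
qed

lemma hm_tensor_mod [simp]: "hmod k H V ==> hmod k H W ==> module k (tensor k V W)" by (simp add: lin)

lemma linear_h_tensor:
 "lmap k (h_tensor k H V W) M = lmap k (tensor k V W) M"
 "lmap k M (h_tensor k H V W) = lmap k M (tensor k V W)" by (intro ext; simp add: linear_map_def)+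

lemma pure_equivariant:
 assumes [simp]: "hmod k H V" "hmod k H W"
 shows "equivar k H V W (h_tensor k H V W) (pure k V W)"
proof (rule equivariantI)
 have b: "blmap k V W (tensor k V W) (pure k V W)" by (rule pure_bil) simp_all
 then show b': "blmap k V W (h_tensor k H V W) (pure k V W)" unfolding bilinear_map_def by (simp add: linear_h_tensor)
 fix h v w assume [simp]: "h |: H" "v |: V" "w |: W"
 have "act2 k V W t (pure k V W v w) = twprod V W (h_tensor k H V W) t (pure k V W) v w" if t: "t |: H2" for t
  by (rule H2_eq[OF _ _ _ _ t, of "tensor k V W"])
   (simp_all add: lin twprod_lin[OF b'] linear_h_tensor(2)[symmetric] b', simp add: linear_h_tensor lin)
 then show "act (h_tensor k H V W) h (pure k V W v w) = twprod V W (h_tensor k H V W) (\<Delta> h) (pure k V W) v w" by simp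
qed

lemma coassoc_inv:
 assumes h: "h |: H" shows "\<psi> *3 e2 (\<Delta> h) = e1 (\<Delta> h) *3 \<psi>"
proof -
 have "\<psi> *3 e2 (\<Delta> h) = \<psi> *3 (e2 (\<Delta> h) *3 \<phi>) *3 \<psi>" using h by (simp add: H3.m_assoc)
 also have "... = e1 (\<Delta> h) *3 \<psi>" using h by (simp add: coassoc H3.m_assoc[symmetric])
 finally show ?thesis .
qed

lemma nested_right_equivariant:
 assumes e: "equivar k H V W Q m3" "equivar k H U Q X m4"
  and [simp]: "hmod k H U" "hmod k H V" "hmod k H W" "hmod k H Q" "hmod k H X"
  and h: "h |: H" and z: "z |: (tensor k U (tensor k V W))"
 shows "act X h (tlift3 X (%u v w. m4 u (m3 v w)) z)
  = tlift3 X (%u v w. m4 u (m3 v w)) (act3 k U V W (e2 (\<Delta> h)) z)"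
proof (rule tensor3_eq[where M = X, OF _ _ _ _ _ _ _ z])
 note b = e[THEN eqvD(1)]
 note t = tri_r[OF b]
 note L = tlift3_lin[OF t]
 show "lmap k (tensor k U (tensor k V W)) X (%z. act X h (tlift3 X (%u v w. m4 u (m3 v w)) z))" by (simp add: lin L h)
 show "lmap k (tensor k U (tensor k V W)) X (%z. tlift3 X (%u v w. m4 u (m3 v w)) (act3 k U V W (e2 (\<Delta> h)) z))"
  by (rule lin_comp[OF L]) (simp_all add: lin h)
 fix u v w assume [simp]: "u |: U" "v |: V" "w |: W"
 show "act X h (tlift3 X (%u v w. m4 u (m3 v w)) (pure3 k U V W u v w))
  = tlift3 X (%u v w. m4 u (m3 v w)) (act3 k U V W (e2 (\<Delta> h)) (pure3 k U V W u v w))"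
  using twprod_nested_right[OF e(1) b(2), of u v w "\<Delta> h" "\<one>\<^sub>2"] h
  by (simp add: tlift3_pure[OF t] eqvD(2)[OF e(2)] bil_cl[OF b(1)] twprod_one[OF b(1)]
   alg_homD(2)[OF j0_hom] del: pure_hm)
qed simp_all

lemma nested_left_equivariant:
 assumes e: "equivar k H U V P m1" "equivar k H P W X m2"
  and [simp]: "hmod k H U" "hmod k H V" "hmod k H W" "hmod k H P" "hmod k H X"
  and h: "h |: H" and z: "z |: (tensor k U (tensor k V W))"
 shows "act X h (tlift3 X (%u v w. m2 (m1 u v) w) z)
  = tlift3 X (%u v w. m2 (m1 u v) w) (act3 k U V W (e1 (\<Delta> h)) z)"
proof (rule tensor3_eq[where M = X, OF _ _ _ _ _ _ _ z])
 note b = e[THEN eqvD(1)]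
 note t = tri_l[OF b]
 note L = tlift3_lin[OF t]
 show "lmap k (tensor k U (tensor k V W)) X (%z. act X h (tlift3 X (%u v w. m2 (m1 u v) w) z))" by (simp add: lin L h)
 show "lmap k (tensor k U (tensor k V W)) X (%z. tlift3 X (%u v w. m2 (m1 u v) w) (act3 k U V W (e1 (\<Delta> h)) z))"
  by (rule lin_comp[OF L]) (simp_all add: lin h)
 fix u v w assume [simp]: "u |: U" "v |: V" "w |: W"
 show "act X h (tlift3 X (%u v w. m2 (m1 u v) w) (pure3 k U V W u v w))
  = tlift3 X (%u v w. m2 (m1 u v) w) (act3 k U V W (e1 (\<Delta> h)) (pure3 k U V W u v w))"
  using twprod_nested_left[OF e(1) b(2), of u v w "\<Delta> h" "\<one>\<^sub>2"] h
  by (simp add: tlift3_pure[OF t] eqvD(2)[OF e(2)] bil_cl[OF b(1)] twprod_one[OF b(1)]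
   alg_homD(2)[OF j3_hom] del: pure_hm)
qed simp_all

text \<open>
 Given the two products on one side of an associativity law, exactly one product of a
 tensor product on the other side makes the law hold. The composition of internal homs, the actions on
 \<open>V \<otimes> W\<close> and the associator all arise in this way.
\<close>

definition "complete_left U V W X m3 m4 t w =
 tlift X (%u v. nested_r U V W X m3 m4 \<phi> u v w) t"

definition "complete_right U V W X m1 m2 u t =
 tlift X (%v w. nested_l U V W X m1 m2 \<psi> u v w) t"

lemma complete_aux:
 assumes f: "trilinear k U V W X f" and [simp]: "hmod k H U" "hmod k H V" "hmod k H W" "module k X"
  and \<theta>: "\<theta> |: H3"
 shows "trilinear k U V W X (%u v w. tlift3 X (%a b c. f (act U a u) (act V b v) (act W c w)) \<theta>)"
proof -
 note L = lin_comp[OF tlift3_lin[OF f]]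
 have *: "trilinear k U V W X (%u v w. tlift3 X f (act3 k U V W \<theta> (pure3 k U V W u v w)))"
  by (rule trilinearI) (simp_all add: L lin \<theta>)
 show ?thesis by (rule trilinear_cong[OF *]) (simp_all add: tlift3_act[OF f] \<theta>)
qed

context
 fixes U and V
  and W and Q
  and X
 assumes hm [simp]: "hmod k H U" "hmod k H V" "hmod k H W" "hmod k H Q" "hmod k H X"
begin

lemma complete_left_pure:
 assumes e: "equivar k H V W Q m3" "equivar k H U Q X m4"
  and "u |: U" "v |: V" "w |: W"
 shows "complete_left U V W X m3 m4 (pure k U V u v) w =
  nested_r U V W X m3 m4 \<phi> u v w"
proof -
 note t = complete_aux[OF tri_r[OF e[THEN eqvD(1)]] hm(1-3) hm_mod[OF hm(5)] phi_closed(1)]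
 have "blmap k U V X (%u v. nested_r U V W X m3 m4 \<phi> u v w)"
  by (rule bilI) (use assms trilinearD[OF t] bil_l[OF trilinearD(2)[OF t]] in simp_all)
 then show ?thesis unfolding complete_left_def by (rule tlift_pure_eq[rotated 2]) (simp_all add: assms)
qed

lemma complete_left_bilinear:
 assumes e: "equivar k H V W Q m3" "equivar k H U Q X m4"
 shows "blmap k (tensor k U V) W X (complete_left U V W X m3 m4)"
proof -
 note t = complete_aux[OF tri_r[OF e[THEN eqvD(1)]] hm(1-3) hm_mod[OF hm(5)] phi_closed(1)]
 have b: "blmap k U V X (%u v. nested_r U V W X m3 m4 \<phi> u v w)"
  if "w |: W" for w by (rule bilI) (use that trilinearD[OF t] bil_l[OF trilinearD(2)[OF t]] in simp_all)
 show ?thesis unfolding complete_left_def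
 proof (rule bilI)
  fix s assume s: "s |: tensor k U V"
  show "lmap k W X (%w. tlift X (%u v. nested_r U V W X m3 m4 \<phi> u v w) s)"
   by (rule tlift_param[OF s]) (use b bil_r[OF trilinearD(2)[OF t]] in simp_all)
 qed (use b in "auto intro!: tlift_lin")
qed

lemma complete_left_law:
 assumes e: "equivar k H V W Q m3" "equivar k H U Q X m4"
 shows "alaw H U V W X (pure k U V) (complete_left U V W X m3 m4) m3 m4" unfolding alaw_def using complete_left_pure[OF e] by simp

lemma complete_left_equivariant:
 assumes e: "equivar k H V W Q m3" "equivar k H U Q X m4"
 shows "equivar k H (h_tensor k H U V) W X (complete_left U V W X m3 m4)"
proof (rule equivariantI)
 let ?m = "complete_left U V W X m3 m4"
 note m = complete_left_bilinear[OF e]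
 note tr = tri_r[OF e[THEN eqvD(1)]]
 note L = lin_comp[OF tlift3_lin[OF tr]]
 show m': "blmap k (h_tensor k H U V) W X ?m" using m unfolding bilinear_map_def by (simp add: linear_h_tensor)
 have p: "?m (pure k U V u v) w = tlift3 X (%u v w. m4 u (m3 v w)) (act3 k U V W \<phi> (pure3 k U V W u v w))"
  if "u |: U" "v |: V" "w |: W" for u v w using that by (simp add: complete_left_pure[OF e] tlift3_act[OF tr])
 fix h t w assume h: "h |: H" and "t |: h_tensor k H U V" and w: "w |: W"
 then have t: "t |: tensor k U V" by simp
 show "act X h (?m t w) = twprod (h_tensor k H U V) W X (\<Delta> h) ?m t w"
 proof (rule tensor_eq[OF _ _ _ _ _ _ t, of X])
  show "lmap k (tensor k U V) X (%t. act X h (?m t w))" by (simp add: lin h bil_l[OF m w])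
  have "blmap k (h_tensor k H U V) W X (twprod (h_tensor k H U V) W X (\<Delta> h) ?m)"
   by (rule twprod_bilinear[OF m']) (simp_all add: h)
  then show "lmap k (tensor k U V) X (%t. twprod (h_tensor k H U V) W X (\<Delta> h) ?m t w)"
   using bil_l w linear_h_tensor(1) by metis
  fix u v assume uv: "u |: U" "v |: V"
  let ?p = "pure3 k U V W u v w"
  have 1: "?m (act2 k U V s (pure k U V u v)) (act W b w)
   = tlift3 X (%u v w. m4 u (m3 v w)) (act3 k U V W (\<phi> *3 tassoc k H H H (pure k H2 H s b)) ?p)"
   if s: "s |: H2" and b: "b |: H" for s b by (rule H2_eq[OF _ _ _ _ s, of X])
    (simp_all add: lin b uv w bil1[OF m] L p act234_mult)
  have 2: "twprod (h_tensor k H U V) W X t ?m (pure k U V u v) w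
   = tlift3 X (%u v w. m4 u (m3 v w)) (act3 k U V W (\<phi> *3 e1 t) ?p)" if t: "t |: H2" for t
   by (rule H2_eq[OF _ _ _ _ t, of X])
    (simp_all add: lin twprod_lin[OF m'] uv w L twprod_pure[OF m'] 1)
  show "act X h (?m (pure k U V u v) w) = twprod (h_tensor k H U V) W X (\<Delta> h) ?m (pure k U V u v) w"
   using h uv w by (simp add: 2 coassoc[symmetric] p nested_right_equivariant[OF e] act234_mult)
 qed simp_all
qed

end

context
 fixes U and V
  and W and P
  and X
 assumes hm [simp]: "hmod k H U" "hmod k H V" "hmod k H W" "hmod k H P" "hmod k H X"
begin

lemma complete_right_pure:
 assumes e: "equivar k H U V P m1" "equivar k H P W X m2"
  and "u |: U" "v |: V" "w |: W"
 shows "complete_right U V W X m1 m2 u (pure k V W v w) =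
  nested_l U V W X m1 m2 \<psi> u v w"
proof -
 note t = complete_aux[OF tri_l[OF e[THEN eqvD(1)]] hm(1-3) hm_mod[OF hm(5)] phi_closed(2)]
 show ?thesis unfolding complete_right_def by (rule tlift_pure_eq[OF _ _ trilinearD(2)[OF t]]) (simp_all add: assms)
qed

lemma complete_right_bilinear:
 assumes e: "equivar k H U V P m1" "equivar k H P W X m2"
 shows "blmap k U (tensor k V W) X (complete_right U V W X m1 m2)"
proof -
 note t = complete_aux[OF tri_l[OF e[THEN eqvD(1)]] hm(1-3) hm_mod[OF hm(5)] phi_closed(2)]
 show ?thesis unfolding complete_right_def by (rule trilinear_inner[OF t]) simp_all
qed

lemma complete_right_law:
 assumes e: "equivar k H U V P m1" "equivar k H P W X m2"
 shows "alaw H U V W X m1 m2 (pure k V W) (complete_right U V W X m1 m2)"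
 by (subst alaw_inv[OF eqvD(1)[OF e(1)] eqvD(1)[OF e(2)] pure_bil complete_right_bilinear[OF e]])
  (simp_all add: complete_right_pure[OF e])

lemma complete_right_equivariant:
 assumes e: "equivar k H U V P m1" "equivar k H P W X m2"
 shows "equivar k H U (h_tensor k H V W) X (complete_right U V W X m1 m2)"
proof (rule equivariantI)
 let ?m = "complete_right U V W X m1 m2"
 note m = complete_right_bilinear[OF e]
 note tr = tri_l[OF e[THEN eqvD(1)]]
 note L = lin_comp[OF tlift3_lin[OF tr]]
 show m': "blmap k U (h_tensor k H V W) X ?m" using m unfolding bilinear_map_def by (simp add: linear_h_tensor)
 have p: "?m u (pure k V W v w) = tlift3 X (%u v w. m2 (m1 u v) w) (act3 k U V W \<psi> (pure3 k U V W u v w))"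
  if "u |: U" "v |: V" "w |: W" for u v w using that by (simp add: complete_right_pure[OF e] tlift3_act[OF tr])
 fix h u t assume h: "h |: H" and "t |: h_tensor k H V W" and u: "u |: U"
 then have t: "t |: tensor k V W" by simp
 show "act X h (?m u t) = twprod U (h_tensor k H V W) X (\<Delta> h) ?m u t"
 proof (rule tensor_eq[OF _ _ _ _ _ _ t, of X])
  show "lmap k (tensor k V W) X (%t. act X h (?m u t))" by (simp add: lin h bil_r[OF m u])
  have "blmap k U (h_tensor k H V W) X (twprod U (h_tensor k H V W) X (\<Delta> h) ?m)"
   by (rule twprod_bilinear[OF m']) (simp_all add: h)
  then show "lmap k (tensor k V W) X (twprod U (h_tensor k H V W) X (\<Delta> h) ?m u)" using bil_r u linear_h_tensor(1) by metis
  fix v w assume vw: "v |: V" "w |: W"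
  let ?p = "pure3 k U V W u v w"
  have 1: "?m (act U a u) (act2 k V W s (pure k V W v w))
   = tlift3 X (%u v w. m2 (m1 u v) w) (act3 k U V W (\<psi> *3 pH2 a s) ?p)"
   if s: "s |: H2" and a: "a |: H" for s a by (rule H2_eq[OF _ _ _ _ s, of X])
    (simp_all add: lin a u vw bil2[OF m] L p act234_mult)
  have 2: "twprod U (h_tensor k H V W) X t ?m u (pure k V W v w)
   = tlift3 X (%u v w. m2 (m1 u v) w) (act3 k U V W (\<psi> *3 e2 t) ?p)" if t: "t |: H2" for t
   by (rule H2_eq[OF _ _ _ _ t, of X])
    (simp_all add: lin twprod_lin[OF m'] u vw L twprod_pure[OF m'] 1)
  show "act X h (?m u (pure k V W v w)) = twprod U (h_tensor k H V W) X (\<Delta> h) ?m u (pure k V W v w)"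
   using h u vw by (simp add: 2 coassoc_inv p nested_left_equivariant[OF e] act234_mult)
 qed simp_all
qed

end

end

lemma tlift3_comp:
 assumes f: "trilinear k U V W N f" and g: "lmap k N M g" and m: "module k U" "module k V" "module k W"
  "module k N" "module k M" and t: "t |: (tensor k U (tensor k V W))"
 shows "g (tlift3 N f t) = tlift3 M (%u v w. g (f u v w)) t"
proof -
 have tr: "trilinear k U V W M (%u v w. g (f u v w))" by (rule trilinearI)
   (simp_all add: lin_comp[OF g] trilinearD[OF f] bil_l[OF trilinearD(2)[OF f]]
    bil_r[OF trilinearD(2)[OF f]])
 show ?thesis by (rule tensor3_eq[where M = M, OF _ _ _ _ _ _ _ t])
   (simp_all add: m tlift3_lin[OF f] lin_comp[OF g] tlift3_lin[OF tr] tlift3_pure[OF f] tlift3_pure[OF tr])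
qed

section \<open>Products of four factors\<close>

text \<open>
 Let \<open>G\<^sub>1, ..., G\<^sub>5\<close> be the linear maps given by the bracketings \<open>((uv)w)x\<close>, \<open>(u(vw))x\<close>, \<open>u((vw)x)\<close>,
 \<open>u(v(wx))\<close>, \<open>(uv)(wx)\<close>. Each edge of the pentagon relates two of them by one of the images of
 \<open>\<phi>\<close> in \<open>H\<^sup>\<otimes>\<^sup>4\<close>. As these are invertible, the pentagon axiom makes each edge a consequence of the
 other four.
\<close>

context quasi_hopf_alg begin

lemma four_edges:
 fixes G1 G2 G3 G4 G5 :: "'z => 'm" and Z :: "('k, 'z, 'y) module_scheme"
 assumes M: "alg_module k H4 Z \<rho>"
 defines "A == \<forall>z\<in>carrier Z. G1 z = G2 (\<rho> (i4 \<phi>) z)"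
  and "B == \<forall>z\<in>carrier Z. G2 z = G3 (\<rho> (d2 \<phi>) z)"
  and "C == \<forall>z\<in>carrier Z. G3 z = G4 (\<rho> (i0 \<phi>) z)"
  and "D == \<forall>z\<in>carrier Z. G1 z = G5 (\<rho> (d1 \<phi>) z)"
  and "E == \<forall>z\<in>carrier Z. G5 z = G4 (\<rho> (d3 \<phi>) z)"
 shows "B ==> C ==> D ==> E ==> A" "A ==> C ==> D ==> E ==> B" "A ==> B ==> D ==> E ==> C"
  "A ==> B ==> C ==> E ==> D" "A ==> B ==> C ==> D ==> E"
proof -
 note [simp] = alg_moduleD(4)[OF M]
 have mul: "\<rho> a (\<rho> b z) = \<rho> (a *4 b) z" if "a |: H4" "b |: H4" "z |: Z" for a b z
  using alg_moduleD(5)[OF M] that by simp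
 have inv: "f \<phi> *4 f \<psi> = \<one>\<^sub>4" "f \<psi> *4 f \<phi> = \<one>\<^sub>4" "f \<psi> |: H4" "f \<phi> |: H4"
  if "algebra_hom k H3 H4 f" for f using alg_homD[OF that] by (simp_all add: alg_homD(3)[OF that, symmetric])
 have c: "\<rho> (f \<phi>) (\<rho> (f \<psi>) z) = z" "\<rho> (f \<psi>) (\<rho> (f \<phi>) z) = z" if "algebra_hom k H3 H4 f" "z |: Z" for f z
  using that by (simp_all add: mul inv[OF that(1)] alg_moduleD(6)[OF M])
 have pent: "\<rho> (d3 \<phi>) (\<rho> (d1 \<phi>) z) = \<rho> (i0 \<phi>) (\<rho> (d2 \<phi>) (\<rho> (i4 \<phi>) z))" if "z |: Z" for z
  using that pentagon by (simp add: mul H4.m_assoc)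
 note cc = c[OF i0_hom] c[OF i4_hom] c[OF d1_hom] c[OF d2_hom] c[OF d3_hom]
 show "B ==> C ==> D ==> E ==> A" unfolding A_def B_def C_def D_def E_def by (simp add: pent)
 show "A ==> B ==> C ==> E ==> D" unfolding A_def B_def C_def D_def E_def by (simp add: pent)
 {
  assume H: A C D E
  have "G2 z = G3 (\<rho> (d2 \<phi>) z)" if z: "z |: Z" for z
   using H pent[of "\<rho> (i4 \<psi>) z"] z unfolding A_def C_def D_def E_def
   by (metis (no_types, lifting) \<open>!!v a. a |: H4 ==> v |: Z ==> \<rho> a v |: Z\<close> cc(3) homs_closed phi_closed)
  then show B unfolding B_def by blast
 }
 {
  assume H: A B D E
  have "G3 z = G4 (\<rho> (i0 \<phi>) z)" if z: "z |: Z" for z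
   using H pent[of "\<rho> (i4 \<psi>) (\<rho> (d2 \<psi>) z)"] z unfolding A_def B_def D_def E_def
   by (metis (no_types, lifting) \<open>!!v a. a |: H4 ==> v |: Z ==> \<rho> a v |: Z\<close> cc(3,7) homs_closed phi_closed)
  then show C unfolding C_def by blast
 }
 {
  assume H: A B C D
  have "G5 z = G4 (\<rho> (d3 \<phi>) z)" if z: "z |: Z" for z
   using H pent[of "\<rho> (d1 \<psi>) z"] z unfolding A_def B_def C_def D_def
   by (metis (no_types, lifting) \<open>!!v a. a |: H4 ==> v |: Z ==> \<rho> a v |: Z\<close> cc(5) homs_closed phi_closed)
  then show E unfolding E_def by blast
 }
qed

end

text \<open>
 The name of a product lists the factors already multiplied on its two sides: \<open>p12_3\<close> multiplies \<open>uv\<close>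
 by \<open>w\<close>.
\<close>

locale four_products = quasi_hopf_alg k H
 for k :: "'k ring" and H :: "('k, 'h) quasi_hopf" +
 fixes U and V
  and W and X
  and P and Q
  and R and T
  and Y and M
  and p1_2 :: "'u => 'v => 'p" and p12_3 :: "'p => 'w => 'q" and p2_3 :: "'v => 'w => 'r"
  and p1_23 :: "'u => 'r => 'q" and p123_4 :: "'q => 'x => 'm" and p23_4 :: "'r => 'x => 's"
  and p1_234 :: "'u => 's => 'm" and p3_4 :: "'w => 'x => 't" and p2_34 :: "'v => 't => 's"
  and p12_34 :: "'p => 't => 'm"
 assumes hm [simp]: "hmod k H U" "hmod k H V" "hmod k H W" "hmod k H X" "hmod k H P"
   "hmod k H Q" "hmod k H R" "hmod k H T" "hmod k H Y" "hmod k H M"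
  and eq: "equivar k H U V P p1_2" "equivar k H P W Q p12_3" "equivar k H V W R p2_3"
   "equivar k H U R Q p1_23" "equivar k H Q X M p123_4" "equivar k H R X T p23_4"
   "equivar k H U T M p1_234" "equivar k H W X Y p3_4" "equivar k H V Y T p2_34"
   "equivar k H P Y M p12_34"
begin

lemmas b = eq[THEN eqvD(1)]
lemmas bl = b[THEN bil_l] b[THEN bil_r] b[THEN bil_cl]
 bil1[OF b(1)] bil1[OF b(2)] bil1[OF b(3)] bil1[OF b(4)] bil1[OF b(5)] bil1[OF b(6)] bil1[OF b(7)] bil1[OF b(8)] bil1[OF b(9)] bil1[OF b(10)]
 bil2[OF b(1)] bil2[OF b(2)] bil2[OF b(3)] bil2[OF b(4)] bil2[OF b(5)] bil2[OF b(6)] bil2[OF b(7)] bil2[OF b(8)] bil2[OF b(9)] bil2[OF b(10)]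

definition "g1 u v w x = p123_4 (p12_3 (p1_2 u v) w) x"
definition "g2 u v w x = p123_4 (p1_23 u (p2_3 v w)) x"
definition "g3 u v w x = p1_234 u (p23_4 (p2_3 v w) x)"
definition "g4 u v w x = p1_234 u (p2_34 v (p3_4 w x))"
definition "g5 u v w x = p12_34 (p1_2 u v) (p3_4 w x)"

lemma quad: "quadlinear k U V W X M g1" "quadlinear k U V W X M g2" "quadlinear k U V W X M g3"
 "quadlinear k U V W X M g4" "quadlinear k U V W X M g5" unfolding g1_def g2_def g3_def g4_def g5_def
 by (rule quadlinearI; simp add: bl lin)+

abbreviation "T4 == tensor k U (tensor k V (tensor k W X))"
abbreviation "p4 u v w x == pure k U (tensor k V (tensor k W X)) u (pure3 k V W X v w x)"
abbreviation "\<rho> == act4 k U V W X"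

lemma Lq: "quadlinear k U V W X M g ==> lmap k T4 M (tlift4 M g)"
 "quadlinear k U V W X M g ==> lmap k Z T4 f ==> lmap k Z M (%z. tlift4 M g (f z))"
 "quadlinear k U V W X M g ==> u |: U ==> v |: V ==> w |: W ==> x |: X ==>
  tlift4 M g (p4 u v w x) = g u v w x"
 using tlift4_lin[of k U V W X M g] lin_comp[OF tlift4_lin[of k U V W X M g]] tlift4_pure[of k U V W X M g] by simp_all

lemma edge:
 assumes "quadlinear k U V W X M g" "quadlinear k U V W X M g'" "t |: H4"
 shows "(\<forall>z\<in>carrier T4. tlift4 M g z = tlift4 M g' (\<rho> t z)) \<longleftrightarrow>
  (\<forall>u\<in>carrier U. \<forall>v\<in>carrier V. \<forall>w\<in>carrier W. \<forall>x\<in>carrier X. g u v w x = tlift4 M g' (\<rho> t (p4 u v w x)))"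
  (is "?l \<longleftrightarrow> ?r")
proof
 assume ?r
 show ?l
 proof
  fix z assume z: "z |: T4"
  show "tlift4 M g z = tlift4 M g' (\<rho> t z)" by (rule tensor4_eq[where M = M, OF _ _ _ _ _ _ _ _ z])
    (use \<open>?r\<close> in "simp_all add: Lq assms lin")
 qed
qed (use Lq(3)[OF assms(1)] in "simp add: lin")

context
 fixes u v w x
 assumes uvwx [simp]: "u |: U" "v |: V" "w |: W" "x |: X"
begin

lemma edge_A:
 assumes t: "t |: H3"
 shows "tlift4 M g2 (\<rho> (i4 t) (p4 u v w x))
  = tlift3 M (%a b c. g2 (act U a u) (act V b v) (act W c w) x) t"
proof -
 have tr: "trilinear k H H H M (%a b c. g2 (act U a u) (act V b v) (act W c w) x)"
  unfolding g2_def by (rule trilinearI; simp add: bl lin)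
 show ?thesis by (rule H3_eq[where M = M, OF _ _ _ _ t]) (simp_all add: Lq quad lin tlift_H3 tlift3_lin[OF tr] tlift_H3_pure tr)
qed

lemma edge_C:
 assumes t: "t |: H3"
 shows "tlift4 M g4 (\<rho> (i0 t) (p4 u v w x))
  = tlift3 M (%a b c. g4 u (act V a v) (act W b w) (act X c x)) t"
proof -
 have tr: "trilinear k H H H M (%a b c. g4 u (act V a v) (act W b w) (act X c x))"
  unfolding g4_def by (rule trilinearI; simp add: bl lin)
 show ?thesis by (rule H3_eq[where M = M, OF _ _ _ _ t]) (simp_all add: Lq quad lin tlift_H3 tlift3_lin[OF tr] tlift_H3_pure tr)
qed

lemma edge_B:
 assumes t: "t |: H3"
 shows "tlift4 M g3 (\<rho> (d2 t) (p4 u v w x))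
  = nested_r U R X M p23_4 p1_234 t u (p2_3 v w) x"
proof -
 have tr: "trilinear k H H H M (%a b c. p1_234 (act U a u) (p23_4 (act R b (p2_3 v w)) (act X c x)))"
  by (rule trilinearI; simp add: bl lin)
 have *: "tlift4 M g3 (\<rho> (pH3 a (tassoc k H H H (pure k H2 H s c))) (p4 u v w x))
  = p1_234 (act U a u) (p23_4 (twprod V W R s p2_3 v w) (act X c x))"
  if "a |: H" "c |: H" and s: "s |: H2" for a s c by (rule H2_eq[OF _ _ _ _ s, of M])
   (simp_all add: Lq quad lin that bl twprod_lin[OF b(3)] twprod_pure[OF b(3)], simp add: g3_def)
 show ?thesis by (rule H3_eq[where M = M, OF _ _ _ _ t])
   (simp_all add: Lq quad lin tlift3_lin[OF tr] tlift_H3_pure[OF tr] * eqvD(2)[OF eq(3)] del: act4_pure)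
qed

lemma edge_D:
 assumes t: "t |: H3"
 shows "tlift4 M g5 (\<rho> (d1 t) (p4 u v w x))
  = nested_r P W X M p3_4 p12_34 t (p1_2 u v) w x"
proof -
 have tr: "trilinear k H H H M (%a b c. p12_34 (act P a (p1_2 u v)) (p3_4 (act W b w) (act X c x)))"
  by (rule trilinearI; simp add: bl lin)
 have *: "tlift4 M g5 (\<rho> (tassoc k H H H2 (pure k H2 H2 s (pH a c))) (p4 u v w x))
  = p12_34 (twprod U V P s p1_2 u v) (p3_4 (act W a w) (act X c x))"
  if "a |: H" "c |: H" and s: "s |: H2" for a s c by (rule H2_eq[OF _ _ _ _ s, of M])
   (simp_all add: Lq quad lin that bl twprod_lin[OF b(1)] twprod_pure[OF b(1)], simp add: g5_def)
 show ?thesis by (rule H3_eq[where M = M, OF _ _ _ _ t])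
   (simp_all add: Lq quad lin tlift3_lin[OF tr] tlift_H3_pure[OF tr] * eqvD(2)[OF eq(1)])
qed

lemma edge_E:
 assumes t: "t |: H3"
 shows "tlift4 M g4 (\<rho> (d3 t) (p4 u v w x))
  = nested_r U V Y M p2_34 p1_234 t u v (p3_4 w x)"
proof -
 have tr: "trilinear k H H H M (%a b c. p1_234 (act U a u) (p2_34 (act V b v) (act Y c (p3_4 w x))))"
  by (rule trilinearI; simp add: bl lin)
 have *: "tlift4 M g4 (\<rho> (pH3 a (pH2 c s)) (p4 u v w x))
  = p1_234 (act U a u) (p2_34 (act V c v) (twprod W X Y s p3_4 w x))"
  if "a |: H" "c |: H" and s: "s |: H2" for a s c by (rule H2_eq[OF _ _ _ _ s, of M])
   (simp_all add: Lq quad lin that bl twprod_lin[OF b(8)] twprod_pure[OF b(8)], simp add: g4_def)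
 show ?thesis by (rule H3_eq[where M = M, OF _ _ _ _ t])
   (simp_all add: Lq quad lin tlift3_lin[OF tr] tlift_H3_pure[OF tr] * eqvD(2)[OF eq(8)] del: act4_pure)
qed

end

abbreviation "edgeA == \<forall>u\<in>carrier U. \<forall>v\<in>carrier V. \<forall>w\<in>carrier W. \<forall>x\<in>carrier X.
 p123_4 (p12_3 (p1_2 u v) w) x = tlift3 M (%a b c. p123_4 (p1_23 (act U a u) (p2_3 (act V b v) (act W c w))) x) \<phi>"
abbreviation "edgeB == \<forall>u\<in>carrier U. \<forall>v\<in>carrier V. \<forall>w\<in>carrier W. \<forall>x\<in>carrier X.
 p123_4 (p1_23 u (p2_3 v w)) x = nested_r U R X M p23_4 p1_234 \<phi> u (p2_3 v w) x"
abbreviation "edgeC == \<forall>u\<in>carrier U. \<forall>v\<in>carrier V. \<forall>w\<in>carrier W. \<forall>x\<in>carrier X.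
 p1_234 u (p23_4 (p2_3 v w) x) = tlift3 M (%a b c. p1_234 u (p2_34 (act V a v) (p3_4 (act W b w) (act X c x)))) \<phi>"
abbreviation "edgeD == \<forall>u\<in>carrier U. \<forall>v\<in>carrier V. \<forall>w\<in>carrier W. \<forall>x\<in>carrier X.
 p123_4 (p12_3 (p1_2 u v) w) x = nested_r P W X M p3_4 p12_34 \<phi> (p1_2 u v) w x"
abbreviation "edgeE == \<forall>u\<in>carrier U. \<forall>v\<in>carrier V. \<forall>w\<in>carrier W. \<forall>x\<in>carrier X.
 p12_34 (p1_2 u v) (p3_4 w x) = nested_r U V Y M p2_34 p1_234 \<phi> u v (p3_4 w x)"

lemma edges:
 "edgeB ==> edgeC ==> edgeD ==> edgeE ==> edgeA" "edgeA ==> edgeC ==> edgeD ==> edgeE ==> edgeB"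
 "edgeA ==> edgeB ==> edgeD ==> edgeE ==> edgeC" "edgeA ==> edgeB ==> edgeC ==> edgeE ==> edgeD"
 "edgeA ==> edgeB ==> edgeC ==> edgeD ==> edgeE"
proof -
 have 1: "edgeA \<longleftrightarrow> (\<forall>z\<in>carrier T4. tlift4 M g1 z = tlift4 M g2 (\<rho> (i4 \<phi>) z))"
  by (subst edge) (simp_all add: quad edge_A, simp add: g1_def g2_def)
 have 2: "edgeB \<longleftrightarrow> (\<forall>z\<in>carrier T4. tlift4 M g2 z = tlift4 M g3 (\<rho> (d2 \<phi>) z))"
  by (subst edge) (simp_all add: quad edge_B, simp add: g2_def)
 have 3: "edgeC \<longleftrightarrow> (\<forall>z\<in>carrier T4. tlift4 M g3 z = tlift4 M g4 (\<rho> (i0 \<phi>) z))"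
  by (subst edge) (simp_all add: quad edge_C del: act4_pure, simp add: g3_def g4_def)
 have 4: "edgeD \<longleftrightarrow> (\<forall>z\<in>carrier T4. tlift4 M g1 z = tlift4 M g5 (\<rho> (d1 \<phi>) z))"
  by (subst edge) (simp_all add: quad edge_D, simp add: g1_def)
 have 5: "edgeE \<longleftrightarrow> (\<forall>z\<in>carrier T4. tlift4 M g5 z = tlift4 M g4 (\<rho> (d3 \<phi>) z))"
  by (subst edge) (simp_all add: quad edge_E, simp add: g5_def)
 show "edgeB ==> edgeC ==> edgeD ==> edgeE ==> edgeA" "edgeA ==> edgeC ==> edgeD ==> edgeE ==> edgeB"
 "edgeA ==> edgeB ==> edgeD ==> edgeE ==> edgeC" "edgeA ==> edgeB ==> edgeC ==> edgeE ==> edgeD"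
 "edgeA ==> edgeB ==> edgeC ==> edgeD ==> edgeE" unfolding 1 2 3 4 5 by (rule four_edges[OF act4_mod[OF hm(1-4)]]; assumption)+
qed

lemma law_edges:
 "alaw H U V W Q p1_2 p12_3 p2_3 p1_23 ==> edgeA"
 "alaw H U R X M p1_23 p123_4 p23_4 p1_234 ==> edgeB"
 "alaw H V W X T p2_3 p23_4 p3_4 p2_34 ==> edgeC"
 "alaw H P W X M p12_3 p123_4 p3_4 p12_34 ==> edgeD"
 "alaw H U V Y M p1_2 p12_34 p2_34 p1_234 ==> edgeE"
proof -
 assume a: "alaw H U V W Q p1_2 p12_3 p2_3 p1_23"
 show edgeA
 proof (intro ballI)
  fix u v w x assume [simp]: "u |: U" "v |: V" "w |: W" "x |: X"
  have "trilinear k H H H Q (%a b c. p1_23 (act U a u) (p2_3 (act V b v) (act W c w)))" by (rule trilinearI; simp add: bl lin)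
  from tlift3_comp[OF this, of M "%q. p123_4 q x"]
  show "p123_4 (p12_3 (p1_2 u v) w) x = tlift3 M (%a b c. p123_4 (p1_23 (act U a u) (p2_3 (act V b v) (act W c w))) x) \<phi>"
   using a by (simp add: alaw_def bl)
 qed
next
 assume a: "alaw H V W X T p2_3 p23_4 p3_4 p2_34"
 show edgeC
 proof (intro ballI)
  fix u v w x assume [simp]: "u |: U" "v |: V" "w |: W" "x |: X"
  have "trilinear k H H H T (%a b c. p2_34 (act V a v) (p3_4 (act W b w) (act X c x)))" by (rule trilinearI; simp add: bl lin)
  from tlift3_comp[OF this, of M "%q. p1_234 u q"]
  show "p1_234 u (p23_4 (p2_3 v w) x) = tlift3 M (%a b c. p1_234 u (p2_34 (act V a v) (p3_4 (act W b w) (act X c x)))) \<phi>"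
   using a by (simp add: alaw_def bl)
 qed
qed (simp_all add: alaw_def bl)

end

section \<open>Evaluation and coevaluation\<close>

lemma lin_hom_simps [simp]:
 "carrier (lin_hom k V W) = {L \<in> extensional (carrier V). lmap k V W L}"
 "zero (lin_hom k V W) = (\<lambda>v\<in>carrier V. \<zero>[W])"
 "add (lin_hom k V W) = (%L L'. \<lambda>v\<in>carrier V. L v \<oplus>[W] L' v)"
 "smult (lin_hom k V W) = (%r L. \<lambda>v\<in>carrier V. r \<odot>[W] L v)" by (simp_all add: lin_hom_def)

declare lin_hom_simps(1) [simp del]

lemma lin_homI: "L \<in> extensional (carrier V) ==> lmap k V W L ==> L |: lin_hom k V W" by (simp add: lin_hom_simps)
lemma lin_homD: "L |: (lin_hom k V W) ==> lmap k V W L"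
 "L |: (lin_hom k V W) ==> L \<in> extensional (carrier V)" by (simp_all add: lin_hom_simps)

lemma lin_hom_eqI: "L |: (lin_hom k V W) ==> L' |: (lin_hom k V W)
  ==> (!!v. v |: V ==> L v = L' v) ==> L = L'" using extensionalityI lin_homD(2) by metis

lemma restrict_lin_hom: "lmap k V W f ==> module k V ==> (\<lambda>v\<in>carrier V. f v) |: lin_hom k V W"
 by (rule lin_homI) (simp_all add: linear_map_cong[of V "\<lambda>v\<in>carrier V. f v" f])

lemma lin_hom_module [simp]:
 assumes V: "module k V" and W: "module k W" shows "module k (lin_hom k V W)"
proof -
 interpret V: module k V by fact
 interpret W: module k W by fact
 note c = lin_cl[OF lin_homD(1)]
 have s: "x \<oplus>[lin_hom k V W] y |: lin_hom k V W" if "x |: lin_hom k V W" "y |: lin_hom k V W" for x y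
  using restrict_lin_hom[OF linear_sum[OF W lin_homD(1)[OF that(1)] lin_homD(1)[OF that(2)]] V] by simp
 have r: "a \<odot>[lin_hom k V W] x |: lin_hom k V W" if "a |: k" "x |: lin_hom k V W" for a x
  using restrict_lin_hom[OF linear_scale[OF W lin_homD(1)[OF that(2)] that(1)] V] by simp
 have z: "\<zero>[lin_hom k V W] |: lin_hom k V W" using restrict_lin_hom[OF linear_const_zero[OF W] V] by simp
 show ?thesis
 proof (rule moduleI[OF V.R.is_cring])
  show "abelian_group (lin_hom k V W)"
  proof (rule abelian_groupI[OF s z])
   fix x assume x: "x |: lin_hom k V W"
   have "(\<ominus>[k] \<one>[k]) \<odot>[lin_hom k V W] x \<oplus>[lin_hom k V W] x = \<zero>[lin_hom k V W]"
    using c[OF x] by (auto simp: W.smult_l_minus W.l_neg)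
   moreover have "(\<ominus>[k] \<one>[k]) \<odot>[lin_hom k V W] x |: lin_hom k V W" using x by (intro r) auto
   ultimately show "\<exists>y\<in>carrier (lin_hom k V W). y \<oplus>[lin_hom k V W] x = \<zero>[lin_hom k V W]" by blast
   show "\<zero>[lin_hom k V W] \<oplus>[lin_hom k V W] x = x" by (rule lin_hom_eqI[OF s[OF z x] x]) (simp add: c[OF x])
  qed (auto simp: c W.a_ac intro!: restrict_ext)
  fix a b x y assume ab: "a |: k" "b |: k" and x: "x |: lin_hom k V W" and y: "y |: lin_hom k V W"
  show "a \<odot>[lin_hom k V W] x |: lin_hom k V W" by (rule r) fact+
  show "(a \<oplus>[k] b) \<odot>[lin_hom k V W] x = a \<odot>[lin_hom k V W] x \<oplus>[lin_hom k V W] b \<odot>[lin_hom k V W] x"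
   using ab c[OF x] by (auto simp: W.smult_l_distr intro!: restrict_ext)
  show "a \<odot>[lin_hom k V W] (x \<oplus>[lin_hom k V W] y) = a \<odot>[lin_hom k V W] x \<oplus>[lin_hom k V W] a \<odot>[lin_hom k V W] y"
   using ab c[OF x] c[OF y] by (auto simp: W.smult_r_distr intro!: restrict_ext)
  show "(a \<otimes>[k] b) \<odot>[lin_hom k V W] x = a \<odot>[lin_hom k V W] (b \<odot>[lin_hom k V W] x)"
   using ab c[OF x] by (auto simp: W.smult_assoc1 intro!: restrict_ext)
 next
  fix x assume x: "x |: lin_hom k V W"
  show "\<one>[k] \<odot>[lin_hom k V W] x = x" by (rule lin_hom_eqI[OF r[OF V.R.one_closed x] x]) (simp add: c[OF x])
 qed
qed

lemma lin_hom_eval [lin]: "v |: V ==> lmap k (lin_hom k V W) W (%L. L v)"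
 by (rule linear_mapI) (simp_all add: lin_cl[OF lin_homD(1)])
lemma lin_hom_apply: "lmap k Z (lin_hom k V W) f ==> v |: V ==> lmap k Z W (%z. f z v)"
 unfolding linear_map_def[of k Z] by (auto simp: Pi_iff lin_cl[OF lin_homD(1)])
lemma lin_hom_arg: "L |: (lin_hom k V W) ==> lmap k Z V g ==> lmap k Z W (%z. L (g z))" by (rule lin_comp[OF lin_homD(1)])
lemma lin_hom_closed: "L |: (lin_hom k V W) ==> v |: V ==> L v |: W" by (rule lin_cl[OF lin_homD(1)])

lemma linear_into_lin_hom:
 assumes "!!z. z |: Z ==> f z |: lin_hom k V W"
  "!!v. v |: V ==> lmap k Z W (%z. f z v)" and Z: "module k Z" and V: "module k V" and W: "module k W"
 shows "lmap k Z (lin_hom k V W) f"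
proof -
 interpret Z: module k Z by fact
 interpret L: module k "lin_hom k V W" using V W by simp
 note a = L.M.a_closed L.smult_closed
 show ?thesis
 proof (rule linear_mapI)
  fix x y assume xy: "x |: Z" "y |: Z"
  show "f (x \<oplus>[Z] y) = f x \<oplus>[lin_hom k V W] f y"
   by (rule lin_hom_eqI[OF assms(1)[OF Z.M.a_closed[OF xy]] a(1)[OF assms(1)[OF xy(1)] assms(1)[OF xy(2)]]])
    (simp add: linear_add[OF assms(2)] xy)
 next
  fix r x assume rx: "r |: k" "x |: Z"
  show "f (r \<odot>[Z] x) = r \<odot>[lin_hom k V W] f x"
   by (rule lin_hom_eqI[OF assms(1)[OF Z.smult_closed[OF rx]] a(2)[OF rx(1) assms(1)[OF rx(2)]]])
    (simp add: linear_smult[OF assms(2)] rx)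
 qed (rule assms(1))
qed

lemma h_hom_simps [simp]:
 "carrier (h_hom k H V W) = carrier (lin_hom k V W)" "add (h_hom k H V W) = add (lin_hom k V W)"
 "zero (h_hom k H V W) = zero (lin_hom k V W)" "smult (h_hom k H V W) = smult (lin_hom k V W)"
 "act (h_hom k H V W) h = hom_act k H V W (comult H h)" by (simp_all add: h_hom_def module.extend_def hmodule.fields_def)

context quasi_hopf_alg begin

lemma linear_h_hom:
 "lmap k (h_hom k H V W) M = lmap k (lin_hom k V W) M"
 "lmap k M (h_hom k H V W) = lmap k M (lin_hom k V W)" by (intro ext; simp add: linear_map_def)+

definition "ev V W L v = tlift3 W (%a b c. act W a (L (act V (S b *1 qalpha H *1 c) v))) \<phi>"

definition "coev U V W f u =
 (\<lambda>v\<in>carrier V. tlift3 W (%x y z. f (act U x u) (act V (y *1 qbeta H *1 S z) v)) \<psi>)"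

context
 fixes V and W
 assumes VW [simp]: "hmod k H V" "hmod k H W"
begin

abbreviation "LH == lin_hom k V W"
abbreviation "ha == hom_act k H V W"

lemma ham:
 assumes L: "L |: LH" and ab: "a |: H" "b |: H"
 shows "(\<lambda>v\<in>carrier V. act W a (L (act V (S b) v))) |: LH"
 by (rule restrict_lin_hom) (simp_all add: lin lin_hom_arg[OF L] ab)

lemma ham_bil:
 assumes L: "L |: LH"
 shows "blmap k H H LH (%a b. \<lambda>v\<in>carrier V. act W a (L (act V (S b) v)))"
 by (intro bilI linear_into_lin_hom) (simp_all add: ham L lin lin_hom_arg[OF L] lin_hom_closed[OF L])

lemma ha_pure [simp]: "L |: LH ==> a |: H ==> b |: H ==>
  ha (pH a b) L = (\<lambda>v\<in>carrier V. act W a (L (act V (S b) v)))"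
 unfolding hom_act_def by (rule tlift_H2_pure[OF ham_bil]) simp_all

lemma ha_mod: "alg_module k H2 LH ha"
proof -
 have b: "blmap k H2 LH LH ha" unfolding hom_act_def
 proof (rule bilI)
  fix u assume u: "u |: H2"
  show "lmap k LH LH (%L. tlift LH (%a b. \<lambda>v\<in>carrier V. act W a (L (act V (S b) v))) u)"
  proof (rule tlift_param[OF u])
   fix a b assume "a |: H" "b |: H"
   then show "lmap k LH LH (%L. \<lambda>v\<in>carrier V. act W a (L (act V (S b) v)))"
    by (intro linear_into_lin_hom) (simp_all add: ham lin)
  qed (simp_all add: ham_bil)
 qed (simp add: tlift_lin ham_bil)
 note cl = bil_cl[OF b]
 show ?thesis unfolding alg_module_def
 proof (intro conjI ballI)
  fix L assume L: "L |: LH"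
  show "ha \<one>\<^sub>2 L = L" by (rule lin_hom_eqI[OF cl L]) (simp_all add: tensor_one L anti(3) lin_hom_closed[OF L])
  fix x y assume x: "x |: H2" and y: "y |: H2"
  show "ha (x *2 y) L = ha x (ha y L)"
  proof (rule H2_eq[OF _ _ _ _ x, of LH])
   fix a b' assume ab: "a |: H" "b' |: H"
   show "ha (pH a b' *2 y) L = ha (pH a b') (ha y L)"
   proof (rule H2_eq[OF _ _ _ _ y, of LH])
    fix c d assume cd: "c |: H" "d |: H"
    show "ha (pH a b' *2 pH c d) L = ha (pH a b') (ha (pH c d) L)" using ham[OF L cd] ab cd
    by (auto simp: tmult_pure L anti(4) hm_mult lin_hom_closed[OF L] intro!: restrict_ext)
   qed (simp_all add: lin bil1[OF b] bil2[OF b] L ab)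
  qed (simp_all add: lin bil1[OF b] bil2[OF b] L y cl)
 qed (simp_all add: b)
qed

lemmas ha_facts = alg_moduleD[OF ha_mod]

lemma ha_eval [lin]: "lmap k Z H2 f ==> L |: LH ==> v |: V ==> lmap k Z W (%z. ha (f z) L v)"
 by (rule lin_hom_apply[OF ha_facts(1)])

lemma ha_apply:
 assumes L: "L |: LH" and v: "v |: V" and t: "t |: H2"
 shows "ha t L v = tlift W (%a b. act W a (L (act V (S b) v))) t" unfolding hom_act_def
 using tlift_linear_comp[OF ham_bil[OF L] lin_hom_apply[OF linear_id v] _ _ _ _ t] v by simp

lemma hm_hom [simp]: "hmod k H (h_hom k H V W)"
proof -
 have mod: "module k (h_hom k H V W)" by (rule module_cong[of LH]) simp_all
 have "blmap k H LH LH (%h. ha (\<Delta> h))" by (rule bilI) (simp_all add: ha_facts lin)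
 then have "blmap k H (h_hom k H V W) (h_hom k H V W) (act (h_hom k H V W))"
  unfolding bilinear_map_def by (simp add: linear_h_hom)
 then show ?thesis unfolding h_module_def using mod by (simp add: alg_homD[OF comult_hom] ha_facts)
qed

lemma hom_pairing_bil:
 assumes L: "L |: LH" and v: "v |: V"
 shows "blmap k H H W (%a x. act W a (L (act V x v)))" by (rule bilI) (simp_all add: lin lin_hom_arg[OF L] lin_hom_closed[OF L] v)

abbreviation "evt t L v == tlift3 W (%a b c. act W a (L (act V (S b *1 qalpha H *1 c) v))) t"

lemma evt_tri: "L |: LH ==> v |: V ==>
 trilinear k H H H W (%a b c. act W a (L (act V (S b *1 qalpha H *1 c) v)))" by (rule EZ_tri(1)[OF _ hom_pairing_bil]) simp_all

lemma ev_bil: "blmap k LH V W (ev V W)" unfolding ev_def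
proof (rule bilI)
 have 1: "lmap k Z W (%z. tlift3 W (g z) \<phi>)"
  if "module k Z" "!!z. z |: Z ==> trilinear k H H H W (g z)"
   "!!x y w. x |: H ==> y |: H ==> w |: H ==> lmap k Z W (%z. g z x y w)"
  for g and Z :: "('k, 'z, 'zz) module_scheme" unfolding tlift3_def
 proof (rule tlift_param[OF phi_closed(1)])
  fix x s assume x: "x |: H" and s: "s |: H2"
  show "lmap k Z W (%z. tlift W (g z x) s)" by (rule tlift_param[OF s]) (simp_all add: that x trilinearD(2)[OF that(2)])
 qed (simp_all add: that trilinear_inner)
 fix v assume v: "v |: V"
 show "lmap k LH W (%L. evt \<phi> L v)" by (rule 1) (simp_all add: evt_tri v lin)
next
 have 1: "lmap k Z W (%z. tlift3 W (g z) \<phi>)"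
  if "module k Z" "!!z. z |: Z ==> trilinear k H H H W (g z)"
   "!!x y w. x |: H ==> y |: H ==> w |: H ==> lmap k Z W (%z. g z x y w)"
  for g and Z :: "('k, 'z, 'zz) module_scheme" unfolding tlift3_def
 proof (rule tlift_param[OF phi_closed(1)])
  fix x s assume x: "x |: H" and s: "s |: H2"
  show "lmap k Z W (%z. tlift W (g z x) s)" by (rule tlift_param[OF s]) (simp_all add: that x trilinearD(2)[OF that(2)])
 qed (simp_all add: that trilinear_inner)
 fix L assume L: "L |: LH"
 show "lmap k V W (evt \<phi> L)" by (rule 1) (simp_all add: evt_tri L lin lin_hom_arg[OF L])
qed

lemma evt_ha:
 assumes L: "L |: LH" and v: "v |: V" and s: "s |: H2" and b: "b |: H" and t: "t |: H3"
 shows "evt t (ha s L) (act V b v) = evt (t *3 tassoc k H H H (pure k H2 H s b)) L v"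
proof (rule H3_eq[where M = W, OF _ _ _ _ t])
 note tr = evt_tri[OF L v] evt_tri[OF ha_facts(4)[OF s L] hm_closed[OF VW(1) b v]]
 note Lt = lin_comp[OF tlift3_lin[OF tr(1)]]
 show "lmap k H3 W (%t. evt t (ha s L) (act V b v))" using tlift3_lin[OF tr(2)] by simp
 show "lmap k H3 W (%t. evt (t *3 tassoc k H H H (pure k H2 H s b)) L v)" by (simp add: lin Lt s b)
 fix x y z assume xyz: "x |: H" "y |: H" "z |: H"
 have "act W x (ha s L (act V (S y *1 qalpha H *1 z) (act V b v)))
  = evt (pH2 x (pH y z) *3 tassoc k H H H (pure k H2 H s b)) L v" by (rule H2_eq[OF _ _ _ _ s, of W])
   (simp_all add: lin Lt L v b xyz ha_facts tmult_pure tlift_H3_pure[OF tr(1)] anti(4) hm_mult[symmetric] lin_hom_closed[OF L] H.m_assoc)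
 then show "evt (pH2 x (pH y z)) (ha s L) (act V b v)
  = evt (pH2 x (pH y z) *3 tassoc k H H H (pure k H2 H s b)) L v" using xyz by (simp add: tlift_H3_pure[OF tr(2)])
qed simp

lemma ev_equivariant: "equivar k H (h_hom k H V W) V W (ev V W)"
proof (rule equivariantI)
 show bb: "blmap k (h_hom k H V W) V W (ev V W)" using ev_bil unfolding bilinear_map_def by (simp add: linear_h_hom)
 fix h L v assume h: "h |: H" and "L |: h_hom k H V W" and v: "v |: V"
 then have L: "L |: LH" by simp
 note Lt = lin_comp[OF tlift3_lin[OF evt_tri[OF L v]]]
 have "twprod (h_hom k H V W) V W t (ev V W) L v = evt (\<phi> *3 e1 t) L v" if t: "t |: H2" for t
  by (rule H2_eq[OF _ _ _ _ t, of W])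
   (simp_all add: lin twprod_lin[OF bb] L v Lt twprod_pure[OF bb], simp add: ev_def evt_ha L v)
 then have "twprod (h_hom k H V W) V W (\<Delta> h) (ev V W) L v = evt (e2 (\<Delta> h) *3 \<phi>) L v"
  using h by (simp add: coassoc)
 also have "... = tlift3 W (%a b c. act W (h *1 a) (L (act V (S b *1 qalpha H *1 c) v))) \<phi>"
  using EZ_e2(1)[OF _ hom_pairing_bil[OF L v], of \<phi> "\<Delta> h"] h by (simp add: counit_comult)
 also have "... = tlift3 W (%a b c. act W h (act W a (L (act V (S b *1 qalpha H *1 c) v)))) \<phi>"
  unfolding tlift3_def using h L v
  by (intro tlift_cong[OF H_mod mod234(1)] tlift_cong[OF H_mod H_mod]) (simp_all add: hm_mult lin_hom_closed[OF L])
 also have "... = act W h (ev V W L v)"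
  unfolding ev_def using h by (intro tlift3_comp[OF evt_tri[OF L v], symmetric]) (simp_all add: lin)
 finally show "act W h (ev V W L v) = twprod (h_hom k H V W) V W (\<Delta> h) (ev V W) L v" ..
qed

end

lemma psi_counit: "\<kappa> \<psi> = \<one>\<^sub>2" "\<kappa>3 \<psi> = \<one>\<^sub>2"
proof -
 have "f \<psi> = \<one>\<^sub>2" if f: "algebra_hom k H3 H2 f" and "f \<phi> = \<one>\<^sub>2" for f
 proof -
  have "f \<psi> = f \<phi> *2 f \<psi>" using that alg_homD(4)[OF f, of \<psi>] by simp
  also have "... = \<one>\<^sub>2" by (simp add: alg_homD(3)[OF f, symmetric] alg_homD(2)[OF f])
  finally show ?thesis .
 qed
 then show "\<kappa> \<psi> = \<one>\<^sub>2" "\<kappa>3 \<psi> = \<one>\<^sub>2" using kappa_hom kappa_phi kappa3_hom kappa3_phi by blast+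
qed

lemma P_e2: "t |: H3 ==> u |: H2 ==>
  \<P> (qbeta H) (qalpha H) (e2 u *3 t) = counit_r u *1 \<P> (qbeta H) (qalpha H) t"
 and Q_e2: "t |: H3 ==> u |: H2 ==>
  \<Q> (qalpha H) (qbeta H) (t *3 e2 u) = S (counit_r u) *1 \<Q> (qalpha H) (qbeta H) t"
proof -
 assume t: "t |: H3" and u: "u |: H2"
 have bil: "blmap k H H H (%x y. x *1 c *1 y)" "blmap k H H H (%x y. S x *1 c *1 y)"
  if "c |: H" for c by (rule bilI; simp add: lin that)+
 have c: "counit_r u |: H" using u by simp
 have "\<E> H (%x. (*1) (counit_r u *1 x *1 qbeta H)) (qalpha H) t
   = tlift3 H (%x y z. counit_r u *1 (x *1 qbeta H *1 S y *1 qalpha H *1 z)) t"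
  "\<Z> H (%x. (*1) (S (x *1 counit_r u) *1 qalpha H)) (qbeta H) t
   = tlift3 H (%x y z. S (counit_r u) *1 (S x *1 qalpha H *1 y *1 qbeta H *1 S z)) t" unfolding tlift3_def using c
  by (rule_tac tlift_cong[OF H_mod mod234(1) t], rule_tac tlift_cong[OF H_mod H_mod]; simp add: H.m_assoc anti(4))+
 then show "\<P> (qbeta H) (qalpha H) (e2 u *3 t) = counit_r u *1 \<P> (qbeta H) (qalpha H) t"
  "\<Q> (qalpha H) (qbeta H) (t *3 e2 u) = S (counit_r u) *1 \<Q> (qalpha H) (qbeta H) t"
  using EZ_e2(1)[OF H_mod bil(1)[OF ab(2)] t u] EZ_e2(2)[OF H_mod bil(2)[OF ab(1)] t u]
   tlift3_comp[OF PQ_tri(1), of "qbeta H" "qalpha H" H "%y. counit_r u *1 y" t]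
   tlift3_comp[OF PQ_tri(2), of "qalpha H" "qbeta H" H "%y. S (counit_r u) *1 y" t] c by (simp_all add: PQ_EZ[symmetric] t u lin)
qed

text \<open>
 The two triangle identities: the functionals \<open>\<Theta>\<close> and \<open>\<Omega>\<close> on \<open>H\<^sup>\<otimes>\<^sup>4\<close> are evaluated on the two
 elements \<open>(\<Delta> \<otimes> id \<otimes> id)(\<phi>) (\<phi>\<inverse> \<otimes> 1)\<close> and \<open>(\<phi> \<otimes> 1) (\<Delta> \<otimes> id \<otimes> id)(\<phi>\<inverse>)\<close>, which the pentagon
 rewrites into products whose factors are absorbed one after the other.
\<close>

lemma pentagon_variants:
 "d1 \<phi> *4 i4 \<psi> = d3 \<psi> *4 (i0 \<phi> *4 d2 \<phi>)"
 "i4 \<phi> *4 d1 \<psi> = d2 \<psi> *4 (i0 \<psi> *4 d3 \<phi>)"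
proof -
 have inv: "f \<phi> *4 f \<psi> = \<one>\<^sub>4" "f \<psi> *4 f \<phi> = \<one>\<^sub>4"
  if "algebra_hom k H3 H4 f" for f using alg_homD[OF that] by (simp_all add: alg_homD(3)[OF that, symmetric])
 have c: "f \<psi> *4 (f \<phi> *4 z) = z" "f \<phi> *4 (f \<psi> *4 z) = z"
  if "algebra_hom k H3 H4 f" "z |: H4" for f z using that alg_homD(4)[OF that(1)] by (simp_all add: H4.m_assoc[symmetric] inv)
 have "d1 \<phi> *4 i4 \<psi> = d3 \<psi> *4 (d3 \<phi> *4 d1 \<phi>) *4 i4 \<psi>" by (simp add: H4.m_assoc c[OF d3_hom])
 then show "d1 \<phi> *4 i4 \<psi> = d3 \<psi> *4 (i0 \<phi> *4 d2 \<phi>)"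
  unfolding pentagon by (simp add: H4.m_assoc inv[OF i4_hom])
 have "i4 \<phi> *4 d1 \<psi> = d2 \<psi> *4 (i0 \<psi> *4 ((i0 \<phi> *4 d2 \<phi> *4 i4 \<phi>) *4 d1 \<psi>))"
  by (simp add: H4.m_assoc c[OF i0_hom] c[OF d2_hom])
 then show "i4 \<phi> *4 d1 \<psi> = d2 \<psi> *4 (i0 \<psi> *4 d3 \<phi>)"
  unfolding pentagon[symmetric] by (simp add: H4.m_assoc inv[OF d1_hom])
qed

context
 fixes V and W
  and U and f
 assumes VW [simp]: "hmod k H V" "hmod k H W" "hmod k H U" and f: "equivar k H U V W f"
begin

lemmas fb = eqvD(1)[OF f]
lemmas fl = bil1[OF fb] bil2[OF fb] bil_cl[OF fb]

lemma copairing_bil: "u |: U ==> v |: V ==> blmap k H H W (%x y. f (act U x u) (act V y v))" by (rule bilI) (simp_all add: lin fl)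

abbreviation "cot s u v == tlift3 W (%x y z. f (act U x u) (act V (y *1 qbeta H *1 S z) v)) s"

lemma cot_tri: "u |: U ==> v |: V ==>
 trilinear k H H H W (%x y z. f (act U x u) (act V (y *1 qbeta H *1 S z) v))" by (rule EZ_tri(2)[OF _ copairing_bil]) simp_all

lemma cot_lin:
 assumes s: "s |: H3"
 shows "v |: V ==> lmap k U W (%u. cot s u v)" "u |: U ==> lmap k V W (%v. cot s u v)"
proof -
 have 1: "lmap k Z W (%z. tlift3 W (g z) s)"
  if "module k Z" "!!z. z |: Z ==> trilinear k H H H W (g z)"
   "!!x y w. x |: H ==> y |: H ==> w |: H ==> lmap k Z W (%z. g z x y w)"
  for g and Z :: "('k, 'z, 'zz) module_scheme" unfolding tlift3_def
 proof (rule tlift_param[OF s])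
  fix x s assume x: "x |: H" and s: "s |: H2"
  show "lmap k Z W (%z. tlift W (g z x) s)" by (rule tlift_param[OF s]) (simp_all add: that x trilinearD(2)[OF that(2)])
 qed (simp_all add: that trilinear_inner)
 show "v |: V ==> lmap k U W (%u. cot s u v)" by (rule 1) (simp_all add: cot_tri lin fl)
 have 1: "lmap k Z W (%z. tlift3 W (g z) s)"
  if "module k Z" "!!z. z |: Z ==> trilinear k H H H W (g z)"
   "!!x y w. x |: H ==> y |: H ==> w |: H ==> lmap k Z W (%z. g z x y w)"
  for g and Z :: "('k, 'z, 'zz) module_scheme" unfolding tlift3_def
 proof (rule tlift_param[OF s])
  fix x s assume x: "x |: H" and s: "s |: H2"
  show "lmap k Z W (%z. tlift W (g z x) s)" by (rule tlift_param[OF s]) (simp_all add: that x trilinearD(2)[OF that(2)])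
 qed (simp_all add: that trilinear_inner)
 show "u |: U ==> lmap k V W (%v. cot s u v)" by (rule 1) (simp_all add: cot_tri lin fl)
qed

lemma coev_closed: "u |: U ==> coev U V W f u |: lin_hom k V W"
 unfolding coev_def by (rule restrict_lin_hom) (simp_all add: cot_lin)

lemma coev_linear: "lmap k U (h_hom k H V W) (coev U V W f)" unfolding linear_h_hom
 by (rule linear_into_lin_hom) (simp_all add: coev_closed, simp add: coev_def cot_lin)

lemma coev_equivariant:
 assumes h: "h |: H" and u: "u |: U"
 shows "coev U V W f (act U h u) = act (h_hom k H V W) h (coev U V W f u)"
proof (rule lin_hom_eqI[OF coev_closed])
 have cl: "coev U V W f u |: lin_hom k V W" by (rule coev_closed[OF u])
 show "act U h u |: U" using h u by simp
 show "act (h_hom k H V W) h (coev U V W f u) |: lin_hom k V W" using alg_moduleD(4)[OF ha_mod[OF VW(1,2)]] h cl by simp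
 fix v assume v: "v |: V"
 note Lt = lin_comp[OF tlift3_lin[OF cot_tri[OF u v]]]
 have 1: "twprod U V W \<sigma> f (act U x u) (act V (y *1 qbeta H *1 S z *1 S b) v)
   = cot (tassoc k H H H (pure k H2 H \<sigma> b) *3 pH2 x (pH y z)) u v"
  if \<sigma>: "\<sigma> |: H2" and "b |: H" "x |: H" "y |: H" "z |: H" for \<sigma> b x y z
  by (rule H2_eq[OF _ _ _ _ \<sigma>, of W])
   (simp_all add: lin twprod_lin[OF fb] u v that Lt twprod_pure[OF fb] tmult_pure tlift_H3_pure[OF cot_tri]
    anti(4) hm_mult[symmetric] H.m_assoc)
 have 2: "act W a (cot s u (act V (S b) v)) = cot (tassoc k H H H (pure k H2 H (\<Delta> a) b) *3 s) u v"
  if s: "s |: H3" and ab: "a |: H" "b |: H" for a b s by (rule H3_eq[where M = W, OF _ _ _ _ s])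
   (simp_all add: lin u v ab Lt lin_comp[OF tlift3_lin[OF cot_tri]] tlift3_lin[OF cot_tri] tlift_H3_pure[OF cot_tri] eqvD(2)[OF f]
    hm_mult[symmetric] 1)
 have bil: "blmap k H H W (%a b. act W a (cot s u (act V (S b) v)))" if "s |: H3" for s
  by (rule bilI) (use that in "simp_all add: lin u v lin_comp[OF cot_lin(2)] lin_cl[OF cot_lin(2)]")
 have 3: "tlift W (%a b. act W a (cot s u (act V (S b) v))) t = cot (e1 t *3 s) u v"
  if s: "s |: H3" and t: "t |: H2" for s t by (rule H2_eq[OF _ _ _ _ t, of W])
   (simp_all add: tlift_lin bil s lin Lt tlift_H2_pure[OF bil] 2)
 have "act (h_hom k H V W) h (coev U V W f u) v = tlift W (%a b. act W a (coev U V W f u (act V (S b) v))) (\<Delta> h)"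
  using ha_apply[OF VW(1,2) cl v, of "\<Delta> h"] h by simp
 also have "... = tlift W (%a b. act W a (cot \<psi> u (act V (S b) v))) (\<Delta> h)"
  using h v by (intro tlift_cong[OF H_mod H_mod]) (simp_all add: coev_def)
 also have "... = cot (\<psi> *3 e2 (\<Delta> h)) u v" using h by (simp add: 3 coassoc_inv)
 also have "... = tlift3 W (%x y z. f (act U (x *1 h) u) (act V (y *1 qbeta H *1 S z) v)) \<psi>"
  using EZ_e2(2)[OF _ copairing_bil[OF u v], of \<psi> "\<Delta> h"] h by (simp add: counit_comult)
 also have "... = coev U V W f (act U h u) v" unfolding coev_def tlift3_def using h u v
  by simp (intro tlift_cong[OF H_mod mod234(1)] tlift_cong[OF H_mod H_mod]; simp add: hm_mult)
 finally show "coev U V W f (act U h u) v = act (h_hom k H V W) h (coev U V W f u) v" ..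
qed

end

end

context quasi_hopf_alg begin

lemma tlift3_cong:
 assumes "t |: H3"
  "!!a b c. a |: H ==> b |: H ==> c |: H ==> f a b c = g a b c"
 shows "tlift3 M f t = tlift3 M g t" unfolding tlift3_def
 by (rule tlift_cong[OF H_mod mod234(1) assms(1)], rule tlift_cong[OF H_mod H_mod]) (simp_all add: assms(2))

lemma PQ_H3_lin:
 "lmap k H3 H (\<P> (qbeta H) (qalpha H))" "lmap k H3 H (\<Q> (qalpha H) (qbeta H))" by (simp_all add: PQ_lin)

context
 fixes V and W
  and U and f
 assumes VW [simp]: "hmod k H V" "hmod k H W" "hmod k H U" and f: "equivar k H U V W f"
begin

theorem ev_coev:
 assumes u: "u |: U" and v: "v |: V"
 shows "ev V W (coev U V W f u) v = f u v"
proof -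
 note fb = eqvD(1)[OF f]
 note fl = bil1[OF fb] bil2[OF fb] bil_cl[OF fb]
 let ?P = "\<P> (qbeta H) (qalpha H)"
 define \<Theta> where "\<Theta> = tlift W (%a x. f (act U a u) (act V (?P x) v))"
 have bil: "blmap k H H3 W (%a x. f (act U a u) (act V (?P x) v))" by (rule bilI) (simp_all add: lin fl u v PQ_H3_lin)
 have \<Theta>p: "\<Theta> (pH3 a x) = f (act U a u) (act V (?P x) v)" if "a |: H" "x |: H3" for a x
  unfolding \<Theta>_def by (rule tlift_pure_eq[OF _ _ bil]) (simp_all add: that)
 have \<Theta>l: "lmap k Z W (%z. \<Theta> (g z))" if "lmap k Z H4 g" for g and Z :: "('k, 'z, 'zz) module_scheme"
  unfolding \<Theta>_def by (rule tlift_arg[OF bil _ _ _ that]) simp_all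
 let ?c = "%s u v. tlift3 W (%x y z. f (act U x u) (act V (y *1 qbeta H *1 S z) v)) s"
 note ct = cot_tri[OF VW f] note cl = cot_lin[OF VW f]
 have 1: "twprod U V W \<sigma> f (act U x u) (act V (y *1 qbeta H *1 S z) (act V (S b *1 qalpha H *1 c) v))
   = \<Theta> (tassoc k H H H2 (pure k H2 H2 \<sigma> (pH b c)) *4 pH3 x (pH2 y (pH z \<one>\<^sub>1)))"
  if \<sigma>: "\<sigma> |: H2" and "x |: H" "y |: H" "z |: H" "b |: H" "c |: H" for \<sigma> x y z b c
  by (rule H2_eq[OF _ _ _ _ \<sigma>, of W])
   (simp_all add: lin \<Theta>l twprod_lin[OF fb] twprod_pure[OF fb] u v that tmult_pure \<Theta>p hm_mult[symmetric] anti(4) H.m_assoc)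
 have 2: "act W a (?c s u (act V (S b *1 qalpha H *1 c) v)) = \<Theta> (d1 (pH2 a (pH b c)) *4 i4 s)"
  if s: "s |: H3" and abc: "a |: H" "b |: H" "c |: H" for s a b c by (rule H3_eq[where M = W, OF _ _ _ _ s])
   (simp_all add: lin \<Theta>l abc u v tlift3_lin[OF ct] tlift_H3_pure[OF ct] eqvD(2)[OF f] 1 del: d1_pure, simp add: d1_pure abc 1)
 have tr: "trilinear k H H H W (%a b c. act W a (?c s u (act V (S b *1 qalpha H *1 c) v)))" if s: "s |: H3" for s
  by (rule trilinearI) (simp_all add: lin lin_comp[OF cl(2)] lin_cl[OF cl(2)] u v s)
 have 3: "tlift3 W (%a b c. act W a (?c s u (act V (S b *1 qalpha H *1 c) v))) t = \<Theta> (d1 t *4 i4 s)"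
  if s: "s |: H3" and t: "t |: H3" for s t by (rule H3_eq[where M = W, OF _ _ _ _ t])
   (simp_all add: lin \<Theta>l s tlift3_lin[OF tr] tlift_H3_pure[OF tr] 2 del: d1_pure)
 have "ev V W (coev U V W f u) v = tlift3 W (%a b c. act W a (?c \<psi> u (act V (S b *1 qalpha H *1 c) v))) \<phi>"
  unfolding ev_def by (rule tlift3_cong) (simp_all add: coev_def u v)
 also have "... = \<Theta> (d3 \<psi> *4 (i0 \<phi> *4 d2 \<phi>))" by (simp add: 3 pentagon_variants)
 also have "... = \<Theta> (i0 \<phi> *4 d2 \<phi>)"
 proof -
  have "\<Theta> (d3 s *4 y) = \<Theta> (j33 (\<kappa>3 s) *4 y)" if s: "s |: H3" and y: "y |: H4" for s y
  proof (rule tensor_eq[OF H_mod mod234(2) _ _ hm_mod[OF VW(2)] _ y])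
   fix a' x assume ax: "a' |: H" "x |: H3"
   show "\<Theta> (d3 s *4 pH3 a' x) = \<Theta> (j33 (\<kappa>3 s) *4 pH3 a' x)"
   proof (rule tensor_eq[OF H_mod mod234(1) _ _ hm_mod[OF VW(2)] _ s])
    fix a t assume at: "a |: H" "t |: H2"
    have "?P (pH2 c \<one>\<^sub>2 *3 x) = c *1 ?P x" if c: "c |: H" for c by (rule H3_eq[where M = H, OF _ _ _ _ ax(2)])
    (simp_all add: lin c PQ_lin tensor_one tmult_pure H.m_assoc)
    then show "\<Theta> (d3 (pH2 a t) *4 pH3 a' x) = \<Theta> (j33 (\<kappa>3 (pH2 a t)) *4 pH3 a' x)"
    using at ax by (simp add: kappa3_pure tmult_pure \<Theta>p P_e2)
   qed (simp_all add: lin \<Theta>l ax lin_comp[OF alg_homD(1)[OF kappa3_hom]] lin_comp[OF alg_homD(1)[OF j33_hom]] alg_homD(1)[OF kappa3_hom])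
  qed (simp_all add: lin \<Theta>l s alg_homD(4)[OF kappa3_hom])
  from this[of \<psi> "i0 \<phi> *4 d2 \<phi>"] show ?thesis by (simp add: psi_counit alg_homD(2)[OF j33_hom])
 qed
 also have "\<Theta> (i0 \<phi> *4 d2 \<phi>) = tlift W (%a b. f (act U a u) (act V b v)) (\<kappa> \<phi>)"
 proof -
  note bb = copairing_bil[OF VW f u v]
  have "\<Theta> (i0 \<phi> *4 d2 s) = tlift W (%a b. f (act U a u) (act V b v)) (\<kappa> s)" if s: "s |: H3" for s
   by (rule tensor_eq[OF H_mod mod234(1) _ _ hm_mod[OF VW(2)] _ s])
    (simp_all add: lin \<Theta>l bb tlift_H2_pure[OF bb] tmult_pure \<Theta>p PQ_e1 antipode)
  then show ?thesis by simp
 qed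
 also have "... = f u v" using u v by (simp add: kappa_phi tensor_one tlift_H2_pure[OF copairing_bil[OF VW f u v]])
 finally show ?thesis .
qed

end

context
 fixes V and W
 assumes VW [simp]: "hmod k H V" "hmod k H W"
begin

theorem coev_ev:
 assumes L: "L |: lin_hom k V W"
 shows "coev (h_hom k H V W) V W (ev V W) L = L"
proof (rule lin_hom_eqI[OF _ L])
 note e = ev_equivariant[OF VW]
 have hh: "hmod k H (h_hom k H V W)" by (rule hm_hom[OF VW])
 show "coev (h_hom k H V W) V W (ev V W) L |: lin_hom k V W" by (rule coev_closed[OF VW hh e]) (simp add: L)
 fix v assume v: "v |: V"
 let ?Q = "\<Q> (qalpha H) (qbeta H)"
 let ?e = "%t L v. tlift3 W (%a b c. act W a (L (act V (S b *1 qalpha H *1 c) v))) t"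
 define \<Omega> where "\<Omega> = tlift W (%a x. act W a (L (act V (?Q x) v)))"
 have bil: "blmap k H H3 W (%a x. act W a (L (act V (?Q x) v)))"
  by (rule bilI) (simp_all add: lin lin_hom_arg[OF L] lin_hom_closed[OF L] v PQ_H3_lin)
 have \<Omega>p: "\<Omega> (pH3 a x) = act W a (L (act V (?Q x) v))" if "a |: H" "x |: H3" for a x
  unfolding \<Omega>_def by (rule tlift_pure_eq[OF _ _ bil]) (simp_all add: that)
 have \<Omega>l: "lmap k Z W (%z. \<Omega> (g z))" if "lmap k Z H4 g" for g and Z :: "('k, 'z, 'zz) module_scheme"
  unfolding \<Omega>_def by (rule tlift_arg[OF bil _ _ _ that]) simp_all
 note Le = lin_comp[OF tlift3_lin[OF evt_tri[OF VW L]]]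
 have 1: "?e (t *3 tassoc k H H H (pure k H2 H \<sigma> \<one>\<^sub>1)) L (act V (y *1 qbeta H *1 S z) v)
  = \<Omega> (i4 t *4 tassoc k H H H2 (pure k H2 H2 \<sigma> (pH y z)))"
  if \<sigma>: "\<sigma> |: H2" and t: "t |: H3" and yz: "y |: H" "z |: H" for \<sigma> t y z
 proof (rule H2_eq[OF _ _ _ _ \<sigma>, of W])
  fix a' b' assume ab: "a' |: H" "b' |: H"
  show "?e (t *3 tassoc k H H H (pure k H2 H (pH a' b') \<one>\<^sub>1)) L (act V (y *1 qbeta H *1 S z) v)
   = \<Omega> (i4 t *4 tassoc k H H H2 (pure k H2 H2 (pH a' b') (pH y z)))" by (rule H3_eq[where M = W, OF _ _ _ _ t])
    (simp_all add: lin \<Omega>l Le ab yz v tmult_pure tlift_H3_pure[OF evt_tri[OF VW L]] \<Omega>p anti(4) hm_mult[symmetric] H.m_assoc)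
 qed (simp_all add: lin \<Omega>l Le t yz v)
 have tr: "trilinear k H H H W (%x y z. ev V W (act (h_hom k H V W) x L) (act V (y *1 qbeta H *1 S z) v))"
  by (rule cot_tri[OF VW hh e]) (simp_all add: L v)
 have 2: "tlift3 W (%x y z. ev V W (act (h_hom k H V W) x L) (act V (y *1 qbeta H *1 S z) v)) s
  = \<Omega> (i4 \<phi> *4 d1 s)" if s: "s |: H3" for s
 proof (rule H3_eq[where M = W, OF _ _ _ _ s])
  fix x y z assume xyz: "x |: H" "y |: H" "z |: H"
  let ?w = "act V (y *1 qbeta H *1 S z) v"
  have "ev V W (hom_act k H V W (\<Delta> x) L) (act V \<one>\<^sub>1 ?w) = ?e (\<phi> *3 tassoc k H H H (pure k H2 H (\<Delta> x) \<one>\<^sub>1)) L ?w"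
   unfolding ev_def by (rule evt_ha[OF VW L]) (simp_all add: xyz v)
  then show "tlift3 W (%x y z. ev V W (act (h_hom k H V W) x L) (act V (y *1 qbeta H *1 S z) v)) (pH2 x (pH y z))
   = \<Omega> (i4 \<phi> *4 d1 (pH2 x (pH y z)))" using tlift_H3_pure[OF tr] xyz v by (simp add: 1)
 qed (simp_all add: lin \<Omega>l tlift3_lin[OF tr, simplified])
 have "coev (h_hom k H V W) V W (ev V W) L v = \<Omega> (i4 \<phi> *4 d1 \<psi>)" using 2[of \<psi>] v by (simp add: coev_def)
 also have "... = \<Omega> (d2 \<psi> *4 (i0 \<psi> *4 d3 \<phi>))" by (simp add: pentagon_variants)
 also have "... = \<Omega> (i0 \<psi> *4 d3 \<phi>)"
 proof -
  define j where "j t = tmap k H H3 id (%c. pH2 \<one>\<^sub>1 (pH \<one>\<^sub>1 c)) t" for t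
  have jl: "lmap k H H3 (%c. pH2 \<one>\<^sub>1 (pH \<one>\<^sub>1 c))" by (simp add: lin)
  have jL: "lmap k Z H4 (%z. j (g z))" if "lmap k Z H2 g" for g and Z :: "('k, 'z, 'zz) module_scheme"
   unfolding j_def by (rule tmap_comp_lin[OF alg_homD(1)[OF algebra_hom_id] jl]) (simp_all add: that)
  have jp: "j (pH a c) = pH3 a (pH2 \<one>\<^sub>1 (pH \<one>\<^sub>1 c))" if "a |: H" "c |: H" for a c
   unfolding j_def by (rule tmap_id_pure[OF jl]) (simp_all add: that)
  have jc: "t |: H2 ==> j t |: H4" for t by (rule lin_cl[OF jL[OF linear_id]])
  have "\<Omega> (d2 s *4 y) = \<Omega> (j (\<kappa> s) *4 y)" if s: "s |: H3" and y: "y |: H4" for s y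
  proof (rule tensor_eq[OF H_mod mod234(2) _ _ hm_mod[OF VW(2)] _ y])
   fix a' x assume ax: "a' |: H" "x |: H3"
   show "\<Omega> (d2 s *4 pH3 a' x) = \<Omega> (j (\<kappa> s) *4 pH3 a' x)"
   proof (rule tensor_eq[OF H_mod mod234(1) _ _ hm_mod[OF VW(2)] _ s])
    fix a t assume at: "a |: H" "t |: H2"
    have "?Q (pH2 \<one>\<^sub>1 (pH \<one>\<^sub>1 c) *3 x) = ?Q x *1 S c" if c: "c |: H" for c
    by (rule H3_eq[where M = H, OF _ _ _ _ ax(2)])
    (simp_all add: lin c PQ_lin tensor_one tmult_pure H.m_assoc anti(4))
    then show "\<Omega> (d2 (pH2 a t) *4 pH3 a' x) = \<Omega> (j (\<kappa> (pH2 a t)) *4 pH3 a' x)"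
    using at ax by (simp add: jp tmult_pure \<Omega>p PQ_e1)
   qed (simp_all add: lin \<Omega>l ax jL)
  qed (simp_all add: lin \<Omega>l s jc)
  from this[of \<psi> "i0 \<psi> *4 d3 \<phi>"] show ?thesis
   by (simp add: psi_counit tensor_one jp) (simp add: tensor_one[symmetric])
 qed
 also have "\<Omega> (i0 \<psi> *4 d3 \<phi>) = tlift W (%a b. act W a (L (act V (S b) v))) (\<kappa>3 \<phi>)"
 proof -
  have bb: "blmap k H H W (%a b. act W a (L (act V (S b) v)))"
   by (rule bilI) (simp_all add: lin lin_hom_arg[OF L] lin_hom_closed[OF L] v)
  have "\<Omega> (i0 \<psi> *4 d3 s) = tlift W (%a b. act W a (L (act V (S b) v))) (\<kappa>3 s)" if s: "s |: H3" for s
   by (rule tensor_eq[OF H_mod mod234(1) _ _ hm_mod[OF VW(2)] _ s])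
    (simp_all add: lin \<Omega>l lin_comp[OF alg_homD(1)[OF kappa3_hom]] alg_homD(1)[OF kappa3_hom] bb tlift_H2_pure[OF bb] kappa3_pure
    tmult_pure \<Omega>p Q_e2 antipode)
  then show ?thesis by simp
 qed
 also have "... = L v"
 proof -
  have bb: "blmap k H H W (%a b. act W a (L (act V (S b) v)))"
   by (rule bilI) (simp_all add: lin lin_hom_arg[OF L] lin_hom_closed[OF L] v)
  show ?thesis using v by (simp add: kappa3_phi tensor_one tlift_H2_pure[OF bb] anti(3) lin_hom_closed[OF L])
 qed
 finally show "coev (h_hom k H V W) V W (ev V W) L v = L v" .
qed

text \<open>
 By \<open>coev_ev\<close>, \<open>L\<close> is built from evaluations of its translates.
\<close>

theorem hom_eqI:
 assumes L: "L |: lin_hom k V W" "L' |: lin_hom k V W"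
  and e: "!!h v. h |: H ==> v |: V ==>
   ev V W (act (h_hom k H V W) h L) v = ev V W (act (h_hom k H V W) h L') v"
 shows "L = L'"
proof -
 have "coev (h_hom k H V W) V W (ev V W) L v = coev (h_hom k H V W) V W (ev V W) L' v" if v: "v |: V" for v
  unfolding coev_def tlift3_def using v
  by (simp del: h_hom_simps) (intro tlift_cong[OF H_mod mod234(1)] tlift_cong[OF H_mod H_mod]; simp add: e del: h_hom_simps)
 then have "L v = L' v" if "v |: V" for v using that by (simp add: coev_ev L)
 then show ?thesis by (rule lin_hom_eqI[OF L])
qed

end

subsection \<open>The adjunction\<close>

lemma equivar_cong:
 assumes e: "equivar k H U V X m" and "!!u v. u |: U ==> v |: V ==> m' u v = m u v"
  and [simp]: "hmod k H U" "hmod k H V"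
 shows "equivar k H U V X m'"
proof (rule equivariantI)
 show "blmap k U V X m'" by (rule bilinear_cong[OF eqvD(1)[OF e]]) (simp_all add: assms)
 fix h u v assume *: "h |: H" "u |: U" "v |: V"
 have "twprod U V X (\<Delta> h) m' u v = twprod U V X (\<Delta> h) m u v"
  unfolding twprod_def by (rule tlift_cong[OF H_mod H_mod]) (simp_all add: * assms(2))
 then show "act X h (m' u v) = twprod U V X (\<Delta> h) m' u v" using * eqvD(2)[OF e] assms(2) by simp
qed

lemma equivar_post:
 assumes e: "equivar k H U V X m" and g: "lmap k X Y g"
  and gh: "!!h x. h |: H ==> x |: X ==> g (act X h x) = act Y h (g x)"
  and [simp]: "hmod k H U" "hmod k H V" "hmod k H X" "hmod k H Y"
 shows "equivar k H U V Y (%u v. g (m u v))"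
proof (rule equivariantI)
 note m = eqvD(1)[OF e]
 show b: "blmap k U V Y (%u v. g (m u v))" by (rule bilI) (simp_all add: lin_comp[OF g] bil_r[OF m] bil_l[OF m])
 fix h u v assume *: "h |: H" "u |: U" "v |: V"
 have "act Y h (g (m u v)) = g (twprod U V X (\<Delta> h) m u v)" using * by (simp add: gh[symmetric] bil_cl[OF m] eqvD(2)[OF e])
 also have "... = twprod U V Y (\<Delta> h) (%u v. g (m u v)) u v"
  unfolding twprod_def by (rule tlift_linear_comp[OF twprod_bil[OF m] g]) (simp_all add: *)
 finally show "act Y h (g (m u v)) = twprod U V Y (\<Delta> h) (%u v. g (m u v)) u v" .
qed

lemma equivar_pre:
 assumes e: "equivar k H U V X m" and f: "lmap k U' U f" and g: "lmap k V' V g"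
  and fh: "!!h u. h |: H ==> u |: U' ==> f (act U' h u) = act U h (f u)"
  and gh: "!!h u. h |: H ==> u |: V' ==> g (act V' h u) = act V h (g u)"
  and [simp]: "hmod k H U" "hmod k H V" "hmod k H U'" "hmod k H V'"
 shows "equivar k H U' V' X (%u v. m (f u) (g v))"
proof (rule equivariantI)
 note m = eqvD(1)[OF e]
 show "blmap k U' V' X (%u v. m (f u) (g v))" by (rule bilI) (simp_all add: bil1[OF m f] bil2[OF m g] lin_cl[OF f] lin_cl[OF g])
 fix h u v assume *: "h |: H" "u |: U'" "v |: V'"
 have "twprod U' V' X (\<Delta> h) (%u v. m (f u) (g v)) u v = twprod U V X (\<Delta> h) m (f u) (g v)"
  unfolding twprod_def by (rule tlift_cong[OF H_mod H_mod]) (simp_all add: * fh gh)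
 then show "act X h (m (f u) (g v)) = twprod U' V' X (\<Delta> h) (%u v. m (f u) (g v)) u v"
  using * eqvD(2)[OF e] lin_cl[OF f] lin_cl[OF g] by simp
qed

context
 fixes V and W
 assumes VW [simp]: "hmod k H V" "hmod k H W"
begin

text \<open>
 For an equivariant product the translates of \<open>m u x\<close> are sums of values of \<open>m\<close>, so that \<open>hom_eqI\<close>
 needs evaluations of values only. Identities between internal homs are proved in this way.
\<close>

lemma products_into_hom_eq:
 assumes m: "equivar k H U X (h_hom k H V W) m" "equivar k H U X (h_hom k H V W) m'"
  and hm [simp]: "hmod k H U" "hmod k H X"
  and e: "!!u x v. u |: U ==> x |: X ==> v |: V ==> ev V W (m u x) v = ev V W (m' u x) v"
  and ux: "u |: U" "x |: X"
 shows "m u x = m' u x"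
proof (rule hom_eqI[OF VW])
 note b = m[THEN eqvD(1)]
 show "m u x |: lin_hom k V W" "m' u x |: lin_hom k V W" using bil_cl[OF b(1) ux] bil_cl[OF b(2) ux] by simp_all
 fix h v assume h: "h |: H" and v: "v |: V"
 note ee = bil_l[OF ev_bil[OF VW] v]
 have *: "ev V W (twprod U X (h_hom k H V W) t m u x) v = ev V W (twprod U X (h_hom k H V W) t m' u x) v"
  if t: "t |: H2" for t by (rule H2_eq[OF _ _ _ _ t, of W])
   (simp_all add: lin_comp[OF ee] twprod_lin[OF b(1)] twprod_lin[OF b(2)] linear_h_hom[symmetric] linear_id ux e v twprod_pure[OF b(1)] twprod_pure[OF b(2)])
 show "ev V W (act (h_hom k H V W) h (m u x)) v = ev V W (act (h_hom k H V W) h (m' u x)) v"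
  using h * ux by (simp only: eqvD(2)[OF m(1)] eqvD(2)[OF m(2)] comult_closed)
qed

lemma alaw_into_hom:
 assumes e: "equivar k H U X P m1" "equivar k H P Y (h_hom k H V W) m2" "equivar k H X Y Q m3"
   "equivar k H U Q (h_hom k H V W) m4"
  and hm [simp]: "hmod k H U" "hmod k H X" "hmod k H Y" "hmod k H P" "hmod k H Q"
  and ev: "!!u x y v. u |: U ==> x |: X ==> y |: Y ==> v |: V ==>
   ev V W (m2 (m1 u x) y) v = tlift3 W (%a b c. ev V W (m4 (act U a u) (m3 (act X b x) (act Y c y))) v) \<phi>"
 shows "alaw H U X Y (h_hom k H V W) m1 m2 m3 m4"
proof -
 let ?H = "h_hom k H V W"
 note b = e[THEN eqvD(1)]
 note t = tri_l[OF b(1,2)] tri_r[OF b(3,4)]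
 have hh: "hmod k H ?H" by simp
 let ?T = "tensor k U (tensor k X Y)"
 let ?G1 = "tlift3 ?H (%u v w. m2 (m1 u v) w)"
 let ?G2 = "tlift3 ?H (%u v w. m4 u (m3 v w))"
 note L1 = lin_comp[OF tlift3_lin[OF t(1)]] and L2 = lin_comp[OF tlift3_lin[OF t(2)]]
 note cl1 = lin_cl[OF L1[OF _ _ _ _ linear_id]] and cl2 = lin_cl[OF L2[OF _ _ _ _ linear_id]]
 have eq: "ev V W (?G1 z) v = ev V W (?G2 (act3 k U X Y \<phi> z)) v" if v: "v |: V" and z: "z |: ?T" for v z
 proof (rule tensor3_eq[where M = W, OF _ _ _ _ _ _ _ z])
  have ee: "lmap k ?H W (%L. ev V W L v)" using bil_l[OF ev_bil[OF VW] v] by (simp add: linear_h_hom)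
  show "lmap k ?T W (%z. ev V W (?G1 z) v)" by (rule lin_comp[OF ee]) (simp add: L1 lin)
  show "lmap k ?T W (%z. ev V W (?G2 (act3 k U X Y \<phi> z)) v)" by (rule lin_comp[OF ee]) (simp add: L2 lin)
  fix u x y assume uxy: "u |: U" "x |: X" "y |: Y"
  have "ev V W (nested_r U X Y ?H m3 m4 \<phi> u x y) v
   = tlift3 W (%a b c. ev V W (m4 (act U a u) (m3 (act X b x) (act Y c y))) v) \<phi>"
   by (rule tlift3_comp[OF act_trilinear[OF t(2)] ee]) (simp_all add: uxy)
  then show "ev V W (?G1 (pure3 k U X Y u x y)) v
   = ev V W (?G2 (act3 k U X Y \<phi> (pure3 k U X Y u x y))) v"
   using uxy by (simp add: tlift3_pure[OF t(1)] tlift3_act[OF t(2), symmetric] ev v)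
 qed simp_all
 have "?G1 z = ?G2 (act3 k U X Y \<phi> z)" if z: "z |: ?T" for z
 proof (rule hom_eqI[OF VW])
  show "?G1 z |: lin_hom k V W" "?G2 (act3 k U X Y \<phi> z) |: lin_hom k V W" using cl1 cl2 z by simp_all
  fix h v assume h: "h |: H" and v: "v |: V"
  have "act ?H h (?G1 z) = ?G1 (act3 k U X Y (e1 (\<Delta> h)) z)"
   by (rule nested_left_equivariant[OF e(1,2)]) (simp_all add: h z)
  moreover have "act ?H h (?G2 (act3 k U X Y \<phi> z)) = ?G2 (act3 k U X Y (e2 (\<Delta> h)) (act3 k U X Y \<phi> z))"
   by (rule nested_right_equivariant[OF e(3,4)]) (simp_all add: h z)
  moreover have "act3 k U X Y (e2 (\<Delta> h)) (act3 k U X Y \<phi> z) = act3 k U X Y \<phi> (act3 k U X Y (e1 (\<Delta> h)) z)"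
   using h z by (simp add: act234_mult[symmetric] coassoc)
  ultimately show "ev V W (act ?H h (?G1 z)) v = ev V W (act ?H h (?G2 (act3 k U X Y \<phi> z))) v"
   using eq[OF v, of "act3 k U X Y (e1 (\<Delta> h)) z"] h z by (simp del: h_hom_simps)
 qed
 then show ?thesis by (subst alaw_tlift[OF b]) simp_all
qed

end

definition "compose_hom V W X M L =
 coev (h_tensor k H (h_hom k H W X) (h_hom k H V W)) V X
  (complete_left (h_hom k H W X) (h_hom k H V W) V X (ev V W) (ev W X))
  (pure k (h_hom k H W X) (h_hom k H V W) M L)"

text \<open>
 The composition is the product determined by the law \<open>(M \<bullet> L) v = (\<phi>\<^sub>1 M) ((\<phi>\<^sub>2 L) (\<phi>\<^sub>3 v))\<close> for evaluations, as the
 adjunct of the completed product.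
\<close>

context
 fixes V and W
  and X
 assumes VWX [simp]: "hmod k H V" "hmod k H W" "hmod k H X"
begin

abbreviation "hM == h_hom k H W X"
abbreviation "hL == h_hom k H V W"
abbreviation "comp_n == complete_left hM hL V X (ev V W) (ev W X)"

lemma comp_n_eq: "equivar k H (h_tensor k H hM hL) V X comp_n"
 by (rule complete_left_equivariant[where Q = W]) (simp_all add: ev_equivariant)

lemma compose_equivariant: "equivar k H hM hL (h_hom k H V X) (compose_hom V W X)" unfolding compose_hom_def
 by (rule equivar_post[OF pure_equivariant])
  (simp_all add: coev_linear[OF _ _ _ comp_n_eq] coev_equivariant[OF _ _ _ comp_n_eq, simplified])

lemma compose_law: "alaw H hM hL V X (compose_hom V W X) (ev V X) (ev V W) (ev W X)" unfolding alaw_def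
proof (intro ballI)
 fix M L v assume "M |: hM" "L |: hL" "v |: V"
 then show "ev V X (compose_hom V W X M L) v = nested_r hM hL V X (ev V W) (ev W X) \<phi> M L v" unfolding compose_hom_def
  by (subst ev_coev[OF _ _ _ comp_n_eq])
   (simp_all add: complete_left_pure[OF _ _ _ _ _ ev_equivariant ev_equivariant] pure_in)
qed

end

lemma h_ev_eq: "hmod k H A ==> hmod k H B ==> h_ev H A B = tlift B (ev A B)"
 unfolding h_ev_def ev_def[abs_def] by (intro ext) simp

lemma h_assoc_eq:
 assumes [simp]: "hmod k H V" "hmod k H W" "hmod k H X" and t: "t |: (tensor k (tensor k V W) X)"
 shows "h_assoc k H V W X t = act3 k V W X \<phi> (tassoc k V W X t)"
proof -
 let ?T = "tensor k V (tensor k W X)" let ?s = "tassoc k V W X t"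
 have s: "?s |: ?T" using t by (simp add: lin)
 have "two_alg_modules k H H2 V (tensor k W X) (act V) (act2 k W X)" "two_alg_modules k H H W X (act W) (act X)"
  by (simp_all add: two_alg_modules_def hm_alg act2_mod)
 note 1 = two_alg_modules.act_pure1[OF this(1)] two_alg_modules.act_pure1[OF this(2)]
 have "h_assoc k H V W X t = tlift3 ?T (%a b c. act3 k V W X (pH2 a (pH b c)) ?s) \<phi>" unfolding h_assoc_def
 proof (rule tlift3_cong[OF phi_closed(1)])
  fix a b c assume abc: "a |: H" "b |: H" "c |: H"
  have "act3 k V W X (pH2 a (pH b c)) ?s = tmap k V (tensor k W X) (act V a) (act2 k W X (pH b c)) ?s"
   unfolding act3_def by (rule 1(1)) (simp_all add: abc s)
  also have "... = tmap k V (tensor k W X) (act V a) (tmap k W X (act W b) (act X c)) ?s"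
   by (rule tmap_cong[of V _ _ "tensor k W X"]) (simp_all add: s act2_tensor_act 1(2) abc)
  finally show "tmap k V (tensor k W X) (act V a) (tmap k W X (act W b) (act X c)) ?s = act3 k V W X (pH2 a (pH b c)) ?s" ..
 qed
 also have "... = act3 k V W X \<phi> ?s"
 proof -
  have tr: "trilinear k H H H ?T (%a b c. act3 k V W X (pH2 a (pH b c)) ?s)" by (rule trilinearI) (simp_all add: lin s)
  show ?thesis by (rule H3_eq[where M = ?T, OF _ _ _ _ phi_closed(1)])
    (simp_all add: tlift3_lin[OF tr] tlift_H3_pure[OF tr] lin s)
 qed
 finally show ?thesis .
qed

text \<open>
 The composition is a definite description; the adjunction provides the witness, and
 \<open>hom_eqI\<close> the uniqueness.
\<close>

lemma h_comp_eq:
 assumes [simp]: "hmod k H V" "hmod k H W" "hmod k H X"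
  and memb: "M |: h_hom k H W X" "L |: h_hom k H V W"
 shows "h_comp k H V W X (pure k (h_hom k H W X) (h_hom k H V W) M L) = compose_hom V W X M L"
proof -
 let ?hM = "h_hom k H W X" and ?hL = "h_hom k H V W" and ?hN = "h_hom k H V X"
 let ?P = "h_tensor k H ?hM ?hL"
 let ?n = "complete_left ?hM ?hL V X (ev V W) (ev W X)"
 let ?c = "coev ?P V X ?n"
 note n = comp_n_eq[of V W X, simplified]
 note nb = eqvD(1)[OF n]
 have hm: "hmod k H ?hM" "hmod k H ?hL" "hmod k H ?hN" "hmod k H ?P" by simp_all
 have rhs: "h_ev H W X (tmap k ?hM W id (h_ev H V W) (h_assoc k H ?hM ?hL V t)) = tlift X ?n t"
  if t: "t |: h_tensor k H ?P V" for t
 proof -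
  have t': "t |: (tensor k (tensor k ?hM ?hL) V)" using t tensor_lin_cong(3)[of ?P "tensor k ?hM ?hL" V V k] by simp
  let ?f = "%u v w. ev W X u (ev V W v w)"
  note eb = eqvD(1)[OF ev_equivariant]
  have tr: "trilinear k ?hM ?hL V X ?f" by (rule tri_r[OF eb eb]) simp_all
  have hv: "lmap k (tensor k ?hL V) W (h_ev H V W)" "lmap k (tensor k ?hM W) X (h_ev H W X)"
   by (simp_all add: h_ev_eq tlift_lin eb)
  have i: "lmap k ?hM ?hM id" by (rule alg_homD(1)[OF algebra_hom_id])
  have z: "h_ev H W X (tmap k ?hM W id (h_ev H V W) z) = tlift3 X ?f z" if z: "z |: (tensor k ?hM (tensor k ?hL V))" for z
   by (rule tensor3_eq[where M = X, OF _ _ _ _ _ _ _ z])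
    (simp_all add: lin_comp[OF hv(2)] tmap_lin[OF i hv(1)] tlift3_lin[OF tr] tmap_id_pure[OF hv(1)] hm tlift3_pure[OF tr],
    simp add: h_ev_eq tlift_pure_eq[OF _ _ eb] bil_cl[OF eb])
  have "h_ev H W X (tmap k ?hM W id (h_ev H V W) (h_assoc k H ?hM ?hL V t)) = tlift3 X ?f (act3 k ?hM ?hL V \<phi> (tassoc k ?hM ?hL V t))"
   by (simp add: h_assoc_eq hm t' z lin)
  also have "... = tlift X ?n t"
  proof (rule tensor3l_eq[where M = X, OF _ _ _ _ _ _ _ t'])
   have nb': "blmap k (tensor k ?hM ?hL) V X ?n" using nb by (simp add: bilinear_map_def linear_h_tensor)
   show "lmap k (tensor k (tensor k ?hM ?hL) V) X (tlift X ?n)" by (rule tlift_lin[OF _ _ nb']) simp_all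
   show "lmap k (tensor k (tensor k ?hM ?hL) V) X (%t. tlift3 X ?f (act3 k ?hM ?hL V \<phi> (tassoc k ?hM ?hL V t)))"
    by (rule lin_comp[OF tlift3_lin[OF tr]]) (simp_all add: lin hm)
   fix u v w assume "u |: ?hM" "v |: ?hL" "w |: V"
   then show "tlift3 X ?f (act3 k ?hM ?hL V \<phi> (tassoc k ?hM ?hL V (pure k (tensor k ?hM ?hL) V (pure k ?hM ?hL u v) w)))
    = tlift X ?n (pure k (tensor k ?hM ?hL) V (pure k ?hM ?hL u v) w)" by (subst tlift_pure_eq[OF _ _ nb'])
    (simp_all add: tassoc_pure hm complete_left_pure[OF _ _ _ _ _ ev_equivariant ev_equivariant] tlift3_act[OF tr, symmetric] lin
    del: h_hom_simps)
  qed simp_all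
  finally show ?thesis .
 qed
 have evN: "lmap k (tensor k ?hN V) X (h_ev H V X)" by (simp add: h_ev_eq tlift_lin eqvD(1)[OF ev_equivariant])
 have lhs: "h_ev H V X (tmap k ?hN V m id t) = tlift X (%s v. ev V X (m s) v) t"
  if m: "lmap k ?P ?hN m" and t: "t |: h_tensor k H ?P V" for m t
 proof -
  have b: "blmap k ?P V X (%s v. ev V X (m s) v)" by (rule bilI)
    (simp_all add: bil1[OF eqvD(1)[OF ev_equivariant] m] bil_r[OF eqvD(1)[OF ev_equivariant]] lin_cl[OF m] hm del: h_hom_simps h_tensor_simps)
  note i = alg_homD(1)[OF algebra_hom_id]
  from t have t': "t |: tensor k ?P V" by simp
  show ?thesis by (rule tensor_eq[where M = X, OF _ _ _ _ _ _ t'])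
    (simp_all add: lin_comp[OF evN] tmap_lin[OF m i] hm tlift_lin[OF _ _ b] tlift_pure_eq[OF _ _ b] tmap_pure_id[OF m] lin_cl[OF m] del: h_hom_simps h_tensor_simps,
    simp add: h_ev_eq tlift_pure_eq[OF _ _ eqvD(1)[OF ev_equivariant]] lin_cl[OF m] del: h_hom_simps h_tensor_simps)
 qed
 let ?m0 = "\<lambda>s\<in>carrier ?P. ?c s"
 let ?ok = "%m. m \<in> extensional (carrier ?P) \<and> h_linear k H ?P ?hN m \<and> (\<forall>t\<in>carrier (h_tensor k H ?P V).
    h_ev H V X (tmap k ?hN V m id t) =
    h_ev H W X (tmap k ?hM W id (h_ev H V W) (h_assoc k H ?hM ?hL V t)))"
 have cl: "lmap k ?P ?hN ?c" by (rule coev_linear[OF _ _ _ n]) simp_all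
 have l0: "lmap k ?P ?hN ?m0" by (subst linear_map_cong[where g = ?c]) (simp_all add: cl hm del: h_hom_simps h_tensor_simps)
 have "?ok ?m0"
 proof (intro conjI ballI)
  show "h_linear k H ?P ?hN ?m0"
   unfolding h_linear_def using l0 coev_equivariant[OF _ _ _ n] by (simp add: hm_closed[OF hm(4)] del: h_hom_simps h_tensor_simps)
  fix t assume t: "t |: h_tensor k H ?P V"
  have "tlift X (%s v. ev V X (?m0 s) v) t = tlift X ?n t"
   by (rule tlift_cong[of k ?P V]) (use t in \<open>simp_all add: hm ev_coev[OF _ _ _ n] del: h_hom_simps h_tensor_simps(1)\<close>, simp)
  then show "h_ev H V X (tmap k ?hN V ?m0 id t) = h_ev H W X (tmap k ?hM W id (h_ev H V W) (h_assoc k H ?hM ?hL V t))"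
   by (simp only: lhs[OF l0 t] rhs[OF t])
 qed simp
 moreover have "m = ?m0" if m: "?ok m" for m
 proof (rule extensionalityI[where A = "carrier ?P"])
  have ml: "lmap k ?P ?hN m" and mh: "!!h s. h |: H ==> s |: ?P ==> m (act ?P h s) = act ?hN h (m s)"
   using m unfolding h_linear_def by auto
  have b: "blmap k ?P V X (%s v. ev V X (m s) v)" by (rule bilI)
    (simp_all add: bil1[OF eqvD(1)[OF ev_equivariant] ml] bil_r[OF eqvD(1)[OF ev_equivariant]] lin_cl[OF ml] hm del: h_hom_simps h_tensor_simps)
  fix s assume s: "s |: ?P"
  have e: "ev V X (m s) v = ?n s v" if s: "s |: ?P" and v: "v |: V" for s v
  proof -
   have p: "pure k ?P V s v |: h_tensor k H ?P V"
    using s v hm by (simp add: pure_in del: h_hom_simps h_tensor_simps) (simp add: pure_in)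
   have "tlift X (%s v. ev V X (m s) v) (pure k ?P V s v) = tlift X ?n (pure k ?P V s v)"
    using m p by (simp only: lhs[OF ml p, symmetric] rhs[OF p, symmetric])
   then show ?thesis using s v hm by (simp add: tlift_pure_eq[OF _ _ b] tlift_pure_eq[OF _ _ nb] del: h_hom_simps h_tensor_simps)
  qed
  have "m s = ?c s"
  proof (rule hom_eqI[of V X])
   show "m s |: lin_hom k V X" "?c s |: lin_hom k V X" using lin_cl[OF ml s] lin_cl[OF cl s] by simp_all
   fix h v assume h: "h |: H" and v: "v |: V"
   have "act ?P h s |: ?P" using hm h s by (simp only: hm_closed)
   then show "ev V X (act ?hN h (m s)) v = ev V X (act ?hN h (?c s)) v" using h s v
    by (simp only: mh[symmetric] coev_equivariant[OF assms(1) assms(3) hm(4) n, symmetric] e ev_coev[OF assms(1) assms(3) hm(4) n])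
  qed simp_all
  then show "m s = ?m0 s" using s by simp
 qed (use m in auto)
 ultimately have "(THE m. ?ok m) = ?m0" by (intro the_equality) blast+
 then have "h_comp k H V W X = ?m0" unfolding h_comp_def Let_def .
 moreover have "pure k ?hM ?hL M L |: ?P" using memb hm by (simp add: pure_in del: h_hom_simps)
 ultimately show ?thesis unfolding compose_hom_def by simp
qed

end

section \<open>Quotient modules\<close>

locale submod =
 fixes k :: "('k, 'r) ring_scheme" and M :: "('k, 'h, 'a, 'm) bimodule" and N :: "'m set"
 assumes M: "module k M" and N_sub: "N \<subseteq> carrier M" and N_zero: "\<zero>[M] \<in> N"
  and N_add: "!!x y. x \<in> N ==> y \<in> N ==> x \<oplus>[M] y \<in> N"
  and N_smult: "!!r x. r |: k ==> x \<in> N ==> r \<odot>[M] x \<in> N"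
begin

interpretation M: module k M by (rule M)

lemma N_neg: "x \<in> N ==> \<ominus>[M] x \<in> N"
 using N_smult[of "\<ominus>[k] \<one>[k]" x] N_sub M.smult_l_minus[of "\<one>[k]" x] M.smult_one[of x] by auto

interpretation N: abelian_subgroup N M
proof (rule abelian_subgroupI3[OF additive_subgroupI M.abelian_group_axioms])
 show "subgroup N (add_monoid M)" using N_sub N_zero N_add N_neg by (intro group.subgroupI[OF M.a_group]) (auto simp: a_inv_def)
qed

abbreviation "\<pi> x == N +>\<^bsub>M\<^esub> x"

lemma coset_eq_iff:
 assumes "x |: M" "y |: M" shows "\<pi> x = \<pi> y \<longleftrightarrow> x \<ominus>[M] y \<in> N"
proof -
 have "\<pi> x = \<pi> y \<longleftrightarrow> x \<in> \<pi> y"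
  using N.a_repr_independence'[of x y] N.a_rcos_self[of x] assms by auto
 then show ?thesis using N.a_rcos_module[of y x] assms by (simp add: a_minus_def)
qed

lemma coset_zero: "\<pi> \<zero>[M] = N" using N.a_rcos_const[OF N_zero] .

lemma coset_zero_iff: "x |: M ==> \<pi> x = N \<longleftrightarrow> x \<in> N"
 using N.a_rcos_const[of x] N.a_rcos_self[of x] by auto

lemma coset_elem: "x |: M ==> y \<in> \<pi> x ==> y |: M \<and> \<pi> y = \<pi> x"
 using N.a_repr_independence'[of y x] N.a_elemrcos_carrier[of x y] by auto

lemma coset_self: "x |: M ==> x \<in> \<pi> x" by (rule N.a_rcos_self)

lemma coset_map_eq:
 assumes "x |: M" and "!!y. y |: M ==> \<pi> y = \<pi> x ==> g y = c"
 shows "(\<Union>y\<in>\<pi> x. g y) = c"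
proof -
 have "g y = c" if "y \<in> \<pi> x" for y using coset_elem[OF assms(1) that] assms(2) by simp
 then have "g ` \<pi> x = {c}" using coset_self[OF assms(1)] by (intro equalityI subsetI) (auto simp: image_iff)
 then show ?thesis by (simp only:) simp
qed

abbreviation "Q == quotient_bimodule M N"

lemma Q_carrier: "carrier Q = \<pi> ` carrier M"
 unfolding quotient_bimodule_def by (simp add: A_RCOSETS_def' UNION_singleton_eq_range)

lemma Q_carrierE: assumes "C |: Q" obtains x where "x |: M" "C = \<pi> x" using assms unfolding Q_carrier by auto

lemma Q_zero: "\<zero>[Q] = N" unfolding quotient_bimodule_def by simp

lemma Q_add: "x |: M ==> y |: M ==> \<pi> x \<oplus>[Q] \<pi> y = \<pi> (x \<oplus>[M] y)"
 unfolding quotient_bimodule_def by (simp add: N.a_rcos_sum)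

lemma coset_map_coset:
 assumes "x |: M" "!!y. y |: M ==> \<pi> y = \<pi> x ==> N' +>\<^bsub>M'\<^esub> f y = N' +>\<^bsub>M'\<^esub> f x"
 shows "coset_map M' N' f (\<pi> x) = N' +>\<^bsub>M'\<^esub> f x" unfolding coset_map_def by (rule coset_map_eq[OF assms])

lemma Q_smult: assumes "r |: k" "x |: M" shows "r \<odot>[Q] \<pi> x = \<pi> (r \<odot>[M] x)"
proof -
 have "\<pi> (r \<odot>[M] y) = \<pi> (r \<odot>[M] x)" if "y |: M" "\<pi> y = \<pi> x" for y
 proof -
  have "r \<odot>[M] (y \<ominus>[M] x) \<in> N" using that assms coset_eq_iff N_smult by blast
  then show ?thesis using that assms by (simp add: coset_eq_iff a_minus_def M.smult_r_distr M.smult_r_minus)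
 qed
 then have "coset_map M N (%x. r \<odot>[M] x) (\<pi> x) = \<pi> (r \<odot>[M] x)" by (rule coset_map_coset[OF assms(2)])
 then show ?thesis unfolding quotient_bimodule_def by simp
qed

lemma Q_module: "module k Q"
proof (rule moduleI[OF M.R.is_cring])
 show "abelian_group Q"
 proof (rule abelian_groupI)
  show "\<zero>[Q] |: Q"  unfolding Q_zero Q_carrier by (rule image_eqI[where x = "\<zero>[M]"]) (simp_all add: coset_zero)
  fix x assume "x |: Q"
  then obtain x' where x': "x' |: M" "x = \<pi> x'" by (rule Q_carrierE)
  then show "\<zero>[Q] \<oplus>[Q] x = x" using Q_add[of "\<zero>[M]" x'] by (simp add: Q_zero coset_zero)
  show "\<exists>y\<in>carrier Q. y \<oplus>[Q] x = \<zero>[Q]"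
   using x' Q_add[of "\<ominus>[M] x'" x'] by (intro bexI[of _ "\<pi> (\<ominus>[M] x')"]) (auto simp: Q_zero coset_zero M.l_neg Q_carrier)
 qed (auto simp: Q_carrier Q_add M.a_ac)
qed (auto simp: Q_carrier Q_add Q_smult M.smult_l_distr M.smult_r_distr M.smult_assoc1)

lemma proj_linear: "lmap k M Q (%x. \<pi> x)" by (rule linear_mapI) (auto simp: Q_carrier Q_add Q_smult)

lemma coset_val_eq:
 assumes f: "lmap k M X f" and X: "module k X" and kill: "!!n. n \<in> N ==> f n = \<zero>[X]" and x: "x |: M"
 shows "coset_val f (\<pi> x) = f x"
proof -
 interpret X: module k X by fact
 have "f y = f x" if "y |: M" "\<pi> y = \<pi> x" for y
 proof -
  have "f (y \<ominus>[M] x) = \<zero>[X]" using that x coset_eq_iff kill by blast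
  then have "f y \<ominus>[X] f x = \<zero>[X]" using that x by (simp add: linear_minus[OF f M X])
  moreover have "f y = (f y \<ominus>[X] f x) \<oplus>[X] f x"
   using that x lin_cl[OF f] by (simp add: a_minus_def X.a_assoc X.l_neg)
  ultimately show ?thesis using x lin_cl[OF f] by simp
 qed
 then have c: "f y = f x" if "y \<in> \<pi> x" for y using coset_elem[OF x that] by blast
 have "f ` \<pi> x = {f x}"
 proof (intro equalityI subsetI)
  fix z assume "z \<in> f ` \<pi> x"
  then show "z \<in> {f x}" using c by (metis imageE singletonI)
 next
  fix z assume "z \<in> {f x}"
  then show "z \<in> f ` \<pi> x" using coset_self[OF x] by blast
 qed
 then show ?thesis unfolding coset_val_def by simp
qed

lemma quot_linear:
 assumes f: "lmap k M X (%x. g (\<pi> x))"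
 shows "lmap k Q X g"
proof (rule linear_mapI)
 fix x y assume "x |: Q" "y |: Q"
 then show "g (x \<oplus>[Q] y) = g x \<oplus>[X] g y" by (elim Q_carrierE) (use linear_add[OF f] in "simp add: Q_add")
next
 fix r x assume "r |: k" "x |: Q"
 then show "g (r \<odot>[Q] x) = r \<odot>[X] g x" by (elim Q_carrierE) (use linear_smult[OF f] in "simp add: Q_smult")
qed (use lin_cl[OF f] Q_carrierE in metis)

lemma map_coset_eq:
 assumes f: "lmap k M X f" and X: "module k X" and N': "submod k X N'"
  and kill: "!!n. n \<in> N ==> f n \<in> N'" and x: "x |: M" and X': "!!y. N' +>\<^bsub>X'\<^esub> y = N' +>\<^bsub>X\<^esub> y"
 shows "coset_map X' N' f (\<pi> x) = N' +>\<^bsub>X\<^esub> f x"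
proof -
 interpret N': submod k X N' by fact
 have "N' +>\<^bsub>X'\<^esub> f y = N' +>\<^bsub>X'\<^esub> f x" if "y |: M" "\<pi> y = \<pi> x" for y
 proof -
  have "f (y \<ominus>[M] x) \<in> N'" using that x coset_eq_iff kill by blast
  then show ?thesis unfolding X' using that x linear_minus[OF f M X] lin_cl[OF f] by (simp add: N'.coset_eq_iff)
 qed
 then show ?thesis using coset_map_coset[OF x, where f = f and N' = N' and M' = X'] by (simp add: X')
qed

end

lemma submod_image:
 assumes D: "lmap k P M D" and P: "module k P" and M: "module k M"
 shows "submod k M (D ` carrier P)"
proof -
 interpret P: module k P by fact
 show ?thesis
 proof (rule submod.intro[OF M])
  show "\<zero>[M] \<in> D ` carrier P" using linear_zero[OF D P M] by (auto intro: rev_image_eqI[of "\<zero>[P]"])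
 qed (auto simp: lin_cl[OF D] linear_add[OF D, symmetric] linear_smult[OF D, symmetric])
qed

section \<open>Algebras and bimodules\<close>

text \<open>
 \<open>V\<close> and its twist, or \<open>hom(V, W)\<close> with and without the actions of \<open>A\<close>, are different records with one
 underlying \<open>H\<close>-module. Notions depending on the latter only are transferred along this relation.
\<close>

definition "same_h U U' \<longleftrightarrow> carrier U = carrier U' \<and> add U = add U' \<and> zero U = zero U' \<and> smult U = smult U' \<and> act U = act U'"

lemma same_refl [simp]: "same_h U U" by (simp add: same_h_def)

lemma twprod_same: "same_h U U' ==> same_h V V' ==> same_h X X' ==> twprod U V X = twprod U' V' X'"
 by (intro ext) (simp add: twprod_def same_h_def tlift_target_cong[of X X'])

lemma linear_same: "same_h U U' ==> same_h X X' ==> lmap k U X = lmap k U' X'"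
 by (intro ext) (simp add: linear_map_def same_h_def)

lemma bilinear_same: "same_h U U' ==> same_h V V' ==> same_h X X' ==> blmap k U V X = blmap k U' V' X'"
 by (intro ext) (simp add: bilinear_map_def linear_same[of U U' X X'] linear_same[of V V' X X'], simp add: same_h_def)

lemma eqv_same:
 assumes "same_h U U'" "same_h V V'" "same_h X X'" shows "equivar k H U V X = equivar k H U' V' X'"
 by (intro ext) (simp add: equivar_def bilinear_same[OF assms] twprod_same[OF assms], use assms in "simp add: same_h_def")

lemma h_module_same:
 assumes "same_h U U'" shows "hmod k H U \<longleftrightarrow> hmod k H U'"
proof -
 have "module k U \<longleftrightarrow> module k U'"
  using module_cong[of U U' k] module_cong[of U' U k] assms by (auto simp: same_h_def)
 then show ?thesis using assms by (simp add: h_module_def bilinear_map_def linear_map_def same_h_def)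
qed

lemma tlift3_target_cong: "add M = add M' ==> zero M = zero M' ==> tlift3 M = tlift3 M'"
 by (intro ext) (simp add: tlift3_def tlift_target_cong[of M M'])

lemma assoc_same:
 assumes "same_h U U'" "same_h V V'" "same_h W W'" "same_h X X'"
 shows "alaw H U V W X = alaw H U' V' W' X'"
 using assms by (intro ext) (simp add: alaw_def same_h_def tlift3_target_cong[of X X'])

context quasi_hopf_alg begin

text \<open>
 If \<open>H\<close> acts on a factor by the counit, such as on a multiple of \<open>1\<^sub>A\<close>, the corresponding leg of \<open>\<phi>\<close> becomes a
 unit. This yields the unit axioms and the unitors.
\<close>

context
 fixes U V W X f
 assumes f: "trilinear k U V W X f" and hm [simp]: "hmod k H U" "hmod k H V" "hmod k H W" "module k X"
begin

lemma tri_lins: "u |: U ==> v |: V ==> w |: W ==> r |: k ==> f (r \<odot>[U] u) v w = r \<odot>[X] f u v w"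
 "u |: U ==> v |: V ==> w |: W ==> r |: k ==> f u (r \<odot>[V] v) w = r \<odot>[X] f u v w"
 "u |: U ==> v |: V ==> w |: W ==> r |: k ==> f u v (r \<odot>[W] w) = r \<odot>[X] f u v w"
 using linear_smult[OF trilinearD(1)[OF f]] linear_smult[OF bil_l[OF trilinearD(2)[OF f]]]
  linear_smult[OF bil_r[OF trilinearD(2)[OF f]]] by auto

lemma tri_bils: "u |: U ==> blmap k V W X (f u)"
 "v |: V ==> blmap k U W X (%u w. f u v w)"
 "w |: W ==> blmap k U V X (%u v. f u v w)"
 by (auto intro!: bilI simp: trilinearD[OF f] bil_l[OF trilinearD(2)[OF f]] bil_r[OF trilinearD(2)[OF f]])

lemma tri_counit:
 assumes [simp]: "u |: U" "v |: V" "w |: W"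
 shows "(!!h. h |: H ==> act U h u = counit H h \<odot>[U] u) ==> t |: H3 ==>
   tlift3 X (%a b c. f (act U a u) (act V b v) (act W c w)) t = twprod V W X (counit_l H2 t) (f u) v w"
  "(!!h. h |: H ==> act V h v = counit H h \<odot>[V] v) ==> t |: H3 ==>
   tlift3 X (%a b c. f (act U a u) (act V b v) (act W c w)) t = twprod U W X (\<kappa> t) (%u w. f u v w) u w"
  "(!!h. h |: H ==> act W h w = counit H h \<odot>[W] w) ==> t |: H3 ==>
   tlift3 X (%a b c. f (act U a u) (act V b v) (act W c w)) t = twprod U V X (\<kappa>3 t) (%u v. f u v w) u v"
proof -
 note tr = act_trilinear[OF f hm(1-3) assms]
 note sm = two_modules.pure_smult_left[OF two_modules.intro, symmetric] two_modules.pure_smult_right[OF two_modules.intro, symmetric]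
 interpret Hm: module k H by simp
 note as = linear_smult[OF bil_l[OF hm_bil]]
 show "tlift3 X (%a b c. f (act U a u) (act V b v) (act W c w)) t = twprod V W X (counit_l H2 t) (f u) v w"
  if "!!h. h |: H ==> act U h u = counit H h \<odot>[U] u" and t: "t |: H3" by (rule H3_eq[where M = X, OF _ _ _ _ t])
   (simp_all add: tlift3_lin[OF tr] tlift_H3_pure[OF tr] lin twprod_lin[OF tri_bils(1)] twprod_pure[OF tri_bils(1)] that(1) sm tri_lins as)
 show "tlift3 X (%a b c. f (act U a u) (act V b v) (act W c w)) t = twprod U W X (\<kappa> t) (%u w. f u v w) u w"
  if "!!h. h |: H ==> act V h v = counit H h \<odot>[V] v" and t: "t |: H3" by (rule H3_eq[where M = X, OF _ _ _ _ t])
   (simp_all add: tlift3_lin[OF tr] tlift_H3_pure[OF tr] lin twprod_lin[OF tri_bils(2)] twprod_pure[OF tri_bils(2)] that(1) tri_lins as)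
 show "tlift3 X (%a b c. f (act U a u) (act V b v) (act W c w)) t = twprod U V X (\<kappa>3 t) (%u v. f u v w) u v"
  if "!!h. h |: H ==> act W h w = counit H h \<odot>[W] w" and t: "t |: H3" by (rule H3_eq[where M = X, OF _ _ _ _ t])
   (simp_all add: tlift3_lin[OF tr] tlift_H3_pure[OF tr] kappa3_pure lin_comp[OF alg_homD(1)[OF kappa3_hom]] alg_homD(1)[OF kappa3_hom]
    twprod_lin[OF tri_bils(3)] twprod_pure[OF tri_bils(3)] that(1) tri_lins as)
qed

end

lemma kappa1_phi: "counit_l H2 \<phi> = \<one>\<^sub>2"
proof -
 define Q where "Q = tmap k H H2 id (counit_l H2)"
 have c: "algebra_hom k H3 H2 (counit_l H2)" by (rule counit_l_hom) simp
 have Q: "algebra_hom k H4 H3 Q" unfolding Q_def by (intro tmap_algebra_hom algebra_hom_id counit_l_hom) simp_all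
 have Qp: "Q (pH3 a s) = pH2 a (counit_l H2 s)" if "a |: H" "s |: H3" for a s
  unfolding Q_def using that by (simp add: tmap_id_pure[OF alg_homD(1)[OF c]])
 note [lin] = lin_comp[OF alg_homD(1)[OF Q]]
 note sm = two_modules.pure_smult_left[OF two_modules.intro] two_modules.pure_smult_right[OF two_modules.intro]
 have k1: "counit_l H2 (tassoc k H H H (pure k H2 H s c)) = pH (counit_l H s) c"
  if "s |: H2" "c |: H" for s c by (rule H2_eq[OF _ _ _ _ that(1), of H2]) (simp_all add: lin that sm)
 have ke1: "counit_l H2 (e1 s) = s" if "s |: H2" for s
  by (rule H2_eq[OF _ _ _ _ that, of H2]) (simp_all add: lin k1 counit_comult)
 have q1: "Q (d3 t) = e2 (\<kappa> t)" if t: "t |: H3" for t by (rule H3_eq[where M = H3, OF _ _ _ _ t])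
   (simp_all add: lin Qp linear_smult[OF alg_homD(1)[OF comult_hom]])
 have q2: "Q (d2 t) = t" if t: "t |: H3" for t
  by (rule tensor_eq[OF H_mod mod234(1) _ _ mod234(2) _ t]) (simp_all add: lin Qp ke1)
 have q3': "Q (tassoc k H H H2 (pure k H2 H2 s t)) = pH2 (counit_r s) t" if "s |: H2" "t |: H2" for s t
  by (rule H2_eq[OF _ _ _ _ that(1), of H3]) (simp_all add: lin Qp that sm)
 have q3: "Q (d1 t) = t" if t: "t |: H3" for t
  by (rule tensor_eq[OF H_mod mod234(1) _ _ mod234(2) _ t]) (simp_all add: lin q3' counit_comult)
 have q5: "Q (i4 t) = j3 (\<kappa> t)" if t: "t |: H3" for t
  by (rule H3_eq[where M = H3, OF _ _ _ _ t]) (simp_all add: lin Qp sm linear_smult[OF tassoc_lin[OF H_mod H_mod H_mod]])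
 have cl: "counit_l H2 \<phi> |: H2" by (rule alg_homD[OF c]) simp
 have "\<one>\<^sub>3 *3 \<phi> = j0 (counit_l H2 \<phi>) *3 \<phi> *3 \<one>\<^sub>3" using arg_cong[OF pentagon, of Q]
  by (simp add: alg_homD(3)[OF Q] q1 q2 q3 q5 Qp kappa_phi alg_homD(2)[OF e2_hom] alg_homD(2)[OF j3_hom])
 then have "\<phi> *3 \<psi> = j0 (counit_l H2 \<phi>) *3 \<phi> *3 \<psi>" using cl by simp
 then have "j0 (counit_l H2 \<phi>) = \<one>\<^sub>3" using cl by (simp add: H3.m_assoc)
 then have "counit_l H2 (j0 (counit_l H2 \<phi>)) = counit_l H2 \<one>\<^sub>3" by simp
 then show ?thesis using cl by (simp add: alg_homD(2)[OF c] counit_facts module.smult_one[OF mod234(1)])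
qed

end

locale h_alg = quasi_hopf_alg k H for k :: "'k ring" and H :: "('k, 'h) quasi_hopf" +
 fixes A :: "('k, 'h, 'a) hmodule"
 assumes hA: "h_algebra k H A"
begin

abbreviation oneA ("\<one>\<^sub>A") where "\<one>\<^sub>A == \<one>[A]"
lemma A_hm [simp]: "hmod k H A" using hA unfolding h_algebra_def by blast
lemma A_eq: "equivar k H A A A (mult A)" using hA tensor_morphism_iff[OF A_hm A_hm A_hm] unfolding h_algebra_def by blast
lemma A_one [simp]: "\<one>\<^sub>A |: A" using hA unfolding h_algebra_def by blast
lemma A_law: "alaw H A A A A (mult A) (mult A) (mult A) (mult A)" using hA unfolding h_algebra_def alaw_def by blast
lemma A_unit: "a |: A ==> \<one>\<^sub>A \<otimes>[A] a = a" "a |: A ==> a \<otimes>[A] \<one>\<^sub>A = a"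
 using hA unfolding h_algebra_def by blast+
lemma A_inv: "h |: H ==> act A h \<one>\<^sub>A = counit H h \<odot>[A] \<one>\<^sub>A"
proof -
 assume h: "h |: H"
 interpret Am: module k A by simp
 have "\<one>[k] |: h_unit k H" by (simp add: h_unit_def module.extend_def hmodule.fields_def ground_module_def)
 then have "(act (h_unit k H) h \<one>[k]) \<odot>[A] \<one>\<^sub>A = act A h (\<one>[k] \<odot>[A] \<one>\<^sub>A)"
  using hA h unfolding h_algebra_def h_linear_def by blast
 then show ?thesis using h by (simp add: h_unit_def module.extend_def hmodule.fields_def)
qed

lemma a_bimodule_iff:
 "a_bimodule k H A V \<longleftrightarrow> hmod k H V \<and> equivar k H A V V (lact V) \<and> equivar k H V A V (ract V) \<and>
  alaw H V A A V (ract V) (ract V) (mult A) (ract V) \<and>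
  alaw H A A V V (mult A) (lact V) (lact V) (lact V) \<and>
  alaw H A V A V (lact V) (ract V) (ract V) (lact V) \<and>
  (\<forall>v\<in>carrier V. lact V \<one>\<^sub>A v = v \<and> ract V v \<one>\<^sub>A = v)"
proof (cases "hmod k H V \<and> equivar k H A V V (lact V) \<and> equivar k H V A V (ract V)")
 case True
 then have [simp]: "hmod k H V" and e: "equivar k H A V V (lact V)" "equivar k H V A V (ract V)" by auto
 note b = e[THEN eqvD(1)] eqvD(1)[OF A_eq]
 show ?thesis
  unfolding a_bimodule_def alaw_inv[OF b(3) b(1) b(1) b(1) A_hm A_hm \<open>hmod k H V\<close> hm_mod[OF \<open>hmod k H V\<close>]]
   alaw_inv[OF b(1) b(2) b(2) b(1) A_hm \<open>hmod k H V\<close> A_hm hm_mod[OF \<open>hmod k H V\<close>]]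
  using True by (simp add: tensor_morphism_iff alaw_def)
next
 case False
 then show ?thesis unfolding a_bimodule_def using tensor_morphism_iff[OF A_hm, of V V] tensor_morphism_iff[OF _ A_hm, of V V] by blast
qed

lemma bimoduleD:
 assumes "a_bimodule k H A V"
 shows "hmod k H V" "equivar k H A V V (lact V)" "equivar k H V A V (ract V)"
  "alaw H V A A V (ract V) (ract V) (mult A) (ract V)"
  "alaw H A A V V (mult A) (lact V) (lact V) (lact V)"
  "alaw H A V A V (lact V) (ract V) (ract V) (lact V)"
  "v |: V ==> lact V \<one>\<^sub>A v = v" "v |: V ==> ract V v \<one>\<^sub>A = v" using assms unfolding a_bimodule_iff by auto

lemma regular_simps [simp]:
 "carrier (regular A) = carrier A" "add (regular A) = add A" "zero (regular A) = zero A" "smult (regular A) = smult A"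
 "act (regular A) = act A" "lact (regular A) = mult A" "ract (regular A) = mult A"
 by (simp_all add: regular_def hmodule.extend_def bimodule.fields_def)

lemma regular_same: "same_h (regular A) A" by (simp add: same_h_def)

lemma regular_bimodule: "a_bimodule k H A (regular A)" unfolding a_bimodule_iff using A_hm A_eq A_law
 by (simp add: h_module_same[OF regular_same] eqv_same[OF same_refl regular_same regular_same, of k H]
  eqv_same[OF regular_same same_refl regular_same, of k H]
  assoc_same[OF regular_same same_refl same_refl regular_same] assoc_same[OF same_refl same_refl regular_same regular_same]
  assoc_same[OF same_refl regular_same same_refl regular_same] A_unit)

end

section \<open>The tensor product of bimodules\<close>

lemma b_tensor_simps [simp]:
 "carrier (b_tensor k H A V W) = carrier (tensor k V W)" "add (b_tensor k H A V W) = add (tensor k V W)"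
 "zero (b_tensor k H A V W) = zero (tensor k V W)" "smult (b_tensor k H A V W) = smult (tensor k V W)"
 "act (b_tensor k H A V W) = (%h. act2 k V W (comult H h))"
 by (simp_all add: b_tensor_def Let_def hmodule.extend_def bimodule.fields_def, simp add: fun_eq_iff)

lemma b_tensor_same: "same_h (b_tensor k H A V W) (h_tensor k H V W)" by (simp add: same_h_def fun_eq_iff)

lemma coset_add_cong: "add M = add M' ==> N +>\<^bsub>M\<^esub> x = N +>\<^bsub>M'\<^esub> x" by (simp add: a_r_coset_def')

lemma b_tensor_coset [simp]: "N +>\<^bsub>b_tensor k H A V W\<^esub> x = N +>\<^bsub>tensor k V W\<^esub> x"
 by (rule coset_add_cong) simp

lemma (in quasi_hopf_alg) b_tensor_actions:
 "lact (b_tensor k H A V W) = complete_right A V W (h_tensor k H V W) (lact V) (pure k V W)"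
 "ract (b_tensor k H A V W) = complete_left V W A (h_tensor k H V W) (ract W) (pure k V W)"
 by (intro ext; simp add: b_tensor_def Let_def hmodule.extend_def bimodule.fields_def complete_right_def complete_left_def
   tlift_target_cong[of "h_tensor k H V W" "tensor k V W"] tlift3_target_cong[of "h_tensor k H V W" "tensor k V W"])+

context quasi_hopf_alg begin

context
 fixes U and V
  and W and X
 assumes hm [simp]: "hmod k H U" "hmod k H V" "hmod k H W" "hmod k H X"
begin

lemma alaw_post:
 assumes a: "alaw H U V W X m1 m2 m3 m4" and b: "blmap k V W Q m3" "blmap k U Q X m4"
  and g: "lmap k X Y g" and [simp]: "module k Y"
 shows "alaw H U V W Y m1 (%u v. g (m2 u v)) m3 (%u v. g (m4 u v))" unfolding alaw_def
proof (intro ballI)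
 fix u v w assume *: "u |: U" "v |: V" "w |: W"
 have "g (nested_r U V W X m3 m4 \<phi> u v w)
  = tlift3 Y (%a b c. g (m4 (act U a u) (m3 (act V b v) (act W c w)))) \<phi>"
  by (rule tlift3_comp[OF act_trilinear[OF tri_r[OF b]] g]) (simp_all add: *)
 then show "g (m2 (m1 u v) w) = tlift3 Y (%a b c. g (m4 (act U a u) (m3 (act V b v) (act W c w)))) \<phi>"
  using a * by (simp add: alaw_def)
qed

lemma law_linear:
 assumes b: "blmap k U V P m1" "blmap k P W X m2" "blmap k V W Q m3" "blmap k U Q X m4"
 shows
  "v |: V ==> w |: W ==> lmap k U X (%u. m2 (m1 u v) w)"
  "v |: V ==> w |: W ==> lmap k U X (%u. nested_r U V W X m3 m4 \<phi> u v w)"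
  "u |: U ==> w |: W ==> lmap k V X (%v. m2 (m1 u v) w)"
  "u |: U ==> w |: W ==> lmap k V X (%v. nested_r U V W X m3 m4 \<phi> u v w)"
  "u |: U ==> v |: V ==> lmap k W X (%w. m2 (m1 u v) w)"
  "u |: U ==> v |: V ==> lmap k W X (%w. nested_r U V W X m3 m4 \<phi> u v w)"
proof -
 note 1 = tri_l[OF b(1,2)]
 note 2 = complete_aux[OF tri_r[OF b(3,4)] hm(1-3) hm_mod[OF hm(4)] phi_closed(1)]
 note d = trilinearD(1) bil_l[OF trilinearD(2)] bil_r[OF trilinearD(2)]
 show "v |: V ==> w |: W ==> lmap k U X (%u. m2 (m1 u v) w)" by (rule d(1)[OF 1])
 show "v |: V ==> w |: W ==> lmap k U X (%u. nested_r U V W X m3 m4 \<phi> u v w)" by (rule d(1)[OF 2])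
 show "u |: U ==> w |: W ==> lmap k V X (%v. m2 (m1 u v) w)" by (rule d(2)[OF 1])
 show "u |: U ==> w |: W ==> lmap k V X (%v. nested_r U V W X m3 m4 \<phi> u v w)" by (rule d(2)[OF 2])
 show "u |: U ==> v |: V ==> lmap k W X (%w. m2 (m1 u v) w)" by (rule d(3)[OF 1])
 show "u |: U ==> v |: V ==> lmap k W X (%w. nested_r U V W X m3 m4 \<phi> u v w)" by (rule d(3)[OF 2])
qed

end

end

locale balanced_pair = h_alg k H A for k :: "'k ring" and H :: "('k, 'h) quasi_hopf" and A :: "('k, 'h, 'a) hmodule" +
 fixes V :: "('k, 'h, 'a, 'v) bimodule" and W :: "('k, 'h, 'a, 'w) bimodule"
 assumes hmV [simp]: "hmod k H V" and hmW [simp]: "hmod k H W"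
  and rV: "equivar k H V A V (ract V)" and lW: "equivar k H A W W (lact W)"
begin

abbreviation "T == h_tensor k H V W"
abbreviation "N == balancing k H A V W"
abbreviation "Q == tensor_over k H A V W"
abbreviation "p == pure_over k H A V W"
abbreviation "proj x == N +>\<^bsub>tensor k V W\<^esub> x"

lemmas rVb = eqvD(1)[OF rV] and lWb = eqvD(1)[OF lW]
lemma p_eq: "equivar k H V W T (pure k V W)" by (rule pure_equivariant) simp_all

definition "balance_map t = tmap k V W (tlift V (ract V)) id t \<ominus>[tensor k V W]
    tmap k V W id (tlift W (lact W)) (h_assoc k H V A W t)"

lemma carrier_VAW: "carrier (h_tensor k H (h_tensor k H V A) W) = carrier (tensor k (tensor k V A) W)"
 using tensor_lin_cong(3)[of "h_tensor k H V A" "tensor k V A" W W k] by simp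

lemma balancing_image: "N = balance_map ` carrier (tensor k (tensor k V A) W)"
 unfolding balancing_def balance_map_def carrier_VAW ..

lemma bal_maps:
 "lmap k (tensor k (tensor k V A) W) (tensor k V W) (%t. tmap k V W (tlift V (ract V)) id t)"
 "lmap k (tensor k (tensor k V A) W) (tensor k V W) (%t. tmap k V W id (tlift W (lact W)) (h_assoc k H V A W t))"
proof -
 note i = alg_homD(1)[OF algebra_hom_id]
 have r: "lmap k (tensor k V A) V (tlift V (ract V))" "lmap k (tensor k A W) W (tlift W (lact W))"
  by (simp_all add: tlift_lin rVb lWb)
 show "lmap k (tensor k (tensor k V A) W) (tensor k V W) (%t. tmap k V W (tlift V (ract V)) id t)"
  using tmap_lin[OF r(1) i, of W] by simp
 have "lmap k (tensor k (tensor k V A) W) (tensor k V W)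
   (%t. tmap k V W id (tlift W (lact W)) (act3 k V A W \<phi> (tassoc k V A W t)))"
  by (rule tmap_comp_lin[OF i r(2)]) (simp_all add: lin)
 then show "lmap k (tensor k (tensor k V A) W) (tensor k V W) (%t. tmap k V W id (tlift W (lact W)) (h_assoc k H V A W t))"
  by (subst linear_map_cong[where g = "%t. tmap k V W id (tlift W (lact W)) (act3 k V A W \<phi> (tassoc k V A W t))"])
   (simp_all add: h_assoc_eq lin)
qed

lemma balance_linear: "lmap k (tensor k (tensor k V A) W) (tensor k V W) balance_map"
 unfolding balance_map_def by (rule linear_diff[OF _ bal_maps]) simp

lemma bal_pure:
 assumes [simp]: "v |: V" "a |: A" "w |: W"
 shows "balance_map (pure k (tensor k V A) W (pure k V A v a) w) = pure k V W (ract V v a) w \<ominus>[tensor k V W]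
  nested_r V A W (tensor k V W) (lact W) (pure k V W) \<phi> v a w"
proof -
 have r: "lmap k (tensor k V A) V (tlift V (ract V))" "lmap k (tensor k A W) W (tlift W (lact W))"
  by (simp_all add: tlift_lin rVb lWb)
 have pb: "blmap k V W (tensor k V W) (pure k V W)" by (simp add: pure_bil)
 note tr = tri_r[OF lWb pb]
 note i = alg_homD(1)[OF algebra_hom_id]
 have "tmap k V W id (tlift W (lact W)) z = tlift3 (tensor k V W) (%v a w. pure k V W v (lact W a w)) z"
  if z: "z |: (tensor k V (tensor k A W))" for z by (rule tensor3_eq[where M = "tensor k V W", OF _ _ _ _ _ _ _ z])
   (simp_all add: tmap_lin[OF i r(2)] tlift3_lin[OF tr] tmap_id_pure[OF r(2)] tlift3_pure[OF tr] tlift_pure_eq[OF _ _ lWb])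
 then show ?thesis unfolding balance_map_def
  by (simp add: tmap_pure_id[OF r(1)] tlift_pure_eq[OF _ _ rVb] h_assoc_eq lin tassoc_pure tlift3_act[OF tr])
qed

lemma submodN: "submod k (b_tensor k H A V W) N"
proof -
 have m: "module k (b_tensor k H A V W)" by (rule module_cong[of "tensor k V W"]) simp_all
 have "lmap k (tensor k (tensor k V A) W) (b_tensor k H A V W) balance_map" using balance_linear by (simp add: linear_map_def)
 then show ?thesis unfolding balancing_image by (rule submod_image) (simp_all add: m lin)
qed

sublocale N: submod k "b_tensor k H A V W" N by (rule submodN)

lemma Q_def': "Q = quotient_bimodule (b_tensor k H A V W) N" unfolding tensor_over_def ..

lemma Q_mod [simp]: "module k Q" unfolding Q_def' by (rule N.Q_module)

lemma Q_carrierE: assumes "C |: Q" obtains x where "x |: tensor k V W" "C = proj x"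
 using N.Q_carrierE[of C] assms unfolding Q_def' by auto

lemma proj_closed [simp]: "x |: (tensor k V W) ==> proj x |: Q" unfolding Q_def' using N.Q_carrier by auto

lemma proj_lin: "lmap k (tensor k V W) Q proj" using N.proj_linear unfolding Q_def' by (simp add: linear_map_def)

lemma proj_comp_lin [lin]: "lmap k Z (tensor k V W) f ==> lmap k Z Q (%z. proj (f z))" by (rule lin_comp[OF proj_lin])

lemma p_def': "p v w = proj (pure k V W v w)" unfolding pure_over_def ..

lemma p_bil: "blmap k V W Q p" unfolding p_def' by (rule bilI) (simp_all add: lin)

lemma p_closed [simp]: "v |: V ==> w |: W ==> p v w |: Q" by (rule bil_cl[OF p_bil])

text \<open>
 On the generators of the balancing submodule, vanishing says that \<open>A\<close> may be moved between the factors,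
 which is an associativity law. Descent to \<open>V \<otimes>\<^sub>A W\<close> can therefore be proved as an edge of the pentagon.
\<close>

lemma kills_iff:
 assumes G: "lmap k (tensor k V W) M G" and M: "module k M"
 shows "(\<forall>n\<in>N. G n = \<zero>[M]) \<longleftrightarrow>
  alaw H V A W M (ract V) (%v w. G (pure k V W v w)) (lact W) (%v w. G (pure k V W v w))"
proof -
 interpret M: module k M by fact
 have pb: "blmap k V W (tensor k V W) (pure k V W)" by (simp add: pure_bil)
 note tr = tri_r[OF lWb pb]
 have eq: "G (balance_map (pure k (tensor k V A) W (pure k V A v a) w)) = G (pure k V W (ract V v a) w) \<ominus>[M]
  tlift3 M (%x y z. G (pure k V W (act V x v) (lact W (act A y a) (act W z w)))) \<phi>"
  if vaw [simp]: "v |: V" "a |: A" "w |: W" for v a w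
 proof -
  note at = act_trilinear[OF tr]
  have c: "nested_r V A W (tensor k V W) (lact W) (pure k V W) \<phi> v a w |: tensor k V W"
   by (rule lin_cl[OF tlift3_lin[OF at]]) simp_all
  have "G (nested_r V A W (tensor k V W) (lact W) (pure k V W) \<phi> v a w)
   = tlift3 M (%x y z. G (pure k V W (act V x v) (lact W (act A y a) (act W z w)))) \<phi>"
   by (rule tlift3_comp[OF at G]) (simp_all add: M)
  then show ?thesis using c by (simp add: bal_pure linear_minus[OF G _ M] bil_cl[OF rVb])
 qed
 have gb: "blmap k V W M (%v w. G (pure k V W v w))" by (rule bilI) (simp_all add: lin_comp[OF G] lin)
 note at' = act_trilinear[OF tri_r[OF lWb gb]]
 have cl: "tlift3 M (%x y z. G (pure k V W (act V x v) (lact W (act A y a) (act W z w)))) \<phi> |: M"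
  if "v |: V" "a |: A" "w |: W" for v a w by (rule lin_cl[OF tlift3_lin[OF at']]) (simp_all add: that M)
 have sub: "x \<ominus>[M] y = \<zero>[M] \<longleftrightarrow> x = y" if "x |: M" "y |: M" for x y
 proof
  assume "x \<ominus>[M] y = \<zero>[M]"
  then have "(x \<ominus>[M] y) \<oplus>[M] y = y" using that by simp
  then show "x = y" using that by (simp add: a_minus_def M.a_assoc M.l_neg)
 qed (use that in "simp add: a_minus_def M.r_neg")
 show ?thesis
 proof
  assume n: "\<forall>n\<in>N. G n = \<zero>[M]"
  show "alaw H V A W M (ract V) (%v w. G (pure k V W v w)) (lact W) (%v w. G (pure k V W v w))" unfolding alaw_def
  proof (intro ballI)
   fix v a w assume *: "v |: V" "a |: A" "w |: W"
   then have "pure k (tensor k V A) W (pure k V A v a) w |: (tensor k (tensor k V A) W)" by (simp add: pure_in)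
   then have "G (balance_map (pure k (tensor k V A) W (pure k V A v a) w)) = \<zero>[M]"
    using n unfolding balancing_image by blast
   then show "G (pure k V W (ract V v a) w) = tlift3 M (%x y z. G (pure k V W (act V x v) (lact W (act A y a) (act W z w)))) \<phi>"
    using * by (simp add: eq sub cl lin_cl[OF G] bil_cl[OF rVb])
  qed
 next
  assume a: "alaw H V A W M (ract V) (%v w. G (pure k V W v w)) (lact W) (%v w. G (pure k V W v w))"
  have "G (balance_map t) = \<zero>[M]" if t: "t |: (tensor k (tensor k V A) W)" for t
   by (rule tensor3l_eq[where M = M and g = "% _. \<zero>[M]", OF _ _ _ _ _ _ _ t])
    (use a in "simp_all add: lin_comp[OF G balance_linear] linear_const_zero M eq sub cl lin_cl[OF G] bil_cl[OF rVb] alaw_def")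
  then show "\<forall>n\<in>N. G n = \<zero>[M]" unfolding balancing_image by blast
 qed
qed

lemma p_balanced: "alaw H V A W Q (ract V) p (lact W) p"
 using kills_iff[OF proj_lin Q_mod] N.coset_zero_iff N.N_sub unfolding p_def' Q_def' by (simp add: N.Q_zero subset_iff)

lemma over_eq:
 assumes f: "lmap k Q M f" and g: "lmap k Q M g" and M: "module k M"
  and "!!v w. v |: V ==> w |: W ==> f (p v w) = g (p v w)" and t: "t |: Q"
 shows "f t = g t"
proof -
 obtain x where x: "x |: tensor k V W" "t = proj x" using t by (rule Q_carrierE)
 have "f (proj x) = g (proj x)" by (rule tensor_eq[of k V W M "%x. f (proj x)"])
   (use assms(4) in "simp_all add: lin_comp[OF f] lin_comp[OF g] proj_lin M x p_def'")
 then show ?thesis using x by simp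
qed

lemma quot_lin: "lmap k (tensor k V W) X (%x. g (proj x)) ==> lmap k Q X g"
 using N.quot_linear[where g = g and X = X] unfolding Q_def' by (simp add: linear_map_def[of k "b_tensor k H A V W"] linear_map_def[of k "tensor k V W"])

lemma coset_val_lift:
 assumes g: "blmap k V W X g" and X: "module k X" and bal: "alaw H V A W X (ract V) g (lact W) g"
 shows "lmap k Q X (coset_val (tlift X g))" "v |: V ==> w |: W ==> coset_val (tlift X g) (p v w) = g v w"
  "x |: (tensor k V W) ==> coset_val (tlift X g) (proj x) = tlift X g x"
proof -
 have l: "lmap k (tensor k V W) X (tlift X g)" by (simp add: tlift_lin g X)
 then have l': "lmap k (b_tensor k H A V W) X (tlift X g)" by (simp add: linear_map_def)
 have "alaw H V A W X (ract V) (%v w. tlift X g (pure k V W v w)) (lact W) (%v w. tlift X g (pure k V W v w))" unfolding alaw_def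
 proof (intro ballI)
  fix v a w assume *: "v |: V" "a |: A" "w |: W"
  have "tlift3 X (%x y z. tlift X g (pure k V W (act V x v) (lact W (act A y a) (act W z w)))) \<phi>
   = nested_r V A W X (lact W) g \<phi> v a w" by (rule tlift3_cong) (simp_all add: * tlift_pure_eq[OF _ _ g] X bil_cl[OF lWb])
  then show "tlift X g (pure k V W (ract V v a) w) = tlift3 X (%x y z. tlift X g (pure k V W (act V x v) (lact W (act A y a) (act W z w)))) \<phi>"
   using bal * by (simp add: alaw_def tlift_pure_eq[OF _ _ g] X bil_cl[OF rVb])
 qed
 then have "\<forall>n\<in>N. tlift X g n = \<zero>[X]" by (simp add: kills_iff[OF l X])
 then have c: "coset_val (tlift X g) (proj x) = tlift X g x" if "x |: tensor k V W" for x
  using N.coset_val_eq[OF l' X] that by simp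
 show "x |: (tensor k V W) ==> coset_val (tlift X g) (proj x) = tlift X g x" by (rule c)
 show "lmap k Q X (coset_val (tlift X g))" by (rule quot_lin) (subst linear_map_cong[OF c], simp_all add: l)
 show "v |: V ==> w |: W ==> coset_val (tlift X g) (p v w) = g v w" unfolding p_def' by (simp add: c tlift_pure_eq[OF _ _ g] X)
qed

end

locale two_bimodules = h_alg k H A for k :: "'k ring" and H :: "('k, 'h) quasi_hopf" and A :: "('k, 'h, 'a) hmodule" +
 fixes V :: "('k, 'h, 'a, 'v) bimodule" and W :: "('k, 'h, 'a, 'w) bimodule"
 assumes V: "a_bimodule k H A V" and W: "a_bimodule k H A W"

sublocale two_bimodules \<subseteq> balanced_pair by unfold_locales (rule bimoduleD[OF V] bimoduleD[OF W])+

context two_bimodules begin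

lemmas actV = bimoduleD(2,3)[OF V] and actW = bimoduleD(2,3)[OF W]
lemmas actVb = actV[THEN eqvD(1)] and actWb = actW[THEN eqvD(1)]

subsection \<open>Its bimodule structure\<close>

lemma descend:
 assumes E: "two_bimodules k H' A' V' W'"
  and f: "lmap k (tensor k V W) (tensor k V' W') f"
  and law: "alaw H V A W (tensor_over k H' A' V' W') (ract V) (%v w. balancing k H' A' V' W' +>\<^bsub>tensor k V' W'\<^esub> f (pure k V W v w))
   (lact W) (%v w. balancing k H' A' V' W' +>\<^bsub>tensor k V' W'\<^esub> f (pure k V W v w))"
  and x: "x |: tensor k V W" and add: "add M = add (tensor k V' W')"
 shows "coset_map M (balancing k H' A' V' W') f (proj x) = balancing k H' A' V' W' +>\<^bsub>tensor k V' W'\<^esub> f x"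
proof -
 interpret E: two_bimodules k H' A' V' W' by fact
 have 0: "E.proj (f n) = \<zero>[E.Q]" if "n \<in> N" for n
  using kills_iff[OF lin_comp[OF E.proj_lin f] E.Q_mod] law that by blast
 have kill: "f n \<in> E.N" if n: "n \<in> N" for n
 proof -
  have c: "n |: tensor k V W" using n N.N_sub by auto
  have "E.proj (f n) = E.N" using 0[OF n] by (simp add: E.Q_def' E.N.Q_zero)
  then show ?thesis using E.N.coset_zero_iff[of "f n"] lin_cl[OF f c] by simp
 qed
 have "lmap k (b_tensor k H A V W) (b_tensor k H' A' V' W') f" using f by (simp add: linear_map_def)
 then show ?thesis
  using N.map_coset_eq[where f = f and x = x and X' = M, OF _ E.N.M E.submodN kill] x by (simp add: coset_add_cong[OF add])
qed

lemma stable: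
 assumes "lmap k (tensor k V W) (tensor k V W) f"
  and "alaw H V A W Q (ract V) (%v w. proj (f (pure k V W v w))) (lact W) (%v w. proj (f (pure k V W v w)))"
  and x: "x |: tensor k V W"
 shows "coset_map (b_tensor k H A V W) N f (proj x) = proj (f x)" by (rule descend[OF two_bimodules_axioms assms]) simp

lemma Q_act: assumes h: "h |: H" and x: "x |: tensor k V W"
 shows "act Q h (proj x) = proj (act2 k V W (\<Delta> h) x)"
proof -
 have "act Q h = coset_map (b_tensor k H A V W) N (act2 k V W (\<Delta> h))" unfolding Q_def' quotient_bimodule_def by simp
 moreover have "coset_map (b_tensor k H A V W) N (act2 k V W (\<Delta> h)) (proj x) = proj (act2 k V W (\<Delta> h) x)"
 proof (rule stable[OF _ _ x])
  show "lmap k (tensor k V W) (tensor k V W) (act2 k V W (\<Delta> h))" by (simp add: lin h)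
  let ?n = "%v w. proj (act2 k V W (\<Delta> h) (pure k V W v w))"
  show "alaw H V A W Q (ract V) ?n (lact W) ?n" unfolding alaw_def
  proof (intro ballI)
   fix v a w assume vaw: "v |: V" "a |: A" "w |: W"
   let ?z = "pure3 k V A W v a w"
   let ?L = "tlift3 T (%u v w. pure k V W (ract V u v) w)" and ?R = "tlift3 T (%u v w. pure k V W u (lact W v w))"
   note b = eqvD(1)[OF p_eq] and hmT = hm_tensor[OF hmV hmW]
   note tr = tri_l[OF rVb b] tri_r[OF lWb b] and pr = proj_lin[folded linear_h_tensor(1)]
   have z: "?z |: (tensor k V (tensor k A W))" using vaw by simp
   have bal: "proj (?L z) = proj (?R (act3 k V A W \<phi> z))" if z: "z |: (tensor k V (tensor k A W))" for z
   proof -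
    have "tlift3 Q (%u v w. p (ract V u v) w) z = tlift3 Q (%u v w. p u (lact W v w)) (act3 k V A W \<phi> z)"
    using p_balanced[unfolded alaw_tlift[OF rVb p_bil lWb p_bil hmV A_hm hmW Q_mod]] z by blast
    then show ?thesis unfolding p_def'
    using tlift3_comp[OF tr(1) pr, of z] tlift3_comp[OF tr(2) pr, of "act3 k V A W \<phi> z"] z hmT by simp
   qed
   note n = nested_left_equivariant[OF rV p_eq hmV A_hm hmW hmV hmT h] nested_right_equivariant[OF lW p_eq hmV A_hm hmW hmW hmT h]
   have "?n (ract V v a) w = proj (act T h (?L ?z))" using vaw by (simp add: tlift3_pure[OF tr(1)] hmT)
   also have "... = proj (?R (act3 k V A W \<phi> (act3 k V A W (e1 (\<Delta> h)) ?z)))"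
    unfolding n(1)[OF z] by (rule bal) (use z h in simp)
   also have "act3 k V A W \<phi> (act3 k V A W (e1 (\<Delta> h)) ?z) = act3 k V A W (e2 (\<Delta> h)) (act3 k V A W \<phi> ?z)"
    using z h by (simp add: act234_mult[symmetric] coassoc)
   also have "proj (?R ...) = proj (act T h (?R (act3 k V A W \<phi> ?z)))" using n(2)[of "act3 k V A W \<phi> ?z"] z by simp
   also have "?R (act3 k V A W \<phi> ?z) = nested_r V A W T (lact W) (pure k V W) \<phi> v a w"
    by (rule tlift3_act[OF tr(2), symmetric]) (simp_all add: vaw hmT)
   also have "proj (act T h ...) = nested_r V A W Q (lact W) ?n \<phi> v a w"
    using tlift3_comp[OF act_trilinear[OF tr(2) hmV A_hm hmW vaw] lin_comp[OF pr hm_lin(3)[OF h hmT]]] hmT by simp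
   finally show "?n (ract V v a) w = nested_r V A W Q (lact W) ?n \<phi> v a w" .
  qed
 qed
 ultimately show ?thesis by simp
qed

lemma Q_hm [simp]: "hmod k H Q"
proof -
 have m: "lmap k (tensor k V W) Q (%x. act Q h (proj x))" if h: "h |: H" for h
  by (subst linear_map_cong[OF Q_act[OF h]]) (simp_all add: lin h)
 have "blmap k H Q Q (act Q)"
 proof (rule bilI)
  show "lmap k Q Q (act Q h)" if "h |: H" for h by (rule quot_lin[OF m[OF that]])
  fix q assume "q |: Q"
  then obtain x where x: "x |: tensor k V W" "q = proj x" by (rule Q_carrierE)
  show "lmap k H Q (%h. act Q h q)" unfolding x(2) by (subst linear_map_cong[OF Q_act[OF _ x(1)]]) (simp_all add: lin x(1))
 qed
 moreover have "act Q \<one>\<^sub>1 q = q" if "q |: Q" for q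
  using that by (elim Q_carrierE) (simp add: Q_act alg_homD(2)[OF comult_hom] alg_moduleD(6)[OF act2_mod])
 moreover have "act Q (g *1 h) q = act Q g (act Q h q)" if "g |: H" "h |: H" "q |: Q" for g h q
  using that by (elim Q_carrierE) (simp add: Q_act alg_homD(3)[OF comult_hom] act234_mult)
 ultimately show ?thesis unfolding h_module_def by simp
qed

lemma p_equivariant: "equivar k H V W Q p" unfolding p_def'
 by (rule equivar_post[OF p_eq]) (simp_all add: proj_lin linear_h_tensor Q_act)

abbreviation "lact_T == complete_right A V W T (lact V) (pure k V W)"
abbreviation "ract_T == complete_left V W A T (ract W) (pure k V W)"

lemma T_actions:
 "equivar k H A T Q (%a t. proj (lact_T a t))" "equivar k H T A Q (%t a. proj (ract_T t a))"
 "alaw H A V W Q (lact V) p (pure k V W) (%a t. proj (lact_T a t))"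
 "alaw H V W A Q (pure k V W) (%t a. proj (ract_T t a)) (ract W) p"
proof -
 note e = complete_right_equivariant[OF A_hm hmV hmW hmV hm_tensor[OF hmV hmW] actV(1) p_eq]
  complete_left_equivariant[OF hmV hmW A_hm hmW hm_tensor[OF hmV hmW] actW(2) p_eq]
 note l = complete_right_law[OF A_hm hmV hmW hmV hm_tensor[OF hmV hmW] actV(1) p_eq]
  complete_left_law[OF hmV hmW A_hm hmW hm_tensor[OF hmV hmW] actW(2) p_eq]
 note pr = proj_lin[folded linear_h_tensor(1)]
 show "equivar k H A T Q (%a t. proj (lact_T a t))" "equivar k H T A Q (%t a. proj (ract_T t a))"
  by (rule equivar_post[OF e(1) pr] equivar_post[OF e(2) pr]; simp add: Q_act)+
 show "alaw H A V W Q (lact V) p (pure k V W) (%a t. proj (lact_T a t))"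
  unfolding p_def' by (rule alaw_post[OF A_hm hmV hmW hm_tensor[OF hmV hmW] l(1) eqvD(1)[OF p_eq] eqvD(1)[OF e(1)] pr]) simp_all
 show "alaw H V W A Q (pure k V W) (%t a. proj (ract_T t a)) (ract W) p"
  unfolding p_def' by (rule alaw_post[OF hmV hmW A_hm hm_tensor[OF hmV hmW] l(2) actWb(2) eqvD(1)[OF p_eq] pr]) simp_all
qed

lemma T_lin:
 "a |: A ==> lmap k (tensor k V W) (tensor k V W) (lact_T a)"
 "a |: A ==> lmap k (tensor k V W) (tensor k V W) (%t. ract_T t a)"
proof -
 note b = complete_right_bilinear[OF A_hm hmV hmW hmV hm_tensor[OF hmV hmW] actV(1) p_eq]
  complete_left_bilinear[OF hmV hmW A_hm hmW hm_tensor[OF hmV hmW] actW(2) p_eq]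
 show "a |: A ==> lmap k (tensor k V W) (tensor k V W) (lact_T a)"
  "a |: A ==> lmap k (tensor k V W) (tensor k V W) (%t. ract_T t a)"
  using bil_r[OF b(1)] bil_l[OF b(2)] by (simp_all add: linear_h_tensor)
qed

text \<open>
 In the pentagon for \<open>A, V, A, W\<close> four edges are known; the remaining one is the balancing condition
 for \<open>v \<otimes> w \<mapsto> a (v \<otimes>\<^sub>A w)\<close>. The right action is treated alike, with \<open>V, A, W, A\<close>.
\<close>

lemma Q_lact:
 assumes a: "a |: A" and x: "x |: tensor k V W"
 shows "lact Q a (proj x) = proj (lact_T a x)"
proof -
 interpret L: four_products k H A V A W V V V T W Q "lact V" "ract V" "ract V" "lact V" p "pure k V W" "%a t. proj (lact_T a t)"
  "lact W" "pure k V W" p by unfold_locales (simp_all add: actV actW p_equivariant p_eq T_actions)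
 note edge = L.edges(3)[OF L.law_edges(1)[OF bimoduleD(6)[OF V]] L.law_edges(2)[OF T_actions(3)]
  L.law_edges(4)[OF p_balanced] L.law_edges(5)[OF T_actions(3)]]
 have "lact Q a = coset_map (b_tensor k H A V W) N (lact_T a)"
  unfolding Q_def' quotient_bimodule_def by (simp add: b_tensor_actions)
 then show ?thesis using stable[OF T_lin(1)[OF a] _ x] edge a by (simp add: alaw_def)
qed

lemma Q_ract:
 assumes a: "a |: A" and x: "x |: tensor k V W"
 shows "ract Q (proj x) a = proj (ract_T x a)"
proof -
 interpret L: four_products k H V A W A V T W W W Q "ract V" "pure k V W" "lact W" "pure k V W" "%t a. proj (ract_T t a)" "ract W" p
  "ract W" "lact W" p by unfold_locales (simp_all add: actV actW p_equivariant p_eq T_actions)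
 note edge = L.edges(1)[OF L.law_edges(2)[OF T_actions(4)] L.law_edges(3)[OF bimoduleD(6)[OF W]] L.law_edges(4)[OF T_actions(4)]
  L.law_edges(5)[OF p_balanced]]
 have "ract Q (proj x) a = coset_map (b_tensor k H A V W) N (%t. ract_T t a) (proj x)"
  unfolding Q_def' quotient_bimodule_def by (simp add: b_tensor_actions)
 then show ?thesis using stable[OF T_lin(2)[OF a] _ x] edge a by (simp add: alaw_def)
qed

lemma actQ: "equivar k H A Q Q (lact Q)" "equivar k H Q A Q (ract Q)"
proof -
 note b = T_actions(1,2)[THEN eqvD(1)]
 show "equivar k H A Q Q (lact Q)"
 proof (rule equivariantI)
  show "blmap k A Q Q (lact Q)"
  proof (rule bilI)
   show "lmap k Q Q (lact Q a)" if a: "a |: A" for a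
    by (rule quot_lin, subst linear_map_cong[OF Q_lact[OF a]]) (use bil_r[OF b(1) a] in "simp_all add: linear_h_tensor")
   fix q assume "q |: Q"
   then obtain x where x: "x |: tensor k V W" "q = proj x" by (rule Q_carrierE)
   show "lmap k A Q (%a. lact Q a q)"
    unfolding x(2) by (subst linear_map_cong[OF Q_lact[OF _ x(1)]]) (use bil_l[OF b(1), of x] x(1) in simp_all)
  qed
  fix h a q assume h: "h |: H" and a: "a |: A" and "q |: Q"
  then obtain x where x: "x |: tensor k V W" "q = proj x" by (auto elim: Q_carrierE)
  have "twprod A Q Q (\<Delta> h) (lact Q) a (proj x) = twprod A T Q (\<Delta> h) (%a t. proj (lact_T a t)) a x"
   unfolding twprod_def by (rule tlift_cong[OF H_mod H_mod]) (simp_all add: h a x(1) Q_act Q_lact)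
  then show "act Q h (lact Q a q) = twprod A Q Q (\<Delta> h) (lact Q) a q"
   using h a x eqvD(2)[OF T_actions(1), of h a x] by (simp add: Q_lact)
 qed
 show "equivar k H Q A Q (ract Q)"
 proof (rule equivariantI)
  show "blmap k Q A Q (ract Q)"
  proof (rule bilI)
   show "lmap k Q Q (%q. ract Q q a)" if a: "a |: A" for a
    by (rule quot_lin, subst linear_map_cong[OF Q_ract[OF a]]) (use bil_l[OF b(2) a] in "simp_all add: linear_h_tensor")
   fix q assume "q |: Q"
   then obtain x where x: "x |: tensor k V W" "q = proj x" by (rule Q_carrierE)
   show "lmap k A Q (ract Q q)"
    unfolding x(2) by (subst linear_map_cong[OF Q_ract[OF _ x(1)]]) (use bil_r[OF b(2), of x] x(1) in simp_all)
  qed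
  fix h a q assume h: "h |: H" and "q |: Q" and a: "a |: A"
  then obtain x where x: "x |: tensor k V W" "q = proj x" by (auto elim: Q_carrierE)
  have "twprod Q A Q (\<Delta> h) (ract Q) (proj x) a = twprod T A Q (\<Delta> h) (%t a. proj (ract_T t a)) x a"
   unfolding twprod_def by (rule tlift_cong[OF H_mod H_mod]) (simp_all add: h a x(1) Q_act Q_ract)
  then show "act Q h (ract Q q a) = twprod Q A Q (\<Delta> h) (ract Q) q a"
   using h a x eqvD(2)[OF T_actions(2), of h x a] by (simp add: Q_ract)
 qed
qed

lemma law_lact: "alaw H A V W Q (lact V) p p (lact Q)"
proof -
 have "nested_r A V W Q p (lact Q) \<phi> a v w
  = tlift3 Q (%x y z. proj (lact_T (act A x a) (pure k V W (act V y v) (act W z w)))) \<phi>"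
  if "a |: A" "v |: V" "w |: W" for a v w by (rule tlift3_cong) (simp_all add: that p_def' Q_lact)
 then show ?thesis using T_actions(3) by (simp add: alaw_def)
qed

lemma law_ract: "alaw H V W A Q p (ract Q) (ract W) p" using T_actions(4) by (simp add: alaw_def p_def' Q_ract)

lemma Q_bimodule: "a_bimodule k H A Q"
proof -
 note bQ = actQ[THEN eqvD(1)]
 interpret L: four_products k H A A V W A V V Q Q Q "mult A" "lact V" "lact V" "lact V" p p "lact Q" p "lact Q" "lact Q"
  by unfold_locales (simp_all add: actV p_equivariant actQ A_eq)
 note 1 = L.edges(5)[OF L.law_edges(1)[OF bimoduleD(5)[OF V]] L.law_edges(2)[OF law_lact] L.law_edges(3)[OF law_lact] L.law_edges(4)[OF law_lact]]
 interpret R: four_products k H V W A A Q Q W W A Q p "ract Q" "ract W" p "ract Q" "ract W" p "mult A" "ract W" "ract Q"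
  by unfold_locales (simp_all add: actW p_equivariant actQ A_eq)
 note 2 = R.edges(4)[OF R.law_edges(1)[OF law_ract] R.law_edges(2)[OF law_ract] R.law_edges(3)[OF bimoduleD(4)[OF W]] R.law_edges(5)[OF law_ract]]
 interpret B: four_products k H A V W A V Q Q Q W Q "lact V" p p "lact Q" "ract Q" "ract Q" "lact Q" "ract W" p p
  by unfold_locales (simp_all add: actV actW p_equivariant actQ A_eq)
 note 3 = B.edges(2)[OF B.law_edges(1)[OF law_lact] B.law_edges(3)[OF law_ract] B.law_edges(4)[OF law_ract] B.law_edges(5)[OF law_lact]]
 have left: "alaw H A A Q Q (mult A) (lact Q) (lact Q) (lact Q)" unfolding alaw_def
  by (intro ballI, rule over_eq[OF law_linear(5,6)[OF A_hm A_hm Q_hm Q_hm eqvD(1)[OF A_eq] bQ(1) bQ(1) bQ(1)]]) (use 1 in simp_all)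
 have right: "alaw H Q A A Q (ract Q) (ract Q) (mult A) (ract Q)" unfolding alaw_def
  by (intro ballI, rule over_eq[OF law_linear(1,2)[OF Q_hm A_hm A_hm Q_hm bQ(2) bQ(2) eqvD(1)[OF A_eq] bQ(2)]]) (use 2 in simp_all)
 have mixed: "alaw H A Q A Q (lact Q) (ract Q) (ract Q) (lact Q)" unfolding alaw_def
  by (intro ballI, rule over_eq[OF law_linear(3,4)[OF A_hm Q_hm A_hm Q_hm bQ(1) bQ(2) bQ(2) bQ(1)]]) (use 3 in simp_all)
 have unit: "lact Q \<one>\<^sub>A (p v w) = p v w" "ract Q (p v w) \<one>\<^sub>A = p v w" if vw: "v |: V" "w |: W" for v w
 proof -
  note t = tri_r[OF p_bil bQ(1)] tri_r[OF actWb(2) p_bil]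
  have "p v w = tlift3 Q (%a b c. lact Q (act A a \<one>\<^sub>A) (p (act V b v) (act W c w))) \<phi>"
   using law_lact[unfolded alaw_def, rule_format, OF A_one vw] bimoduleD(7)[OF V vw(1)] by simp
  also have "... = twprod V W Q (counit_l H2 \<phi>) (%v w. lact Q \<one>\<^sub>A (p v w)) v w"
   by (rule tri_counit(1)[OF t(1)]) (simp_all add: vw A_inv)
  also have "... = lact Q \<one>\<^sub>A (p v w)"
   unfolding kappa1_phi by (rule twprod_one[OF trilinearD(2)[OF t(1)]]) (simp_all add: vw)
  finally show "lact Q \<one>\<^sub>A (p v w) = p v w" ..
  have "ract Q (p v w) \<one>\<^sub>A = tlift3 Q (%a b c. p (act V a v) (ract W (act W b w) (act A c \<one>\<^sub>A))) \<phi>"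
   using law_ract[unfolded alaw_def, rule_format, OF vw A_one] .
  also have "... = twprod V W Q (\<kappa>3 \<phi>) (%v w. p v (ract W w \<one>\<^sub>A)) v w"
   by (rule tri_counit(3)[OF t(2)]) (simp_all add: vw A_inv)
  also have "... = p v (ract W w \<one>\<^sub>A)"
   unfolding kappa3_phi by (rule twprod_one) (simp_all add: vw bilI bil1[OF p_bil] bil2[OF p_bil] bil_l[OF actWb(2)] bil_r[OF p_bil] bil_l[OF p_bil] bil_cl[OF actWb(2)] linear_id)
  finally show "ract Q (p v w) \<one>\<^sub>A = p v w" using bimoduleD(8)[OF W vw(2)] by simp
 qed
 have "lact Q \<one>\<^sub>A q = q \<and> ract Q q \<one>\<^sub>A = q" if q: "q |: Q" for q
  by (intro conjI; rule over_eq[where M = Q, OF _ _ _ _ q])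
   (simp_all add: linear_id unit bil_r[OF bQ(1)] bil_l[OF bQ(2)])
 then show ?thesis unfolding a_bimodule_iff using left right mixed actQ by simp
qed

end

lemma bim_homD:
 assumes "bimodule_hom k H A V W f"
 shows "lmap k V W f" "v |: V ==> f v |: W"
  "h |: H ==> v |: V ==> f (act V h v) = act W h (f v)"
  "a |: A ==> v |: V ==> f (lact V a v) = lact W a (f v)"
  "v |: V ==> a |: A ==> f (ract V v a) = ract W (f v) a"
 using assms lin_cl[of k V W f v] unfolding bimodule_hom_def h_linear_def by auto

context two_bimodules begin

subsection \<open>Morphisms\<close>

text \<open>
 The actions on \<open>V \<otimes>\<^sub>A W\<close> are given on pure tensors by laws. A descended map thus respects them as soon as
 it turns \<open>v \<otimes>\<^sub>A w\<close> into a product that satisfies the same laws.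
\<close>

lemma over_bimodule_hom:
 assumes m: "lmap k Q X m" and X: "a_bimodule k H A X"
  and e: "equivar k H V W X (%v w. m (p v w))"
  and L: "alaw H A V W X (lact V) (%v w. m (p v w)) (%v w. m (p v w)) (lact X)"
  and R: "alaw H V W A X (%v w. m (p v w)) (ract X) (ract W) (%v w. m (p v w))"
 shows "bimodule_hom k H A Q X m"
proof -
 note [simp] = bimoduleD(1)[OF X] and aX = bimoduleD(2,3)[OF X]
 note bX = aX[THEN eqvD(1)] and bQ = actQ[THEN eqvD(1)]
 have h: "m (act Q h q) = act X h (m q)" if h: "h |: H" and q: "q |: Q" for h q
 proof (rule over_eq[where M = X, OF _ _ _ _ q])
  fix v w assume vw: "v |: V" "w |: W"
  have "m (twprod V W Q (\<Delta> h) p v w) = twprod V W X (\<Delta> h) (%v w. m (p v w)) v w"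
   unfolding twprod_def by (rule tlift_linear_comp[OF twprod_bil[OF p_bil] m]) (simp_all add: h vw)
  then show "m (act Q h (p v w)) = act X h (m (p v w))" by (simp add: eqvD(2)[OF p_equivariant h vw] eqvD(2)[OF e h vw])
 qed (simp_all add: lin_comp[OF m] lin m h)
 have l: "m (lact Q a q) = lact X a (m q)" if a: "a |: A" and q: "q |: Q" for a q
 proof (rule over_eq[where M = X, OF _ _ _ _ q])
  fix v w assume vw: "v |: V" "w |: W"
  note tr = act_trilinear[OF tri_l[OF actVb(1) p_bil]]
  have "lact Q a (p v w) = nested_l A V W Q (lact V) p \<psi> a v w"
   using law_lact[unfolded alaw_inv[OF actVb(1) p_bil p_bil bQ(1) A_hm hmV hmW Q_mod]] a vw by simp
  then have "m (lact Q a (p v w)) = tlift3 X (%x y z. m (p (lact V (act A x a) (act V y v)) (act W z w))) \<psi>"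
   using tlift3_comp[OF tr m] a vw by simp
  also have "... = lact X a (m (p v w))"
   using L[unfolded alaw_inv[OF actVb(1) eqvD(1)[OF e] eqvD(1)[OF e] bX(1) A_hm hmV hmW hm_mod[OF bimoduleD(1)[OF X]]]] a vw
   by simp
  finally show "m (lact Q a (p v w)) = lact X a (m (p v w))" .
 qed (simp_all add: lin_comp[OF m] bil2[OF bX(1) m] bil_r[OF bQ(1)] a)
 have r: "m (ract Q q a) = ract X (m q) a" if a: "a |: A" and q: "q |: Q" for a q
 proof (rule over_eq[where M = X, OF _ _ _ _ q])
  fix v w assume vw: "v |: V" "w |: W"
  note tr = act_trilinear[OF tri_r[OF actWb(2) p_bil]]
  have "m (ract Q (p v w) a) = tlift3 X (%x y z. m (p (act V x v) (ract W (act W y w) (act A z a)))) \<phi>"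
   using tlift3_comp[OF tr m] law_ract a vw by (simp add: alaw_def)
  then show "m (ract Q (p v w) a) = ract X (m (p v w)) a" using R a vw by (simp add: alaw_def)
 qed (simp_all add: lin_comp[OF m] bil1[OF bX(2) m] bil_l[OF bQ(2)] a)
 show ?thesis unfolding bimodule_hom_def h_linear_def using m h l r by blast
qed

lemma map_over:
 assumes E: "two_bimodules k H A V' W'" and f: "bimodule_hom k H A V V' f" and g: "bimodule_hom k H A W W' g"
 shows "bimodule_hom k H A Q (tensor_over k H A V' W') (map_over k H A V W V' W' f g)"
  "v |: V ==> w |: W ==> map_over k H A V W V' W' f g (p v w) = pure_over k H A V' W' (f v) (g w)"
proof -
 interpret E: two_bimodules k H A V' W' by fact
 let ?m = "map_over k H A V W V' W' f g"
 note f' = bim_homD[OF f] and g' = bim_homD[OF g]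
 have tl: "lmap k (tensor k V W) (tensor k V' W') (tmap k V' W' f g)" by (rule tmap_lin[OF f'(1) g'(1)]) simp_all
 have tp: "E.proj (tmap k V' W' f g (pure k V W v w)) = E.p (f v) (g w)" if "v |: V" "w |: W" for v w
  using that by (simp add: tmap_pure[OF f'(1) g'(1)] E.p_def')
 have pr: "?m (proj x) = E.proj (tmap k V' W' f g x)" if x: "x |: tensor k V W" for x
 proof -
  have "alaw H V A W E.Q (ract V) (%v w. E.proj (tmap k V' W' f g (pure k V W v w))) (lact W) (%v w. E.proj (tmap k V' W' f g (pure k V W v w)))"
   unfolding alaw_def
  proof (intro ballI)
   fix v a w assume vaw: "v |: V" "a |: A" "w |: W"
   have "tlift3 E.Q (%x y z. E.proj (tmap k V' W' f g (pure k V W (act V x v) (lact W (act A y a) (act W z w))))) \<phi>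
    = nested_r V' A W' E.Q (lact W') E.p \<phi> (f v) a (g w)"
    by (rule tlift3_cong) (simp_all add: vaw tp f' g' bil_cl[OF actWb(1)])
   then show "E.proj (tmap k V' W' f g (pure k V W (ract V v a) w))
    = tlift3 E.Q (%x y z. E.proj (tmap k V' W' f g (pure k V W (act V x v) (lact W (act A y a) (act W z w))))) \<phi>"
    using E.p_balanced vaw by (simp add: tp f' g' bil_cl[OF actVb(2)] alaw_def)
  qed
  from descend[OF E tl this x HOL.refl] show ?thesis using x by (simp add: map_over_def)
 qed
 have lm: "lmap k Q E.Q ?m" by (rule quot_lin, subst linear_map_cong[OF pr]) (simp_all add: lin_comp[OF E.proj_lin tl])
 show mp: "?m (p v w) = E.p (f v) (g w)" if "v |: V" "w |: W" for v w using that by (simp add: p_def'[of v w] pr tp)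
 show "bimodule_hom k H A Q E.Q ?m"
 proof (rule over_bimodule_hom[OF lm E.Q_bimodule])
  have "equivar k H V W E.Q (%v w. E.p (f v) (g w))" by (rule equivar_pre[OF E.p_equivariant f'(1) g'(1)]) (simp_all add: f' g')
  then show "equivar k H V W E.Q (%v w. ?m (p v w))" by (rule equivar_cong) (simp_all add: mp)
  show "alaw H A V W E.Q (lact V) (%v w. ?m (p v w)) (%v w. ?m (p v w)) (lact E.Q)" unfolding alaw_def
  proof (intro ballI)
   fix a v w assume vaw: "a |: A" "v |: V" "w |: W"
   have "tlift3 E.Q (%x y z. lact E.Q (act A x a) (?m (p (act V y v) (act W z w)))) \<phi>
    = nested_r A V' W' E.Q E.p (lact E.Q) \<phi> a (f v) (g w)" by (rule tlift3_cong) (simp_all add: vaw mp f' g')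
   then show "?m (p (lact V a v) w) = tlift3 E.Q (%x y z. lact E.Q (act A x a) (?m (p (act V y v) (act W z w)))) \<phi>"
    using E.law_lact vaw by (simp add: mp f' g' bil_cl[OF actVb(1)] alaw_def)
  qed
  show "alaw H V W A E.Q (%v w. ?m (p v w)) (ract E.Q) (ract W) (%v w. ?m (p v w))" unfolding alaw_def
  proof (intro ballI)
   fix v w a assume vaw: "v |: V" "w |: W" "a |: A"
   have "tlift3 E.Q (%x y z. ?m (p (act V x v) (ract W (act W y w) (act A z a)))) \<phi>
    = nested_r V' W' A E.Q (ract W') E.p \<phi> (f v) (g w) a"
    by (rule tlift3_cong) (simp_all add: vaw mp f' g' bil_cl[OF actWb(2)])
   then show "ract E.Q (?m (p v w)) a = tlift3 E.Q (%x y z. ?m (p (act V x v) (ract W (act W y w) (act A z a)))) \<phi>"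
    using E.law_ract vaw by (simp add: mp f' g' alaw_def)
  qed
 qed
qed

end

subsection \<open>Associator and unitors\<close>

locale three_bimodules = h_alg k H A for k :: "'k ring" and H :: "('k, 'h) quasi_hopf" and A :: "('k, 'h, 'a) hmodule" +
 fixes V :: "('k, 'h, 'a, 'v) bimodule" and W :: "('k, 'h, 'a, 'w) bimodule" and X :: "('k, 'h, 'a, 'x) bimodule"
 assumes V: "a_bimodule k H A V" and W: "a_bimodule k H A W" and X: "a_bimodule k H A X"
begin

sublocale VW: two_bimodules k H A V W by unfold_locales (fact V, fact W)
sublocale WX: two_bimodules k H A W X by unfold_locales (fact W, fact X)
sublocale L: two_bimodules k H A VW.Q X by unfold_locales (fact VW.Q_bimodule, fact X)
sublocale R: two_bimodules k H A V WX.Q by unfold_locales (fact V, fact WX.Q_bimodule)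

abbreviation "assoc_T == complete_left V W X R.Q WX.p R.p"

lemma assoc_T: "equivar k H VW.T X R.Q assoc_T" "alaw H V W X R.Q (pure k V W) assoc_T WX.p R.p"
 by (rule complete_left_equivariant[where Q = WX.Q] complete_left_law[where Q = WX.Q];
   simp add: WX.p_equivariant R.p_equivariant)+

text \<open>
 The associator in two steps, \<open>V \<otimes>\<^sub>A W\<close> first: for each \<open>x\<close>, the completed product \<open>assoc_T\<close> is balanced by an
 edge for \<open>V, A, W, X\<close>, and the descended product is then balanced in its arguments \<open>V \<otimes>\<^sub>A W\<close> and \<open>X\<close>.
\<close>

definition "assoc_Q D x = coset_val (tlift R.Q (%v w. nested_r V W X R.Q WX.p R.p \<phi> v w x)) D"

lemma assoc_Q:
 assumes x: "x |: X"
 shows "lmap k VW.Q R.Q (%D. assoc_Q D x)"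
  "v |: V ==> w |: W ==>
   assoc_Q (VW.p v w) x = nested_r V W X R.Q WX.p R.p \<phi> v w x"
  "t |: (tensor k V W) ==> assoc_Q (VW.proj t) x = assoc_T t x"
proof -
 let ?g = "%v w. nested_r V W X R.Q WX.p R.p \<phi> v w x"
 note tr = complete_aux[OF tri_r[OF WX.p_bil R.p_bil] VW.hmV VW.hmW WX.hmW R.Q_mod phi_closed(1)]
 have b: "blmap k V W R.Q ?g" by (rule bilI) (use x trilinearD(1)[OF tr] bil_l[OF trilinearD(2)[OF tr]] in simp_all)
 interpret E: four_products k H V A W X V VW.T W WX.Q WX.Q R.Q "ract V" "pure k V W" "lact W" "pure k V W" assoc_T WX.p R.p
  WX.p "lact WX.Q" R.p by unfold_locales (simp_all add: VW.actV VW.actW WX.p_equivariant R.p_equivariant VW.p_eq assoc_T WX.actQ)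
 note edge = E.edges(1)[OF E.law_edges(2)[OF assoc_T(2)] E.law_edges(3)[OF WX.law_lact] E.law_edges(4)[OF assoc_T(2)] E.law_edges(5)[OF R.p_balanced]]
 have g: "assoc_T (pure k V W v w) x = ?g v w" if "v |: V" "w |: W" for v w using assoc_T(2) that x by (simp add: alaw_def)
 have bal: "alaw H V A W R.Q (ract V) ?g (lact W) ?g" unfolding alaw_def
 proof (intro ballI)
  fix v a w assume vaw: "v |: V" "a |: A" "w |: W"
  have "nested_r V A W R.Q (lact W) ?g \<phi> v a w
   = tlift3 R.Q (%b c d. assoc_T (pure k V W (act V b v) (lact W (act A c a) (act W d w))) x) \<phi>"
   by (rule tlift3_cong) (simp_all add: g vaw bil_cl[OF VW.actWb(1)])
  then show "?g (ract V v a) w = nested_r V A W R.Q (lact W) ?g \<phi> v a w"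
   using edge vaw x by (simp add: g[symmetric] bil_cl[OF VW.actVb(2)])
 qed
 note c = VW.coset_val_lift[OF b R.Q_mod bal]
 show "lmap k VW.Q R.Q (%D. assoc_Q D x)" "v |: V ==> w |: W ==> assoc_Q (VW.p v w) x = ?g v w"
  unfolding assoc_Q_def by (rule c; assumption)+
 show "t |: (tensor k V W) ==> assoc_Q (VW.proj t) x = assoc_T t x" unfolding assoc_Q_def complete_left_def by (rule c(3))
qed

lemma assoc_Q_equivariant: "equivar k H VW.Q X R.Q assoc_Q"
proof (rule equivariantI)
 note b = eqvD(1)[OF assoc_T(1)]
 show "blmap k VW.Q X R.Q assoc_Q"
 proof (rule bilI)
  fix D assume "D |: VW.Q"
  then obtain t where t: "t |: tensor k V W" "D = VW.proj t" by (rule VW.Q_carrierE)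
  show "lmap k X R.Q (assoc_Q D)"
   unfolding t(2) by (subst linear_map_cong[OF assoc_Q(3)[OF _ t(1)]]) (use bil_r[OF b, of t] t(1) in simp_all)
 qed (rule assoc_Q(1))
 fix h D x assume h: "h |: H" and "D |: VW.Q" and x: "x |: X"
 then obtain t where t: "t |: tensor k V W" "D = VW.proj t" by (auto elim: VW.Q_carrierE)
 have "twprod VW.Q X R.Q (\<Delta> h) assoc_Q (VW.proj t) x = twprod VW.T X R.Q (\<Delta> h) assoc_T t x"
  unfolding twprod_def by (rule tlift_cong[OF H_mod H_mod]) (simp_all add: h x t(1) VW.Q_act assoc_Q(3))
 then show "act R.Q h (assoc_Q D x) = twprod VW.Q X R.Q (\<Delta> h) assoc_Q D x"
  using h x t eqvD(2)[OF assoc_T(1), of h t x] by (simp add: assoc_Q(3))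
qed

lemma law_assoc_Q: "alaw H V W X R.Q VW.p assoc_Q WX.p R.p" unfolding alaw_def by (simp add: assoc_Q(2))

lemma assoc_over:
 shows "lmap k L.Q R.Q (assoc_over k H A V W X)"
  "D |: VW.Q ==> x |: X ==> assoc_over k H A V W X (L.p D x) = assoc_Q D x"
proof -
 note b = eqvD(1)[OF assoc_Q_equivariant]
 interpret E: four_products k H V W A X VW.Q VW.Q W WX.Q X R.Q VW.p "ract VW.Q" "ract W" VW.p assoc_Q WX.p R.p "lact X" WX.p assoc_Q
  by unfold_locales (simp_all add: VW.actW WX.actW VW.p_equivariant WX.p_equivariant R.p_equivariant assoc_Q_equivariant VW.actQ)
 note edge = E.edges(4)[OF E.law_edges(1)[OF VW.law_ract] E.law_edges(2)[OF law_assoc_Q] E.law_edges(3)[OF WX.p_balanced] E.law_edges(5)[OF law_assoc_Q]]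
 have bal: "alaw H VW.Q A X R.Q (ract VW.Q) assoc_Q (lact X) assoc_Q" unfolding alaw_def
  by (intro ballI, rule VW.over_eq[OF law_linear(1,2)[OF VW.Q_hm A_hm WX.hmW R.Q_hm eqvD(1)[OF VW.actQ(2)] b WX.actWb(1) b]]) (use edge in simp_all)
 have e: "assoc_over k H A V W X = coset_val (tlift R.Q assoc_Q)" unfolding assoc_over_def assoc_Q_def Let_def ..
 show "lmap k L.Q R.Q (assoc_over k H A V W X)"
  "D |: VW.Q ==> x |: X ==> assoc_over k H A V W X (L.p D x) = assoc_Q D x"
  unfolding e by (rule L.coset_val_lift[OF b R.Q_mod bal]; assumption)+
qed

end

lemma (in h_alg) unit_over:
 assumes V: "a_bimodule k H A V"
 shows "two_bimodules k H A (regular A) V" "two_bimodules k H A V (regular A)"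
  "lmap k (tensor_over k H A (regular A) V) V (lunit_over V)"
  "lmap k (tensor_over k H A V (regular A)) V (runit_over V)"
  "a |: A ==> v |: V ==> lunit_over V (pure_over k H A (regular A) V a v) = lact V a v"
  "a |: A ==> v |: V ==> runit_over V (pure_over k H A V (regular A) v a) = ract V v a"
proof -
 show t: "two_bimodules k H A (regular A) V" "two_bimodules k H A V (regular A)" using V regular_bimodule by unfold_locales
 interpret L: two_bimodules k H A "regular A" V by (rule t)
 interpret R: two_bimodules k H A V "regular A" by (rule t)
 have b: "blmap k (regular A) V V (lact V)" "blmap k V (regular A) V (ract V)" using L.actWb(1) R.actVb(2)
  by (simp_all add: bilinear_same[OF regular_same same_refl same_refl] bilinear_same[OF same_refl regular_same same_refl])
 have l: "alaw H (regular A) A V V (ract (regular A)) (lact V) (lact V) (lact V)"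
  "alaw H V A (regular A) V (ract V) (ract V) (lact (regular A)) (ract V)" using bimoduleD(4,5)[OF V]
  by (simp_all add: assoc_same[OF regular_same same_refl same_refl same_refl] assoc_same[OF same_refl same_refl regular_same same_refl])
 show "lmap k (tensor_over k H A (regular A) V) V (lunit_over V)"
  "a |: A ==> v |: V ==> lunit_over V (pure_over k H A (regular A) V a v) = lact V a v"
  unfolding lunit_over_def by (rule L.coset_val_lift[OF b(1) _ l(1)]; simp)+
 show "lmap k (tensor_over k H A V (regular A)) V (runit_over V)"
  "a |: A ==> v |: V ==> runit_over V (pure_over k H A V (regular A) v a) = ract V v a"
  unfolding runit_over_def by (rule R.coset_val_lift[OF b(2) _ l(2)]; simp)+
qed

section \<open>The internal hom of bimodules\<close>

lemma b_hom_simps [simp]: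
 "carrier (b_hom k H A V W) = carrier (lin_hom k V W)" "add (b_hom k H A V W) = add (lin_hom k V W)"
 "zero (b_hom k H A V W) = zero (lin_hom k V W)" "smult (b_hom k H A V W) = smult (lin_hom k V W)"
 "act (b_hom k H A V W) = (%h. hom_act k H V W (comult H h))"
 by (simp_all add: b_hom_def hmodule.extend_def bimodule.fields_def, simp add: fun_eq_iff)

lemma b_hom_same: "same_h (b_hom k H A V W) (h_hom k H V W)" by (simp add: same_h_def fun_eq_iff)

lemma (in quasi_hopf_alg) lhat_coev: "lhat k H A V = coev A V V (lact V)" by (intro ext) (simp add: lhat_def coev_def)

lemma sub_module:
 assumes M: "module k M" and "N \<subseteq> carrier M" "\<zero>[M] \<in> N"
  and "!!x y. x \<in> N ==> y \<in> N ==> x \<oplus>[M] y \<in> N" "!!r x. r |: k ==> x \<in> N ==> r \<odot>[M] x \<in> N"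
 shows "module k (M\<lparr>carrier := N\<rparr>)"
proof -
 interpret M: module k M by fact
 have neg: "\<ominus>[M] x \<in> N" if "x \<in> N" for x
  using assms(5)[of "\<ominus>[k] \<one>[k]" x] assms(2) that M.smult_l_minus[of "\<one>[k]" x] M.smult_one[of x] by auto
 have c: "x \<in> N ==> x |: M" for x using assms(2) by auto
 show ?thesis
 proof (rule moduleI[OF M.R.is_cring])
  show "abelian_group (M\<lparr>carrier := N\<rparr>)"
  proof (rule abelian_groupI)
   fix x assume "x |: M\<lparr>carrier := N\<rparr>"
   then show "\<exists>y\<in>carrier (M\<lparr>carrier := N\<rparr>). y \<oplus>[M\<lparr>carrier := N\<rparr>] x = \<zero>[M\<lparr>carrier := N\<rparr>]"
    using neg[of x] c by (intro bexI[of _ "\<ominus>[M] x"]) (simp_all add: M.l_neg)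
  qed (simp_all add: assms c M.a_ac)
 qed (simp_all add: assms c M.smult_l_distr M.smult_r_distr M.smult_assoc1)
qed

context two_bimodules begin

abbreviation "B == b_hom k H A V W"
abbreviation "e == ev V W"

lemma B_hm [simp]: "hmod k H B" using hm_hom[OF hmV hmW] by (simp add: h_module_same[OF b_hom_same])

lemma e_eq: "equivar k H B V W e" using ev_equivariant[OF hmV hmW] by (simp add: eqv_same[OF b_hom_same same_refl same_refl])
lemmas e_bil = eqvD(1)[OF e_eq]

lemma lhat:
 assumes X: "a_bimodule k H A X"
 shows "lmap k A (h_hom k H X X) (lhat k H A X)" "a |: A ==> lhat k H A X a |: h_hom k H X X"
  "h |: H ==> a |: A ==> lhat k H A X (act A h a) = act (h_hom k H X X) h (lhat k H A X a)"
  "a |: A ==> x |: X ==> ev X X (lhat k H A X a) x = lact X a x"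
proof -
 note c = bimoduleD(1)[OF X] bimoduleD(1)[OF X] A_hm bimoduleD(2)[OF X]
 show l: "lmap k A (h_hom k H X X) (lhat k H A X)" unfolding lhat_coev by (rule coev_linear[OF c])
 show "a |: A ==> lhat k H A X a |: h_hom k H X X" by (rule lin_cl[OF l])
 show "h |: H ==> a |: A ==> lhat k H A X (act A h a) = act (h_hom k H X X) h (lhat k H A X a)"
  unfolding lhat_coev by (rule coev_equivariant[OF c])
 show "a |: A ==> x |: X ==> ev X X (lhat k H A X a) x = lact X a x" unfolding lhat_coev by (rule ev_coev[OF c])
qed

lemma B_actions:
 assumes "a |: A" "L |: B"
 shows "lact B a L = compose_hom V W W (lhat k H A W a) L" "ract B L a = compose_hom V V W L (lhat k H A V a)"
 using assms lhat(2)[OF W] lhat(2)[OF V] by (simp_all add: b_hom_def hmodule.extend_def bimodule.fields_def h_comp_eq)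

lemma actB: "equivar k H A B B (lact B)" "equivar k H B A B (ract B)"
proof -
 note i = linear_id[of k "h_hom k H V W"]
 have "equivar k H A (h_hom k H V W) (h_hom k H V W) (%a L. compose_hom V W W (lhat k H A W a) L)"
  by (rule equivar_pre[OF compose_equivariant[OF hmV hmW hmW] lhat(1)[OF W] i]) (simp_all add: lhat(3)[OF W] del: h_hom_simps(1,5))
 then have "equivar k H A (h_hom k H V W) (h_hom k H V W) (lact B)" by (rule equivar_cong) (simp_all add: B_actions)
 then show "equivar k H A B B (lact B)" by (simp add: eqv_same[OF same_refl b_hom_same b_hom_same])
 have "equivar k H (h_hom k H V W) A (h_hom k H V W) (%L a. compose_hom V V W L (lhat k H A V a))"
  by (rule equivar_pre[OF compose_equivariant[OF hmV hmV hmW] i lhat(1)[OF V]]) (simp_all add: lhat(3)[OF V] del: h_hom_simps(1,5))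
 then have "equivar k H (h_hom k H V W) A (h_hom k H V W) (ract B)" by (rule equivar_cong) (simp_all add: B_actions)
 then show "equivar k H B A B (ract B)" by (simp add: eqv_same[OF b_hom_same same_refl b_hom_same])
qed
lemmas actBb = actB[THEN eqvD(1)]

lemma law_lactB: "alaw H A B V W (lact B) e e (lact W)" unfolding alaw_def
proof (intro ballI)
 fix a L v assume aLv: "a |: A" "L |: B" "v |: V"
 have "e (lact B a L) v = nested_r (h_hom k H W W) (h_hom k H V W) V W e (ev W W) \<phi> (lhat k H A W a) L v"
  using compose_law[OF hmV hmW hmW] lhat(2)[OF W aLv(1)] aLv by (simp add: B_actions alaw_def)
 also have "... = nested_r A B V W e (lact W) \<phi> a L v"
 proof (rule tlift3_cong)
  fix x y z assume xyz: "x |: H" "y |: H" "z |: H"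
  have "act B y L |: B" by (rule hm_closed) (use xyz aLv in simp_all)
  then have "e (act B y L) (act V z v) |: W" using xyz aLv by (intro bil_cl[OF e_bil]) simp_all
  then show "ev W W (act (h_hom k H W W) x (lhat k H A W a)) (e (act (h_hom k H V W) y L) (act V z v))
   = lact W (act A x a) (e (act B y L) (act V z v))" using xyz aLv lhat(4)[OF W, of "act A x a"] by (simp add: lhat(3)[OF W])
 qed simp
 finally show "e (lact B a L) v = nested_r A B V W e (lact W) \<phi> a L v" .
qed

lemma law_ractB: "alaw H B A V W (ract B) e (lact V) e" unfolding alaw_def
proof (intro ballI)
 fix L a v assume aLv: "L |: B" "a |: A" "v |: V"
 have "e (ract B L a) v = nested_r (h_hom k H V W) (h_hom k H V V) V W (ev V V) e \<phi> L (lhat k H A V a) v"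
  using compose_law[OF hmV hmV hmW] lhat(2)[OF V aLv(2)] aLv by (simp add: B_actions alaw_def)
 also have "... = nested_r B A V W (lact V) e \<phi> L a v"
  by (rule tlift3_cong) (use aLv lhat(3,4)[OF V] in \<open>simp_all add: lhat(3)[OF V, symmetric] del: h_hom_simps(5)\<close>, simp)
 finally show "e (ract B L a) v = nested_r B A V W (lact V) e \<phi> L a v" .
qed

lemma into_B:
 assumes m: "equivar k H U X P m1" "equivar k H P Y B m2" "equivar k H X Y Q' m3" "equivar k H U Q' B m4"
  and hm: "hmod k H U" "hmod k H X" "hmod k H Y" "hmod k H P" "hmod k H Q'"
  and ev: "!!u x y v. u |: U ==> x |: X ==> y |: Y ==> v |: V ==>
   e (m2 (m1 u x) y) v = tlift3 W (%a b c. e (m4 (act U a u) (m3 (act X b x) (act Y c y))) v) \<phi>"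
 shows "alaw H U X Y B m1 m2 m3 m4" using alaw_into_hom[OF hmV hmW m(1) _ m(3) _ hm ev] m(2,4)
 by (simp add: eqv_same[OF same_refl same_refl b_hom_same] assoc_same[OF same_refl same_refl same_refl b_hom_same])

lemma B_eqI:
 assumes "L |: B" "L' |: B" "!!h v. h |: H ==> v |: V ==> e (act B h L) v = e (act B h L') v"
 shows "L = L'" by (rule hom_eqI[OF hmV hmW]) (use assms in simp_all)

lemma B_bimodule: "a_bimodule k H A B"
proof -
 interpret L: four_products k H A A B V A B B W W W "mult A" "lact B" "lact B" "lact B" e e "lact W" e "lact W" "lact W"
  by unfold_locales (simp_all add: actB actW A_eq e_eq del: b_hom_simps)
 note 1 = L.edges(1)[OF L.law_edges(2)[OF law_lactB] L.law_edges(3)[OF law_lactB] L.law_edges(4)[OF law_lactB] L.law_edges(5)[OF bimoduleD(5)[OF W]]]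
 interpret R: four_products k H B A A V B B A V V W "ract B" "ract B" "mult A" "ract B" e "lact V" e "lact V" "lact V" e
  by unfold_locales (simp_all add: actB actV A_eq e_eq del: b_hom_simps)
 note 2 = R.edges(1)[OF R.law_edges(2)[OF law_ractB] R.law_edges(3)[OF bimoduleD(5)[OF V]] R.law_edges(4)[OF law_ractB] R.law_edges(5)[OF law_ractB]]
 interpret M: four_products k H A B A V B B B W V W "lact B" "ract B" "ract B" "lact B" e e "lact W" "lact V" e e
  by unfold_locales (simp_all add: actB actV actW A_eq e_eq del: b_hom_simps)
 note 3 = M.edges(1)[OF M.law_edges(2)[OF law_lactB] M.law_edges(3)[OF law_ractB] M.law_edges(4)[OF law_ractB] M.law_edges(5)[OF law_lactB]]
 have left: "alaw H A A B B (mult A) (lact B) (lact B) (lact B)"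
  by (rule into_B[OF A_eq actB(1) actB(1) actB(1)]) (use 1 in "simp_all del: b_hom_simps")
 have right: "alaw H B A A B (ract B) (ract B) (mult A) (ract B)"
  by (rule into_B[OF actB(2) actB(2) A_eq actB(2)]) (use 2 in "simp_all del: b_hom_simps")
 have mixed: "alaw H A B A B (lact B) (ract B) (ract B) (lact B)"
  by (rule into_B[OF actB(1) actB(2) actB(2) actB(1)]) (use 3 in "simp_all del: b_hom_simps")
 have u: "e (lact B \<one>\<^sub>A L) v = e L v" "e (ract B L \<one>\<^sub>A) v = e L v" if Lv: "L |: B" "v |: V" for L v
 proof -
  note t = tri_r[OF e_bil actWb(1)] tri_r[OF actVb(1) e_bil]
  have "e (lact B \<one>\<^sub>A L) v = tlift3 W (%a b c. lact W (act A a \<one>\<^sub>A) (e (act B b L) (act V c v))) \<phi>"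
   using law_lactB[unfolded alaw_def, rule_format, OF A_one Lv] .
  also have "... = twprod B V W (counit_l H2 \<phi>) (%L v. lact W \<one>\<^sub>A (e L v)) L v"
   by (rule tri_counit(1)[OF t(1)]) (simp_all add: Lv A_inv del: b_hom_simps)
  also have "... = lact W \<one>\<^sub>A (e L v)"
   unfolding kappa1_phi by (rule twprod_one[OF trilinearD(2)[OF t(1)]]) (simp_all add: Lv del: b_hom_simps)
  finally show "e (lact B \<one>\<^sub>A L) v = e L v" using bimoduleD(7)[OF W bil_cl[OF e_bil Lv]] by simp
  have "e (ract B L \<one>\<^sub>A) v = tlift3 W (%a b c. e (act B a L) (lact V (act A b \<one>\<^sub>A) (act V c v))) \<phi>"
   using law_ractB[unfolded alaw_def, rule_format, OF Lv(1) A_one Lv(2)] .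
  also have "... = twprod B V W (\<kappa> \<phi>) (%L v. e L (lact V \<one>\<^sub>A v)) L v"
   by (rule tri_counit(2)[OF t(2)]) (simp_all add: Lv A_inv del: b_hom_simps)
  also have "... = e L (lact V \<one>\<^sub>A v)" unfolding kappa_phi
   by (rule twprod_one) (simp_all add: Lv bilI bil1[OF e_bil] bil2[OF e_bil] bil_r[OF actVb(1)] bil_l[OF e_bil] bil_cl[OF actVb(1)] del: b_hom_simps)
  finally show "e (ract B L \<one>\<^sub>A) v = e L v" using bimoduleD(7)[OF V Lv(2)] by simp
 qed
 have "lact B \<one>\<^sub>A L = L \<and> ract B L \<one>\<^sub>A = L" if L: "L |: B" for L
 proof (intro conjI; rule B_eqI)
  fix h v assume h: "h |: H" and v: "v |: V"
  have hL: "act B h L |: B" by (rule hm_closed[OF B_hm h L])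
  have "act B h (lact B \<one>\<^sub>A L) = lact B \<one>\<^sub>A (act B h L)"
   using eqvD(2)[OF actB(1) h A_one L] twprod_counit_l[OF actBb(1) A_hm B_hm hm_mod[OF B_hm] A_one L comult_closed[OF h] A_inv] h
   by (simp only: counit_comult)
  then show "e (act B h (lact B \<one>\<^sub>A L)) v = e (act B h L) v" by (simp only: u(1)[OF hL v])
  have "act B h (ract B L \<one>\<^sub>A) = ract B (act B h L) \<one>\<^sub>A"
   using eqvD(2)[OF actB(2) h L A_one] twprod_counit_r[OF actBb(2) B_hm A_hm hm_mod[OF B_hm] L A_one comult_closed[OF h] A_inv] h
   by (simp only: counit_comult)
  then show "e (act B h (ract B L \<one>\<^sub>A)) v = e (act B h L) v" by (simp only: u(2)[OF hL v])
 qed (use L bil_cl[OF actBb(1) A_one L] bil_cl[OF actBb(2) L A_one] in simp_all)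
 then show ?thesis unfolding a_bimodule_iff using left right mixed actB B_hm by blast
qed

end

subsection \<open>Submodules\<close>

lemma carrier_update_id [simp]: "M\<lparr>carrier := carrier M\<rparr> = M" by (cases M) simp

lemma tlift_sub [simp]: "tlift (M\<lparr>carrier := C\<rparr>) = tlift M" "tlift3 (M\<lparr>carrier := C\<rparr>) = tlift3 M"
 by (rule tlift_target_cong tlift3_target_cong; simp)+

lemma bilinear_sub:
 assumes "blmap k U V X m" "C1 \<subseteq> carrier U" "C2 \<subseteq> carrier V" "!!u v. u \<in> C1 ==> v \<in> C2 ==> m u v \<in> C3"
 shows "blmap k (U\<lparr>carrier := C1\<rparr>) (V\<lparr>carrier := C2\<rparr>) (X\<lparr>carrier := C3\<rparr>) m"
 using assms unfolding bilinear_map_def linear_map_def by (auto simp: subset_iff)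

lemma equivar_sub:
 fixes U and V and X
 assumes "equivar k H U V X m" "C1 \<subseteq> carrier U" "C2 \<subseteq> carrier V" "!!u v. u \<in> C1 ==> v \<in> C2 ==> m u v \<in> C3"
 shows "equivar k H (U\<lparr>carrier := C1\<rparr>) (V\<lparr>carrier := C2\<rparr>) (X\<lparr>carrier := C3\<rparr>) m"
 using assms bilinear_sub[OF eqvD(1)[OF assms(1)] assms(2-4)] eqvD(2)[OF assms(1)]
 by (auto simp: equivar_def twprod_def subset_iff)

lemma alaw_sub:
 fixes U and V
  and W and X
 assumes "alaw H U V W X m1 m2 m3 m4" "C1 \<subseteq> carrier U" "C2 \<subseteq> carrier V" "C3 \<subseteq> carrier W"
 shows "alaw H (U\<lparr>carrier := C1\<rparr>) (V\<lparr>carrier := C2\<rparr>) (W\<lparr>carrier := C3\<rparr>) (X\<lparr>carrier := C4\<rparr>) m1 m2 m3 m4"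
 using assms by (auto simp: alaw_def subset_iff)

definition "h_stable k H M C \<longleftrightarrow> C \<subseteq> carrier M \<and> \<zero>[M] \<in> C \<and> (\<forall>x\<in>C. \<forall>y\<in>C. x \<oplus>[M] y \<in> C) \<and>
 (\<forall>r\<in>carrier k. \<forall>x\<in>C. r \<odot>[M] x \<in> C) \<and> (\<forall>h\<in>carrier H. \<forall>x\<in>C. act M h x \<in> C)"

lemma (in quasi_hopf_alg) sub_h_module:
 fixes M
 assumes M: "hmod k H M" and C: "h_stable k H M C"
 shows "hmod k H (M\<lparr>carrier := C\<rparr>)"
proof -
 note C' = C[unfolded h_stable_def]
 have "module k (M\<lparr>carrier := C\<rparr>)" by (rule sub_module) (use M C' in auto)
 moreover have "blmap k (H\<lparr>carrier := carrier H\<rparr>) (M\<lparr>carrier := C\<rparr>) (M\<lparr>carrier := C\<rparr>) (act M)"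
  by (rule bilinear_sub[OF hm_bil[OF M]]) (use C' in auto)
 ultimately show ?thesis using M C' unfolding h_module_def by auto
qed

lemma (in h_alg) sub_bimodule:
 assumes M: "a_bimodule k H A M" and C: "h_stable k H M C"
  and l: "!!a m. a |: A ==> m \<in> C ==> lact M a m \<in> C" and r: "!!a m. a |: A ==> m \<in> C ==> ract M m a \<in> C"
 shows "a_bimodule k H A (M\<lparr>carrier := C\<rparr>)"
proof -
 note D = bimoduleD[OF M]
 have s: "C \<subseteq> carrier M" using C by (simp add: h_stable_def)
 let ?O = "M\<lparr>carrier := C\<rparr>" and ?A = "A\<lparr>carrier := carrier A\<rparr>"
 have "equivar k H ?A ?O ?O (lact M)" by (rule equivar_sub[OF D(2)]) (use s l in auto)
 moreover have "equivar k H ?O ?A ?O (ract M)" by (rule equivar_sub[OF D(3)]) (use s r in auto)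
 moreover have "alaw H ?O ?A ?A ?O (ract M) (ract M) (mult A) (ract M)"
   "alaw H ?A ?A ?O ?O (mult A) (lact M) (lact M) (lact M)"
   "alaw H ?A ?O ?A ?O (lact M) (ract M) (ract M) (lact M)"
  by (rule alaw_sub[OF D(4)] alaw_sub[OF D(5)] alaw_sub[OF D(6)]; use s in simp)+
 ultimately show ?thesis unfolding a_bimodule_iff using sub_h_module[OF D(1) C] D(7,8) s by auto
qed

context two_bimodules begin

subsection \<open>Maps linear over \<open>A\<close>\<close>

text \<open>
 This equation sees \<open>L\<close> only through evaluation, and by \<open>hom_eqI\<close> it is the evaluations of all translates that determine \<open>L\<close>;
 hence \<open>homA\<close> asks it of all translates.
\<close>

definition "right_lin L \<longleftrightarrow> (\<forall>v\<in>carrier V. \<forall>a\<in>carrier A. ract W (e L v) a = nested_r B V A W (ract V) e \<phi> L v a)"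

definition "homA = {L \<in> carrier B. \<forall>h\<in>carrier H. right_lin (act B h L)}"
abbreviation "\<O> == B\<lparr>carrier := homA\<rparr>"

lemma sides_linear:
 assumes va: "v |: V" "a |: A"
 shows "lmap k B W (%L. ract W (e L v) a)"
  "lmap k B W (%L. nested_r B V A W (ract V) e \<phi> L v a)"
 by (rule law_linear(1,2)[OF B_hm hmV A_hm hmW e_bil actWb(2) actVb(2) e_bil va])+

lemma right_lin_linear:
 assumes "lmap k Z B f" "z |: Z" "z' |: Z" "right_lin (f z)" "right_lin (f z')" "module k Z"
 shows "right_lin (f (z \<oplus>[Z] z'))" "right_lin (f \<zero>[Z])" "r |: k ==> right_lin (f (r \<odot>[Z] z))"
 using assms(2-6) linear_add[OF lin_comp[OF sides_linear(1) assms(1)]] linear_add[OF lin_comp[OF sides_linear(2) assms(1)]]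
  linear_zero[OF lin_comp[OF sides_linear(1) assms(1)]] linear_zero[OF lin_comp[OF sides_linear(2) assms(1)]]
  linear_smult[OF lin_comp[OF sides_linear(1) assms(1)]] linear_smult[OF lin_comp[OF sides_linear(2) assms(1)]]
 unfolding right_lin_def by simp_all

lemma homA_sub: "homA \<subseteq> carrier B" unfolding homA_def by blast

lemma homA_stable: "h_stable k H B homA"
proof -
 have l: "lmap k B B (act B h)" if "h |: H" for h by (rule hm_lin(3)[OF that B_hm])
 interpret Bm: module k B by (rule hm_mod[OF B_hm])
 have z: "right_lin \<zero>[B]" unfolding right_lin_def
  using linear_zero[OF sides_linear(1) hm_mod[OF B_hm] hm_mod[OF hmW]] linear_zero[OF sides_linear(2) hm_mod[OF B_hm] hm_mod[OF hmW]] by simp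
 have "right_lin (act B h (act B h' L))" if "L \<in> homA" "h |: H" "h' |: H" for h h' L
 proof -
  have "act B (h *1 h') L = act B h (act B h' L)" by (rule hm_mult[OF B_hm]) (use that homA_sub in auto)
  moreover have "h *1 h' |: H" using that by simp
  ultimately show ?thesis using that(1) unfolding homA_def by (metis (mono_tags, lifting) mem_Collect_eq)
 qed
 then have "act B h L \<in> homA" if "L \<in> homA" "h |: H" for h L
  using that hm_closed[OF B_hm that(2), of L] unfolding homA_def by blast
 moreover have "\<zero>[B] \<in> homA"
  using z linear_zero[OF l hm_mod[OF B_hm] hm_mod[OF B_hm]] Bm.zero_closed unfolding homA_def by (simp del: b_hom_simps)
 moreover have "L \<oplus>[B] L' \<in> homA" if "L \<in> homA" "L' \<in> homA" for L L'
  using that right_lin_linear(1)[OF l _ _ _ _ hm_mod[OF B_hm]] Bm.a_closed unfolding homA_def by (simp del: b_hom_simps)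
 moreover have "r \<odot>[B] L \<in> homA" if "r |: k" "L \<in> homA" for r L
  using that right_lin_linear(3)[OF l, where z = L and z' = L and r = r, OF _ _ _ _ _ hm_mod[OF B_hm]] Bm.smult_closed unfolding homA_def by (simp del: b_hom_simps)
 ultimately show ?thesis unfolding h_stable_def using homA_sub by blast
qed

lemma O_hm [simp]: "hmod k H \<O>" by (rule sub_h_module[OF B_hm homA_stable])

lemma homA_right_lin: "L \<in> homA ==> right_lin L"
proof -
 assume L: "L \<in> homA"
 then have "act B \<one>\<^sub>1 L = L" using homA_sub by (intro hm_one[OF B_hm]) auto
 then show "right_lin L" using L H.one_closed unfolding homA_def by (metis (mono_tags, lifting) mem_Collect_eq)
qed

lemma e_O: "equivar k H \<O> V W e"
 using equivar_sub[OF e_eq homA_sub order.refl, of "carrier W"] bil_cl[OF e_bil] homA_sub by auto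

lemma law_O: "alaw H \<O> V A W e (ract W) (ract V) e" using homA_right_lin by (simp add: alaw_def right_lin_def)

lemma homA_twprod:
 assumes m: "blmap k U X B m" and hm: "hmod k H U" "hmod k H X" and ux: "u |: U" "x |: X" and t: "t |: H2"
  and r: "!!b c. b |: H ==> c |: H ==> right_lin (m (act U b u) (act X c x))"
 shows "right_lin (twprod U X B t m u x)" unfolding right_lin_def
proof (intro ballI)
 fix v a assume va: "v |: V" "a |: A"
 note s = sides_linear[OF va]
 show "ract W (e (twprod U X B t m u x) v) a = nested_r B V A W (ract V) e \<phi> (twprod U X B t m u x) v a"
 proof (rule H2_eq[OF _ _ _ _ t, of W])
  note l = twprod_lin[OF m hm hm_mod[OF B_hm] ux linear_id]
  show "lmap k H2 W (%t. ract W (e (twprod U X B t m u x) v) a)"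
   "lmap k H2 W (%t. nested_r B V A W (ract V) e \<phi> (twprod U X B t m u x) v a)"
   by (rule lin_comp[OF s(1) l] lin_comp[OF s(2) l])+
  fix b c assume bc: "b |: H" "c |: H"
  show "ract W (e (twprod U X B (pH b c) m u x) v) a = nested_r B V A W (ract V) e \<phi> (twprod U X B (pH b c) m u x) v a"
   using r[OF bc] va unfolding twprod_pure[OF m hm hm_mod[OF B_hm] ux bc] right_lin_def by blast
 qed simp
qed

lemma homA_actions:
 assumes a: "a |: A" and L: "L \<in> homA"
 shows "lact B a L \<in> homA" "ract B L a \<in> homA"
proof -
 note LB = subsetD[OF homA_sub L]
 have c: "a |: A ==> L \<in> homA ==> lact B a L |: B" "L \<in> homA ==> a |: A ==> ract B L a |: B" for a L
  using bil_cl[OF actBb(1)] bil_cl[OF actBb(2)] homA_sub by blast+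
 have aO: "equivar k H A \<O> B (lact B)" "equivar k H \<O> A B (ract B)"
  using equivar_sub[OF actB(1) order.refl homA_sub c(1)] equivar_sub[OF actB(2) homA_sub order.refl c(2)]
  by (simp_all del: b_hom_simps)
 have lO: "alaw H A \<O> V W (lact B) e e (lact W)" "alaw H \<O> A V W (ract B) e (lact V) e"
  using alaw_sub[OF law_lactB order.refl homA_sub order.refl, of "carrier W"]
   alaw_sub[OF law_ractB homA_sub order.refl order.refl, of "carrier W"] by simp_all
 interpret L: four_products k H A \<O> V A B W W W V W "lact B" e e "lact W" "ract W" "ract W" "lact W" "ract V" e e
  by unfold_locales (simp_all add: aO e_O e_eq actW actV del: b_hom_simps)
 note 1 = L.edges(4)[OF L.law_edges(1)[OF lO(1)] L.law_edges(2)[OF bimoduleD(6)[OF W]] L.law_edges(3)[OF law_O] L.law_edges(5)[OF lO(1)]]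
 interpret R: four_products k H \<O> A V A B W V V V W "ract B" e "lact V" e "ract W" "ract V" e "ract V" "lact V" e
  by unfold_locales (simp_all add: aO e_O e_eq actW actV del: b_hom_simps)
 note 2 = R.edges(4)[OF R.law_edges(1)[OF lO(2)] R.law_edges(2)[OF law_O] R.law_edges(3)[OF bimoduleD(6)[OF V]] R.law_edges(5)[OF lO(2)]]
 have r: "right_lin (lact B a L)" "right_lin (ract B L a)" if "a |: A" "L \<in> homA" for a L
  using 1 2 that by (simp_all add: right_lin_def del: b_hom_simps)
 have st: "act B h L \<in> homA" if "h |: H" for h using homA_stable L that by (simp add: h_stable_def)
 have "right_lin (act B h (lact B a L))" "right_lin (act B h (ract B L a))" if h: "h |: H" for h
  unfolding eqvD(2)[OF actB(1) h a LB] eqvD(2)[OF actB(2) h LB a]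
  by (rule homA_twprod[OF actBb(1)] homA_twprod[OF actBb(2)]; use h a LB r st in "simp del: b_hom_simps")+
 then show "lact B a L \<in> homA" "ract B L a \<in> homA"
  using bil_cl[OF actBb(1) a LB] bil_cl[OF actBb(2) LB a] unfolding homA_def by blast+
qed

lemma O_bimodule: "a_bimodule k H A \<O>" by (rule sub_bimodule[OF B_bimodule homA_stable]) (simp_all add: homA_actions)

subsection \<open>The internal hom\<close>

abbreviation "A' == regular A"
abbreviation "VA == b_tensor k H A V A'"

text \<open>
 The products \<open>L \<otimes> (v \<otimes> a) \<mapsto> L (v a)\<close> and \<open>(L v) a\<close>, the latter rebracketed by \<open>\<phi>\<inverse>\<close>. Their adjuncts are the
 maps \<open>D\<^sub>1\<close> and \<open>D\<^sub>2\<close> of which \<open>hom\<^sub>A(V, W)\<close> is the equaliser.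
\<close>

definition "g1 L t = e L (tlift V (ract V) t)"
abbreviation "g2 == complete_right B V A' W e (ract W)"

lemma A'_hm [simp]: "hmod k H A'" using regular_bimodule bimoduleD(1) by blast

lemma VA_hm [simp]: "hmod k H VA" by (simp add: h_module_same[OF b_tensor_same])

lemma regular_actions:
 "equivar k H V A' V (ract V)" "equivar k H W A' W (ract W)"
 using actV(2) actW(2) by (simp_all add: eqv_same[OF same_refl regular_same same_refl])

lemma VA_facts:
 "equivar k H V A' VA (pure k V A')" "equivar k H A VA VA (lact VA)"
 "alaw H A V A' VA (lact V) (pure k V A') (pure k V A') (lact VA)"
 "lmap k VA V (tlift V (ract V))"
 "h |: H ==> t |: VA ==> tlift V (ract V) (act VA h t) = act V h (tlift V (ract V) t)"
 "a |: A ==> t |: VA ==> tlift V (ract V) (lact VA a t) = lact V a (tlift V (ract V) t)"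
proof -
 note e = pure_equivariant[OF hmV A'_hm]
 note c = A_hm hmV A'_hm hmV hm_tensor[OF hmV A'_hm] actV(1) e
 let ?T = "h_tensor k H V A'"
 show "equivar k H V A' VA (pure k V A')" using e by (simp add: eqv_same[OF same_refl same_refl b_tensor_same])
 show "equivar k H A VA VA (lact VA)"
  using complete_right_equivariant[OF c] by (simp add: b_tensor_actions eqv_same[OF same_refl b_tensor_same b_tensor_same])
 show "alaw H A V A' VA (lact V) (pure k V A') (pure k V A') (lact VA)"
  using complete_right_law[OF c] by (simp add: b_tensor_actions assoc_same[OF same_refl same_refl same_refl b_tensor_same])
 note rb = eqvD(1)[OF regular_actions(1)]
 have rl: "lmap k (tensor k V A') V (tlift V (ract V))" by (rule tlift_lin[OF _ _ rb]) simp_all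
 then show "lmap k VA V (tlift V (ract V))" by (simp add: linear_map_def)
 show "h |: H ==> t |: VA ==> tlift V (ract V) (act VA h t) = act V h (tlift V (ract V) t)"
  using regular_actions(1)[folded tensor_morphism_iff[OF hmV A'_hm hmV]] unfolding tensor_morphism_def h_linear_def by simp
 assume a: "a |: A" and "t |: VA"
 then have t: "t |: tensor k V A'" by simp
 note lb = bil_r[OF complete_right_bilinear[OF c] a, unfolded linear_h_tensor]
 show "tlift V (ract V) (lact VA a t) = lact V a (tlift V (ract V) t)"
 proof (rule tensor_eq[where M = V, OF _ _ _ _ _ _ t])
  show "lmap k (tensor k V A') V (%t. tlift V (ract V) (lact VA a t))" unfolding b_tensor_actions by (rule lin_comp[OF rl lb])
  show "lmap k (tensor k V A') V (%t. lact V a (tlift V (ract V) t))" by (rule bil2[OF actVb(1) rl a])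
  fix v b assume vb: "v |: V" "b |: A'"
  note tr = act_trilinear[OF tri_l[OF actVb(1) eqvD(1)[OF e]] A_hm hmV A'_hm a vb]
  have "tlift V (ract V) (lact VA a (pure k V A' v b))
   = tlift3 V (%x y z. tlift V (ract V) (pure k V A' (lact V (act A x a) (act V y v)) (act A' z b))) \<psi>"
   unfolding b_tensor_actions complete_right_pure[OF c a vb]
   by (rule tlift3_comp[OF tr, unfolded linear_h_tensor, OF rl]) simp_all
  also have "... = nested_l A V A V (lact V) (ract V) \<psi> a v b"
   by (rule tlift3_cong) (use a vb in "simp_all add: tlift_pure_eq[OF _ _ rb] bil_cl[OF actVb(1)]")
  also have "... = lact V a (ract V v b)" using V a vb unfolding a_bimodule_def by simp
  also have "... = lact V a (tlift V (ract V) (pure k V A' v b))" using vb by (simp add: tlift_pure_eq[OF _ _ rb])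
  finally show "tlift V (ract V) (lact VA a (pure k V A' v b)) = lact V a (tlift V (ract V) (pure k V A' v b))" .
 qed simp_all
qed

lemma g_equivariant: "equivar k H B VA W g1" "equivar k H B VA W g2"
proof -
 show "equivar k H B VA W g1"
  unfolding g1_def by (rule equivar_pre[OF e_eq linear_id VA_facts(4)]) (simp_all add: VA_facts(5) del: b_hom_simps b_tensor_simps)
 show "equivar k H B VA W g2" using complete_right_equivariant[OF B_hm hmV A'_hm hmW hmW e_eq regular_actions(2)]
  by (simp add: eqv_same[OF same_refl b_tensor_same same_refl])
qed
lemmas g_bil = g_equivariant[THEN eqvD(1)]

lemma g_balanced: "alaw H B A VA W (ract B) g1 (lact VA) g1" "alaw H B A VA W (ract B) g2 (lact VA) g2"
proof -
 show "alaw H B A VA W (ract B) g1 (lact VA) g1" unfolding alaw_def g1_def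
 proof (intro ballI)
  fix L a t assume *: "L |: B" "a |: A" "t |: VA"
  have "tlift3 W (%x y z. e (act B x L) (tlift V (ract V) (lact VA (act A y a) (act VA z t)))) \<phi>
   = nested_r B A V W (lact V) e \<phi> L a (tlift V (ract V) t)"
   by (rule tlift3_cong) (use * VA_facts(5,6) hm_closed[OF VA_hm] in "simp_all del: b_hom_simps b_tensor_simps")
  then show "e (ract B L a) (tlift V (ract V) t) = tlift3 W (%x y z. e (act B x L) (tlift V (ract V) (lact VA (act A y a) (act VA z t)))) \<phi>"
   using law_ractB * lin_cl[OF VA_facts(4) *(3)] by (simp add: alaw_def del: b_hom_simps b_tensor_simps)
 qed
 note g2b = g_bil(2) and g2l = complete_right_law[OF B_hm hmV A'_hm hmW hmW e_eq regular_actions(2)]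
 interpret E: four_products k H B A V A' B W V VA VA W "ract B" e "lact V" e "ract W" "pure k V A'" g2 "pure k V A'" "lact VA" g2
  by unfold_locales (simp_all add: actB e_eq actV regular_actions VA_facts g_equivariant del: b_hom_simps b_tensor_simps)
 note edge = E.edges(5)[OF E.law_edges(1)[OF law_ractB] E.law_edges(2)[OF g2l] E.law_edges(3)[OF VA_facts(3)] E.law_edges(4)[OF g2l]]
 show "alaw H B A VA W (ract B) g2 (lact VA) g2" unfolding alaw_def
 proof (intro ballI)
  fix L a t assume *: "L |: B" "a |: A" "t |: VA"
  then have t: "t |: tensor k V A'" by simp
  note l = law_linear(5,6)[OF B_hm A_hm VA_hm hmW actBb(2) g2b eqvD(1)[OF VA_facts(2)] g2b *(1,2)]
  have eq: "lmap k (tensor k V A') W = lmap k VA W" by (intro ext) (simp add: linear_map_def)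
  show "g2 (ract B L a) t = nested_r B A VA W (lact VA) g2 \<phi> L a t"
   by (rule tensor_eq[where M = W, OF _ _ _ _ _ _ t]) (use * edge l in "simp_all add: eq del: b_hom_simps b_tensor_simps")
 qed
qed

end

lemma (in abelian_group) diff_zero_iff:
 assumes "x |: G" "y |: G" shows "x \<ominus> y = \<zero> \<longleftrightarrow> x = y"
proof
 assume "x \<ominus> y = \<zero>"
 then have "(x \<ominus> y) \<oplus> y = y" using assms by simp
 then show "x = y" using assms by (simp add: a_minus_def a_assoc l_neg)
qed (use assms in "simp add: a_minus_def r_neg")

lemma (in quasi_hopf_alg) alaw_cong:
 assumes a: "alaw H U V W X m1 m2 m3 m4"
  and m1: "!!u v. u |: U ==> v |: V ==> m1 u v |: P" and m3: "!!v w. v |: V ==> w |: W ==> m3 v w |: Q"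
  and m2: "!!u v. u |: P ==> v |: W ==> m2' u v = m2 u v" and m4: "!!u v. u |: U ==> v |: Q ==> m4' u v = m4 u v"
  and m1': "!!u v. u |: U ==> v |: V ==> m1' u v = m1 u v" and m3': "!!v w. v |: V ==> w |: W ==> m3' v w = m3 v w"
  and hm: "hmod k H U" "hmod k H V" "hmod k H W"
 shows "alaw H U V W X m1' m2' m3' m4'" unfolding alaw_def
proof (intro ballI)
 fix u v w assume *: "u |: U" "v |: V" "w |: W"
 have "nested_r U V W X m3' m4' \<phi> u v w = nested_r U V W X m3 m4 \<phi> u v w"
  by (rule tlift3_cong) (simp_all add: * m4 m3 m3' hm)
 then show "m2' (m1' u v) w = nested_r U V W X m3' m4' \<phi> u v w" using a * by (simp add: alaw_def m2 m1 m1')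
qed

context two_bimodules begin

lemma hom_f_val:
 assumes L: "L |: B" and t: "t |: VA"
 shows "hom_f1 k H A V W (pure_over k H A B VA L t) = g1 L t" "hom_f2 k H A V W (pure_over k H A B VA L t) = g2 L t"
proof -
 interpret BV: two_bimodules k H A B V by unfold_locales (rule B_bimodule, rule V)
 interpret G: balanced_pair k H A B VA by unfold_locales (simp_all add: actB VA_facts del: b_hom_simps b_tensor_simps)
 have ev: "ev_over H V W (BV.p L v) = e L v" if "L |: B" "v |: V" for L v
  unfolding ev_over_def h_ev_eq[OF hmV hmW] by (rule BV.coset_val_lift(2)[OF e_bil _ law_ractB that]) simp
 let ?k1 = "%L. tlift W (%v a. ev_over H V W (BV.p L (ract V v a)))"
 let ?k2 = "%L. tlift W (%v a. tlift3 W (%x y z. ract W (ev_over H V W (BV.p (act B x L) (act V y v))) (act A z a)) \<psi>)"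
 have c1: "?k1 L t = g1 L t" if L: "L |: B" and t: "t |: VA" for L t
 proof -
  note rb = eqvD(1)[OF regular_actions(1)]
  have t': "t |: tensor k V A'" using t by simp
  have "?k1 L t = tlift W (%v a. e L (ract V v a)) t"
   by (rule tlift_cong[OF _ _ t']) (simp_all add: ev L bil_cl[OF rb] del: b_hom_simps)
  also have "... = e L (tlift V (ract V) t)" by (rule tlift_linear_comp[OF rb bil_r[OF e_bil L], symmetric]) (simp_all add: t')
  finally show ?thesis unfolding g1_def .
 qed
 have c2: "?k2 L t = g2 L t" if L: "L |: B" and t: "t |: VA" for L t
 proof -
  have t': "t |: tensor k V A'" using t by simp
  have "ev_over H V W (BV.p (act B x L) (act V y v)) = e (act B x L) (act V y v)"
   if "x |: H" "y |: H" "v |: V" for x y v by (rule ev) (use that L hm_closed[OF B_hm] in "simp_all del: b_hom_simps")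
  then show ?thesis unfolding complete_right_def by (intro tlift_cong[OF _ _ t'] tlift3_cong) simp_all
 qed
 have 1: "blmap k B VA W ?k1" "blmap k B VA W ?k2"
  by (rule bilinear_cong[OF g_bil(1) c1] bilinear_cong[OF g_bil(2) c2]; simp del: b_hom_simps b_tensor_simps)+
 note cl = bil_cl[OF actBb(2)] bil_cl[OF eqvD(1)[OF VA_facts(2)]]
 have 2: "alaw H B A VA W (ract B) ?k1 (lact VA) ?k1" "alaw H B A VA W (ract B) ?k2 (lact VA) ?k2"
  by (rule alaw_cong[OF g_balanced(1) cl c1 c1 HOL.refl HOL.refl B_hm A_hm VA_hm] alaw_cong[OF g_balanced(2) cl c2 c2 HOL.refl HOL.refl B_hm A_hm VA_hm]; assumption)+
 show "hom_f1 k H A V W (G.p L t) = g1 L t" "hom_f2 k H A V W (G.p L t) = g2 L t" unfolding hom_f1_def hom_f2_def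
  using G.coset_val_lift(2)[OF 1(1) _ 2(1) L t] G.coset_val_lift(2)[OF 1(2) _ 2(2) L t] c1[OF L t] c2[OF L t] by simp_all
qed

lemma hom_D_val:
 assumes L: "L |: B"
 shows "hom_D k H A V W (hom_f1 k H A V W) L = coev B VA W g1 L" "hom_D k H A V W (hom_f2 k H A V W) L = coev B VA W g2 L"
 unfolding hom_D_def Let_def coev_def
 by (intro restrict_ext tlift3_cong; use L hm_closed[OF B_hm] hm_closed[OF VA_hm] in "simp add: hom_f_val del: b_hom_simps b_tensor_simps")+

lemma homA_iff:
 assumes L: "L |: B"
 shows "L \<in> homA \<longleftrightarrow> (\<forall>h\<in>carrier H. \<forall>t\<in>carrier VA. g1 (act B h L) t = g2 (act B h L) t)"
proof
 note cr = B_hm hmV A'_hm hmW hmW e_eq regular_actions(2)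
 note rb = eqvD(1)[OF regular_actions(1)]
 have g1p: "g1 M (pure k V A' v a) = e M (ract V v a)" if "M |: B" "v |: V" "a |: A'" for M v a
  using that by (simp add: g1_def tlift_pure_eq[OF _ _ rb])
 have hL: "act B h L |: B" if "h |: H" for h by (rule hm_closed[OF B_hm that L])
 {
  assume g: "\<forall>h\<in>carrier H. \<forall>t\<in>carrier VA. g1 (act B h L) t = g2 (act B h L) t"
  have "right_lin (act B h L)" if h: "h |: H" for h unfolding right_lin_def
  proof (intro ballI)
   fix v a assume va: "v |: V" "a |: A"
   have "ract W (e (act B h L) v) a = nested_r B V A' W (pure k V A') g2 \<phi> (act B h L) v a"
    using complete_right_law[OF cr, unfolded alaw_def] hL[OF h] va by (simp del: b_hom_simps)
   also have "... = nested_r B V A W (ract V) e \<phi> (act B h L) v a"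
   proof (rule tlift3_cong)
    fix x y z assume xyz: "x |: H" "y |: H" "z |: H"
    have p: "pure k V A' (act V y v) (act A' z a) |: VA" using xyz va by simp
    have m: "act B x (act B h L) = act B (x *1 h) L" using hm_mult[OF B_hm xyz(1) h L] by simp
    have "g2 (act B x (act B h L)) (pure k V A' (act V y v) (act A' z a)) = g1 (act B x (act B h L)) (pure k V A' (act V y v) (act A' z a))"
    unfolding m using g p xyz h by (simp del: b_hom_simps b_tensor_simps)
    also have "... = e (act B x (act B h L)) (ract V (act V y v) (act A z a))"
    by (subst g1p) (use xyz h va hL hm_closed[OF B_hm] in "simp_all del: b_hom_simps b_tensor_simps")
    finally show "g2 (act B x (act B h L)) (pure k V A' (act V y v) (act A' z a)) = e (act B x (act B h L)) (ract V (act V y v) (act A z a))" .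
   qed simp
   finally show "ract W (e (act B h L) v) a = nested_r B V A W (ract V) e \<phi> (act B h L) v a" .
  qed
  then show "L \<in> homA" using L unfolding homA_def by blast
 }
 assume LA: "L \<in> homA"
 show "\<forall>h\<in>carrier H. \<forall>t\<in>carrier VA. g1 (act B h L) t = g2 (act B h L) t"
 proof (intro ballI)
  fix h t assume h: "h |: H" and t: "t |: VA"
  have hA: "act B h L |: \<O>" using homA_stable LA h by (simp add: h_stable_def)
  note inv = law_O[unfolded alaw_inv[OF eqvD(1)[OF e_O] actWb(2) actVb(2) eqvD(1)[OF e_O] O_hm hmV A_hm hm_mod[OF hmW]], rule_format, OF hA]
  have eq: "lmap k (tensor k V A') W = lmap k VA W" by (intro ext) (simp add: linear_map_def)
  have t': "t |: tensor k V A'" using t by simp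
  show "g1 (act B h L) t = g2 (act B h L) t"
  proof (rule tensor_eq[where M = W, OF _ _ _ _ _ _ t'])
   fix v a assume va: "v |: V" "a |: A'"
   show "g1 (act B h L) (pure k V A' v a) = g2 (act B h L) (pure k V A' v a)"
    unfolding g1p[OF hL[OF h] va] complete_right_pure[OF cr hL[OF h] va] using inv va by simp
  qed (use bil_r[OF g_bil(1) hL[OF h]] bil_r[OF g_bil(2) hL[OF h]] in "simp_all add: eq del: b_hom_simps b_tensor_simps")
 qed
qed

text \<open>
 By \<open>hom_eqI\<close>, \<open>D\<^sub>1 L = D\<^sub>2 L\<close> means that all translates of the two sides have equal evaluations; \<open>ev_coev\<close> turns
 these into \<open>g1\<close> and \<open>g2\<close> at the translates of \<open>L\<close>.
\<close>

theorem hom_over_eq: "hom_over k H A V W = \<O>"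
proof -
 let ?D1 = "coev B VA W g1" and ?D2 = "coev B VA W g2" and ?hVA = "h_hom k H VA W"
 note c = VA_hm hmW B_hm
 have hh: "hmod k H ?hVA" by (rule hm_hom) (simp_all del: b_tensor_simps)
 interpret hVA: module k ?hVA by (rule hm_mod[OF hh])
 note cl = lin_cl[OF coev_linear[OF c g_equivariant(1)]] lin_cl[OF coev_linear[OF c g_equivariant(2)]]
 have "L \<in> homA \<longleftrightarrow> ?D1 L = ?D2 L" if L: "L |: B" for L
 proof
  assume a: "L \<in> homA"
  show "?D1 L = ?D2 L"
  proof (rule hom_eqI[OF VA_hm hmW])
   show "?D1 L |: lin_hom k VA W" "?D2 L |: lin_hom k VA W" using cl[OF L] unfolding h_hom_simps(1) by simp_all
   fix h t assume ht: "h |: H" "t |: VA"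
   have hL: "act B h L |: B" by (rule hm_closed[OF B_hm ht(1) L])
   show "ev VA W (act ?hVA h (?D1 L)) t = ev VA W (act ?hVA h (?D2 L)) t"
    unfolding coev_equivariant[OF c g_equivariant(1) ht(1) L, symmetric] coev_equivariant[OF c g_equivariant(2) ht(1) L, symmetric]
    ev_coev[OF c g_equivariant(1) hL ht(2)] ev_coev[OF c g_equivariant(2) hL ht(2)] using homA_iff[OF L] a ht by blast
  qed
 next
  assume D: "?D1 L = ?D2 L"
  show "L \<in> homA" unfolding homA_iff[OF L]
  proof (intro ballI)
   fix h t assume ht: "h |: H" "t |: VA"
   have hL: "act B h L |: B" by (rule hm_closed[OF B_hm ht(1) L])
   have "?D1 (act B h L) = ?D2 (act B h L)"
    unfolding coev_equivariant[OF c g_equivariant(1) ht(1) L] coev_equivariant[OF c g_equivariant(2) ht(1) L] D ..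
   then show "g1 (act B h L) t = g2 (act B h L) t"
    using ev_coev[OF c g_equivariant(1) hL ht(2)] ev_coev[OF c g_equivariant(2) hL ht(2)] by simp
  qed
 qed
 moreover have "?D1 L \<ominus>[?hVA] ?D2 L = \<zero>[?hVA] \<longleftrightarrow> ?D1 L = ?D2 L" if "L |: B" for L
  by (rule hVA.diff_zero_iff[OF cl[OF that]])
 ultimately have "L \<in> homA \<longleftrightarrow> hom_D k H A V W (hom_f1 k H A V W) L \<ominus>[?hVA] hom_D k H A V W (hom_f2 k H A V W) L = \<zero>[?hVA]"
  if "L |: B" for L unfolding hom_D_val[OF that] using that by simp
 then have "a_kernel B ?hVA (%L. hom_D k H A V W (hom_f1 k H A V W) L \<ominus>[?hVA] hom_D k H A V W (hom_f2 k H A V W) L) = homA"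
  unfolding a_kernel_def' using homA_sub by (intro subset_antisym subsetI) (simp_all del: b_hom_simps h_hom_simps, blast)
 then show ?thesis unfolding hom_over_def Let_def by simp
qed

end

subsection \<open>Functoriality\<close>

lemma (in h_alg) hom_act_natural:
 assumes hm: "hmod k H V" "hmod k H W" "hmod k H V'" "hmod k H W'"
  and f: "bimodule_hom k H A V' V f" and g: "bimodule_hom k H A W W' g"
  and L: "L |: lin_hom k V W" and t: "t |: H2"
 shows "hom_act k H V' W' t (\<lambda>v\<in>carrier V'. g (L (f v))) = (\<lambda>v\<in>carrier V'. g (hom_act k H V W t L (f v)))"
proof -
 note f' = bim_homD[OF f] and g' = bim_homD[OF g] and r = restrict_lin_hom[OF lin_comp[OF g'(1) lin_hom_arg[OF _ f'(1)]] hm_mod[OF hm(3)]]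
 let ?G = "%L. \<lambda>v\<in>carrier V'. g (L (f v))"
 note G = r[OF L] and c = ha_facts(4)[OF hm(1,2) t L]
 show ?thesis
 proof (rule lin_hom_eqI[OF ha_facts(4)[OF hm(3,4) t G] r[OF c]])
  fix v assume v: "v |: V'"
  have "hom_act k H V' W' t (?G L) v = g (hom_act k H V W t L (f v))"
  proof (rule H2_eq[OF _ _ _ _ t, of W'])
   show "lmap k H2 W' (%t. g (hom_act k H V W t L (f v)))"
    by (rule lin_comp[OF g'(1) ha_eval[OF hm(1,2) linear_id L f'(2)[OF v]]])
   show "lmap k H2 W' (%t. hom_act k H V' W' t (?G L) v)" by (rule ha_eval[OF hm(3,4) linear_id G v])
   fix a b assume ab: "a |: H" "b |: H"
   show "hom_act k H V' W' (pH a b) (?G L) v = g (hom_act k H V W (pH a b) L (f v))"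
    unfolding ha_pure[OF hm(1,2) L ab] ha_pure[OF hm(3,4) G ab] using v ab by (simp add: f' g' hm lin_hom_closed[OF L])
  qed (simp add: hm)
  then show "hom_act k H V' W' t (?G L) v = ?G (hom_act k H V W t L) v" using v by simp
 qed
qed

locale hom_map = two_bimodules k H A V W + E: two_bimodules k H A V' W'
 for k :: "'k ring" and H :: "('k, 'h) quasi_hopf" and A :: "('k, 'h, 'a) hmodule" and V :: "('k, 'h, 'a, 'v) bimodule"
  and W :: "('k, 'h, 'a, 'w) bimodule" and V' :: "('k, 'h, 'a, 'v2) bimodule" and W' :: "('k, 'h, 'a, 'w2) bimodule" +
 fixes f :: "'v2 => 'v" and g :: "'w => 'w2"
 assumes f: "bimodule_hom k H A V' V f" and g: "bimodule_hom k H A W W' g"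
begin

lemmas f' = bim_homD[OF f] and g' = bim_homD[OF g]

definition "gm L = (\<lambda>v\<in>carrier V'. g (L (f v)))"

lemma gm_linear: "lmap k B E.B gm"
proof -
 have "lmap k (lin_hom k V W) (lin_hom k V' W') gm"
 proof (rule linear_into_lin_hom)
  fix L assume L: "L |: lin_hom k V W"
  show "gm L |: lin_hom k V' W'" unfolding gm_def by (rule restrict_lin_hom[OF lin_comp[OF g'(1) lin_hom_arg[OF L f'(1)]]]) simp
 qed (simp_all add: gm_def lin_comp[OF g'(1)] lin_hom_eval f')
 then show ?thesis by (simp add: linear_map_def)
qed

lemma gm_closed: "L |: B ==> gm L |: E.B" by (rule lin_cl[OF gm_linear])

lemma e_gm:
 assumes L: "L |: B" and v: "v |: V'"
 shows "E.e (gm L) v = g (e L (f v))"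
proof -
 have L': "L |: lin_hom k V W" using L by simp
 have "g (e L (f v)) = tlift3 W' (%a b c. g (act W a (L (act V (S b *1 qalpha H *1 c) (f v))))) \<phi>"
  unfolding ev_def by (rule tlift3_comp[OF evt_tri[OF hmV hmW L' f'(2)[OF v]] g'(1)]) simp_all
 also have "... = E.e (gm L) v" unfolding ev_def by (rule tlift3_cong) (simp_all add: gm_def v f' g' lin_hom_closed[OF L'])
 finally show ?thesis ..
qed

lemma gm_act: "L |: B ==> h |: H ==> gm (act B h L) = act E.B h (gm L)"
 using hom_act_natural[OF hmV hmW E.hmV E.hmW f g, of L "\<Delta> h"] by (simp add: gm_def)

lemma gm_homA: assumes L: "L \<in> homA" shows "gm L \<in> E.homA"
proof -
 have "E.right_lin (act E.B h (gm L))" if h: "h |: H" for h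
 proof -
  have LB: "L |: B" using L homA_sub by blast
  define M where "M = act B h L"
  have M: "M |: B" "right_lin M" using hm_closed[OF B_hm h LB] L h unfolding M_def homA_def by auto
  have xM: "act B x M |: B" if "x |: H" for x by (rule hm_closed[OF B_hm that M(1)])
  have "E.right_lin (gm M)" unfolding E.right_lin_def
  proof (intro ballI)
   fix v a assume va: "v |: V'" "a |: A"
   note tr = act_trilinear[OF tri_r[OF actVb(2) e_bil] B_hm hmV A_hm M(1) f'(2)[OF va(1)] va(2)]
   have "ract W' (E.e (gm M) v) a = g (ract W (e M (f v)) a)"
    using va by (simp add: e_gm M(1) g' f' bil_cl[OF e_bil] del: b_hom_simps)
   also have "... = tlift3 W' (%x y z. g (e (act B x M) (ract V (act V y (f v)) (act A z a)))) \<phi>"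
    using M(2) va f'(2) tlift3_comp[OF tr g'(1)] by (simp add: right_lin_def del: b_hom_simps)
   also have "... = nested_r E.B V' A W' (ract V') E.e \<phi> (gm M) v a"
    by (rule tlift3_cong) (use va in "simp_all add: gm_act[symmetric] M(1) xM e_gm f' bil_cl[OF E.actVb(2)] del: b_hom_simps")
   finally show "ract W' (E.e (gm M) v) a = nested_r E.B V' A W' (ract V') E.e \<phi> (gm M) v a" .
  qed
  then show ?thesis unfolding M_def gm_act[OF LB h] .
 qed
 then show ?thesis using L homA_sub gm_closed unfolding E.homA_def by blast
qed

lemma gm_actions:
 assumes a: "a |: A" and L: "L |: B"
 shows "gm (lact B a L) = lact E.B a (gm L)" "gm (ract B L a) = ract E.B (gm L) a"
proof -
 note sm = eqv_same[OF same_refl same_refl b_hom_same]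
 show "gm (lact B a L) = lact E.B a (gm L)"
 proof (rule products_into_hom_eq[OF E.hmV E.hmW _ _ A_hm B_hm _ a L])
  have "equivar k H A B E.B (%a L. gm (lact B a L))" by (rule equivar_post[OF actB(1) gm_linear gm_act A_hm B_hm B_hm E.B_hm])
  then show "equivar k H A B (h_hom k H V' W') (%a L. gm (lact B a L))" by (simp only: sm)
  have "equivar k H A B E.B (%a L. lact E.B a (gm L))"
   by (rule equivar_pre[OF E.actB(1) linear_id gm_linear HOL.refl gm_act A_hm E.B_hm A_hm B_hm])
  then show "equivar k H A B (h_hom k H V' W') (%a L. lact E.B a (gm L))" by (simp only: sm)
  fix a L v assume *: "a |: A" "L |: B" "v |: V'"
  note tr = act_trilinear[OF tri_r[OF e_bil actWb(1)] A_hm B_hm hmV *(1,2) f'(2)[OF *(3)]]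
  have yL: "act B y L |: B" if "y |: H" for y by (rule hm_closed[OF B_hm that *(2)])
  have "E.e (gm (lact B a L)) v = g (e (lact B a L) (f v))" by (rule e_gm[OF bil_cl[OF actBb(1) *(1,2)] *(3)])
  also have "... = tlift3 W' (%x y z. g (lact W (act A x a) (e (act B y L) (act V z (f v))))) \<phi>"
   using law_lactB * f'(2) tlift3_comp[OF tr g'(1)] by (simp add: alaw_def del: b_hom_simps)
  also have "... = nested_r A E.B V' W' E.e (lact W') \<phi> a (gm L) v"
   by (rule tlift3_cong) (use * in "simp_all add: gm_act[symmetric] yL e_gm f' g' bil_cl[OF e_bil] del: b_hom_simps")
  also have "... = E.e (lact E.B a (gm L)) v" using E.law_lactB * gm_closed by (simp add: alaw_def del: b_hom_simps)
  finally show "E.e (gm (lact B a L)) v = E.e (lact E.B a (gm L)) v" .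
 qed
 show "gm (ract B L a) = ract E.B (gm L) a"
 proof (rule products_into_hom_eq[OF E.hmV E.hmW _ _ B_hm A_hm _ L a])
  have "equivar k H B A E.B (%L a. gm (ract B L a))" by (rule equivar_post[OF actB(2) gm_linear gm_act B_hm A_hm B_hm E.B_hm])
  then show "equivar k H B A (h_hom k H V' W') (%L a. gm (ract B L a))" by (simp only: sm)
  have "equivar k H B A E.B (%L a. ract E.B (gm L) a)"
   by (rule equivar_pre[OF E.actB(2) gm_linear linear_id gm_act HOL.refl E.B_hm A_hm B_hm A_hm])
  then show "equivar k H B A (h_hom k H V' W') (%L a. ract E.B (gm L) a)" by (simp only: sm)
  fix L a v assume *: "L |: B" "a |: A" "v |: V'"
  note tr = act_trilinear[OF tri_r[OF actVb(1) e_bil] B_hm A_hm hmV *(1,2) f'(2)[OF *(3)]]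
  have yL: "act B y L |: B" if "y |: H" for y by (rule hm_closed[OF B_hm that *(1)])
  have "E.e (gm (ract B L a)) v = g (e (ract B L a) (f v))" by (rule e_gm[OF bil_cl[OF actBb(2) *(1,2)] *(3)])
  also have "... = tlift3 W' (%x y z. g (e (act B x L) (lact V (act A y a) (act V z (f v))))) \<phi>"
   using law_ractB * f'(2) tlift3_comp[OF tr g'(1)] by (simp add: alaw_def del: b_hom_simps)
  also have "... = nested_r E.B A V' W' (lact V') E.e \<phi> (gm L) a v"
   by (rule tlift3_cong) (use * in "simp_all add: gm_act[symmetric] yL e_gm f' bil_cl[OF E.actVb(1)] del: b_hom_simps")
  also have "... = E.e (ract E.B (gm L) a) v" using E.law_ractB * gm_closed by (simp add: alaw_def del: b_hom_simps)
  finally show "E.e (gm (ract B L a)) v = E.e (ract E.B (gm L) a) v" .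
 qed
qed

theorem gm_bimodule_hom: "bimodule_hom k H A (hom_over k H A V W) (hom_over k H A V' W') gm"
 unfolding hom_over_eq E.hom_over_eq bimodule_hom_def h_linear_def
proof (intro conjI ballI)
 show "lmap k \<O> E.\<O> gm" by (rule linear_mapI)
   (use gm_homA subsetD[OF homA_sub] linear_add[OF gm_linear] linear_smult[OF gm_linear] in "simp_all del: b_hom_simps")
qed (use gm_act gm_actions subsetD[OF homA_sub] in "simp_all del: b_hom_simps")

end

section \<open>Twisting algebras and bimodules\<close>

lemma twist_algebra_simps [simp]:
 "carrier (twist_algebra k H F A) = carrier A" "add (twist_algebra k H F A) = add A" "zero (twist_algebra k H F A) = zero A"
 "smult (twist_algebra k H F A) = smult A" "one (twist_algebra k H F A) = one A" "act (twist_algebra k H F A) = act A"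
 "mult (twist_algebra k H F A) = twprod A A A (twist_inv k H F) (mult A)"
 by (simp_all add: twist_algebra_def twprod_def fun_eq_iff)

lemma twist_bimodule_simps [simp]:
 "carrier (twist_bimodule k H F A V) = carrier V" "add (twist_bimodule k H F A V) = add V" "zero (twist_bimodule k H F A V) = zero V"
 "smult (twist_bimodule k H F A V) = smult V" "mult (twist_bimodule k H F A V) = mult V" "one (twist_bimodule k H F A V) = one V"
 "act (twist_bimodule k H F A V) = act V"
 "lact (twist_bimodule k H F A V) = twprod A V V (twist_inv k H F) (lact V)"
 "ract (twist_bimodule k H F A V) = twprod V A V (twist_inv k H F) (ract V)"
 by (simp_all add: twist_bimodule_def twprod_def fun_eq_iff)

lemma twist_same: "same_h (twist_algebra k H F A) A" "same_h (twist_bimodule k H F A V) V" by (simp_all add: same_h_def)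

lemma twprod_sub: "add X = add X' ==> zero X = zero X' ==> act U = act U' ==> act V = act V' ==> twprod U V X t m = twprod U' V' X' t m"
 by (intro ext) (simp add: twprod_def tlift_target_cong[of X X'])

locale twist_data = twist_alg k H F + h_alg k H A
 for k :: "'k ring" and H :: "('k, 'h) quasi_hopf" and F :: "('h, 'h) tens" and A :: "('k, 'h, 'a) hmodule"
begin

abbreviation "AF == twist_algebra k H F A"
abbreviation "FF V == twist_bimodule k H F A V"

lemma HF_qha: "quasi_hopf_alg k HF" by unfold_locales (rule twist_quasi_hopf)

lemma AF_algebra: "h_algebra k HF AF"
proof -
 interpret G: quasi_hopf_alg k HF by (rule HF_qha)
 have hm: "hmod k HF AF" by (simp add: h_module_HF h_module_same[OF twist_same(1)])
 have e: "equivar k HF AF AF AF (mult AF)"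
  using equivar_twist[OF A_eq] by (simp add: eqv_same[OF twist_same(1) twist_same(1) twist_same(1)])
 have law: "alaw HF AF AF AF AF (mult AF) (mult AF) (mult AF) (mult AF)"
  using assoc_twist[OF A_eq A_eq A_eq A_eq A_hm A_hm A_hm A_hm A_hm A_hm A_law]
  by (simp add: assoc_same[OF twist_same(1) twist_same(1) twist_same(1) twist_same(1)] del: HF_simps)
 have u: "h_linear k HF (h_unit k HF) AF (%r. r \<odot>[AF] \<one>[AF])"
  using hA unfolding h_algebra_def h_linear_def by (simp add: h_unit_def linear_map_def module.extend_def hmodule.fields_def)
 note b = eqvD(1)[OF A_eq]
 have "\<one>[AF] \<otimes>[AF] a = a \<and> a \<otimes>[AF] \<one>[AF] = a" if a: "a |: A" for a
  using twprod_counit_l[OF b A_hm A_hm hm_mod[OF A_hm] A_one a F_closed(2) A_inv]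
   twprod_counit_r[OF b A_hm A_hm hm_mod[OF A_hm] a A_one F_closed(2) A_inv] a by (simp add: F'_counit A_unit)
 then show ?thesis unfolding h_algebra_def G.tensor_morphism_iff[OF hm hm hm]
  using hm e u law A_one by (simp add: alaw_def del: HF_simps twist_algebra_simps(7))
qed

lemma HF_alg': "h_alg k HF AF" by (rule h_alg.intro[OF HF_qha]) (unfold_locales, rule AF_algebra)

lemma twist_is_bimodule:
 assumes V: "a_bimodule k H A V"
 shows "a_bimodule k HF AF (FF V)"
proof -
 interpret G: h_alg k HF AF by (rule HF_alg')
 note D = bimoduleD[OF V] and s = twist_same(1)[of k H F A] and s' = twist_same(2)[of k H F A V]
 note hm [simp] = D(1)
 have e: "equivar k HF AF (FF V) (FF V) (lact (FF V))" "equivar k HF (FF V) AF (FF V) (ract (FF V))"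
  using equivar_twist[OF D(2)] equivar_twist[OF D(3)] by (simp_all add: eqv_same[OF s s' s'] eqv_same[OF s' s s'])
 have l: "alaw HF (FF V) AF AF (FF V) (ract (FF V)) (ract (FF V)) (mult AF) (ract (FF V))"
  "alaw HF AF AF (FF V) (FF V) (mult AF) (lact (FF V)) (lact (FF V)) (lact (FF V))"
  "alaw HF AF (FF V) AF (FF V) (lact (FF V)) (ract (FF V)) (ract (FF V)) (lact (FF V))"
  using assoc_twist[OF D(3) D(3) A_eq D(3) _ _ _ _ _ _ D(4)] assoc_twist[OF A_eq D(2) D(2) D(2) _ _ _ _ _ _ D(5)]
   assoc_twist[OF D(2) D(3) D(3) D(2) _ _ _ _ _ _ D(6)]
  by (simp_all add: assoc_same[OF s' s s s'] assoc_same[OF s s s' s'] assoc_same[OF s s' s s'] del: HF_simps)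
 have u: "lact (FF V) \<one>[AF] v = v \<and> ract (FF V) v \<one>[AF] = v" if v: "v |: V" for v
  using twprod_counit_l[OF eqvD(1)[OF D(2)] A_hm hm hm_mod[OF hm] A_one v F_closed(2) A_inv]
   twprod_counit_r[OF eqvD(1)[OF D(3)] hm A_hm hm_mod[OF hm] v A_one F_closed(2) A_inv] v by (simp add: F'_counit D(7,8))
 have "hmod k HF (FF V)" by (simp add: h_module_HF h_module_same[OF s'])
 then show ?thesis unfolding G.a_bimodule_iff using e l u by simp
qed

end

subsection \<open>Twisting back\<close>

context twist_alg begin

text \<open>
 Since \<open>F\<inverse>\<close> is a twist of \<open>H\<^sub>F\<close>, every statement on twisting has a converse for free.
\<close>

lemma inverse_twist: "cochain_twist k HF F'" "twist_inv k HF F' = F"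
proof -
 have u: "F' \<in> Units H2" unfolding Units_def using F_inv F_closed by blast
 have "tens2 k HF = H2" by simp
 then show "cochain_twist k HF F'" unfolding cochain_twist_def using u F'_counit by simp
 have "inv\<^bsub>H2\<^esub> F' = F" using F_inv F_closed by (metis H2.inv_unique')
 then show "twist_inv k HF F' = F" unfolding twist_inv_def[of k HF] by simp
qed

abbreviation "H'' == twist_hopf k HF F'"

lemma inverse_alg: "twist_alg k HF F'" by (rule twist_alg.intro) (unfold_locales, rule twist_quasi_hopf, rule inverse_twist)

lemma H''_comult: "h |: H ==> comult H'' h = \<Delta> h"
proof -
 interpret T': twist_alg k HF F' by (rule inverse_alg)
 assume h: "h |: H"
 have c: "F' *2 (F *2 x) = x" if "x |: H2" for x using that by (simp add: H2.m_assoc[symmetric])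
 have "comult H'' h = F' *2 (F *2 \<Delta> h *2 F') *2 F" by (simp add: inverse_twist)
 also have "... = \<Delta> h" using h by (simp add: H2.m_assoc c)
 finally show ?thesis .
qed

lemma H''_phi: "phi H'' = \<phi>"
proof -
 interpret T': twist_alg k HF F' by (rule inverse_alg)
 have "phi H'' = j0 F' *3 id_comult k HF F' *3 phi_F *3 comult_id k HF F *3 j3 F"
  unfolding T'.HF_simps inverse_twist phi_HF by (simp add: phi_F_def)
 also have "... = \<phi>" by (simp add: twisted_maps phi_F_def H3.m_assoc homs_cancel homs_inv)
 finally show ?thesis .
qed

lemma H''_laws:
 "alaw H'' U V W X = alaw H U V W X" "equivar k H'' U V X = equivar k H U V X"
proof -
 interpret T': twist_alg k HF F' by (rule inverse_alg)
 show "alaw H'' U V W X = alaw H U V W X" unfolding alaw_def[abs_def] H''_phi ..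
 show "equivar k H'' U V X = equivar k H U V X" unfolding equivar_def[abs_def] using H''_comult by (simp add: fun_eq_iff)
qed

lemma twprod_cancel:
 assumes "blmap k U V X m" "hmod k H U" "hmod k H V" "module k X" "u |: U" "v |: V"
 shows "twprod U V X F (twprod U V X F' m) u v = m u v" "twprod U V X F' (twprod U V X F m) u v = m u v"
 using assms by (simp_all add: twprod_mult[OF assms(1)] twprod_one)

lemma alaw_untwist:
 assumes e: "equivar k HF U V P m1" "equivar k HF P W X m2" "equivar k HF V W Q m3" "equivar k HF U Q X m4"
  and hm [simp]: "hmod k H U" "hmod k H V" "hmod k H W" "hmod k H P" "hmod k H Q" "hmod k H X"
  and a: "alaw HF U V W X m1 m2 m3 m4"
 shows "alaw H U V W X (twprod U V P F m1) (twprod P W X F m2) (twprod V W Q F m3) (twprod U Q X F m4)"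
proof -
 interpret T': twist_alg k HF F' by (rule inverse_alg)
 show ?thesis using T'.assoc_twist[OF e] a by (simp add: inverse_twist H''_laws h_module_HF)
qed

lemma alaw_twist_iff:
 assumes e: "equivar k H U V P m1" "equivar k H P W X m2" "equivar k H V W Q m3" "equivar k H U Q X m4"
  and hm [simp]: "hmod k H U" "hmod k H V" "hmod k H W" "hmod k H P" "hmod k H Q" "hmod k H X"
 shows "alaw HF U V W X (tw U V P m1) (tw P W X m2) (tw V W Q m3) (tw U Q X m4) \<longleftrightarrow> alaw H U V W X m1 m2 m3 m4"
proof
 note b = e[THEN eqvD(1)]
 assume "alaw HF U V W X (tw U V P m1) (tw P W X m2) (tw V W Q m3) (tw U Q X m4)"
 then have "alaw H U V W X (twprod U V P F (tw U V P m1)) (twprod P W X F (tw P W X m2))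
   (twprod V W Q F (tw V W Q m3)) (twprod U Q X F (tw U Q X m4))"
  by (intro alaw_untwist[OF equivar_twist[OF e(1)] equivar_twist[OF e(2)] equivar_twist[OF e(3)] equivar_twist[OF e(4)]]) simp_all
 then show "alaw H U V W X m1 m2 m3 m4"
  by (rule alaw_cong[where P = P and Q = Q]) (simp_all add: twprod_cancel b bil_cl[OF b(1)] bil_cl[OF b(3)])
qed (rule assoc_twist[OF assms])

end

context twist_data begin

lemma inverse_data: "twist_data k HF F' AF" by (rule twist_data.intro[OF inverse_alg HF_alg'])

abbreviation "GG V == twist_bimodule k HF F' AF V"

lemma GG_bimodule:
 assumes V: "a_bimodule k HF AF V"
 shows "a_bimodule k H A (GG V)"
proof -
 interpret T': twist_data k HF F' AF by (rule inverse_data)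
 interpret G: h_alg k H'' T'.AF by (rule T'.HF_alg')
 note D = G.bimoduleD[OF T'.twist_is_bimodule[OF V], unfolded H''_laws]
 have hm: "hmod k H (GG V)" using D(1) unfolding T'.h_module_HF h_module_HF .
 have s: "same_h T'.AF A" by (simp add: same_h_def)
 have m: "mult T'.AF a b = mult A a b" if "a |: A" "b |: A" for a b
  using that twprod_cancel(1)[OF eqvD(1)[OF A_eq] A_hm A_hm hm_mod[OF A_hm]]
  by (simp add: inverse_twist twprod_same[OF twist_same(1) twist_same(1) twist_same(1)])
 note e = D(2)[unfolded eqv_same[OF s same_refl same_refl]] D(3)[unfolded eqv_same[OF same_refl s same_refl]]
 note c = bil_cl[OF eqvD(1)[OF e(1)]] bil_cl[OF eqvD(1)[OF e(2)]] bil_cl[OF eqvD(1)[OF A_eq]]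
 have l: "alaw H (GG V) A A (GG V) (ract (GG V)) (ract (GG V)) (mult T'.AF) (ract (GG V))"
  "alaw H A A (GG V) (GG V) (mult T'.AF) (lact (GG V)) (lact (GG V)) (lact (GG V))"
  "alaw H A (GG V) A (GG V) (lact (GG V)) (ract (GG V)) (ract (GG V)) (lact (GG V))"
  using D(4-6) unfolding assoc_same[OF same_refl s s same_refl] assoc_same[OF s s same_refl same_refl]
   assoc_same[OF s same_refl s same_refl] by blast+
 have cm: "mult T'.AF a b |: A" if "a |: A" "b |: A" for a b using c(3) m that by simp
 have l': "alaw H (GG V) A A (GG V) (ract (GG V)) (ract (GG V)) (mult A) (ract (GG V))"
  by (rule alaw_cong[OF l(1) c(2) cm HOL.refl HOL.refl HOL.refl m[symmetric] hm A_hm A_hm])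
 have l'': "alaw H A A (GG V) (GG V) (mult A) (lact (GG V)) (lact (GG V)) (lact (GG V))"
  by (rule alaw_cong[OF l(2) cm c(1) HOL.refl HOL.refl m[symmetric] HOL.refl A_hm A_hm hm])
 have "\<forall>v\<in>carrier (GG V). lact (GG V) \<one>\<^sub>A v = v \<and> ract (GG V) v \<one>\<^sub>A = v"
  using D(7,8) by (simp del: twist_bimodule_simps(8,9))
 then show ?thesis unfolding a_bimodule_iff using hm e l' l'' l(3) by blast
qed

lemma twist_cancel:
 assumes V: "a_bimodule k H A V" and [simp]: "v |: V" "a |: A"
 shows "lact (GG (FF V)) a v = lact V a v" "ract (GG (FF V)) v a = ract V v a"
 using twprod_cancel(1)[OF eqvD(1)[OF bimoduleD(2)[OF V]]] twprod_cancel(1)[OF eqvD(1)[OF bimoduleD(3)[OF V]]] bimoduleD(1)[OF V]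
 by (simp_all add: inverse_twist twprod_same[OF twist_same(1) twist_same(2) twist_same(2)] twprod_same[OF twist_same(2) twist_same(1) twist_same(2)])

lemma twist_cancel':
 assumes V: "a_bimodule k HF AF V" and [simp]: "v |: V" "a |: A"
 shows "lact (FF (GG V)) a v = lact V a v" "ract (FF (GG V)) v a = ract V v a"
proof -
 interpret G: h_alg k HF AF by (rule HF_alg')
 note D = G.bimoduleD[OF V]
 have b: "blmap k A V V (lact V)" "blmap k V A V (ract V)" "hmod k H V" using eqvD(1)[OF D(2)] eqvD(1)[OF D(3)] D(1)
  by (simp_all add: bilinear_same[OF twist_same(1) same_refl same_refl] bilinear_same[OF same_refl twist_same(1) same_refl] h_module_HF)
 show "lact (FF (GG V)) a v = lact V a v" "ract (FF (GG V)) v a = ract V v a"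
  using twprod_cancel(2)[OF b(1)] twprod_cancel(2)[OF b(2)] b(3)
  by (simp_all add: inverse_twist twprod_same[OF twist_same(1) same_refl same_refl] twprod_same[OF same_refl twist_same(1) same_refl]
   twprod_same[OF same_refl twist_same(2) twist_same(2)] twprod_same[OF twist_same(2) same_refl twist_same(2)])
qed

lemma twist_hom:
 assumes V: "a_bimodule k H A V" and W: "a_bimodule k H A W" and f: "bimodule_hom k H A V W f"
 shows "bimodule_hom k HF AF (FF V) (FF W) f"
proof -
 note f' = bim_homD[OF f] and D = bimoduleD[OF V] bimoduleD[OF W]
 note hm = hm_mod[OF bimoduleD(1)[OF V]] hm_mod[OF bimoduleD(1)[OF W]]
 have l: "f (tw A V V (lact V) a v) = tw A W W (lact W) a (f v)" "f (tw V A V (ract V) v a) = tw W A W (ract W) (f v) a"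
  if va: "v |: V" "a |: A" for v a
 proof -
  note 1 = tlift_linear_comp[OF twprod_bil[OF eqvD(1)[OF D(2)] A_hm D(1) va(2,1)] f'(1) H_mod H_mod hm F_closed(2)]
   tlift_linear_comp[OF twprod_bil[OF eqvD(1)[OF D(3)] D(1) A_hm va] f'(1) H_mod H_mod hm F_closed(2)]
  show "f (tw A V V (lact V) a v) = tw A W W (lact W) a (f v)" "f (tw V A V (ract V) v a) = tw W A W (ract W) (f v) a"
   unfolding twprod_def 1 by (rule tlift_cong[OF H_mod H_mod F_closed(2)]; simp add: va f' D)+
 qed
 have "lmap k (FF V) (FF W) f" using f'(1) by (simp add: linear_map_def)
 then show ?thesis unfolding bimodule_hom_def h_linear_def using l f'(3) by simp
qed

end

section \<open>The twist and the tensor product\<close>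

lemma (in two_bimodules) proj_act2:
 assumes t: "t |: H2" and [simp]: "v |: V" "w |: W"
 shows "proj (act2 k V W t (pure k V W v w)) = twprod V W Q t p v w"
 by (rule H2_eq[OF _ _ _ _ t, of Q]) (simp_all add: lin twprod_lin[OF p_bil] twprod_pure[OF p_bil], simp add: p_def')

locale twist_two = twist_data k H F A for k :: "'k ring" and H :: "('k, 'h) quasi_hopf" and F :: "('h, 'h) tens" and A :: "('k, 'h, 'a) hmodule" +
 fixes V :: "('k, 'h, 'a, 'v) bimodule" and W :: "('k, 'h, 'a, 'w) bimodule"
 assumes V: "a_bimodule k H A V" and W: "a_bimodule k H A W"
begin

sublocale P: two_bimodules k H A V W by unfold_locales (rule V, rule W)
sublocale PF: two_bimodules k HF AF "FF V" "FF W"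
 by (rule two_bimodules.intro[OF HF_alg']) (unfold_locales, rule twist_is_bimodule[OF V], rule twist_is_bimodule[OF W])

abbreviation "\<tau> == twist_tensor_map k H F A V W"

lemma FF_tensor: "tensor k (FF V) (FF W) = tensor k V W" "pure k (FF V) (FF W) = pure k V W" "act2 k (FF V) (FF W) = act2 k V W"
proof -
 show "tensor k (FF V) (FF W) = tensor k V W" "pure k (FF V) (FF W) = pure k V W" by (rule tensor_cong tensor_lin_cong(2); simp)+
 then show "act2 k (FF V) (FF W) = act2 k V W" by (intro ext) (simp add: act2_def tmap_def)
qed

lemma hmQ: "hmod k H PF.Q" using PF.Q_hm unfolding h_module_HF .
lemma hmFF: "hmod k H (FF V)" "hmod k H (FF W)" "hmod k H AF"
 using P.hmV P.hmW A_hm h_module_same[OF twist_same(2)] h_module_same[OF twist_same(1)] by blast+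

lemma p_F: "v |: V ==> w |: W ==> P.proj (act2 k V W F' (pure k V W v w)) = tw V W P.Q P.p v w" by (rule P.proj_act2) simp_all

lemma \<tau>_proj:
 assumes x: "x |: tensor k V W"
 shows "\<tau> (PF.proj x) = P.proj (act2 k V W F' x)"
proof -
 let ?n = "%v w. P.proj (act2 k V W F' (pure k V W v w))"
 note b = twprod_bilinear[OF P.rVb P.hmV A_hm P.hmV[THEN hm_mod] F_closed(2)] twprod_bilinear[OF P.lWb A_hm P.hmW P.hmW[THEN hm_mod] F_closed(2)]
 have "alaw HF V A W P.Q (tw V A V (ract V)) (tw V W P.Q P.p) (tw A W W (lact W)) (tw V W P.Q P.p)"
  by (rule assoc_twist[OF P.rV P.p_equivariant P.lW P.p_equivariant _ _ _ _ _ _ P.p_balanced]) simp_all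
 then have "alaw HF V A W P.Q (tw V A V (ract V)) ?n (tw A W W (lact W)) ?n"
  by (rule PF.alaw_cong[OF _ bil_cl[OF b(1)] bil_cl[OF b(2)] p_F p_F HOL.refl HOL.refl]; simp only: h_module_HF P.hmV P.hmW A_hm)
 then have law: "alaw HF (FF V) AF (FF W) P.Q (ract (FF V)) ?n (lact (FF W)) ?n"
  by (simp add: assoc_same[OF twist_same(2) twist_same(1) twist_same(2) same_refl] del: HF_simps)
 have "lmap k (tensor k V W) (tensor k V W) (act2 k V W F')" by (simp add: lin)
 from PF.descend[OF P.two_bimodules_axioms, unfolded FF_tensor, OF this law x HOL.refl]
 show ?thesis using PF.proj_closed[of x] x unfolding twist_tensor_map_def FF_tensor by simp
qed

lemma \<tau>_linear: "lmap k PF.Q (FF P.Q) \<tau>"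
proof (rule PF.quot_lin)
 have "lmap k (tensor k V W) P.Q (%x. \<tau> (PF.proj x))"
  unfolding FF_tensor by (subst linear_map_cong[OF \<tau>_proj[unfolded FF_tensor]]) (simp_all add: lin P.proj_comp_lin)
 then show "lmap k (tensor k (FF V) (FF W)) (FF P.Q) (%x. \<tau> (PF.proj x))" unfolding FF_tensor by (simp add: linear_map_def)
qed

lemma \<tau>_pure: "v |: V ==> w |: W ==> \<tau> (PF.p v w) = tw V W P.Q P.p v w"
 using \<tau>_proj[of "pure k V W v w"] p_F unfolding PF.p_def' FF_tensor by simp

lemma \<tau>_bij: "bij_betw \<tau> (carrier PF.Q) (carrier P.Q)"
proof -
 let ?s = "coset_map (tensor k V W) PF.N (act2 k V W F)"
 let ?n = "%v w. PF.proj (act2 k V W F (pure k V W v w))"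
 have c: "?s (P.proj x) = PF.proj (act2 k V W F x)" if x: "x |: tensor k V W" for x
 proof -
  have n: "?n v w = twprod (FF V) (FF W) PF.Q F PF.p v w" if "v |: V" "w |: W" for v w
   using PF.proj_act2[of F v w] that unfolding FF_tensor by simp
  have cV: "ract V v a = twprod (FF V) AF (FF V) F (ract (FF V)) v a" if "v |: FF V" "a |: AF" for v a
   using that by (simp add: twprod_same[OF twist_same(2) twist_same(1) twist_same(2)] twprod_cancel P.rVb)
  have cW: "lact W a w = twprod AF (FF W) (FF W) F (lact (FF W)) a w" if "w |: FF W" "a |: AF" for w a
   using that by (simp add: twprod_same[OF twist_same(1) twist_same(2) twist_same(2)] twprod_cancel P.lWb)
  have "alaw H (FF V) AF (FF W) PF.Q (twprod (FF V) AF (FF V) F (ract (FF V))) (twprod (FF V) (FF W) PF.Q F PF.p)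
    (twprod AF (FF W) (FF W) F (lact (FF W))) (twprod (FF V) (FF W) PF.Q F PF.p)"
   by (rule alaw_untwist[OF PF.rV PF.p_equivariant PF.lW PF.p_equivariant _ _ _ _ _ _ PF.p_balanced]) (rule hmFF hmQ)+
  then have "alaw H (FF V) AF (FF W) PF.Q (ract V) ?n (lact W) ?n" by (rule alaw_cong[where P = V and Q = W])
    (use hmFF n cV[symmetric] cW[symmetric] in "simp_all add: bil_cl[OF P.rVb] bil_cl[OF P.lWb] del: twist_bimodule_simps(8,9)")
  then have law: "alaw H V A W PF.Q (ract V) ?n (lact W) ?n"
   by (simp add: assoc_same[OF twist_same(2) twist_same(1) twist_same(2) same_refl])
  have "lmap k (tensor k V W) (tensor k V W) (act2 k V W F)" by (simp add: lin)
  from P.descend[OF PF.two_bimodules_axioms, unfolded FF_tensor, OF this law[unfolded FF_tensor] x HOL.refl]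
  show ?thesis unfolding FF_tensor .
 qed
 have i: "act2 k V W F (act2 k V W F' x) = x" "act2 k V W F' (act2 k V W F x) = x" if "x |: tensor k V W" for x
  using that by (simp_all add: act234_mult[symmetric] alg_moduleD(6)[OF act2_mod])
 have cl: "act2 k V W t x |: tensor k V W" if "x |: tensor k V W" "t |: H2" for x t using that by simp
 have "?s (\<tau> q) = q \<and> \<tau> q |: P.Q" if "q |: PF.Q" for q using that
 proof (rule PF.Q_carrierE)
  fix x assume "x |: (tensor k (FF V) (FF W))" "q = PF.proj x"
  then show ?thesis unfolding FF_tensor using \<tau>_proj[of x] c cl[of x F'] i by (simp add: FF_tensor)
 qed
 moreover have "\<tau> (?s q) = q \<and> ?s q |: PF.Q" if "q |: P.Q" for q using that
 proof (rule P.Q_carrierE)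
  fix x assume x: "x |: tensor k V W" "q = P.proj x"
  then show ?thesis using \<tau>_proj[of "act2 k V W F x"] c cl[of x F] i PF.proj_closed[of "act2 k V W F x"] by (simp add: FF_tensor)
 qed
 ultimately show ?thesis by (intro bij_betwI[where g = ?s]) auto
qed

theorem \<tau>_hom: "bimodule_hom k HF AF PF.Q (FF P.Q) \<tau>"
proof -
 let ?n = "%v w. \<tau> (PF.p v w)"
 note s = twist_same(1)[of k H F A] twist_same(2)[of k H F A V] twist_same(2)[of k H F A W] twist_same(2)[of k H F A P.Q]
 note hm = P.hmV P.hmW A_hm P.Q_hm
 note hms = hm_mod[OF P.hmV] hm_mod[OF P.hmW] F_closed(2)
 have hmF: "hmod k HF V" "hmod k HF W" "hmod k HF A" using hm by (simp_all only: h_module_HF)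
 show ?thesis
 proof (rule PF.over_bimodule_hom[OF \<tau>_linear twist_is_bimodule[OF P.Q_bimodule]])
  have "equivar k HF V W P.Q (tw V W P.Q P.p)" by (rule equivar_twist[OF P.p_equivariant]) (rule hm)+
  then have "equivar k HF V W P.Q ?n" by (rule PF.equivar_cong[OF _ \<tau>_pure hmF(1,2)])
  then show "equivar k HF (FF V) (FF W) (FF P.Q) ?n" by (simp add: eqv_same[OF s(2,3,4)])
  have "alaw HF A V W P.Q (tw A V V (lact V)) (tw V W P.Q P.p) (tw V W P.Q P.p) (tw A P.Q P.Q (lact P.Q))"
   by (rule assoc_twist[OF P.actV(1) P.p_equivariant P.p_equivariant P.actQ(1) _ _ _ _ _ _ P.law_lact]) (rule hm)+
  then have "alaw HF A V W P.Q (tw A V V (lact V)) ?n ?n (tw A P.Q P.Q (lact P.Q))"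
   by (rule PF.alaw_cong[OF _ bil_cl[OF twprod_bilinear[OF P.actVb(1) A_hm P.hmV hms(1,3)]]
    bil_cl[OF twprod_bilinear[OF P.p_bil P.hmV P.hmW P.Q_mod hms(3)]] \<tau>_pure HOL.refl HOL.refl \<tau>_pure hmF(3,1,2)])
  then show "alaw HF AF (FF V) (FF W) (FF P.Q) (lact (FF V)) ?n ?n (lact (FF P.Q))" by (simp add: assoc_same[OF s] del: HF_simps)
  have "alaw HF V W A P.Q (tw V W P.Q P.p) (tw P.Q A P.Q (ract P.Q)) (tw W A W (ract W)) (tw V W P.Q P.p)"
   by (rule assoc_twist[OF P.p_equivariant P.actQ(2) P.actW(2) P.p_equivariant _ _ _ _ _ _ P.law_ract]) (rule hm)+
  then have "alaw HF V W A P.Q ?n (tw P.Q A P.Q (ract P.Q)) (tw W A W (ract W)) ?n"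
   by (rule PF.alaw_cong[OF _ bil_cl[OF twprod_bilinear[OF P.p_bil P.hmV P.hmW P.Q_mod hms(3)]]
    bil_cl[OF twprod_bilinear[OF P.actWb(2) P.hmW A_hm hms(2,3)]] HOL.refl \<tau>_pure \<tau>_pure HOL.refl hmF(1,2,3)])
  then show "alaw HF (FF V) (FF W) AF (FF P.Q) ?n (ract (FF P.Q)) (ract (FF W)) ?n"
   by (simp add: assoc_same[OF s(2,3,1,4)] del: HF_simps)
 qed
qed

lemma \<tau>_natural:
 assumes E: "twist_two k H F A V1 W1" and f: "bimodule_hom k H A V V1 f" and g: "bimodule_hom k H A W W1 g" and q: "q |: PF.Q"
 shows "twist_tensor_map k H F A V1 W1 (map_over k HF AF (FF V) (FF W) (FF V1) (FF W1) f g q) = map_over k H A V W V1 W1 f g (\<tau> q)"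
proof -
 interpret E: twist_two k H F A V1 W1 by fact
 note m = P.map_over[OF E.P.two_bimodules_axioms f g]
  and mF = PF.map_over[OF E.PF.two_bimodules_axioms twist_hom[OF V E.V f] twist_hom[OF W E.W g]]
 note l = bim_homD(1)[OF m(1)] bim_homD(1)[OF mF(1)] and f' = bim_homD[OF f] and g' = bim_homD[OF g]
 have t: "lmap k PF.Q P.Q \<tau>" "lmap k E.PF.Q E.P.Q E.\<tau>"
  using \<tau>_linear E.\<tau>_linear by (simp_all add: linear_same[OF same_refl twist_same(2)])
 show ?thesis
 proof (rule PF.over_eq[where M = E.P.Q, OF _ _ _ _ q])
  fix v w assume "v |: FF V" "w |: FF W"
  then have vw: "v |: V" "w |: W" by simp_all
  have "map_over k H A V W V1 W1 f g (tw V W P.Q P.p v w) = tw V W E.P.Q (%v w. map_over k H A V W V1 W1 f g (P.p v w)) v w"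
   unfolding twprod_def by (rule tlift_linear_comp[OF twprod_bil[OF P.p_bil P.hmV P.hmW vw] l(1)]) simp_all
  also have "... = tw V1 W1 E.P.Q E.P.p (f v) (g w)"
   unfolding twprod_def by (rule tlift_cong[OF H_mod H_mod]) (simp_all add: vw m(2) f' g')
  finally show "E.\<tau> (map_over k HF AF (FF V) (FF W) (FF V1) (FF W1) f g (PF.p v w)) = map_over k H A V W V1 W1 f g (\<tau> (PF.p v w))"
   using vw by (simp add: mF(2) \<tau>_pure E.\<tau>_pure f' g')
 qed (rule lin_comp[OF t(2) l(2)] lin_comp[OF l(1) t(1)] E.P.Q_mod)+
qed

end

lemma bimodule_hom_id: "bimodule_hom k H A V V (%x. x)" by (simp add: bimodule_hom_def h_linear_def linear_id)

context twist_data begin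

subsection \<open>Coherence\<close>

text \<open>
 Both sides are linear, and on pure tensors they agree by \<open>assoc_twist\<close>, applied to the law which
 determines the associator.
\<close>

lemma \<tau>_assoc:
 assumes V: "a_bimodule k H A V" and W: "a_bimodule k H A W" and X: "a_bimodule k H A X"
  and t: "t |: (tensor_over k HF AF (tensor_over k HF AF (FF V) (FF W)) (FF X))"
 shows "assoc_over k H A V W X (twist_tensor_map k H F A (tensor_over k H A V W) X
   (map_over k HF AF (tensor_over k HF AF (FF V) (FF W)) (FF X) (FF (tensor_over k H A V W)) (FF X)
    (twist_tensor_map k H F A V W) (%x. x) t)) =
  twist_tensor_map k H F A V (tensor_over k H A W X)
   (map_over k HF AF (FF V) (tensor_over k HF AF (FF W) (FF X)) (FF V) (FF (tensor_over k H A W X))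
    (%v. v) (twist_tensor_map k H F A W X) (assoc_over k HF AF (FF V) (FF W) (FF X) t))"
proof -
 interpret S: three_bimodules k H A V W X by unfold_locales (rule V, rule W, rule X)
 interpret SF: three_bimodules k HF AF "FF V" "FF W" "FF X"
  by (rule three_bimodules.intro[OF HF_alg']) (unfold_locales, rule twist_is_bimodule[OF V], rule twist_is_bimodule[OF W], rule twist_is_bimodule[OF X])
 interpret VW: twist_two k H F A V W by unfold_locales (rule V, rule W)
 interpret WX: twist_two k H F A W X by unfold_locales (rule W, rule X)
 interpret L: twist_two k H F A S.VW.Q X by unfold_locales (rule S.VW.Q_bimodule, rule X)
 interpret R: twist_two k H F A V S.WX.Q by unfold_locales (rule V, rule S.WX.Q_bimodule)
 let ?mL = "map_over k HF AF SF.VW.Q (FF X) (FF S.VW.Q) (FF X) VW.\<tau> (%x. x)"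
 let ?mR = "map_over k HF AF (FF V) SF.WX.Q (FF V) (FF S.WX.Q) (%v. v) WX.\<tau>"
 let ?aF = "assoc_over k HF AF (FF V) (FF W) (FF X)" and ?a = "assoc_over k H A V W X"
 note mL = SF.L.map_over[OF L.PF.two_bimodules_axioms VW.\<tau>_hom bimodule_hom_id]
  and mR = SF.R.map_over[OF R.PF.two_bimodules_axioms bimodule_hom_id WX.\<tau>_hom]
 note lL = bim_homD(1)[OF mL(1)] and lR = bim_homD(1)[OF mR(1)]
 have tl: "lmap k L.PF.Q S.L.Q L.\<tau>" "lmap k R.PF.Q S.R.Q R.\<tau>"
  using L.\<tau>_linear R.\<tau>_linear by (simp_all add: linear_same[OF same_refl twist_same(2)])
 note left = lin_comp[OF S.assoc_over(1) lin_comp[OF tl(1) lL]] and right' = lin_comp[OF tl(2) lR]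
 note right = lin_comp[OF right' SF.assoc_over(1)]
 have \<tau>c: "VW.\<tau> D |: S.VW.Q" if "D |: SF.VW.Q" for D using lin_cl[OF VW.\<tau>_linear that] by simp
 have \<tau>c': "WX.\<tau> D |: S.WX.Q" if "D |: SF.WX.Q" for D using lin_cl[OF WX.\<tau>_linear that] by simp
 have main: "?a (L.\<tau> (?mL (SF.L.p (SF.VW.p v w) x))) = R.\<tau> (?mR (?aF (SF.L.p (SF.VW.p v w) x)))"
  if vwx: "v |: V" "w |: W" "x |: X" for v w x
 proof -
  have vwF: "v |: FF V" "w |: FF W" "x |: FF X" using vwx by simp_all
  note D = SF.VW.p_closed[OF vwF(1,2)]
  have twc: "tw V W S.VW.Q S.VW.p v w |: S.VW.Q" using \<tau>c[OF D] VW.\<tau>_pure vwx by simp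
  have "?a (L.\<tau> (?mL (SF.L.p (SF.VW.p v w) x))) = ?a (tw S.VW.Q X S.L.Q S.L.p (tw V W S.VW.Q S.VW.p v w) x)"
   using mL(2)[OF D vwF(3)] L.\<tau>_pure[OF twc vwx(3)] VW.\<tau>_pure[OF vwx(1,2)] by simp
  also have "... = tw S.VW.Q X S.R.Q (%D x. ?a (S.L.p D x)) (tw V W S.VW.Q S.VW.p v w) x" unfolding twprod_def[of S.VW.Q]
   by (rule tlift_linear_comp[OF twprod_bil[OF S.L.p_bil S.VW.Q_hm bimoduleD(1)[OF X] twc vwx(3)] S.assoc_over(1)]) simp_all
  also have "... = tw S.VW.Q X S.R.Q S.assoc_Q (tw V W S.VW.Q S.VW.p v w) x"
   unfolding twprod_def[of S.VW.Q] by (rule tlift_cong[OF H_mod H_mod]) (simp_all add: S.assoc_over(2) twc vwx)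
  also have "... = nested_r V W X S.R.Q (tw W X S.WX.Q S.WX.p) (tw V S.WX.Q S.R.Q S.R.p) phi_F v w x"
   using assoc_twist[OF S.VW.p_equivariant S.assoc_Q_equivariant S.WX.p_equivariant S.R.p_equivariant _ _ _ _ _ _ S.law_assoc_Q] vwx
   unfolding alaw_def phi_HF by simp
  also have "... = tlift3 S.R.Q (%a b c. R.\<tau> (?mR (SF.R.p (act V a v) (SF.WX.p (act W b w) (act X c x))))) phi_F"
  proof (rule tlift3_cong)
   fix a b c assume abc: "a |: H" "b |: H" "c |: H"
   have w: "act V a v |: V" "act W b w |: W" "act X c x |: X" using abc vwx by simp_all
   then have wF: "act V a v |: FF V" "act W b w |: FF W" "act X c x |: FF X" by simp_all
   note D' = SF.WX.p_closed[OF wF(2,3)]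
   show "tw V S.WX.Q S.R.Q S.R.p (act V a v) (tw W X S.WX.Q S.WX.p (act W b w) (act X c x))
    = R.\<tau> (?mR (SF.R.p (act V a v) (SF.WX.p (act W b w) (act X c x))))"
    using mR(2)[OF wF(1) D'] R.\<tau>_pure[OF w(1) \<tau>c'[OF D']] WX.\<tau>_pure[OF w(2,3)] by simp
  qed simp
  also have "... = R.\<tau> (?mR (SF.assoc_Q (SF.VW.p v w) x))"
  proof -
   have hh: "hmod k H (FF V)" "hmod k H (FF W)" "hmod k H (FF X)" by (rule VW.hmFF WX.hmFF)+
   note tr = act_trilinear[OF tri_r[OF SF.WX.p_bil SF.R.p_bil] hh vwF]
   have "tlift3 S.R.Q (%a b c. R.\<tau> (?mR (SF.R.p (act V a v) (SF.WX.p (act W b w) (act X c x))))) phi_F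
    = R.\<tau> (?mR (nested_r V W X SF.R.Q SF.WX.p SF.R.p phi_F v w x))"
    using tlift3_comp[OF tr right' H_mod H_mod H_mod SF.R.Q_mod S.R.Q_mod phi_psi_F(1)] by simp
   then show ?thesis using SF.assoc_Q(2)[OF vwF(3,1,2)] unfolding phi_HF by simp
  qed
  also have "... = R.\<tau> (?mR (?aF (SF.L.p (SF.VW.p v w) x)))" using SF.assoc_over(2)[OF D vwF(3)] by simp
  finally show ?thesis .
 qed
 show ?thesis
 proof (rule SF.L.over_eq[OF left right S.R.Q_mod _ t])
  fix D x assume D: "D |: SF.VW.Q" and x: "x |: FF X"
  note lp = bil_l[OF SF.L.p_bil x]
  show "?a (L.\<tau> (?mL (SF.L.p D x))) = R.\<tau> (?mR (?aF (SF.L.p D x)))"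
   by (rule SF.VW.over_eq[OF lin_comp[OF left lp] lin_comp[OF right lp] S.R.Q_mod _ D]) (use main x in simp)
 qed
qed

lemma twist_unit:
 shows "bimodule_hom k HF AF (regular AF) (FF (regular A)) (twist_unit_map A)"
  "bij_betw (twist_unit_map A) (carrier (regular AF)) (carrier (FF (regular A)))"
proof -
 interpret G: h_alg k HF AF by (rule HF_alg')
 note s = twist_same(1)[of k H F A] regular_same
 have c: "carrier (regular AF) = carrier A" by simp
 have m: "tw A A A (mult A) a b |: A" if "a |: A" "b |: A" for a b
  by (rule bil_cl[OF twprod_bilinear[OF eqvD(1)[OF A_eq] A_hm A_hm hm_mod[OF A_hm] F_closed(2)] that])
 have "lmap k (regular AF) (FF (regular A)) (twist_unit_map A)"
  by (rule linear_mapI) (simp_all add: twist_unit_map_def module_add_closed[OF hm_mod[OF A_hm]] module.smult_closed[OF hm_mod[OF A_hm]])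
 then show "bimodule_hom k HF AF (regular AF) (FF (regular A)) (twist_unit_map A)" unfolding bimodule_hom_def h_linear_def
  by (simp add: twist_unit_map_def m twprod_same[OF same_refl regular_same regular_same] twprod_same[OF regular_same same_refl regular_same] hm_closed[OF A_hm])
 show "bij_betw (twist_unit_map A) (carrier (regular AF)) (carrier (FF (regular A)))"
  by (simp add: bij_betw_def inj_on_def twist_unit_map_def)
qed

lemma \<tau>_unit:
 assumes V: "a_bimodule k H A V"
 shows "t |: (tensor_over k HF AF (regular AF) (FF V)) ==>
   lunit_over V (twist_tensor_map k H F A (regular A) V
    (map_over k HF AF (regular AF) (FF V) (FF (regular A)) (FF V) (twist_unit_map A) (%v. v) t)) = lunit_over (FF V) t"
  "s |: (tensor_over k HF AF (FF V) (regular AF)) ==>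
   runit_over V (twist_tensor_map k H F A V (regular A)
    (map_over k HF AF (FF V) (regular AF) (FF V) (FF (regular A)) (%v. v) (twist_unit_map A) s)) = runit_over (FF V) s"
proof -
 interpret G: h_alg k HF AF by (rule HF_alg')
 note U = unit_over[OF V] and UF = G.unit_over[OF twist_is_bimodule[OF V]]
 interpret L: twist_two k H F A "regular A" V by unfold_locales (rule regular_bimodule, rule V)
 interpret R: twist_two k H F A V "regular A" by unfold_locales (rule V, rule regular_bimodule)
 interpret LF: two_bimodules k HF AF "regular AF" "FF V" by (rule UF)
 interpret RF: two_bimodules k HF AF "FF V" "regular AF" by (rule UF)
 note mL = LF.map_over[OF L.PF.two_bimodules_axioms twist_unit(1) bimodule_hom_id]
  and mR = RF.map_over[OF R.PF.two_bimodules_axioms bimodule_hom_id twist_unit(1)]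
 note lL = bim_homD(1)[OF mL(1)] and lR = bim_homD(1)[OF mR(1)]
 have tl: "lmap k L.PF.Q L.P.Q L.\<tau>" "lmap k R.PF.Q R.P.Q R.\<tau>"
  using L.\<tau>_linear R.\<tau>_linear by (simp_all add: linear_same[OF same_refl twist_same(2)])
 have uF: "lmap k LF.Q V (lunit_over (FF V))" "lmap k RF.Q V (runit_over (FF V))"
  using UF(3,4) by (simp_all add: linear_same[OF same_refl twist_same(2)])
 have hmV: "hmod k H V" "module k V" by simp_all
 show "lunit_over V (L.\<tau> (map_over k HF AF (regular AF) (FF V) (FF (regular A)) (FF V) (twist_unit_map A) (%v. v) t)) = lunit_over (FF V) t"
  if t: "t |: LF.Q"
 proof (rule LF.over_eq[OF lin_comp[OF U(3) lin_comp[OF tl(1) lL]] uF(1) hmV(2) _ t])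
  fix a v assume av': "a |: regular AF" "v |: FF V"
  then have av: "a |: A" "v |: V" "a |: regular A" "a |: AF" by simp_all
  have "lunit_over V (tw (regular A) V L.P.Q L.P.p a v) = tw (regular A) V V (%a v. lunit_over V (L.P.p a v)) a v"
   unfolding twprod_def by (rule tlift_linear_comp[OF twprod_bil[OF L.P.p_bil L.P.hmV L.P.hmW av(3,2)] U(3)]) simp_all
  also have "... = tw A V V (lact V) a v"
   unfolding twprod_def regular_simps by (rule tlift_cong[OF H_mod H_mod]) (simp_all add: av U(5))
  finally show "lunit_over V (L.\<tau> (map_over k HF AF (regular AF) (FF V) (FF (regular A)) (FF V) (twist_unit_map A) (%v. v) (LF.p a v))) = lunit_over (FF V) (LF.p a v)"
   unfolding mL(2)[OF av'] UF(5)[OF av(4) av'(2)] using L.\<tau>_pure[OF av(3,2)] av by (simp add: twist_unit_map_def)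
 qed
 show "runit_over V (R.\<tau> (map_over k HF AF (FF V) (regular AF) (FF V) (FF (regular A)) (%v. v) (twist_unit_map A) s)) = runit_over (FF V) s"
  if s: "s |: RF.Q"
 proof (rule RF.over_eq[OF lin_comp[OF U(4) lin_comp[OF tl(2) lR]] uF(2) hmV(2) _ s])
  fix v a assume av': "v |: FF V" "a |: regular AF"
  then have av: "a |: A" "v |: V" "a |: regular A" "a |: AF" by simp_all
  have "runit_over V (tw V (regular A) R.P.Q R.P.p v a) = tw V (regular A) V (%v a. runit_over V (R.P.p v a)) v a"
   unfolding twprod_def by (rule tlift_linear_comp[OF twprod_bil[OF R.P.p_bil R.P.hmV R.P.hmW av(2,3)] U(4)]) simp_all
  also have "... = tw V A V (ract V) v a"
   unfolding twprod_def regular_simps by (rule tlift_cong[OF H_mod H_mod]) (simp_all add: av U(6))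
  finally show "runit_over V (R.\<tau> (map_over k HF AF (FF V) (regular AF) (FF V) (FF (regular A)) (%v. v) (twist_unit_map A) (RF.p v a))) = runit_over (FF V) (RF.p v a)"
   unfolding mR(2)[OF av'] UF(6)[OF av(4) av'(1)] using R.\<tau>_pure[OF av(2,3)] av by (simp add: twist_unit_map_def)
 qed
qed

end

section \<open>The twist and the internal hom\<close>

lemma (in quasi_hopf_alg) products_into_B_eq:
 assumes "hmod k H V" "hmod k H W"
  and "equivar k H U X (b_hom k H A V W) m" "equivar k H U X (b_hom k H A V W) m'"
  and "hmod k H U" "hmod k H X"
  and "!!u x v. u |: U ==> x |: X ==> v |: V ==> ev V W (m u x) v = ev V W (m' u x) v"
  and "u |: U" "x |: X"
 shows "m u x = m' u x"
proof -
 have e: "equivar k H U X (h_hom k H V W) m" "equivar k H U X (h_hom k H V W) m'"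
  using assms(3,4) by (simp_all only: eqv_same[OF same_refl same_refl b_hom_same])
 show ?thesis by (rule products_into_hom_eq[OF assms(1,2) e assms(5-9)])
qed

context twist_two begin

abbreviation "gm == hom_act k H V W F'"
abbreviation "gm' == hom_act k H V W F"

lemma FF_hom: "lin_hom k (FF V) (FF W) = lin_hom k V W" "hom_act k HF (FF V) (FF W) = hom_act k H V W"
proof -
 show "lin_hom k (FF V) (FF W) = lin_hom k V W" by (simp add: lin_hom_def linear_map_def)
 then show "hom_act k HF (FF V) (FF W) = hom_act k H V W" by (intro ext) (simp add: hom_act_def)
qed

lemma B_carriers: "carrier PF.B = carrier (lin_hom k V W)" "carrier P.B = carrier (lin_hom k V W)"
 "lmap k PF.B = lmap k P.B" "lmap k Z PF.B = lmap k Z P.B"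
 unfolding linear_map_def[abs_def] by (simp_all add: FF_hom del: lin_hom_simps)

lemma hmB: "hmod k H PF.B" "hmod k HF P.B" using PF.B_hm P.B_hm unfolding h_module_HF .

lemma gm_facts:
 "L |: PF.B ==> gm L |: P.B" "L |: P.B ==> gm' L |: PF.B"
 "lmap k PF.B P.B gm" "lmap k P.B PF.B gm'"
 "L |: PF.B ==> gm' (gm L) = L" "L |: P.B ==> gm (gm' L) = L"
proof -
 note f = ha_facts[OF P.hmV P.hmW]
 have l: "lmap k P.B P.B (hom_act k H V W t)" if "t |: H2" for t using f(3)[OF that] by (simp add: linear_map_def)
 show "lmap k PF.B P.B gm" "lmap k P.B PF.B gm'" unfolding B_carriers by (rule l; simp)+
 then show "L |: PF.B ==> gm L |: P.B" "L |: P.B ==> gm' L |: PF.B"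
  using lin_cl[of k PF.B P.B gm L] lin_cl[of k P.B PF.B gm' L] by blast+
 show "L |: PF.B ==> gm' (gm L) = L" "L |: P.B ==> gm (gm' L) = L"
  using f(5)[OF F_closed, of L, symmetric] f(5)[OF F_closed(2,1), of L, symmetric] f(6)[of L] unfolding B_carriers F_inv by argo+
qed

lemma gm_act:
 assumes h: "h |: H" and L: "L |: PF.B"
 shows "gm (act PF.B h L) = act P.B h (gm L)"
proof -
 note f = ha_facts[OF P.hmV P.hmW]
 have L': "L |: lin_hom k V W" using L unfolding B_carriers .
 have "gm (act PF.B h L) = hom_act k H V W (F' *2 (F *2 \<Delta> h *2 F')) L"
  using h by (simp add: FF_hom f(5)[OF _ _ L'] del: lin_hom_simps)
 also have "F' *2 (F *2 \<Delta> h *2 F') = \<Delta> h *2 F'" using h by (simp add: H2.m_assoc) (simp add: H2.m_assoc[symmetric])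
 finally show ?thesis using h by (simp add: f(5)[OF _ _ L'] del: lin_hom_simps)
qed

lemma gm'_act:
 assumes h: "h |: H" and L: "L |: P.B"
 shows "gm' (act P.B h L) = act PF.B h (gm' L)"
 using gm_act[OF h gm_facts(2)[OF L]] gm_facts(5)[OF hm_closed[OF hmB(1) h gm_facts(2)[OF L]]] gm_facts(6)[OF L] by simp

text \<open>
 The factors in \<open>\<phi>\<^sub>F\<close> and \<open>\<alpha>\<^sub>F\<close> cancel or are absorbed by the antipode, up to two copies of \<open>F\<inverse>\<close>: one twists
 the product \<open>ev\<close>, the other acts on \<open>L\<close>.
\<close>

lemma ev_twist:
 assumes L: "L |: PF.B" and v: "v |: V"
 shows "PF.e L v = tw P.B V W P.e (gm L) v"
proof -
 have L': "L |: lin_hom k V W" and gL: "gm L |: lin_hom k V W" using L gm_facts(1)[OF L] unfolding B_carriers by simp_all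
 let ?g = "%x y. act W x (L (act V y v))"
 let ?al = "qalpha H"
 note g = hom_pairing_bil[OF P.hmV P.hmW L' v] and Wm = hm_mod[OF P.hmW]
 have al: "?al |: H" by simp
 have q: "qalpha HF = \<A> ?al F'" by (simp add: twist_hopf_def)
 have evE: "tlift3 W (%a b c. act W a (L (act V (S b *1 x *1 c) v))) t = \<E> W ?g x t" for x t ..
 have "PF.e L v = \<E> W ?g (\<A> ?al F') phi_F"
  by (simp add: PF.ev_def q phi_HF tlift3_target_cong[of "FF W" W] del: HF_simps(10))
 also have "... = \<E> W ?g ?al (j0 F' *3 phi_F)" by (rule E_j0[OF Wm g al F_closed(2) phi_psi_F(1), symmetric])
 also have "j0 F' *3 phi_F = e2 F *3 (\<phi> *3 (e1 F' *3 j3 F'))" by (simp add: phi_F_def H3.m_assoc homs_cancel homs_inv)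
 also have "\<E> W ?g ?al ... = \<E> W (%x. ?g (counit_r F *1 x)) ?al (\<phi> *3 (e1 F' *3 j3 F'))"
  by (rule EZ_e2(1)[OF Wm g]) simp_all
 also have "... = \<E> W ?g ?al (\<phi> *3 (e1 F' *3 j3 F'))" unfolding F_counit by (rule tlift3_cong) simp_all
 also have "... = tw P.B V W P.e (gm L) v"
 proof -
  have ge: "P.e (hom_act k H V W (\<Delta> a) (gm L)) (act V b v) = \<E> W ?g ?al (\<phi> *3 tassoc k H H H (pure k H2 H (\<Delta> a *2 F') b))"
   if ab: "a |: H" "b |: H" for a b
  proof -
   have "hom_act k H V W (\<Delta> a) (gm L) = hom_act k H V W (\<Delta> a *2 F') L"
    using ab ha_facts(5)[OF P.hmV P.hmW _ _ L'] by simp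
   then show ?thesis unfolding ev_def using evt_ha[OF P.hmV P.hmW L' v _ ab(2) phi_closed(1), of "\<Delta> a *2 F'"] ab by simp
  qed
  have lE: "lmap k Z H3 f ==> lmap k Z W (%z. \<E> W ?g ?al (f z))" for f and Z :: "('k, 'z, 'zz) module_scheme"
   by (rule EZ_lin(1)[OF Wm g al])
  have "\<E> W ?g ?al (\<phi> *3 (e1 t *3 j3 F')) = twprod P.B V W t P.e (gm L) v" if t: "t |: H2" for t
  proof (rule H2_eq[OF _ _ _ _ t, of W])
   show "lmap k H2 W (%t. twprod P.B V W t P.e (gm L) v)"
    by (rule twprod_lin[OF P.e_bil P.B_hm P.hmV Wm gm_facts(1)[OF L] v linear_id])
   show "lmap k H2 W (%t. \<E> W ?g ?al (\<phi> *3 (e1 t *3 j3 F')))" by (rule lE) (simp add: lin)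
   fix a b assume ab: "a |: H" "b |: H"
   have "e1 (pH a b) *3 j3 F' = tassoc k H H H (pure k H2 H (\<Delta> a *2 F') b)"
    using ab by (simp add: alg_homD(3)[OF tassoc_algebra_hom, symmetric] tmult_pure lin)
   then show "\<E> W ?g ?al (\<phi> *3 (e1 (pH a b) *3 j3 F')) = twprod P.B V W (pH a b) P.e (gm L) v"
    unfolding twprod_pure[OF P.e_bil P.B_hm P.hmV Wm gm_facts(1)[OF L] v ab] b_hom_simps(5) ge[OF ab] by simp
  qed simp
  then show ?thesis by simp
 qed
 finally show ?thesis .
qed

lemma twist_sub:
 "tlift (FF W) = tlift W" "tlift3 (FF W) = tlift3 W" "tlift3 (FF V) = tlift3 V"
 by (rule tlift_target_cong tlift3_target_cong; simp)+

lemma right_lin_twist: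
 assumes L: "L |: PF.B"
 shows "PF.right_lin L \<longleftrightarrow> (\<forall>v\<in>carrier V. \<forall>a\<in>carrier A. tw W A W (ract W) (tw P.B V W P.e (gm L) v) a =
  nested_r P.B V A W (tw V A V (ract V)) (tw P.B V W P.e) phi_F (gm L) v a)"
proof -
 note cl = bil_cl[OF twprod_bilinear[OF P.actVb(2) P.hmV A_hm hm_mod[OF P.hmV] F_closed(2)]]
 have "nested_r PF.B V A W (tw V A V (ract V)) PF.e phi_F L v a =
   nested_r P.B V A W (tw V A V (ract V)) (tw P.B V W P.e) phi_F (gm L) v a"
  if va: "v |: V" "a |: A" for v a
 proof (rule tlift3_cong)
  fix x y z assume xyz: "x |: H" "y |: H" "z |: H"
  have "tw V A V (ract V) (act V y v) (act A z a) |: V" by (rule cl) (use xyz va in simp_all)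
  then show "PF.e (act PF.B x L) (tw V A V (ract V) (act V y v) (act A z a)) =
   tw P.B V W P.e (act P.B x (gm L)) (tw V A V (ract V) (act V y v) (act A z a))"
   unfolding gm_act[OF xyz(1) L, symmetric] by (rule ev_twist[OF hm_closed[OF hmB(1) xyz(1) L]])
 qed simp
 then show ?thesis unfolding PF.right_lin_def phi_HF twist_sub by (simp add: ev_twist[OF L] del: b_hom_simps)
qed

lemma gm_homA: "L |: PF.B ==> L \<in> PF.homA \<longleftrightarrow> gm L \<in> P.homA"
proof
 note s = twprod_sub[of W W, OF HOL.refl HOL.refl, where V = V and V' = V]
 have tws: "tw (P.B\<lparr>carrier := C\<rparr>) V W P.e = tw P.B V W P.e" for C by (rule twprod_sub) simp_all
 {
  fix L assume L: "L |: PF.B" "gm L \<in> P.homA"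
  have law: "alaw HF P.\<O> V A W (tw P.B V W P.e) (tw W A W (ract W)) (tw V A V (ract V)) (tw P.B V W P.e)"
   using assoc_twist[OF P.e_O P.actW(2) P.actV(2) P.e_O P.O_hm P.hmV A_hm P.hmW P.hmV P.hmW P.law_O] unfolding tws .
  have "PF.right_lin (act PF.B h L)" if h: "h |: H" for h
  proof -
   have "act P.B h (gm L) \<in> P.homA" using P.homA_stable h L(2) by (simp add: h_stable_def)
   then show ?thesis using law unfolding right_lin_twist[OF hm_closed[OF hmB(1) h L(1)]] gm_act[OF h L(1)] alaw_def phi_HF by simp
  qed
  then show "L \<in> PF.homA" using L(1) unfolding PF.homA_def by simp
 }
 fix L assume L: "L \<in> PF.homA"
 let ?N = "gm ` PF.homA" let ?O = "P.B\<lparr>carrier := ?N\<rparr>"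
 note st = PF.homA_stable[unfolded h_stable_def] and lg = gm_facts(3)
 have sub: "L |: PF.B" if "L \<in> PF.homA" for L using that PF.homA_sub by blast
 note mB = hm_mod[OF hmB(1)] hm_mod[OF P.B_hm]
 have stN: "h_stable k H P.B ?N" unfolding h_stable_def
 proof (intro conjI ballI)
  show "?N \<subseteq> carrier P.B" using gm_facts(1)[OF sub] by blast
  show "\<zero>[P.B] \<in> ?N" using linear_zero[OF lg mB] st by (metis imageI)
  fix x y assume "x \<in> ?N" "y \<in> ?N"
  then obtain x' y' where xy: "x' \<in> PF.homA" "x = gm x'" "y' \<in> PF.homA" "y = gm y'" by blast
  then have "x \<oplus>[P.B] y = gm (x' \<oplus>[PF.B] y')" using linear_add[OF lg sub sub] by simp
  moreover have "x' \<oplus>[PF.B] y' \<in> PF.homA" using st xy by blast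
  ultimately show "x \<oplus>[P.B] y \<in> ?N" by blast
 next
  fix r x assume r: "r |: k" and "x \<in> ?N"
  then obtain x' where x: "x' \<in> PF.homA" "x = gm x'" by blast
  then have "r \<odot>[P.B] x = gm (r \<odot>[PF.B] x')" using linear_smult[OF lg r sub] by simp
  moreover have "r \<odot>[PF.B] x' \<in> PF.homA" using st x r by blast
  ultimately show "r \<odot>[P.B] x \<in> ?N" by blast
 next
  fix h x assume h: "h |: H" and "x \<in> ?N"
  then obtain x' where x: "x' \<in> PF.homA" "x = gm x'" by blast
  then have "act P.B h x = gm (act PF.B h x')" using gm_act[OF h sub] by simp
  moreover have "act PF.B h x' \<in> PF.homA" using st x h by (simp del: b_hom_simps)
  ultimately show "act P.B h x \<in> ?N" by blast
 qed
 have sN: "?N \<subseteq> carrier P.B" using stN by (simp add: h_stable_def)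
 have O: "hmod k H ?O" by (rule sub_h_module[OF P.B_hm stN])
 have eO: "equivar k H ?O V W P.e" using equivar_sub[OF P.e_eq sN order.refl, of "carrier W"] bil_cl[OF P.e_bil] sN by auto
 have "alaw HF ?O V A W (tw P.B V W P.e) (tw W A W (ract W)) (tw V A V (ract V)) (tw P.B V W P.e)" unfolding alaw_def
 proof (intro ballI)
  fix M v a assume "M |: ?O" and va: "v |: V" "a |: A"
  then obtain L where L: "L \<in> PF.homA" "M = gm L" by auto
  show "tw W A W (ract W) (tw P.B V W P.e M v) a =
   nested_r ?O V A W (tw V A V (ract V)) (tw P.B V W P.e) (phi HF) M v a"
   using PF.homA_right_lin[OF L(1)] right_lin_twist[OF sub[OF L(1)]] va unfolding L(2) phi_HF by simp
 qed
 then have "alaw HF ?O V A W (tw ?O V W P.e) (tw W A W (ract W)) (tw V A V (ract V)) (tw ?O V W P.e)" unfolding tws .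
 then have law: "alaw H ?O V A W P.e (ract W) (ract V) P.e"
  unfolding alaw_twist_iff[OF eO P.actW(2) P.actV(2) eO O P.hmV A_hm P.hmW P.hmV P.hmW] .
 have "P.right_lin (act P.B h (gm L))" if h: "h |: H" for h
 proof -
  have "act P.B h (gm L) \<in> ?N" using stN h L unfolding h_stable_def by blast
  then show ?thesis
   unfolding P.right_lin_def using bspec[OF law[unfolded alaw_def], of "act P.B h (gm L)"] by (simp del: b_hom_simps)
 qed
 then show "gm L \<in> P.homA" unfolding P.homA_def using gm_facts(1)[OF sub[OF L]] by blast
qed

lemma gm_actions:
 assumes a: "a |: A" and L: "L |: PF.B"
 shows "gm (lact PF.B a L) = tw A P.B P.B (lact P.B) a (gm L)" "gm (ract PF.B L a) = tw P.B A P.B (ract P.B) (gm L) a"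
proof -
 have hm: "hmod k HF A" "hmod k HF P.B" using A_hm P.B_hm unfolding h_module_HF .
 note mB = hm_mod[OF P.B_hm]
 note bl = twprod_bilinear[OF P.actBb(1) A_hm P.B_hm mB F_closed(2)] and br = twprod_bilinear[OF P.actBb(2) P.B_hm A_hm mB F_closed(2)]
 have act1: "gm (act PF.B h L) = act P.B h (gm L)" if "h |: HF" "L |: PF.B" for h L using gm_act that by simp
 have act2: "gm' (act P.B h L) = act PF.B h (gm' L)" if "h |: HF" "L |: P.B" for h L using gm'_act that by simp
 let ?l = "%a L. gm' (tw A P.B P.B (lact P.B) a (gm L))" and ?r = "%L a. gm' (tw P.B A P.B (ract P.B) (gm L) a)"
 note e0 = equivar_twist[OF P.actB(1) A_hm P.B_hm P.B_hm] equivar_twist[OF P.actB(2) P.B_hm A_hm P.B_hm]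
 note e1 = PF.equivar_pre[OF e0(1) linear_id gm_facts(3) HOL.refl act1 hm hm(1) PF.B_hm]
  PF.equivar_pre[OF e0(2) gm_facts(3) linear_id act1 HOL.refl hm(2,1) PF.B_hm hm(1)]
 have el: "equivar k HF A PF.B PF.B ?l"
  by (rule PF.equivar_post[OF e1(1) gm_facts(4) act2 hm(1) PF.B_hm hm(2) PF.B_hm]; assumption)
 have er: "equivar k HF PF.B A PF.B ?r" by (rule PF.equivar_post[OF e1(2) gm_facts(4) act2 PF.B_hm hm PF.B_hm]; assumption)
 have eF: "equivar k HF A PF.B PF.B (lact PF.B)" "equivar k HF PF.B A PF.B (ract PF.B)"
  using PF.actB by (simp_all only: eqv_same[OF twist_same(1) same_refl same_refl] eqv_same[OF same_refl twist_same(1) same_refl])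
 have evF: "PF.e (gm' M) v = tw P.B V W P.e M v" if "M |: P.B" "v |: V" for M v
  using ev_twist[OF gm_facts(2)[OF that(1)] that(2)] gm_facts(6)[OF that(1)] by simp
 have evg: "PF.e (act PF.B y L) v = tw P.B V W P.e (act P.B y (gm L)) v" if "y |: H" "L |: PF.B" "v |: V" for y L v
  using ev_twist[OF hm_closed[OF hmB(1) that(1,2)] that(3)] gm_act[OF that(1,2)] by simp
 have "lact PF.B a L = ?l a L"
 proof (rule PF.products_into_B_eq[OF PF.hmV PF.hmW eF(1) el hm(1) PF.B_hm _ a L])
  fix a L v assume a: "a |: A" and L: "L |: PF.B" and "v |: FF V"
  then have v: "v |: V" and aF: "a |: AF" "v |: FF V" by simp_all
  note gL = gm_facts(1)[OF L]
  have "PF.e (lact PF.B a L) v = nested_r A PF.B V W PF.e (tw A W W (lact W)) phi_F a L v"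
   using PF.law_lactB aF L unfolding alaw_def phi_HF twist_sub by (simp add: twprod_same[OF same_refl twist_same(2) twist_same(2)] del: b_hom_simps)
  also have "... = nested_r A P.B V W (tw P.B V W P.e) (tw A W W (lact W)) phi_F a (gm L) v"
   by (rule tlift3_cong) (use evg L v in "simp_all del: b_hom_simps")
  also have "... = tw P.B V W P.e (tw A P.B P.B (lact P.B) a (gm L)) v"
   using assoc_twist[OF P.actB(1) P.e_eq P.e_eq P.actW(1) A_hm P.B_hm P.hmV P.B_hm P.hmW P.hmW P.law_lactB] a gL v
   unfolding alaw_def phi_HF by (simp del: b_hom_simps)
  finally show "PF.e (lact PF.B a L) v = PF.e (?l a L) v" using evF[OF bil_cl[OF bl a gL] v] by simp
 qed
 then show "gm (lact PF.B a L) = tw A P.B P.B (lact P.B) a (gm L)" using gm_facts(6)[OF bil_cl[OF bl a gm_facts(1)[OF L]]] by simp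
 have "ract PF.B L a = ?r L a"
 proof (rule PF.products_into_B_eq[OF PF.hmV PF.hmW eF(2) er PF.B_hm hm(1) _ L a])
  fix L a v assume L: "L |: PF.B" and a: "a |: A" and "v |: FF V"
  then have v: "v |: V" and aF: "a |: AF" "v |: FF V" by simp_all
  note gL = gm_facts(1)[OF L]
  note cl = bil_cl[OF twprod_bilinear[OF P.actVb(1) A_hm P.hmV hm_mod[OF P.hmV] F_closed(2)]]
  have "PF.e (ract PF.B L a) v = nested_r PF.B A V W (tw A V V (lact V)) PF.e phi_F L a v"
   using PF.law_ractB aF L unfolding alaw_def phi_HF twist_sub by (simp add: twprod_same[OF same_refl twist_same(2) twist_same(2)] del: b_hom_simps)
  also have "... = nested_r P.B A V W (tw A V V (lact V)) (tw P.B V W P.e) phi_F (gm L) a v"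
   by (rule tlift3_cong) (use evg L v a cl in "simp_all del: b_hom_simps")
  also have "... = tw P.B V W P.e (tw P.B A P.B (ract P.B) (gm L) a) v"
   using assoc_twist[OF P.actB(2) P.e_eq P.actV(1) P.e_eq P.B_hm A_hm P.hmV P.B_hm P.hmV P.hmW P.law_ractB] a gL v
   unfolding alaw_def phi_HF by (simp del: b_hom_simps)
  finally show "PF.e (ract PF.B L a) v = PF.e (?r L a) v" using evF[OF bil_cl[OF br gL a] v] by simp
 qed
 then show "gm (ract PF.B L a) = tw P.B A P.B (ract P.B) (gm L) a" using gm_facts(6)[OF bil_cl[OF br gm_facts(1)[OF L] a]] by simp
qed

abbreviation "\<theta> == twist_hom_map k H F A V W"

lemma \<theta>_eq: "\<theta> = (\<lambda>L\<in>PF.homA. gm L)" unfolding twist_hom_map_def PF.hom_over_eq by simp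

theorem \<theta>_hom: "bimodule_hom k HF AF (hom_over k HF AF (FF V) (FF W)) (FF (hom_over k H A V W)) \<theta>"
proof -
 have sub: "L |: PF.B" if "L \<in> PF.homA" for L using that PF.homA_sub by blast
 have homA: "gm L \<in> P.homA" if "L \<in> PF.homA" for L using gm_homA[OF sub[OF that]] that by blast
 note st = PF.homA_stable[unfolded h_stable_def] and ac = PF.homA_actions
 have tws: "tw A P.\<O> P.\<O> m = tw A P.B P.B m" "tw P.\<O> A P.\<O> m' = tw P.B A P.B m'" for m m' by (rule twprod_sub; simp)+
 have "lmap k PF.\<O> P.\<O> \<theta>" by (rule linear_mapI)
   (use st homA sub linear_add[OF gm_facts(3)] linear_smult[OF gm_facts(3)] in \<open>simp_all add: \<theta>_eq del: b_hom_simps\<close>)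
 then have "lmap k PF.\<O> (FF P.\<O>) \<theta>" by (simp add: linear_same[OF same_refl twist_same(2)])
 moreover have "\<theta> (act PF.\<O> h L) = act (FF P.\<O>) h (\<theta> L)" if "h |: HF" "L |: PF.\<O>" for h L
  using that st sub gm_act by (simp add: \<theta>_eq del: b_hom_simps)
 moreover have "\<theta> (lact PF.\<O> a L) = lact (FF P.\<O>) a (\<theta> L) \<and> \<theta> (ract PF.\<O> L a) = ract (FF P.\<O>) (\<theta> L) a"
  if "a |: AF" "L |: PF.\<O>" for a L using that ac[of a L] sub gm_actions[of a L] by (simp add: \<theta>_eq tws del: b_hom_simps)
 ultimately show ?thesis unfolding PF.hom_over_eq P.hom_over_eq bimodule_hom_def h_linear_def by blast
qed

lemma \<theta>_bij: "bij_betw \<theta> (carrier (hom_over k HF AF (FF V) (FF W))) (carrier (hom_over k H A V W))"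
proof -
 have sub: "L |: PF.B" if "L \<in> PF.homA" for L using that PF.homA_sub by blast
 have sub': "L |: P.B" if "L \<in> P.homA" for L using that P.homA_sub by blast
 have 1: "gm L \<in> P.homA \<and> gm' (gm L) = L" if "L \<in> PF.homA" for L
  using gm_homA[OF sub[OF that]] gm_facts(5)[OF sub[OF that]] that by blast
 have 2: "gm' L \<in> PF.homA \<and> gm (gm' L) = L" if "L \<in> P.homA" for L
  using gm_homA[OF gm_facts(2)[OF sub'[OF that]]] gm_facts(6)[OF sub'[OF that]] that by simp
 have "bij_betw gm PF.homA P.homA" by (rule bij_betwI[where g = gm']) (use 1 2 in blast)+
 then show ?thesis unfolding PF.hom_over_eq P.hom_over_eq \<theta>_eq
  by (simp add: bij_betw_cong[of PF.homA "\<lambda>L\<in>PF.homA. gm L" gm] del: b_hom_simps)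
qed

end

lemma \<theta>_natural:
 assumes VW: "twist_two k H F A V W" and VW': "twist_two k H F A V' W'"
  and f: "bimodule_hom k H A V' V f" and g: "bimodule_hom k H A W W' g"
  and L: "L |: (hom_over k (twist_hopf k H F) (twist_algebra k H F A) (twist_bimodule k H F A V) (twist_bimodule k H F A W))"
 shows "hom_act k H V' W' (twist_inv k H F) (\<lambda>v\<in>carrier V'. g (L (f v))) = (\<lambda>v\<in>carrier V'. g (hom_act k H V W (twist_inv k H F) L (f v)))"
proof -
 interpret P: twist_two k H F A V W by fact
 interpret E: twist_two k H F A V' W' by fact
 have "L |: lin_hom k V W" using L P.PF.homA_sub unfolding P.PF.hom_over_eq P.B_carriers[symmetric] by auto
 then show ?thesis by (rule P.hom_act_natural[OF P.P.hmV P.P.hmW E.P.hmV E.P.hmW f g _ P.F_closed(2)])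
qed

section \<open>Categories and functors\<close>

lemma category_op: assumes "category C" shows "category (op_cat C)" using assms unfolding category_def op_cat_def by simp

lemma category_prod: assumes "category C" "category D" shows "category (prod_cat C D)"
 using assms unfolding category_def prod_cat_def by auto

lemma is_functor_comp: "is_functor C D F ==> is_functor D E G ==> is_functor C E (comp_fctr G F)"
 unfolding is_functor_def comp_fctr_def by auto

lemma is_functor_op: assumes "is_functor C D F" shows "is_functor (op_cat C) (op_cat D) (op_fctr F)"
proof -
 have "category (op_cat C)" "category (op_cat D)" using assms by (auto simp: is_functor_def intro!: category_op)
 then show ?thesis using assms unfolding is_functor_def by (auto simp: op_cat_def op_fctr_def)
qed

lemma is_functor_prod:
 assumes "is_functor C D F" "is_functor C' D' F'"
 shows "is_functor (prod_cat C C') (prod_cat D D') (prod_fctr F F')"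
proof -
 have "category (prod_cat C C')" "category (prod_cat D D')" using assms by (auto simp: is_functor_def intro!: category_prod)
 then show ?thesis using assms unfolding is_functor_def by (auto simp: prod_cat_def prod_fctr_def)
qed

lemma is_functor_id: "category C ==> is_functor C C id_fctr" by (simp add: is_functor_def id_fctr_def)

lemma Ob_bimod [simp]: "V \<in> Ob (bimod_cat k H A) \<longleftrightarrow> a_bimodule k H A V"
 and Hom_bimod [simp]: "f \<in> Hom (bimod_cat k H A) V W \<longleftrightarrow> f \<in> extensional (carrier V) \<and> bimodule_hom k H A V W f"
 and Id_bimod [simp]: "Id (bimod_cat k H A) V = (\<lambda>v\<in>carrier V. v)"
 and Comp_bimod [simp]: "Comp (bimod_cat k H A) U V W g f = compose (carrier U) g f" by (simp_all add: bimod_cat_def)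

lemma op_simps [simp]: "Ob (op_cat C) = Ob C" "Hom (op_cat C) X Y = Hom C Y X" "Id (op_cat C) = Id C"
 "Comp (op_cat C) X Y Z g f = Comp C Z Y X f g" by (simp_all add: op_cat_def)

lemma prod_simps [simp]: "Ob (prod_cat C D) = Ob C \<times> Ob D" "Hom (prod_cat C D) (X, X') (Y, Y') = Hom C X Y \<times> Hom D X' Y'"
 "Id (prod_cat C D) (X, X') = (Id C X, Id D X')"
 "Comp (prod_cat C D) (X, X') (Y, Y') (Z, Z') (g, g') (f, f') = (Comp C X Y Z g f, Comp D X' Y' Z' g' f')"
 by (simp_all add: prod_cat_def)

lemma restrict_natural:
 assumes "bimodule_hom k H A X Y f"
 shows "compose (carrier X) (\<lambda>v\<in>carrier Y. v) f = compose (carrier X) f (\<lambda>v\<in>carrier X. v)"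
 unfolding compose_def by (rule restrict_ext) (simp add: bim_homD(2)[OF assms])

context h_alg begin

lemma pair: "a_bimodule k H A V ==> a_bimodule k H A W ==> two_bimodules k H A V W" by unfold_locales

lemma hom_cong:
 assumes V: "a_bimodule k H A V" and eq: "!!v. v |: V ==> f v = g v"
 shows "bimodule_hom k H A V W f \<longleftrightarrow> bimodule_hom k H A V W g"
proof -
 note cl = bil_cl[OF eqvD(1)[OF bimoduleD(2)[OF V]]] bil_cl[OF eqvD(1)[OF bimoduleD(3)[OF V]]]
  hm_closed[OF bimoduleD(1)[OF V]]
 have l: "lmap k V W f = lmap k V W g" by (rule linear_map_cong) (simp_all add: eq hm_mod[OF bimoduleD(1)[OF V]])
 show ?thesis unfolding bimodule_hom_def h_linear_def l by (intro conj_cong ball_cong HOL.refl) (simp_all add: cl eq)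
qed

lemma hom_compose:
 assumes V: "a_bimodule k H A V" and f: "bimodule_hom k H A V W f" and g: "bimodule_hom k H A W X g"
 shows "bimodule_hom k H A V X (compose (carrier V) g f)"
proof -
 have "bimodule_hom k H A V X (%v. g (f v))"
  using lin_comp[OF bim_homD(1)[OF g] bim_homD(1)[OF f]] bim_homD(2-5)[OF f] bim_homD(2-5)[OF g]
  by (simp add: bimodule_hom_def h_linear_def)
 then show ?thesis by (subst hom_cong[OF V]) (simp_all add: compose_def)
qed

lemma hom_identity: "a_bimodule k H A V ==> bimodule_hom k H A V V (\<lambda>v\<in>carrier V. v)"
 by (subst hom_cong[where g = "%v. v"]) (simp_all add: bimodule_hom_id)

lemma category_bimod: "category (bimod_cat k H A)" unfolding category_def
proof (intro conjI ballI)
 fix W X Y Z f g h assume *: "W \<in> Ob (bimod_cat k H A)" "f \<in> Hom (bimod_cat k H A) W X" "g \<in> Hom (bimod_cat k H A) X Y"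
 then show "Comp (bimod_cat k H A) W Y Z h (Comp (bimod_cat k H A) W X Y g f) = Comp (bimod_cat k H A) W X Z (Comp (bimod_cat k H A) X Y Z h g) f"
  using bim_homD(2)[of k H A W X f] by (auto simp: compose_def restrict_def fun_eq_iff)
next
 fix X Y f assume *: "f \<in> Hom (bimod_cat k H A) X Y"
 then show "Comp (bimod_cat k H A) X X Y f (Id (bimod_cat k H A) X) = f" "Comp (bimod_cat k H A) X Y Y (Id (bimod_cat k H A) Y) f = f"
  using bim_homD(2)[of k H A X Y f] by (auto simp: compose_def fun_eq_iff extensional_def)
qed (auto simp: hom_identity hom_compose)

text \<open>
 Arrows are extensional functions, so the inverse has to be restricted to the carrier of its domain.
\<close>

lemma iso_inI:
 assumes V: "a_bimodule k H A V" and W: "a_bimodule k H A W" and f: "bimodule_hom k H A V W f"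
  and ext: "f \<in> extensional (carrier V)" and bij: "bij_betw f (carrier V) (carrier W)"
 shows "iso_in (bimod_cat k H A) V W f"
proof -
 note f' = bim_homD[OF f]
 define g where "g = restrict (inv_into (carrier V) f) (carrier W)"
 have g: "g (f v) = v" if "v |: V" for v using that bij f'(2) by (simp add: g_def bij_betw_def inv_into_f_f)
 have g': "g w |: V \<and> f (g w) = w" if "w |: W" for w
  using that bij by (simp add: g_def bij_betw_def f_inv_into_f inv_into_into)
 have gI: "g w = v" if "v |: V" "f v = w" for v w using g that by blast
 note hV = hm_mod[OF bimoduleD(1)[OF V]]
 note cl = bil_cl[OF eqvD(1)[OF bimoduleD(2)[OF V]]] bil_cl[OF eqvD(1)[OF bimoduleD(3)[OF V]]]
  hm_closed[OF bimoduleD(1)[OF V]] module_add_closed[OF hV] module.smult_closed[OF hV]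
 have "lmap k W V g" by (rule linear_mapI) (use g' in "auto intro!: gI simp: linear_add[OF f'(1)] linear_smult[OF f'(1)] cl")
 then have "bimodule_hom k H A W V g" unfolding bimodule_hom_def h_linear_def using g' by (auto intro!: gI simp: f' cl)
 moreover have "g \<in> extensional (carrier W)" by (simp add: g_def)
 ultimately have "g \<in> Hom (bimod_cat k H A) W V" by simp
 moreover have "compose (carrier V) g f = (\<lambda>v\<in>carrier V. v)" "compose (carrier W) f g = (\<lambda>v\<in>carrier W. v)"
  using g g' by (auto simp: compose_def restrict_def fun_eq_iff)
 ultimately show ?thesis unfolding iso_in_def using V W f ext by auto
qed

lemma tensor_is_functor:
 "is_functor (prod_cat (bimod_cat k H A) (bimod_cat k H A)) (bimod_cat k H A) (tensor_functor k H A)"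
proof -
 have map_ext: "map_over k H A V W V' W' f g \<in> extensional (carrier (tensor_over k H A V W))" for V W V' W' f g
  by (simp add: map_over_def)
 have id: "map_over k H A V W V W (\<lambda>v\<in>carrier V. v) (\<lambda>w\<in>carrier W. w) = (\<lambda>q\<in>carrier (tensor_over k H A V W). q)"
  if V: "a_bimodule k H A V" and W: "a_bimodule k H A W" for V W
 proof -
  interpret P: two_bimodules k H A V W by (rule pair[OF V W])
  note m = P.map_over[OF P.two_bimodules_axioms hom_identity[OF V] hom_identity[OF W]]
  have "map_over k H A V W V W (\<lambda>v\<in>carrier V. v) (\<lambda>w\<in>carrier W. w) q = q" if q: "q |: P.Q" for q
   by (rule P.over_eq[OF bim_homD(1)[OF m(1)] linear_id P.Q_mod _ q]) (simp add: m(2))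
  then show ?thesis by (intro extensionalityI[where A = "carrier P.Q"]) (auto simp: map_ext)
 qed
 have comp: "map_over k H A V W V'' W'' (compose (carrier V) f' f) (compose (carrier W) g' g)
   = compose (carrier (tensor_over k H A V W)) (map_over k H A V' W' V'' W'' f' g') (map_over k H A V W V' W' f g)"
  if V: "a_bimodule k H A V" "a_bimodule k H A W" "a_bimodule k H A V'" "a_bimodule k H A W'" "a_bimodule k H A V''" "a_bimodule k H A W''"
   and f: "bimodule_hom k H A V V' f" "bimodule_hom k H A W W' g" "bimodule_hom k H A V' V'' f'" "bimodule_hom k H A W' W'' g'"
  for V W V' W' V'' W'' f g f' g'
 proof -
  interpret P: two_bimodules k H A V W by (rule pair[OF V(1,2)])
  interpret P': two_bimodules k H A V' W' by (rule pair[OF V(3,4)])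
  interpret P'': two_bimodules k H A V'' W'' by (rule pair[OF V(5,6)])
  note m = P.map_over[OF P'.two_bimodules_axioms f(1,2)] and m' = P'.map_over[OF P''.two_bimodules_axioms f(3,4)]
   and m'' = P.map_over[OF P''.two_bimodules_axioms hom_compose[OF V(1) f(1,3)] hom_compose[OF V(2) f(2,4)]]
  note l = bim_homD(1)[OF m(1)] bim_homD(1)[OF m'(1)] bim_homD(1)[OF m''(1)]
  have "map_over k H A V W V'' W'' (compose (carrier V) f' f) (compose (carrier W) g' g) q
   = map_over k H A V' W' V'' W'' f' g' (map_over k H A V W V' W' f g q)" if q: "q |: P.Q" for q
   by (rule P.over_eq[OF l(3) lin_comp[OF l(2,1)] P''.Q_mod _ q])
    (simp add: m(2) m'(2) m''(2) bim_homD(2)[OF f(1)] bim_homD(2)[OF f(2)] compose_eq)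
  then show ?thesis by (intro extensionalityI[where A = "carrier P.Q"]) (auto simp: map_ext compose_def)
 qed
 have tb: "a_bimodule k H A (tensor_over k H A V W)" if "a_bimodule k H A V" "a_bimodule k H A W" for V W
  using two_bimodules.Q_bimodule[OF pair[OF that]] .
 have mh: "bimodule_hom k H A (tensor_over k H A V W) (tensor_over k H A V' W') (map_over k H A V W V' W' f g)"
  if "a_bimodule k H A V" "a_bimodule k H A W" "a_bimodule k H A V'" "a_bimodule k H A W'" "bimodule_hom k H A V V' f" "bimodule_hom k H A W W' g"
  for V W V' W' f g using two_bimodules.map_over(1)[OF pair[OF that(1,2)] pair[OF that(3,4)] that(5,6)] .
 show ?thesis unfolding is_functor_def by (auto simp: category_prod category_bimod tensor_functor_def tb mh map_ext id comp)
qed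

lemma hom_elements:
 assumes "a_bimodule k H A V" "a_bimodule k H A W" "L |: hom_over k H A V W"
 shows "L \<in> extensional (carrier V)" "v |: V ==> L v |: W"
proof -
 interpret P: two_bimodules k H A V W by (rule pair[OF assms(1,2)])
 have "L |: P.B" using assms(3) P.homA_sub unfolding P.hom_over_eq by auto
 then have L: "L |: lin_hom k V W" by simp
 show "L \<in> extensional (carrier V)" "v |: V ==> L v |: W" by (rule lin_homD(2)[OF L] lin_hom_closed[OF L]; assumption)+
qed

lemma hom_map_hom:
 assumes "a_bimodule k H A V" "a_bimodule k H A W" "a_bimodule k H A V'" "a_bimodule k H A W'" "bimodule_hom k H A V' V f" "bimodule_hom k H A W W' g"
 shows "bimodule_hom k H A (hom_over k H A V W) (hom_over k H A V' W') (\<lambda>L\<in>carrier (hom_over k H A V W). \<lambda>v\<in>carrier V'. g (L (f v)))"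
proof -
 interpret M: hom_map k H A V W V' W' f g
  by (rule hom_map.intro[OF pair[OF assms(1,2)] pair[OF assms(3,4)]]) (unfold_locales, fact+)
 have "a_bimodule k H A (hom_over k H A V W)" unfolding M.hom_over_eq by (rule M.O_bimodule)
 then show ?thesis by (subst hom_cong[where g = M.gm]) (simp_all add: M.gm_bimodule_hom, simp add: M.gm_def)
qed

lemma hom_is_functor:
 "is_functor (prod_cat (op_cat (bimod_cat k H A)) (bimod_cat k H A)) (bimod_cat k H A) (hom_functor k H A)"
proof -
 have hb: "a_bimodule k H A (hom_over k H A V W)" if "a_bimodule k H A V" "a_bimodule k H A W" for V W
  using two_bimodules.O_bimodule[OF pair[OF that]] two_bimodules.hom_over_eq[OF pair[OF that]] by simp
 have id: "(\<lambda>L\<in>carrier (hom_over k H A V W). \<lambda>v\<in>carrier V. (\<lambda>w\<in>carrier W. w) (L ((\<lambda>v\<in>carrier V. v) v)))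
   = (\<lambda>L\<in>carrier (hom_over k H A V W). L)" if "a_bimodule k H A V" "a_bimodule k H A W" for V W
  by (rule restrict_ext, rule extensionalityI[where A = "carrier V"]) (use hom_elements[OF that] in auto)
 have comp: "(\<lambda>L\<in>carrier (hom_over k H A V W). \<lambda>v\<in>carrier V''. compose (carrier W) g' g (L (compose (carrier V'') f f' v)))
   = compose (carrier (hom_over k H A V W)) (\<lambda>L\<in>carrier (hom_over k H A V' W'). \<lambda>v\<in>carrier V''. g' (L (f' v)))
    (\<lambda>L\<in>carrier (hom_over k H A V W). \<lambda>v\<in>carrier V'. g (L (f v)))"
  if V: "a_bimodule k H A V" "a_bimodule k H A W" "a_bimodule k H A V'" "a_bimodule k H A W'"
   and f: "bimodule_hom k H A V' V f" "bimodule_hom k H A W W' g" "bimodule_hom k H A V'' V' f'"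
  for V W V' W' V'' f g f' g' unfolding compose_def
 proof (rule restrict_ext)
  fix L assume L: "L |: hom_over k H A V W"
  have c: "(\<lambda>v\<in>carrier V'. g (L (f v))) |: hom_over k H A V' W'"
   using bim_homD(2)[OF hom_map_hom[OF V f(1,2)] L] L by simp
  show "(\<lambda>v\<in>carrier V''. (\<lambda>x\<in>carrier W. g' (g x)) (L ((\<lambda>x\<in>carrier V''. f (f' x)) v)))
   = (\<lambda>L\<in>carrier (hom_over k H A V' W'). \<lambda>v\<in>carrier V''. g' (L (f' v))) ((\<lambda>L\<in>carrier (hom_over k H A V W). \<lambda>v\<in>carrier V'. g (L (f v))) L)"
   using c L hom_elements(2)[OF V(1,2) L] bim_homD(2)[OF f(1)] bim_homD(2)[OF f(3)] by (auto simp: restrict_def fun_eq_iff)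
 qed
 show ?thesis unfolding is_functor_def
  by (auto simp: category_prod category_op category_bimod hom_functor_def hb hom_map_hom id comp simp del: restrict_apply restrict_apply')
qed

end

section \<open>The equivalence\<close>

context twist_data begin

lemma category_twist: "category (bimod_cat k HF AF)" by (rule h_alg.category_bimod[OF HF_alg'])

lemma twist_two: "a_bimodule k H A V ==> a_bimodule k H A W ==> twist_two k H F A V W" by unfold_locales

lemma twist_is_functor: "is_functor (bimod_cat k H A) (bimod_cat k HF AF) (twist_functor k H F A)" unfolding is_functor_def
 by (auto simp: category_bimod category_twist twist_functor_def twist_is_bimodule twist_hom)

lemma untwist_is_functor: "is_functor (bimod_cat k HF AF) (bimod_cat k H A) (twist_functor k HF F' AF)"
proof -
 interpret T': twist_data k HF F' AF by (rule inverse_data)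
 have "bimodule_hom k H A (GG V) (GG W) f" if "a_bimodule k HF AF V" "a_bimodule k HF AF W" "bimodule_hom k HF AF V W f" for V W f
  using T'.twist_hom[OF that] by (simp add: bimodule_hom_def h_linear_def)
 then show ?thesis unfolding is_functor_def by (auto simp: category_bimod category_twist twist_functor_def GG_bimodule)
qed

lemma id_hom:
 assumes "carrier V = carrier V'" "add V = add V'" "smult V = smult V'" "act V = act V'"
  and "!!a v. a |: A ==> v |: V ==> lact V a v = lact V' a v \<and> ract V v a = ract V' v a"
 shows "bimodule_hom k H0 A V V' (%v. v)" using assms by (simp add: bimodule_hom_def h_linear_def linear_map_def)

text \<open>
 Untwisting restores the actions on the carriers, so the identity maps are natural isomorphisms.
\<close>

theorem twist_equivalence: "equivalence (bimod_cat k H A) (bimod_cat k HF AF) (twist_functor k H F A)"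
proof -
 interpret G: h_alg k HF AF by (rule HF_alg')
 let ?C = "bimod_cat k H A" and ?D = "bimod_cat k HF AF" and ?F = "twist_functor k H F A" and ?G = "twist_functor k HF F' AF"
 let ?i = "%V. \<lambda>v\<in>carrier V. v"
 have i: "iso_in ?C V (GG (FF V)) (?i V)" if V: "a_bimodule k H A V" for V
 proof (rule iso_inI[OF V GG_bimodule[OF twist_is_bimodule[OF V]]])
  show "bimodule_hom k H A V (GG (FF V)) (?i V)"
   by (subst hom_cong[OF V, where g = "%v. v"]) (simp, rule id_hom, simp_all add: twist_cancel[OF V] del: twist_bimodule_simps(8,9))
 qed (simp_all add: bij_betw_def inj_on_def)
 have e: "iso_in ?D (FF (GG V)) V (?i V)" if V: "a_bimodule k HF AF V" for V
 proof (rule G.iso_inI[OF twist_is_bimodule[OF GG_bimodule[OF V]] V])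
  show "bimodule_hom k HF AF (FF (GG V)) V (?i V)"
  proof (subst G.hom_cong[OF twist_is_bimodule[OF GG_bimodule[OF V]], where g = "%v. v"])
   show "bimodule_hom k HF AF (FF (GG V)) V (%v. v)"
    using id_hom[of "FF (GG V)" V HF] twist_cancel'[OF V] by (simp add: bimodule_hom_def del: twist_bimodule_simps(8,9))
  qed simp
 qed (simp_all add: bij_betw_def inj_on_def)
 have "natural_iso ?C ?C id_fctr (comp_fctr ?G ?F) ?i" unfolding natural_iso_def
  using is_functor_id[OF category_bimod] is_functor_comp[OF twist_is_functor untwist_is_functor] i
  by (auto simp: id_fctr_def comp_fctr_def twist_functor_def restrict_natural simp del: restrict_apply restrict_apply')
 moreover have "natural_iso ?D ?D (comp_fctr ?F ?G) id_fctr ?i" unfolding natural_iso_def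
  using is_functor_id[OF category_twist] is_functor_comp[OF untwist_is_functor twist_is_functor] e
  by (auto simp: id_fctr_def comp_fctr_def twist_functor_def restrict_natural simp del: restrict_apply restrict_apply')
 ultimately show ?thesis unfolding equivalence_def using twist_is_functor untwist_is_functor by blast
qed

theorem twist_tensor_natural:
 "natural_iso (prod_cat (bimod_cat k H A) (bimod_cat k H A)) (bimod_cat k HF AF)
  (comp_fctr (tensor_functor k HF AF) (prod_fctr (twist_functor k H F A) (twist_functor k H F A)))
  (comp_fctr (twist_functor k H F A) (tensor_functor k H A)) (%(V, W). twist_tensor_map k H F A V W)"
proof -
 interpret G: h_alg k HF AF by (rule HF_alg')
 note f = is_functor_comp[OF is_functor_prod[OF twist_is_functor twist_is_functor] G.tensor_is_functor]
  is_functor_comp[OF tensor_is_functor twist_is_functor]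
 have iso: "iso_in (bimod_cat k HF AF) (tensor_over k HF AF (FF V) (FF W)) (FF (tensor_over k H A V W)) (twist_tensor_map k H F A V W)"
  if "a_bimodule k H A V" "a_bimodule k H A W" for V W
 proof -
  interpret T: twist_two k H F A V W by (rule twist_two[OF that])
  show ?thesis by (rule G.iso_inI[OF T.PF.Q_bimodule twist_is_bimodule[OF T.P.Q_bimodule] T.\<tau>_hom])
    (use T.\<tau>_bij in "simp_all add: twist_tensor_map_def")
 qed
 have nat: "compose (carrier (tensor_over k HF AF (FF V) (FF W))) (twist_tensor_map k H F A V' W') (map_over k HF AF (FF V) (FF W) (FF V') (FF W') f g)
  = compose (carrier (tensor_over k HF AF (FF V) (FF W))) (map_over k H A V W V' W' f g) (twist_tensor_map k H F A V W)"
  if "a_bimodule k H A V" "a_bimodule k H A W" "a_bimodule k H A V'" "a_bimodule k H A W'" "bimodule_hom k H A V V' f" "bimodule_hom k H A W W' g"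
  for V W V' W' f g unfolding compose_def
  by (rule restrict_ext) (rule twist_two.\<tau>_natural[OF twist_two[OF that(1,2)] twist_two[OF that(3,4)] that(5,6)])
 show ?thesis unfolding natural_iso_def
  using f iso nat by (auto simp: comp_fctr_def prod_fctr_def tensor_functor_def twist_functor_def id_apply)
qed

theorem twist_monoidal: "twist_strong_monoidal k H F A TYPE('v) TYPE('w) TYPE('x)"
proof -
 interpret G: h_alg k HF AF by (rule HF_alg')
 have u: "iso_in (bimod_cat k HF AF) (regular AF) (FF (regular A)) (twist_unit_map A)"
  by (rule G.iso_inI[OF G.regular_bimodule twist_is_bimodule[OF regular_bimodule] twist_unit(1) _ twist_unit(2)]) (simp add: twist_unit_map_def)
 show ?thesis unfolding twist_strong_monoidal_def Let_def
 proof (intro conjI allI impI ballI, goal_cases)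
  case (3 V W X t) then show ?case by (intro \<tau>_assoc) simp_all
 next
  case (4 V t) then show ?case by (rule \<tau>_unit(1))
 next
  case (5 V t) then show ?case by (rule \<tau>_unit(2))
 qed (fact twist_tensor_natural u)+
qed

theorem twist_closed: "twist_preserves_hom k H F A TYPE('v) TYPE('w)"
proof -
 interpret G: h_alg k HF AF by (rule HF_alg')
 note f = is_functor_comp[OF is_functor_prod[OF is_functor_op[OF twist_is_functor] twist_is_functor] G.hom_is_functor]
  is_functor_comp[OF hom_is_functor twist_is_functor]
 have iso: "iso_in (bimod_cat k HF AF) (hom_over k HF AF (FF V) (FF W)) (FF (hom_over k H A V W)) (twist_hom_map k H F A V W)"
  if "a_bimodule k H A V" "a_bimodule k H A W" for V W
 proof -
  interpret T: twist_two k H F A V W by (rule twist_two[OF that])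
  have b: "a_bimodule k HF AF (hom_over k HF AF (FF V) (FF W))" "a_bimodule k HF AF (FF (hom_over k H A V W))"
   unfolding T.PF.hom_over_eq T.P.hom_over_eq by (rule T.PF.O_bimodule, rule twist_is_bimodule[OF T.P.O_bimodule])
  show ?thesis by (rule G.iso_inI[OF b T.\<theta>_hom]) (use T.\<theta>_bij in "simp_all add: twist_hom_map_def")
 qed
 have nat: "compose (carrier (hom_over k HF AF (FF V) (FF W))) (twist_hom_map k H F A V' W')
   (\<lambda>L\<in>carrier (hom_over k HF AF (FF V) (FF W)). \<lambda>v\<in>carrier V'. g (L (f v)))
  = compose (carrier (hom_over k HF AF (FF V) (FF W))) (\<lambda>L\<in>carrier (hom_over k H A V W). \<lambda>v\<in>carrier V'. g (L (f v))) (twist_hom_map k H F A V W)"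
  if V: "a_bimodule k H A V" "a_bimodule k H A W" "a_bimodule k H A V'" "a_bimodule k H A W'" and h: "bimodule_hom k H A V' V f" "bimodule_hom k H A W W' g"
  for V W V' W' f g unfolding compose_def
 proof (rule restrict_ext)
  interpret T: twist_two k H F A V W by (rule twist_two[OF V(1,2)])
  fix L assume L: "L |: (hom_over k HF AF (FF V) (FF W))"
  have c: "(\<lambda>v\<in>carrier V'. g (L (f v))) |: (hom_over k HF AF (FF V') (FF W'))"
   using bim_homD(2)[OF G.hom_map_hom[OF V[THEN twist_is_bimodule] twist_hom[OF V(3,1) h(1)] twist_hom[OF V(2,4) h(2)]] L] L by simp
  have t: "twist_hom_map k H F A V W L |: hom_over k H A V W" using T.\<theta>_bij L unfolding bij_betw_def by blast
  show "twist_hom_map k H F A V' W' ((\<lambda>L\<in>carrier (hom_over k HF AF (FF V) (FF W)). \<lambda>v\<in>carrier V'. g (L (f v))) L)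
   = (\<lambda>L\<in>carrier (hom_over k H A V W). \<lambda>v\<in>carrier V'. g (L (f v))) (twist_hom_map k H F A V W L)"
   using c t L \<theta>_natural[OF twist_two[OF V(1,2)] twist_two[OF V(3,4)] h L] by (simp add: twist_hom_map_def)
 qed
 show ?thesis unfolding twist_preserves_hom_def Let_def natural_iso_def
  using f iso nat by (auto simp: comp_fctr_def prod_fctr_def op_fctr_def hom_functor_def twist_functor_def id_apply)
qed

end

theorem theorem4p13:
 fixes k :: "'k ring"
  and H :: "('k, 'h) quasi_hopf"
  and A :: "('k, 'h, 'a) hmodule"
  and F :: "('h, 'h) tens"
 assumes "quasi_hopf_algebra k H"
  and "h_algebra k H A"
  and "cochain_twist k H F"
 shows "twist_closed_monoidal_equivalence k H F A TYPE('v) TYPE('w) TYPE('x)"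
proof -
 interpret twist_data k H F A by unfold_locales (fact assms)+
 show ?thesis unfolding twist_closed_monoidal_equivalence_def
  using twist_quasi_hopf AF_algebra twist_equivalence twist_monoidal twist_closed by blast
qed

end
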